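(* Let $(\mathcal H,\nu)$ be any pmp discrete groupoid, $\mathbb P=\{\mathbb P_j\}_{j\in J}$ a sofic approximation to $(\mathcal H,\nu)$, $\beta$ a bias for $J$, $p\in[1,\infty]$, and let $\pi:(\mathcal G,\mu)\to(\mathcal H,\nu)$ be the Bernoulli shift over $(\mathcal H,\nu)$ with base space a standard probability space $(K,\kappa)$. Then $h_{\mathbb P,\mu}(\pi)=H(K,\kappa)$, where $$H(K,\kappa):=-\sum_{k\in K'}\kappa(\{k\})\log\kappa(\{k\})$$ for any countable subset $K'\subset K$ with $\kappa(K')=1$, and $H(K,\kappa):=+\infty$ if no such countable set exists.
   Context: **Groupoids.** A groupoid $\mathcal H$ is a small category in which every morphism is invertible; it is identified with its set of morphisms, $\mathcal H^0\subset\mathcal H$ denotes the units (objects), $\mathfrak s,\mathfrak r:\mathcal H\to\mathcal H^0$ are source and range, and $fg$ is defined iff $\mathfrak s(f)=\mathfrak r(g)$. It is discrete if $\mathfrak s^{-1}(x),\mathfrak r^{-1}(x)$ are countable for all $x\in\mathcal H^0$. A measurable groupoid carries a standard Borel structure for which $\mathcal H^0$ and the set of composable pairs are Borel and source, range, composition and inversion are Borel. A discrete measurable groupoid with a Borel probability measure $\nu$ on $\mathcal H^0$ is pmp if the measures $\nu_{\mathfrak s}(B)=\int|\mathfrak s^{-1}(x)\cap B|\,d\nu(x)$ and $\nu_{\mathfrak r}(B)=\int|\mathfrak r^{-1}(x)\cap B|\,d\nu(x)$ on $\mathcal H$ coincide; the common measure is again denoted $\nu$. $[[\mathcal H]]$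 is the set of Borel $f\subset\mathcal H$ such that $\mathfrak s|_f,\mathfrak r|_f$ are Borel isomorphisms onto their images, with $fg=\{f'g':f'\in f,g'\in g \text{ composable}\}$ and $f^{-1}=\{h^{-1}:h\in f\}$; $[\mathcal H]$ is the set of $f\in[[\mathcal H]]$ with $\mathfrak s(f)=\mathfrak r(f)=\mathcal H^0$. For $x\in\mathfrak s(f)$, $fx$ denotes the unique element of $f$ with source $x$. Put $\mathrm{tr}_{\mathcal H}(f)=\nu(f\cap\mathcal H^0)$. For $d\in\mathbb N$, $\Delta_d=\{1,\dots,d\}^2$ is the groupoid with $\mathfrak s(i,j)=(j,j)$, $\mathfrak r(i,j)=(i,i)$, $(i,j)(j,k)=(i,k)$; its unit set $\Delta_d^0$ is identified with $\{1,\dots,d\}$. $[[d]]:=[[\Delta_d]]$, $|f|_d=|f|/d$, $\mathrm{tr}_d(f)=|f\cap\Delta_d^0|/d$. For $f\in[[d]]$ and $A\subset\Delta_d^0$, $f\cdot A=\{i:(i,j)\in f\text{ for some }j\in A\}$. **Bernoulli shift.** Let $(K,\kappa)$ be a standard probability space. $\mathcal G^0$ is the set of pairs $(x,\omega)$ with $x\in\mathcal H^0$ and $\omega:\mathfrak s^{-1}(x)\to K$ a function. Its sigma-algebra is the smallest one making $(x,\omega)\mapsto x$ and, for every $h\in[\mathcal H]$, $(x,\omega)\mapsto\omega(hx)$ measurable. The measure is $d\mu(x,\omega)=d\kappa^{\mathfrak s^{-1}(x)}(\omega)\,d\nu(x)$, where $\kappa^{\mathfrak s^{-1}(x)}$ is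 the product measure on $K^{\mathfrak s^{-1}(x)}$. The elements of $\mathcal G$ are pairs $(h,\omega)$ with $h\in\mathcal H$ and $(\mathfrak s(h),\omega)\in\mathcal G^0$ (with the Borel structure of the fibre product of $\mathcal H$ and $\mathcal G^0$ over $\mathcal H^0$ via $\mathfrak s$); $\mathfrak s(h,\omega)=(\mathfrak s(h),\omega)$; $\mathfrak r(h,\omega)=(y,\psi)$ where $y=\mathfrak r(h)$ and $\psi:\mathfrak s^{-1}(y)\to K$, $\psi(f)=\omega(fh)$; composition $(f,\psi)(h,\omega)=(fh,\omega)$. The map $\pi:\mathcal G\to\mathcal H$, $\pi(h,\omega)=h$ (so $\pi(x,\omega)=x$ on units), is a pmp class-bijective extension. **Sofic approximations.** For finite $F\subset[[\mathcal H]]$ and $\delta>0$, $\sigma:[[\mathcal H]]\to[[d]]$ is $(F,\delta)$-multiplicative if $|\sigma(st)\vartriangle\sigma(s)\sigma(t)|_d<\delta$ for all $s,t\in F$, and $(F,\delta)$-trace-preserving if $|\mathrm{tr}_d(\sigma(s))-\mathrm{tr}_{\mathcal H}(s)|<\delta$ for all $s\in F$. $\mathrm{Map}([[\mathcal H]],[[d]])$ is the set of all maps, with the Borel structure generated by the sets $\{\sigma':\sigma'|_F=\sigma|_F\}$, $F$ finite. A sofic approximation to $(\mathcal H,\nu)$ is a family $\{\mathbb P_j\}_{j\in J}$ ($J$ a directed set) of Borel probability measures on $\mathrm{Map}([[\mathcal H]],[[d_j]])$, $d_j\in\mathbb N$, such that: (1) for all finite $F$ and $\delta>0$, $\lim_{j\to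 J}\mathbb P_j(\sigma\text{ is }(F,\delta)\text{-trace-preserving})=1$; (2) for all finite $F$ and $\delta>0$ there is $j$ such that for $j'\ge j$, $\mathbb P_{j'}$-a.e. $\sigma$ is $(F,\delta)$-multiplicative; (3) $\lim_{j\to J} d_j=\infty$; (4) if $\nu(f\vartriangle f')=0$ then $\sigma(f)=\sigma(f')$ for $\mathbb P_j$-a.e. $\sigma$. **Bias.** A bias $\beta$ for $J$ is an element of $\{-,+\}$ or an ultrafilter on $J$ containing $\{j'\in J:j'\ge j\}$ for each $j$. $\lim_{j\to\beta}\Phi(j)$ means $\liminf_{j\to J}$ if $\beta=-$, $\limsup_{j\to J}$ if $\beta=+$, and the ultralimit otherwise. $\|\cdot\|_{p,\mathbb P_j}$ is the $L^p$-norm with respect to $\mathbb P_j$. **Extensions.** A (Borel) groupoid morphism $\pi:\mathcal G\to\mathcal H$ (preserving products, inverses, units) is class-bijective if for every $a\in\mathcal G^0$ it restricts to bijections $\mathfrak s^{-1}(a)\to\mathfrak s^{-1}(\pi(a))$ and $\mathfrak r^{-1}(a)\to\mathfrak r^{-1}(\pi(a))$; a class-bijective extension is a surjective class-bijective morphism. It is pmp if $(\mathcal G,\mu),(\mathcal H,\nu)$ are pmp and $\pi_*\mu=\nu$. For $f\in[[\mathcal H]]$ and $x\in\mathcal G^0$ with $\pi(x)\in\mathfrak s(f)$, $f\cdot x$ is the range of the unique element of $\pi^{-1}(f)$ with source $x$; for $P\subset\mathcal G^0$, $f\cdot P=\{f\cdot x:x\in P,\pi(x)\in\mathfrak s(f)\}$.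 **Measure entropy.** For a finite partition $\mathcal P$ of $\mathcal G^0$ and finite $F\subset[[\mathcal H]]$, $\mathcal P^F$ is the coarsest partition of $\mathcal G^0$ such that each $f\cdot P$ ($f\in F,P\in\mathcal P$) is a union of its atoms, and $\Sigma(\mathcal P)$ is the sigma-algebra generated by $\mathcal P$. $\mathcal B(\Delta_d^0)$ is the set of all subsets of $\Delta_d^0$. A homomorphism $\phi:\Sigma(\mathcal P)\to\mathcal B(\Delta_d^0)$ is a map preserving unions and intersections with $\phi(\emptyset)=\emptyset$, $\phi(\mathcal G^0)=\Delta_d^0$. For $\sigma:[[\mathcal H]]\to[[d]]$, $\delta>0$ and finite $F\ni\mathcal H^0$, $\mathrm{Hom}(\pi,\sigma,\mathcal P,F,\delta)$ is the set of homomorphisms $\phi:\Sigma(\mathcal P^F)\to\mathcal B(\Delta_d^0)$ with $\sum_{P\in\mathcal P}|\sigma(f)\cdot\phi(P)\vartriangle\phi(f\cdot P)|d^{-1}<\delta$ for all $f\in F$ and $\sum_{P\in\mathcal P^F}\big||\phi(P)|d^{-1}-\mu(P)\big|<\delta$. For $\mathcal Q\le\mathcal P$ (meaning $\mathcal P$ refines $\mathcal Q$), $|\mathrm{Hom}(\pi,\sigma,\mathcal P,F,\delta)|_{\mathcal Q}$ is the number of distinct restrictions to $\Sigma(\mathcal Q)$ of elements of $\mathrm{Hom}(\pi,\sigma,\mathcal P,F,\delta)$. For finite Borel partitions $\mathcal Q\le\mathcal P$ let $$h_{\mathbb P,\mu}(\pi,\mathcal Q,\mathcal P)=\inf_F\inf_{\delta>0}\lim_{j\to\beta}\frac1{d_j}\log\big\||\mathrm{Hom}(\pi,\cdot,\mathcal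 P,F,\delta)|_{\mathcal Q}\big\|_{p,\mathbb P_j},$$ $F$ over finite subsets of $[[\mathcal H]]$ containing $\mathcal H^0$; and $h_{\mathbb P,\mu}(\pi)=\sup_{\mathcal Q}\inf_{\mathcal P\ge\mathcal Q}h_{\mathbb P,\mu}(\pi,\mathcal Q,\mathcal P)$ over finite Borel partitions of $\mathcal G^0$. *)

theory Defs
  imports "HOL-Probability.Probability"
begin

section \<open>Measurable groupoids\<close>

definition standard_borel :: "'a measure \<Rightarrow> bool" where
  "standard_borel M \<longleftrightarrow>
     (\<exists>X. completely_metrizable_space X \<and> second_countable X \<and> topspace X = space M
        \<and> sets M = sigma_sets (topspace X) {U. openin X U})"

text \<open>Units are identified with identity morphisms. The component \<open>arrows\<close> carries the underlying set
  of morphisms (its \<open>space\<close>) and the Borel structure (its \<open>sets\<close>); its \<open>emeasure\<close> is never used.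
  \<open>cmp f g\<close> is meaningful only if \<open>src f = rng g\<close>.\<close>

record 'h gpd =
  arrows :: "'h measure"
  units :: "'h set"
  src :: "'h \<Rightarrow> 'h"
  rng :: "'h \<Rightarrow> 'h"
  cmp :: "'h \<Rightarrow> 'h \<Rightarrow> 'h"
  ginv :: "'h \<Rightarrow> 'h"

definition composable :: "'h gpd \<Rightarrow> ('h \<times> 'h) set" where
  "composable H = {(f, g). f \<in> space (arrows H) \<and> g \<in> space (arrows H) \<and> src H f = rng H g}"

definition src_fibre :: "'h gpd \<Rightarrow> 'h \<Rightarrow> 'h set" where
  "src_fibre H x = {h \<in> space (arrows H). src H h = x}"

definition rng_fibre :: "'h gpd \<Rightarrow> 'h \<Rightarrow> 'h set" where
  "rng_fibre H x = {h \<in> space (arrows H). rng H h = x}"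

definition unit_space :: "'h gpd \<Rightarrow> 'h measure" where
  "unit_space H = restrict_space (arrows H) (units H)"

locale groupoid =
  fixes H :: "'h gpd"
  assumes units_subset: "units H \<subseteq> space (arrows H)"
    and src_in: "h \<in> space (arrows H) \<Longrightarrow> src H h \<in> units H"
    and rng_in: "h \<in> space (arrows H) \<Longrightarrow> rng H h \<in> units H"
    and src_unit: "x \<in> units H \<Longrightarrow> src H x = x"
    and rng_unit: "x \<in> units H \<Longrightarrow> rng H x = x"
    and cmp_in: "(f, g) \<in> composable H \<Longrightarrow> cmp H f g \<in> space (arrows H)"
    and src_cmp: "(f, g) \<in> composable H \<Longrightarrow> src H (cmp H f g) = src H g"
    and rng_cmp: "(f, g) \<in> composable H \<Longrightarrow> rng H (cmp H f g) = rng H f"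
    and cmp_assoc: "(f, g) \<in> composable H \<Longrightarrow> (g, h) \<in> composable H \<Longrightarrow>
          cmp H (cmp H f g) h = cmp H f (cmp H g h)"
    and cmp_src: "h \<in> space (arrows H) \<Longrightarrow> cmp H h (src H h) = h"
    and rng_cmp_left: "h \<in> space (arrows H) \<Longrightarrow> cmp H (rng H h) h = h"
    and ginv_in: "h \<in> space (arrows H) \<Longrightarrow> ginv H h \<in> space (arrows H)"
    and src_ginv: "h \<in> space (arrows H) \<Longrightarrow> src H (ginv H h) = rng H h"
    and rng_ginv: "h \<in> space (arrows H) \<Longrightarrow> rng H (ginv H h) = src H h"
    and cmp_ginv_right: "h \<in> space (arrows H) \<Longrightarrow> cmp H h (ginv H h) = rng H h"
    and cmp_ginv_left: "h \<in> space (arrows H) \<Longrightarrow> cmp H (ginv H h) h = src H h"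

locale measurable_groupoid = groupoid H for H :: "'h gpd" +
  assumes standard_borel_arrows: "standard_borel (arrows H)"
    and units_borel: "units H \<in> sets (arrows H)"
    and composable_borel: "composable H \<in> sets (arrows H \<Otimes>\<^sub>M arrows H)"
    and src_borel: "src H \<in> arrows H \<rightarrow>\<^sub>M unit_space H"
    and rng_borel: "rng H \<in> arrows H \<rightarrow>\<^sub>M unit_space H"
    and cmp_borel: "(\<lambda>(f, g). cmp H f g) \<in>
          restrict_space (arrows H \<Otimes>\<^sub>M arrows H) (composable H) \<rightarrow>\<^sub>M arrows H"
    and ginv_borel: "ginv H \<in> arrows H \<rightarrow>\<^sub>M arrows H"

locale discrete_measurable_groupoid = measurable_groupoid H for H :: "'h gpd" +
  assumes countable_src_fibre: "x \<in> units H \<Longrightarrow> countable (src_fibre H x)"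
    and countable_rng_fibre: "x \<in> units H \<Longrightarrow> countable (rng_fibre H x)"

text \<open>The values of the measures \<open>\<nu>\<^sub>\<ss>\<close> and \<open>\<nu>\<^sub>\<rr>\<close> on a Borel set of arrows.\<close>

definition src_measure :: "'h gpd \<Rightarrow> 'h measure \<Rightarrow> 'h set \<Rightarrow> ennreal" where
  "src_measure H \<nu> B = (\<integral>\<^sup>+ x. emeasure (count_space UNIV) (src_fibre H x \<inter> B) \<partial>\<nu>)"

definition rng_measure :: "'h gpd \<Rightarrow> 'h measure \<Rightarrow> 'h set \<Rightarrow> ennreal" where
  "rng_measure H \<nu> B = (\<integral>\<^sup>+ x. emeasure (count_space UNIV) (rng_fibre H x \<inter> B) \<partial>\<nu>)"

locale pmp_discrete_groupoid = discrete_measurable_groupoid H for H :: "'h gpd" +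
  fixes \<nu> :: "'h measure"
  assumes prob_space_\<nu>: "prob_space \<nu>"
    and sets_\<nu>: "sets \<nu> = sets (unit_space H)"
    and measure_preserving:
      "B \<in> sets (arrows H) \<Longrightarrow> src_measure H \<nu> B = rng_measure H \<nu> B"


section \<open>Partial and full bisections\<close>

definition borel_iso_onto_image :: "'a measure \<Rightarrow> 'b measure \<Rightarrow> 'a set \<Rightarrow> ('a \<Rightarrow> 'b) \<Rightarrow> bool" where
  "borel_iso_onto_image M N A f \<longleftrightarrow>
     inj_on f A \<and>
     f \<in> restrict_space M A \<rightarrow>\<^sub>M restrict_space N (f ` A) \<and>
     the_inv_into A f \<in> restrict_space N (f ` A) \<rightarrow>\<^sub>M restrict_space M A"

text \<open>\<open>bisections H\<close> is \<open>[[H]]\<close>, \<open>full_bisections H\<close> is \<open>[H]\<close>.\<close>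

definition bisections :: "'h gpd \<Rightarrow> 'h set set" where
  "bisections H = {f \<in> sets (arrows H).
     borel_iso_onto_image (arrows H) (unit_space H) f (src H) \<and>
     borel_iso_onto_image (arrows H) (unit_space H) f (rng H)}"

definition full_bisections :: "'h gpd \<Rightarrow> 'h set set" where
  "full_bisections H = {f \<in> bisections H. src H ` f = units H \<and> rng H ` f = units H}"

definition bis_prod :: "'h gpd \<Rightarrow> 'h set \<Rightarrow> 'h set \<Rightarrow> 'h set" where
  "bis_prod H f g = {cmp H f' g' | f' g'. f' \<in> f \<and> g' \<in> g \<and> (f', g') \<in> composable H}"

definition bis_at :: "'h gpd \<Rightarrow> 'h set \<Rightarrow> 'h \<Rightarrow> 'h" where
  "bis_at H f x = (THE h. h \<in> f \<and> src H h = x)"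

definition gpd_trace :: "'h gpd \<Rightarrow> 'h measure \<Rightarrow> 'h set \<Rightarrow> real" where
  "gpd_trace H \<nu> f = measure \<nu> (f \<inter> units H)"


section \<open>The finite groupoids\<close>

definition fin_gpd :: "nat \<Rightarrow> (nat \<times> nat) gpd" where
  "fin_gpd d = \<lparr> arrows = count_space ({1..d} \<times> {1..d}),
                units = {(i, i) | i. i \<in> {1..d}},
                src = (\<lambda>(i, j). (j, j)),
                rng = (\<lambda>(i, j). (i, i)),
                cmp = (\<lambda>(i, j) (k, l). (i, l)),
                ginv = (\<lambda>(i, j). (j, i)) \<rparr>"

definition fin_card :: "nat \<Rightarrow> (nat \<times> nat) set \<Rightarrow> real" where
  "fin_card d f = real (card f) / real d"

definition fin_trace :: "nat \<Rightarrow> (nat \<times> nat) set \<Rightarrow> real" where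
  "fin_trace d f = real (card (f \<inter> units (fin_gpd d))) / real d"

text \<open>Subsets of the unit set of \<open>fin_gpd d\<close> are written as subsets of \<open>{1..d}\<close>.\<close>

definition fin_act :: "(nat \<times> nat) set \<Rightarrow> nat set \<Rightarrow> nat set" where
  "fin_act f A = {i. \<exists>j\<in>A. (i, j) \<in> f}"


section \<open>Sofic approximations\<close>

definition directed_set :: "'j set \<Rightarrow> ('j \<Rightarrow> 'j \<Rightarrow> bool) \<Rightarrow> bool" where
  "directed_set J le \<longleftrightarrow> J \<noteq> {} \<and>
     (\<forall>i\<in>J. le i i) \<and>
     (\<forall>i\<in>J. \<forall>j\<in>J. \<forall>k\<in>J. le i j \<longrightarrow> le j k \<longrightarrow> le i k) \<and>
     (\<forall>i\<in>J. \<forall>j\<in>J. \<exists>k\<in>J. le i k \<and> le j k)"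

definition net_filter :: "'j set \<Rightarrow> ('j \<Rightarrow> 'j \<Rightarrow> bool) \<Rightarrow> 'j filter" where
  "net_filter J le = (INF j\<in>J. principal {j' \<in> J. le j j'})"

definition sofic_maps :: "'h gpd \<Rightarrow> nat \<Rightarrow> ('h set \<Rightarrow> (nat \<times> nat) set) set" where
  "sofic_maps H d = bisections H \<rightarrow>\<^sub>E bisections (fin_gpd d)"

definition sofic_maps_borel :: "'h gpd \<Rightarrow> nat \<Rightarrow> ('h set \<Rightarrow> (nat \<times> nat) set) measure" where
  "sofic_maps_borel H d = sigma (sofic_maps H d)
     {{\<sigma>' \<in> sofic_maps H d. restrict \<sigma>' F = restrict \<sigma> F} | \<sigma> F.
        \<sigma> \<in> sofic_maps H d \<and> finite F \<and> F \<subseteq> bisections H}"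

definition multiplicative ::
  "'h gpd \<Rightarrow> nat \<Rightarrow> 'h set set \<Rightarrow> real \<Rightarrow> ('h set \<Rightarrow> (nat \<times> nat) set) \<Rightarrow> bool" where
  "multiplicative H d F \<delta> \<sigma> \<longleftrightarrow> (\<forall>s\<in>F. \<forall>t\<in>F.
     fin_card d (sym_diff (\<sigma> (bis_prod H s t)) (bis_prod (fin_gpd d) (\<sigma> s) (\<sigma> t))) < \<delta>)"

definition trace_preserving ::
  "'h gpd \<Rightarrow> 'h measure \<Rightarrow> nat \<Rightarrow> 'h set set \<Rightarrow> real \<Rightarrow> ('h set \<Rightarrow> (nat \<times> nat) set) \<Rightarrow> bool" where
  "trace_preserving H \<nu> d F \<delta> \<sigma> \<longleftrightarrow> (\<forall>s\<in>F. \<bar>fin_trace d (\<sigma> s) - gpd_trace H \<nu> s\<bar> < \<delta>)"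

locale sofic_approximation =
  fixes H :: "'h gpd" and \<nu> :: "'h measure"
    and J :: "'j set" and le :: "'j \<Rightarrow> 'j \<Rightarrow> bool"
    and d :: "'j \<Rightarrow> nat" and \<P> :: "'j \<Rightarrow> ('h set \<Rightarrow> (nat \<times> nat) set) measure"
  assumes directed: "directed_set J le"
    and d_pos: "j \<in> J \<Longrightarrow> 1 \<le> d j"
    and prob_space_\<P>: "j \<in> J \<Longrightarrow> prob_space (\<P> j)"
    and sets_\<P>: "j \<in> J \<Longrightarrow> sets (\<P> j) = sets (sofic_maps_borel H (d j))"
    and asymp_trace_preserving:
      "finite F \<Longrightarrow> F \<subseteq> bisections H \<Longrightarrow> \<delta> > 0 \<Longrightarrow>
        ((\<lambda>j. measure (\<P> j) {\<sigma> \<in> space (\<P> j). trace_preserving H \<nu> (d j) F \<delta> \<sigma>}) \<longlongrightarrow> 1)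
          (net_filter J le)"
    and asymp_multiplicative:
      "finite F \<Longrightarrow> F \<subseteq> bisections H \<Longrightarrow> \<delta> > 0 \<Longrightarrow>
        \<exists>j\<in>J. \<forall>j'\<in>J. le j j' \<longrightarrow> (AE \<sigma> in \<P> j'. multiplicative H (d j') F \<delta> \<sigma>)"
    and d_tendsto: "filterlim d at_top (net_filter J le)"
    and respects_null:
      "f \<in> bisections H \<Longrightarrow> f' \<in> bisections H \<Longrightarrow> src_measure H \<nu> (sym_diff f f') = 0 \<Longrightarrow>
        j \<in> J \<Longrightarrow> AE \<sigma> in \<P> j. \<sigma> f = \<sigma> f'"


section \<open>Biases\<close>

text \<open>An ultrafilter on \<open>J\<close> is represented by an ultrafilter on the ambient type containing \<open>J\<close>.\<close>

datatype 'j bias = Minus | Plus | Ultra "'j filter"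

fun is_bias :: "'j set \<Rightarrow> ('j \<Rightarrow> 'j \<Rightarrow> bool) \<Rightarrow> 'j bias \<Rightarrow> bool" where
  "is_bias J le Minus \<longleftrightarrow> True"
| "is_bias J le Plus \<longleftrightarrow> True"
| "is_bias J le (Ultra U) \<longleftrightarrow> U \<noteq> bot \<and>
     (\<forall>A. eventually (\<lambda>j. j \<in> A) U \<or> eventually (\<lambda>j. j \<notin> A) U) \<and>
     eventually (\<lambda>j. j \<in> J) U \<and>
     (\<forall>j\<in>J. eventually (\<lambda>j'. j' \<in> {j' \<in> J. le j j'}) U)"

fun bias_lim :: "'j set \<Rightarrow> ('j \<Rightarrow> 'j \<Rightarrow> bool) \<Rightarrow> 'j bias \<Rightarrow> ('j \<Rightarrow> ereal) \<Rightarrow> ereal" where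
  "bias_lim J le Minus \<Phi> = Liminf (net_filter J le) \<Phi>"
| "bias_lim J le Plus \<Phi> = Limsup (net_filter J le) \<Phi>"
| "bias_lim J le (Ultra U) \<Phi> = Lim U \<Phi>"


section \<open>Entropy of an extension\<close>

definition Lp_norm :: "ennreal \<Rightarrow> 'a measure \<Rightarrow> ('a \<Rightarrow> real) \<Rightarrow> ereal" where
  "Lp_norm p M f =
     (if p = \<infinity> then esssup M (\<lambda>x. ereal \<bar>f x\<bar>)
      else let I = \<integral>\<^sup>+ x. ennreal (\<bar>f x\<bar> powr enn2real p) \<partial>M
           in if I = \<infinity> then \<infinity> else ereal (enn2real I powr (1 / enn2real p)))"

text \<open>The logarithm with values in the extended reals, so that \<open>log 0 = -\<infinity>\<close>.\<close>

definition elog :: "ereal \<Rightarrow> ereal" where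
  "elog x = (if x \<le> 0 then -\<infinity> else if x = \<infinity> then \<infinity> else ereal (ln (real_of_ereal x)))"

definition bis_act_point :: "'g gpd \<Rightarrow> ('g \<Rightarrow> 'h) \<Rightarrow> 'h set \<Rightarrow> 'g \<Rightarrow> 'g" where
  "bis_act_point G \<pi> f x = rng G (THE g. g \<in> space (arrows G) \<and> \<pi> g \<in> f \<and> src G g = x)"

definition bis_act :: "'h gpd \<Rightarrow> 'g gpd \<Rightarrow> ('g \<Rightarrow> 'h) \<Rightarrow> 'h set \<Rightarrow> 'g set \<Rightarrow> 'g set" where
  "bis_act H G \<pi> f P = {bis_act_point G \<pi> f x | x. x \<in> P \<and> \<pi> x \<in> src H ` f}"

text \<open>\<open>refines A P Q\<close> says that the partition \<open>P\<close> of \<open>A\<close> is finer than \<open>Q\<close>.\<close>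

definition act_partition ::
  "'h gpd \<Rightarrow> 'g gpd \<Rightarrow> ('g \<Rightarrow> 'h) \<Rightarrow> 'g set set \<Rightarrow> 'h set set \<Rightarrow> 'g set set" where
  "act_partition H G \<pi> P F =
     (let admissible = (\<lambda>A. partition_on (units G) A \<and>
            (\<forall>f\<in>F. \<forall>B\<in>P. \<exists>C\<subseteq>A. bis_act H G \<pi> f B = \<Union>C))
      in THE A. admissible A \<and> (\<forall>A'. admissible A' \<longrightarrow> refines (units G) A' A))"

abbreviation part_sigma :: "'g gpd \<Rightarrow> 'g set set \<Rightarrow> 'g set set" where
  "part_sigma G P \<equiv> sigma_sets (units G) P"

definition set_homs :: "'g gpd \<Rightarrow> 'g set set \<Rightarrow> nat \<Rightarrow> ('g set \<Rightarrow> nat set) set" where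
  "set_homs G \<Sigma> d = {\<phi> \<in> \<Sigma> \<rightarrow>\<^sub>E Pow {1..d}.
     (\<forall>A\<in>\<Sigma>. \<forall>B\<in>\<Sigma>. \<phi> (A \<union> B) = \<phi> A \<union> \<phi> B \<and> \<phi> (A \<inter> B) = \<phi> A \<inter> \<phi> B) \<and>
     \<phi> {} = {} \<and> \<phi> (units G) = {1..d}}"

definition approx_homs ::
  "'h gpd \<Rightarrow> 'g gpd \<Rightarrow> 'g measure \<Rightarrow> ('g \<Rightarrow> 'h) \<Rightarrow> nat \<Rightarrow> ('h set \<Rightarrow> (nat \<times> nat) set) \<Rightarrow>
   'g set set \<Rightarrow> 'h set set \<Rightarrow> real \<Rightarrow> ('g set \<Rightarrow> nat set) set" where
  "approx_homs H G \<mu> \<pi> d \<sigma> P F \<delta> =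
     {\<phi> \<in> set_homs G (part_sigma G (act_partition H G \<pi> P F)) d.
        (\<forall>f\<in>F. (\<Sum>B\<in>P. real (card (sym_diff (fin_act (\<sigma> f) (\<phi> B)) (\<phi> (bis_act H G \<pi> f B))))
                    / real d) < \<delta>) \<and>
        (\<Sum>B\<in>act_partition H G \<pi> P F. \<bar>real (card (\<phi> B)) / real d - measure \<mu> B\<bar>) < \<delta>}"

definition approx_homs_count ::
  "'h gpd \<Rightarrow> 'g gpd \<Rightarrow> 'g measure \<Rightarrow> ('g \<Rightarrow> 'h) \<Rightarrow> nat \<Rightarrow> 'g set set \<Rightarrow> 'g set set \<Rightarrow>
   'h set set \<Rightarrow> real \<Rightarrow> ('h set \<Rightarrow> (nat \<times> nat) set) \<Rightarrow> nat" where
  "approx_homs_count H G \<mu> \<pi> d Q P F \<delta> \<sigma> =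
     card ((\<lambda>\<phi>. restrict \<phi> (part_sigma G Q)) ` approx_homs H G \<mu> \<pi> d \<sigma> P F \<delta>)"

definition finite_borel_partitions :: "'g gpd \<Rightarrow> 'g measure \<Rightarrow> 'g set set set" where
  "finite_borel_partitions G \<mu> = {P. finite P \<and> P \<subseteq> sets \<mu> \<and> partition_on (units G) P}"

definition partition_entropy ::
  "'h gpd \<Rightarrow> 'g gpd \<Rightarrow> 'g measure \<Rightarrow> ('g \<Rightarrow> 'h) \<Rightarrow>
   'j set \<Rightarrow> ('j \<Rightarrow> 'j \<Rightarrow> bool) \<Rightarrow> ('j \<Rightarrow> nat) \<Rightarrow> ('j \<Rightarrow> ('h set \<Rightarrow> (nat \<times> nat) set) measure) \<Rightarrow>
   'j bias \<Rightarrow> ennreal \<Rightarrow> 'g set set \<Rightarrow> 'g set set \<Rightarrow> ereal" where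
  "partition_entropy H G \<mu> \<pi> J le d \<P> \<beta> p Q P =
     (INF F\<in>{F. finite F \<and> F \<subseteq> bisections H \<and> units H \<in> F}. INF \<delta>\<in>{0<..}.
        bias_lim J le \<beta> (\<lambda>j.
          elog (Lp_norm p (\<P> j) (\<lambda>\<sigma>. real (approx_homs_count H G \<mu> \<pi> (d j) Q P F \<delta> \<sigma>)))
            / ereal (real (d j))))"

definition measure_entropy ::
  "'h gpd \<Rightarrow> 'g gpd \<Rightarrow> 'g measure \<Rightarrow> ('g \<Rightarrow> 'h) \<Rightarrow>
   'j set \<Rightarrow> ('j \<Rightarrow> 'j \<Rightarrow> bool) \<Rightarrow> ('j \<Rightarrow> nat) \<Rightarrow> ('j \<Rightarrow> ('h set \<Rightarrow> (nat \<times> nat) set) measure) \<Rightarrow>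
   'j bias \<Rightarrow> ennreal \<Rightarrow> ereal" where
  "measure_entropy H G \<mu> \<pi> J le d \<P> \<beta> p =
     (SUP Q\<in>finite_borel_partitions G \<mu>.
        INF P\<in>{P \<in> finite_borel_partitions G \<mu>. refines (units G) P Q}.
          partition_entropy H G \<mu> \<pi> J le d \<P> \<beta> p Q P)"


section \<open>The Bernoulli shift\<close>

text \<open>Only the measurable space underlying \<open>K\<close> matters for the groupoid. A function on the source
  fibre of \<open>x\<close> is an element of the extensional function space \<open>src_fibre H x \<rightarrow>\<^sub>E space K\<close>.\<close>

definition bernoulli_units :: "'h gpd \<Rightarrow> 'k measure \<Rightarrow> ('h \<times> ('h \<Rightarrow> 'k)) set" where
  "bernoulli_units H K = (SIGMA x : units H. src_fibre H x \<rightarrow>\<^sub>E space K)"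

definition bernoulli_unit_space :: "'h gpd \<Rightarrow> 'k measure \<Rightarrow> ('h \<times> ('h \<Rightarrow> 'k)) measure" where
  "bernoulli_unit_space H K = sigma (bernoulli_units H K)
     ({{(x, \<omega>) \<in> bernoulli_units H K. x \<in> B} | B. B \<in> sets (unit_space H)} \<union>
      {{(x, \<omega>) \<in> bernoulli_units H K. \<omega> (bis_at H h x) \<in> A} | h A.
         h \<in> full_bisections H \<and> A \<in> sets K})"

definition bernoulli_measure :: "'h gpd \<Rightarrow> 'h measure \<Rightarrow> 'k measure \<Rightarrow> ('h \<times> ('h \<Rightarrow> 'k)) measure" where
  "bernoulli_measure H \<nu> \<kappa> =
     measure_of (bernoulli_units H \<kappa>) (sets (bernoulli_unit_space H \<kappa>))
       (\<lambda>A. \<integral>\<^sup>+ x. emeasure (\<Pi>\<^sub>M h\<in>src_fibre H x. \<kappa>) {\<omega>. (x, \<omega>) \<in> A} \<partial>\<nu>)"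

definition bernoulli_arrows :: "'h gpd \<Rightarrow> 'k measure \<Rightarrow> ('h \<times> ('h \<Rightarrow> 'k)) set" where
  "bernoulli_arrows H K = (SIGMA h : space (arrows H). src_fibre H (src H h) \<rightarrow>\<^sub>E space K)"

text \<open>\<open>translate H h \<omega>\<close> is the function \<open>f \<mapsto> \<omega> (f h)\<close> on the source fibre of the range of \<open>h\<close>.\<close>

definition translate :: "'h gpd \<Rightarrow> 'h \<Rightarrow> ('h \<Rightarrow> 'k) \<Rightarrow> 'h \<Rightarrow> 'k" where
  "translate H h \<omega> = (\<lambda>f\<in>src_fibre H (rng H h). \<omega> (cmp H f h))"

definition bernoulli_gpd :: "'h gpd \<Rightarrow> 'k measure \<Rightarrow> ('h \<times> ('h \<Rightarrow> 'k)) gpd" where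
  "bernoulli_gpd H K =
     \<lparr> arrows = vimage_algebra (bernoulli_arrows H K) (\<lambda>(h, \<omega>). (h, (src H h, \<omega>)))
                  (arrows H \<Otimes>\<^sub>M bernoulli_unit_space H K),
       units = bernoulli_units H K,
       src = (\<lambda>(h, \<omega>). (src H h, \<omega>)),
       rng = (\<lambda>(h, \<omega>). (rng H h, translate H h \<omega>)),
       cmp = (\<lambda>(f, \<psi>) (h, \<omega>). (cmp H f h, \<omega>)),
       ginv = (\<lambda>(h, \<omega>). (ginv H h, translate H h \<omega>)) \<rparr>"

abbreviation bernoulli_proj :: "'h \<times> ('h \<Rightarrow> 'k) \<Rightarrow> 'h" where
  "bernoulli_proj \<equiv> fst"


section \<open>Entropy of the base space\<close>

definition countable_full :: "'k measure \<Rightarrow> 'k set \<Rightarrow> bool" where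
  "countable_full \<kappa> K' \<longleftrightarrow> countable K' \<and> K' \<subseteq> space \<kappa> \<and> measure \<kappa> K' = 1"

text \<open>The summands are nonnegative, so the sum always exists in the extended reals; it does not
  depend on the chosen set (see \<open>base_entropy_eq\<close>).\<close>

definition base_entropy :: "'k measure \<Rightarrow> ereal" where
  "base_entropy \<kappa> =
     (if \<exists>K'. countable_full \<kappa> K'
      then \<Sum>\<^sub>\<infinity>k\<in>(SOME K'. countable_full \<kappa> K'). ereal (- (measure \<kappa> {k} * ln (measure \<kappa> {k})))
      else \<infinity>)"

lemma base_entropy_eq:
  assumes "prob_space \<kappa>" and "countable_full \<kappa> K'"
  shows "base_entropy \<kappa> = (\<Sum>\<^sub>\<infinity>k\<in>K'. ereal (- (measure \<kappa> {k} * ln (measure \<kappa> {k}))))"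
proof -
  interpret prob_space \<kappa> by fact
  define L where "L = (SOME K'. countable_full \<kappa> K')"
  have L: "countable_full \<kappa> L"
    unfolding L_def using assms(2) by (rule someI)
  have zero: "measure \<kappa> {k} = 0"
    if "countable_full \<kappa> A" "k \<notin> A" for A k
  proof (cases "{k} \<in> sets \<kappa>")
    case True
    from that(1) have A: "A \<in> sets \<kappa>" "prob A = 1"
      unfolding countable_full_def using measure_notin_sets[of A \<kappa>] by force+
    have "prob (A \<union> {k}) = prob A + prob {k}"
      using that(2) A(1) True by (intro finite_measure_Union) auto
    then show ?thesis
      using A(2) prob_le_1[of "A \<union> {k}"] measure_nonneg[of \<kappa> "{k}"] by linarith
  qed (simp add: measure_notin_sets)
  have "(\<Sum>\<^sub>\<infinity>k\<in>L. ereal (- (measure \<kappa> {k} * ln (measure \<kappa> {k})))) =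
        (\<Sum>\<^sub>\<infinity>k\<in>K'. ereal (- (measure \<kappa> {k} * ln (measure \<kappa> {k}))))"
    by (rule infsum_cong_neutral) (auto simp: zero[OF L] zero[OF assms(2)])
  then show ?thesis
    using assms(2) unfolding base_entropy_def L_def by auto
qed

end

(* The sets {(x, \<omega>). \<omega> (g x) \<in> A}, for a bisection g and a measurable A, generate the sigma-algebra of
   the Bernoulli shift and are permuted by bisections, so every finite partition is approximated by
   the pattern of finitely many of them.

   Lower bound: label the vertices of a sofic model independently with distribution \<kappa>. The pattern
   seen at a vertex v depends on the labels at the vertices \<sigma>(g) v; for most v these coincide or differ
   exactly as the arrows g x do at a \<nu>-random x, so the expected pattern statistics are close to \<mu>, and
   by the second moment they concentrate. Hence most labelings yield approximate homomorphisms. The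
   restriction of such a homomorphism to the partition by the coordinate at the unit determines the
   labeling up to a small Hamming error, and no labeling with the right frequencies has much weight,
   so there are about exp(d H) of them.

   Upper bound: as g-cylinders are translates of cylinders at the unit, an approximate homomorphism is
   determined up to a small Hamming error by its values on the latter, whose frequencies are
   prescribed. This works for every map \<sigma>, so the mode of convergence, the bias and p do not matter. *)

theory Submission
  imports Defs
begin

section \<open>Standard Borel spaces\<close>

text \<open>What has to be compared between the groupoid and a model is which of finitely many
  arrows g x exist and coincide. Equality of g x and g' x on a Borel set C is an identity between
  products of bisections, hence inherited by almost multiplicative maps. Inequality says that the
  product of the inverse of g with g' C contains no unit; it is inherited because traces are almost
  preserved. These products are only partial bisections, while the sigma-algebra of the shift is
  generated by full ones; hence the preliminary work on bisections.

  A homomorphism from a finite algebra into subsets of {1..d} is an inverse image map, given by a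
  function from vertices to points. In this form labelings yield homomorphisms at once, and
  conversely every vertex of a homomorphism has a code.

  Approximations of sets are small also after translation by the finitely many bisections in play,
  so that equivariance survives them. A Hamming ball of relative radius \<theta> over an alphabet Y
  has at most exp (d (\<theta> ln (1/t) + t |Y|)) points for any t in (0, 1]; therefore t is always
  fixed before the error that determines \<theta>.\<close>

text \<open>A point is coded by the set of indices of the basic open sets that contain it. The last
  clause, that the codes of points form a measurable subset of the power set of the naturals, is
  where completeness of the metric enters; it is what allows measurable maps to be extended from
  arbitrary subsets.\<close>

lemma standard_borel_code:
  fixes M :: "'a measure"
  assumes "standard_borel M"
  obtains U :: "nat \<Rightarrow> 'a set" where
    "sets M = sigma_sets (space M) (range U)"
    "\<And>n. U n \<subseteq> space M"
    "\<And>x y. x \<in> space M \<Longrightarrow> y \<in> space M \<Longrightarrow> (\<And>n. x \<in> U n \<longleftrightarrow> y \<in> U n) \<Longrightarrow> x = y"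
    "{A. \<exists>p\<in>space M. \<forall>n. n \<in> A \<longleftrightarrow> p \<in> U n} \<in> sigma_sets UNIV (range (\<lambda>n. {A. n \<in> A}))"
proof -
  obtain X where X: "completely_metrizable_space X" "second_countable X" "topspace X = space M"
      "sets M = sigma_sets (topspace X) {U. openin X U}"
    using assms unfolding standard_borel_def by blast
  obtain M' dd where "Metric_space M' dd" and mc: "Metric_space.mcomplete M' dd"
    and Xm: "X = Metric_space.mtopology M' dd"
    using X(1) unfolding completely_metrizable_space_def by blast
  interpret Metric_space M' dd by fact
  have sp: "space M = M'" using X(3) Xm by simp
  obtain \<B> where \<B>: "countable \<B>" "\<And>V. V \<in> \<B> \<Longrightarrow> openin X V"
      "\<And>U x. openin X U \<Longrightarrow> x \<in> U \<Longrightarrow> \<exists>V\<in>\<B>. x \<in> V \<and> V \<subseteq> U"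
    using X(2) unfolding second_countable_def by metis
  \<comment> \<open>The empty set is inserted so that \<open>from_nat_into\<close> enumerates a
    non-empty countable set; its index lies in the code of no point.\<close>
  define U where "U = from_nat_into (insert {} \<B>)"
  have rU: "range U = insert {} \<B>"
    unfolding U_def by (rule range_from_nat_into) (use \<B>(1) in auto)
  have Uo: "openin X (U n)" for n
    using rU \<B>(2) by (metis insert_iff openin_empty rangeI)
  have Ub: "\<exists>n. x \<in> U n \<and> U n \<subseteq> W" if "openin X W" "x \<in> W" for x W
  proof -
    obtain V where "V \<in> \<B>" "x \<in> V" "V \<subseteq> W" using \<B>(3) \<open>openin X W\<close> \<open>x \<in> W\<close> by blast
    moreover then obtain n where "U n = V" using rU by (metis imageE insertI2)
    ultimately show ?thesis by blast
  qed
  have Us: "U n \<subseteq> M'" for n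
    using Uo[of n] openin_subset Xm by fastforce
  have W_Un: "W = \<Union>(U ` {n. U n \<subseteq> W})" if "openin X W" for W
    using Ub[OF that] by blast
  have s1: "sets M = sigma_sets (space M) (range U)"
  proof
    show "sets M \<subseteq> sigma_sets (space M) (range U)"
      unfolding X(4) X(3)
    proof (rule sigma_sets_mono, safe)
      fix W assume W: "openin X W"
      show "W \<in> sigma_sets (space M) (range U)"
        by (subst W_Un[OF W]) (rule sigma_sets_UNION, auto)
    qed
    show "sigma_sets (space M) (range U) \<subseteq> sets M"
      unfolding X(4) X(3) by (rule sigma_sets_mono) (use Uo in auto)
  qed
  have s3: "x = y" if "x \<in> M'" "y \<in> M'" "\<And>n. x \<in> U n \<longleftrightarrow> y \<in> U n" for x y
  proof (rule ccontr)
    assume "x \<noteq> y"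
    then have "x \<in> mball x (dd x y)" using that by simp
    moreover have "openin X (mball x (dd x y))" using Xm by simp
    ultimately obtain n where "x \<in> U n" "U n \<subseteq> mball x (dd x y)" using Ub by blast
    with that(3)[of n] show False by auto
  qed
  \<comment> \<open>A description of the codes by countably many conditions: the quantifiers that
    involve \<open>A\<close> run over indices only, and the conditions on the sets
    \<open>U m\<close> are constants, so the set of such \<open>A\<close> is measurable. Members of
    small radius and closures of members inside intersections of members are what Cantor's
    intersection theorem asks for.\<close>
  let ?c = "\<lambda>A::nat set. (\<forall>k. \<exists>m. m \<in> A \<and> (\<exists>a. U m \<subseteq> mcball a (1 / real (Suc k)))) \<and>
     (\<forall>m1 m2. m1 \<in> A \<longrightarrow> m2 \<in> A \<longrightarrow> (\<exists>n. n \<in> A \<and> mtopology closure_of U n \<subseteq> U m1 \<inter> U m2)) \<and>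
     (\<forall>m n. n \<in> A \<longrightarrow> U n \<subseteq> U m \<longrightarrow> m \<in> A) \<and> (\<forall>n. n \<in> A \<longrightarrow> U n \<noteq> {})"
  have iff: "(\<exists>p\<in>M'. \<forall>n. n \<in> A \<longleftrightarrow> p \<in> U n) \<longleftrightarrow> ?c A" for A
  proof
    assume "\<exists>p\<in>M'. \<forall>n. n \<in> A \<longleftrightarrow> p \<in> U n"
    then obtain p where p: "p \<in> M'" "\<And>n. n \<in> A \<longleftrightarrow> p \<in> U n" by blast
    have 1: "\<exists>n. n \<in> A \<and> U n \<subseteq> mball p r" if "r > 0" for r
    proof -
      have "openin X (mball p r)" "p \<in> mball p r" using Xm p(1) that by auto
      from Ub[OF this] show ?thesis using p(2) by blast
    qed
    have "\<exists>m. m \<in> A \<and> (\<exists>a. U m \<subseteq> mcball a (1 / real (Suc k)))" for k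
      using 1[of "1 / real (Suc k)"] mball_subset_mcball[of p "1 / real (Suc k)"] by (meson divide_pos_pos of_nat_0_less_iff order_trans zero_less_Suc zero_less_one)
    moreover have "\<exists>n. n \<in> A \<and> mtopology closure_of U n \<subseteq> U m1 \<inter> U m2" if "m1 \<in> A" "m2 \<in> A" for m1 m2
    proof -
      have "openin mtopology (U m1 \<inter> U m2)" using Uo Xm by auto
      then obtain r where r: "r > 0" "mball p r \<subseteq> U m1 \<inter> U m2"
        using \<open>m1 \<in> A\<close> \<open>m2 \<in> A\<close> p(2) openin_mtopology by (metis IntI)
      obtain n where n: "n \<in> A" "U n \<subseteq> mball p (r/2)" using 1[of "r/2"] r(1) by auto
      have "mtopology closure_of U n \<subseteq> mcball p (r/2)"
        using n(2) mball_subset_mcball closedin_mcball by (meson closure_of_minimal order_trans)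
      also have "\<dots> \<subseteq> mball p r" using r(1) by auto
      finally show ?thesis using n r by blast
    qed
    ultimately show "?c A" using p by blast
  next
    assume c: "?c A"
    have c1: "\<exists>m a. m \<in> A \<and> U m \<subseteq> mcball a (1 / real (Suc k))" for k using c[THEN conjunct1] by blast
    have c2: "\<exists>n. n \<in> A \<and> mtopology closure_of U n \<subseteq> U m1 \<inter> U m2" if "m1 \<in> A" "m2 \<in> A" for m1 m2
      using c[THEN conjunct2, THEN conjunct1] that by simp
    have c3: "m \<in> A" if "n \<in> A" "U n \<subseteq> U m" for m n
      using c[THEN conjunct2, THEN conjunct2, THEN conjunct1] that by simp
    have c4: "U n \<noteq> {}" if "n \<in> A" for n using c that by simp
    define \<C> where "\<C> = (\<lambda>n. mtopology closure_of U n) ` A"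
    have fip: "\<exists>n\<in>A. U n \<subseteq> \<Inter>((\<lambda>n. mtopology closure_of U n) ` F)" if "finite F" "F \<subseteq> A" for F
      using that
    proof (induction F rule: finite_induct)
      case empty then show ?case using c1 by (metis Inter_empty image_empty subset_UNIV)
    next
      case (insert m F)
      then obtain n where n: "n \<in> A" "U n \<subseteq> \<Inter>((\<lambda>n. mtopology closure_of U n) ` F)" by auto
      obtain n' where "n' \<in> A" "mtopology closure_of U n' \<subseteq> U n \<inter> U m" using c2[OF n(1)] insert.prems by (metis insert_subset)
      moreover have "U n' \<subseteq> mtopology closure_of U n'" by (rule closure_of_subset) (use Us in auto)
      moreover have "U m \<subseteq> mtopology closure_of U m" by (rule closure_of_subset) (use Us in auto)
      ultimately show ?case using n(2) by (intro bexI[of _ n']) auto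
    qed
    have "\<Inter>\<C> \<noteq> {}"
    proof (rule mcomplete_fip[THEN iffD1, OF mc, rule_format], intro conjI allI impI ballI)
      show "closedin mtopology C" if "C \<in> \<C>" for C using that unfolding \<C>_def by auto
      show "\<exists>C a. C \<in> \<C> \<and> C \<subseteq> mcball a e" if "e > 0" for e
      proof -
        obtain k where k: "1 / real (Suc k) < e" by (rule nat_approx_posE[OF \<open>e > 0\<close>])
        obtain m a where ma: "m \<in> A" "U m \<subseteq> mcball a (1 / real (Suc k))" using c1 by blast
        have "mcball a (1 / real (Suc k)) \<subseteq> mcball a e" using k by auto
        then have "mtopology closure_of U m \<subseteq> mcball a e"
          using ma(2) closedin_mcball by (meson closure_of_minimal order_trans)
        then show ?thesis using ma(1) unfolding \<C>_def by blast
      qed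
      fix \<F> assume "finite \<F> \<and> \<F> \<subseteq> \<C>"
      then obtain F where "finite F" "F \<subseteq> A" "\<F> = (\<lambda>n. mtopology closure_of U n) ` F"
        unfolding \<C>_def by (meson finite_subset_image)
      moreover from this obtain n where "n \<in> A" "U n \<subseteq> \<Inter>\<F>" using fip[of F] by metis
      moreover have "U n \<noteq> {}" using c4 \<open>n \<in> A\<close> by blast
      ultimately show "\<Inter>\<F> \<noteq> {}" by auto
    qed
    then obtain p where p: "\<And>n. n \<in> A \<Longrightarrow> p \<in> mtopology closure_of U n" unfolding \<C>_def by blast
    obtain m0 where "m0 \<in> A" using c1 by blast
    then have pM: "p \<in> M'" using p closure_of_subset_topspace[of mtopology] by fastforce
    have "n \<in> A \<longleftrightarrow> p \<in> U n" for n
    proof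
      assume "n \<in> A"
      then obtain n' where "n' \<in> A" "mtopology closure_of U n' \<subseteq> U n" using c2[of n n] by blast
      then show "p \<in> U n" using p by blast
    next
      assume "p \<in> U n"
      then obtain r where r: "r > 0" "mball p r \<subseteq> U n"
        using Uo Xm openin_mtopology by metis
      obtain k where k: "1 / real (Suc k) < r/2" by (rule nat_approx_posE[of "r/2"]) (use r(1) in auto)
      obtain m a where ma: "m \<in> A" "U m \<subseteq> mcball a (1 / real (Suc k))" using c1 by blast
      obtain m' where m': "m' \<in> A" "mtopology closure_of U m' \<subseteq> U m" using c2[OF ma(1) ma(1)] by blast
      have pa: "p \<in> mcball a (1 / real (Suc k))" using p[OF m'(1)] m'(2) ma(2) by blast
      \<comment> \<open>The point \<open>p\<close> lies in the closure of a member contained in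
        \<open>U m\<close>, hence in the same closed ball of radius less than \<open>r/2\<close> as
        all of \<open>U m\<close>.\<close>
      have "U m \<subseteq> mball p r"
      proof
        fix y assume "y \<in> U m"
        then have y: "y \<in> mcball a (1 / real (Suc k))" using ma(2) by blast
        have "dd p y \<le> dd a p + dd a y" using pa y by (metis commute in_mcball triangle)
        also have "\<dots> < r" using pa y k by auto
        finally show "y \<in> mball p r" using pM y by auto
      qed
      then show "n \<in> A" using c3[OF ma(1)] r(2) by (meson order_trans)
    qed
    then show "\<exists>p\<in>M'. \<forall>n. n \<in> A \<longleftrightarrow> p \<in> U n" using pM by blast
  qed
  let ?N = "sigma UNIV (range (\<lambda>n::nat. {A. n \<in> A}))"
  have [measurable]: "Measurable.pred ?N (\<lambda>A. n \<in> A)" for n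
    unfolding pred_def by (auto simp: sigma_sets.Basic)
  have "Measurable.pred ?N ?c" by measurable
  then have "{A. ?c A} \<in> sets ?N" unfolding pred_def by simp
  then have s4: "{A. \<exists>p\<in>space M. \<forall>n. n \<in> A \<longleftrightarrow> p \<in> U n} \<in> sigma_sets UNIV (range (\<lambda>n. {A. n \<in> A}))"
    unfolding sp iff by simp
  show ?thesis by (rule that[of U]) (use s1 s3 s4 sp Us in auto)
qed

text \<open>The inverse image of \<open>U n\<close> is the trace on \<open>S\<close> of a measurable
  set \<open>V n\<close>. A point \<open>y\<close> is sent to the point whose code is the set of
  \<open>n\<close> with \<open>y\<close> in \<open>V n\<close>, if there is one, and to
  \<open>g y\<close> otherwise; the first case is a measurable condition since the codes form a
  measurable set. \<open>S\<close> itself may be any subset, as is required for images of bisections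
  before these are known to be Borel.\<close>

lemma standard_borel_measurable_extend:
  assumes M: "standard_borel M" and S: "S \<subseteq> space N" and f: "f \<in> restrict_space N S \<rightarrow>\<^sub>M M"
    and g: "g \<in> N \<rightarrow>\<^sub>M M"
  obtains f' where "f' \<in> N \<rightarrow>\<^sub>M M" "\<And>x. x \<in> S \<Longrightarrow> f' x = f x"
proof -
  obtain U where U: "sets M = sigma_sets (space M) (range U)"
    "\<And>n. U n \<subseteq> space M"
    "\<And>x y. x \<in> space M \<Longrightarrow> y \<in> space M \<Longrightarrow> (\<And>n. x \<in> U n \<longleftrightarrow> y \<in> U n) \<Longrightarrow> x = y"
    "{A. \<exists>p\<in>space M. \<forall>n. n \<in> A \<longleftrightarrow> p \<in> U n} \<in> sigma_sets UNIV (range (\<lambda>n::nat. {A. n \<in> A}))"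
    by (rule standard_borel_code[OF M]) blast
  have spR: "space (restrict_space N S) = S" using S by (auto simp: space_restrict_space)
  have "\<exists>V\<in>sets N. f -` U n \<inter> S = S \<inter> V" for n
  proof -
    have "U n \<in> sets M" unfolding U(1) by (rule sigma_sets.Basic) simp
    from measurable_sets[OF f this] show ?thesis
      unfolding spR sets_restrict_space by blast
  qed
  then obtain V where V: "\<And>n. V n \<in> sets N" "\<And>n. f -` U n \<inter> S = S \<inter> V n" by metis
  define c where "c y = {n. y \<in> V n}" for y
  define Good where "Good = {y \<in> space N. \<exists>p\<in>space M. \<forall>n. y \<in> V n \<longleftrightarrow> p \<in> U n}"
  define pt where "pt y = (THE p. p \<in> space M \<and> (\<forall>n. y \<in> V n \<longleftrightarrow> p \<in> U n))" for y
  have pt: "pt y = p" if "p \<in> space M" "\<And>n. y \<in> V n \<longleftrightarrow> p \<in> U n" for p y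
    unfolding pt_def using that U(3) by (intro the_equality) blast+
  define f' where "f' y = (if y \<in> Good then pt y else g y)" for y
  have "c \<in> N \<rightarrow>\<^sub>M sigma UNIV (range (\<lambda>n::nat. {A. n \<in> A}))"
  proof (rule measurable_sigma_sets[OF sets_measure_of])
    show "c -` y \<inter> space N \<in> sets N" if "y \<in> range (\<lambda>n. {A. n \<in> A})" for y
    proof -
      from \<open>y \<in> range (\<lambda>n. {A. n \<in> A})\<close> obtain n where "y = {A. n \<in> A}" by blast
      then have "c -` y \<inter> space N = V n" using V(1)[of n] sets.sets_into_space by (auto simp: c_def)
      then show ?thesis using V(1) by simp
    qed
  qed auto
  from measurable_sets[OF this, of "{A. \<exists>p\<in>space M. \<forall>n. n \<in> A \<longleftrightarrow> p \<in> U n}"] U(4)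
  have "c -` {A. \<exists>p\<in>space M. \<forall>n. n \<in> A \<longleftrightarrow> p \<in> U n} \<inter> space N \<in> sets N"
    by simp
  also have "c -` {A. \<exists>p\<in>space M. \<forall>n. n \<in> A \<longleftrightarrow> p \<in> U n} \<inter> space N = Good"
    by (auto simp: c_def Good_def)
  finally have Good: "Good \<in> sets N" .
  have ptU: "pt y \<in> space M" "pt y \<in> U n \<longleftrightarrow> y \<in> V n" if "y \<in> Good" for y n
    using that pt unfolding Good_def by auto
  have "f' \<in> N \<rightarrow>\<^sub>M M"
  proof (rule measurable_sigma_sets[OF U(1)])
    show "f' \<in> space N \<rightarrow> space M" using ptU(1) measurable_space[OF g] by (auto simp: f'_def)
    show "f' -` y \<inter> space N \<in> sets N" if "y \<in> range U" for y
    proof -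
      from \<open>y \<in> range U\<close> obtain n where n: "y = U n" by blast
      have "f' -` y \<inter> space N = (Good \<inter> V n) \<union> (g -` U n \<inter> space N - Good)"
        using ptU sets.sets_into_space[OF Good] by (auto simp: f'_def n split: if_splits)
      moreover have "g -` U n \<inter> space N \<in> sets N"
        by (rule measurable_sets[OF g]) (auto simp: U(1) sigma_sets.Basic)
      ultimately show ?thesis using Good V by auto
    qed
  qed (use U in auto)
  moreover have "f' x = f x" if "x \<in> S" for x
  proof -
    have "f x \<in> space M" using measurable_space[OF f] that spR by auto
    moreover have "x \<in> V n \<longleftrightarrow> f x \<in> U n" for n using V(2)[of n] that by auto
    ultimately show ?thesis using that S pt by (auto simp: f'_def Good_def)
  qed
  ultimately show ?thesis using that by blast
qed

text \<open>Two values differ iff one of the countably many sets \<open>U n\<close> separates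
  them.\<close>

lemma standard_borel_sets_Collect_eq:
  assumes M: "standard_borel M" and f: "f \<in> N \<rightarrow>\<^sub>M M" and g: "g \<in> N \<rightarrow>\<^sub>M M"
  shows "{x \<in> space N. f x = g x} \<in> sets N"
proof -
  obtain U where U: "sets M = sigma_sets (space M) (range U)"
    "\<And>n::nat. U n \<subseteq> space M"
    "\<And>x y. x \<in> space M \<Longrightarrow> y \<in> space M \<Longrightarrow> (\<And>n. x \<in> U n \<longleftrightarrow> y \<in> U n) \<Longrightarrow> x = y"
    "{A. \<exists>p\<in>space M. \<forall>n. n \<in> A \<longleftrightarrow> p \<in> U n} \<in> sigma_sets UNIV (range (\<lambda>n::nat. {A. n \<in> A}))"
    by (rule standard_borel_code[OF M]) blast
  have "U n \<in> sets M" for n unfolding U(1) by (rule sigma_sets.Basic) simp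
  then have "f -` U n \<inter> space N \<in> sets N" "g -` U n \<inter> space N \<in> sets N" for n
    using f g by (auto intro: measurable_sets)
  then have "space N - (\<Union>n. sym_diff (f -` U n \<inter> space N) (g -` U n \<inter> space N)) \<in> sets N"
    by auto
  also have "space N - (\<Union>n. sym_diff (f -` U n \<inter> space N) (g -` U n \<inter> space N)) = {x \<in> space N. f x = g x}"
    (is "?l = ?r")
  proof (intro set_eqI iffI)
    fix x assume x: "x \<in> ?l"
    then show "x \<in> ?r" using U(3)[of "f x" "g x"] measurable_space[OF f] measurable_space[OF g] by blast
  qed auto
  finally show ?thesis .
qed

section \<open>Bisections\<close>

context groupoid begin

lemma ginv_ginv:
  assumes h: "h \<in> space (arrows H)"
  shows "ginv H (ginv H h) = h"
proof -
  let ?i = "ginv H h" and ?j = "ginv H (ginv H h)"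
  have in': "?i \<in> space (arrows H)" "?j \<in> space (arrows H)" using h by (auto simp: ginv_in)
  have c: "(?j, ?i) \<in> composable H" "(?i, h) \<in> composable H"
    using h in' by (auto simp: composable_def src_ginv rng_ginv)
  have "h = cmp H (cmp H ?j ?i) h" using h in' by (simp add: cmp_ginv_left src_ginv rng_cmp_left)
  also have "\<dots> = cmp H ?j (src H h)" using cmp_assoc[OF c] h by (simp add: cmp_ginv_left)
  also have "\<dots> = ?j" using cmp_src[OF in'(2)] h in' by (simp add: src_ginv rng_ginv)
  finally show ?thesis by simp
qed

lemma cmp_cancel_right:
  assumes "(f, h) \<in> composable H"
  shows "cmp H (cmp H f h) (ginv H h) = f"
proof -
  have h: "h \<in> space (arrows H)" "f \<in> space (arrows H)" "src H f = rng H h"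
    using assms by (auto simp: composable_def)
  have "(h, ginv H h) \<in> composable H" using h by (simp add: composable_def ginv_in rng_ginv)
  from cmp_assoc[OF assms this] have "cmp H (cmp H f h) (ginv H h) = cmp H f (src H f)"
    using h by (simp add: cmp_ginv_right)
  then show ?thesis using cmp_src[OF h(2)] by simp
qed

lemma src_image_units:
  assumes "A \<subseteq> units H"
  shows "src H ` A = A"
proof -
  have "src H ` A = (\<lambda>x. x) ` A" by (rule image_cong) (use assms src_unit in auto)
  then show ?thesis by simp
qed

lemma rng_image_units:
  assumes "A \<subseteq> units H"
  shows "rng H ` A = A"
proof -
  have "rng H ` A = (\<lambda>x. x) ` A" by (rule image_cong) (use assms rng_unit in auto)
  then show ?thesis by simp
qed

lemma space_unit_space: "space (unit_space H) = units H"
  using units_subset by (auto simp: unit_space_def space_restrict_space)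

end

context measurable_groupoid begin

lemma sets_unit_space_iff: "B \<in> sets (unit_space H) \<longleftrightarrow> B \<subseteq> units H \<and> B \<in> sets (arrows H)"
  unfolding unit_space_def
  by (subst sets_restrict_space_iff) (use units_borel units_subset in \<open>auto simp: Int_absorb2\<close>)

lemma measurable_unit_arrow: "(\<lambda>x. x) \<in> unit_space H \<rightarrow>\<^sub>M arrows H"
  unfolding unit_space_def by (rule measurable_restrict_space1) simp

lemma measurable_into_arrows: "f \<in> N \<rightarrow>\<^sub>M unit_space H \<Longrightarrow> f \<in> N \<rightarrow>\<^sub>M arrows H"
  using measurable_compose[OF _ measurable_unit_arrow] .

text \<open>The inverses in the definition are maps on subspaces of unit sets that are not known to
  be Borel. Extending them to all units gives a form without subspaces, from which all closure
  properties below are derived: a Borel set with two global Borel maps recovering an arrow from its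
  source and from its range.\<close>

lemma bisection_iff:
  "f \<in> bisections H \<longleftrightarrow> f \<in> sets (arrows H) \<and>
     (\<exists>k \<in> unit_space H \<rightarrow>\<^sub>M arrows H. \<forall>h\<in>f. k (src H h) = h) \<and>
     (\<exists>k \<in> unit_space H \<rightarrow>\<^sub>M arrows H. \<forall>h\<in>f. k (rng H h) = h)"
proof -
  have *: "borel_iso_onto_image (arrows H) (unit_space H) f s \<longleftrightarrow>
      (\<exists>k \<in> unit_space H \<rightarrow>\<^sub>M arrows H. \<forall>h\<in>f. k (s h) = h)"
    if f: "f \<in> sets (arrows H)" and s: "s \<in> arrows H \<rightarrow>\<^sub>M unit_space H" for s
  proof
    have sf: "s ` f \<subseteq> space (unit_space H)"
      using measurable_space[OF s] sets.sets_into_space[OF f] by blast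
    assume "borel_iso_onto_image (arrows H) (unit_space H) f s"
    then have i: "inj_on s f" and
      m: "the_inv_into f s \<in> restrict_space (unit_space H) (s ` f) \<rightarrow>\<^sub>M restrict_space (arrows H) f"
      unfolding borel_iso_onto_image_def by auto
    have "the_inv_into f s \<in> restrict_space (unit_space H) (s ` f) \<rightarrow>\<^sub>M arrows H"
      using m by (simp add: measurable_restrict_space2_iff)
    from standard_borel_measurable_extend[OF standard_borel_arrows sf this measurable_unit_arrow]
    obtain k where k: "k \<in> unit_space H \<rightarrow>\<^sub>M arrows H" "\<And>x. x \<in> s ` f \<Longrightarrow> k x = the_inv_into f s x"
      by blast
    then show "\<exists>k \<in> unit_space H \<rightarrow>\<^sub>M arrows H. \<forall>h\<in>f. k (s h) = h"
      using the_inv_into_f_f[OF i] by (intro bexI[of _ k]) auto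
  next
    assume "\<exists>k \<in> unit_space H \<rightarrow>\<^sub>M arrows H. \<forall>h\<in>f. k (s h) = h"
    then obtain k where k: "k \<in> unit_space H \<rightarrow>\<^sub>M arrows H" "\<forall>h\<in>f. k (s h) = h" by blast
    then have i: "inj_on s f" by (metis inj_onI)
    have "k \<in> restrict_space (unit_space H) (s ` f) \<rightarrow>\<^sub>M restrict_space (arrows H) f"
      by (rule measurable_restrict_space3[OF k(1)]) (use k(2) in auto)
    also have "?this \<longleftrightarrow> the_inv_into f s \<in> restrict_space (unit_space H) (s ` f) \<rightarrow>\<^sub>M restrict_space (arrows H) f"
      by (rule measurable_cong) (use k(2) the_inv_into_f_f[OF i] in \<open>auto simp: space_restrict_space\<close>)
    finally show "borel_iso_onto_image (arrows H) (unit_space H) f s"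
      unfolding borel_iso_onto_image_def using i measurable_restrict_space3[OF s] by auto
  qed
  show ?thesis unfolding bisections_def using *[OF _ src_borel] *[OF _ rng_borel] by blast
qed

lemma bisectionI:
  assumes "f \<in> sets (arrows H)"
    and "k \<in> unit_space H \<rightarrow>\<^sub>M arrows H" "\<And>h. h \<in> f \<Longrightarrow> k (src H h) = h"
    and "l \<in> unit_space H \<rightarrow>\<^sub>M arrows H" "\<And>h. h \<in> f \<Longrightarrow> l (rng H h) = h"
  shows "f \<in> bisections H"
  unfolding bisection_iff using assms by blast

lemma bisectionE:
  assumes "f \<in> bisections H"
  obtains k l where "f \<in> sets (arrows H)"
    "k \<in> unit_space H \<rightarrow>\<^sub>M arrows H" "\<And>h. h \<in> f \<Longrightarrow> k (src H h) = h"
    "l \<in> unit_space H \<rightarrow>\<^sub>M arrows H" "\<And>h. h \<in> f \<Longrightarrow> l (rng H h) = h"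
  using assms unfolding bisection_iff by blast

lemma bis_in: "f \<in> bisections H \<Longrightarrow> h \<in> f \<Longrightarrow> h \<in> space (arrows H)"
  unfolding bisection_iff using sets.sets_into_space by blast

lemma bis_src_inj: "f \<in> bisections H \<Longrightarrow> h \<in> f \<Longrightarrow> h' \<in> f \<Longrightarrow> src H h = src H h' \<Longrightarrow> h = h'"
  unfolding bisection_iff by metis

lemma bis_rng_inj: "f \<in> bisections H \<Longrightarrow> h \<in> f \<Longrightarrow> h' \<in> f \<Longrightarrow> rng H h = rng H h' \<Longrightarrow> h = h'"
  unfolding bisection_iff by metis

lemma bis_at_eq: "f \<in> bisections H \<Longrightarrow> h \<in> f \<Longrightarrow> bis_at H f (src H h) = h"
  unfolding bis_at_def using bis_src_inj by blast

text \<open>A unit x is the source of an arrow of \<open>f\<close> iff \<open>k x\<close> belongs to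
  \<open>f\<close> and has source x, so the image is described by inverse images under
  \<open>k\<close>.\<close>

lemma bis_src_borel:
  assumes "f \<in> bisections H"
  shows "src H ` f \<in> sets (unit_space H)"
proof (rule bisectionE[OF assms])
  fix k l assume f: "f \<in> sets (arrows H)"
    and k: "k \<in> unit_space H \<rightarrow>\<^sub>M arrows H" "\<And>h. h \<in> f \<Longrightarrow> k (src H h) = h"
  have "{x \<in> space (unit_space H). src H (k x) = x} \<in> sets (unit_space H)"
    by (rule standard_borel_sets_Collect_eq[OF standard_borel_arrows])
      (use k(1) src_borel in \<open>auto intro: measurable_into_arrows measurable_unit_arrow measurable_compose\<close>)
  moreover have "k -` f \<inter> space (unit_space H) \<in> sets (unit_space H)"
    using k(1) f by (rule measurable_sets)
  ultimately have "{x \<in> space (unit_space H). src H (k x) = x} \<inter> (k -` f \<inter> space (unit_space H)) \<in> sets (unit_space H)"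
    by (rule sets.Int)
  also have "{x \<in> space (unit_space H). src H (k x) = x} \<inter> (k -` f \<inter> space (unit_space H)) = src H ` f"
    using k(2) bis_in[OF assms] src_in by (auto simp: space_unit_space image_iff) (metis)
  finally show ?thesis .
qed

lemma bis_rng_borel:
  assumes "f \<in> bisections H"
  shows "rng H ` f \<in> sets (unit_space H)"
proof (rule bisectionE[OF assms])
  fix k l assume f: "f \<in> sets (arrows H)"
    and k: "l \<in> unit_space H \<rightarrow>\<^sub>M arrows H" "\<And>h. h \<in> f \<Longrightarrow> l (rng H h) = h"
  have "{x \<in> space (unit_space H). rng H (l x) = x} \<in> sets (unit_space H)"
    by (rule standard_borel_sets_Collect_eq[OF standard_borel_arrows])
      (use k(1) rng_borel in \<open>auto intro: measurable_into_arrows measurable_unit_arrow measurable_compose\<close>)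
  moreover have "l -` f \<inter> space (unit_space H) \<in> sets (unit_space H)"
    using k(1) f by (rule measurable_sets)
  ultimately have "{x \<in> space (unit_space H). rng H (l x) = x} \<inter> (l -` f \<inter> space (unit_space H)) \<in> sets (unit_space H)"
    by (rule sets.Int)
  also have "{x \<in> space (unit_space H). rng H (l x) = x} \<inter> (l -` f \<inter> space (unit_space H)) = rng H ` f"
    using k(2) bis_in[OF assms] rng_in by (auto simp: space_unit_space image_iff) (metis)
  finally show ?thesis .
qed

lemma bis_src_subset: "f \<in> bisections H \<Longrightarrow> src H ` f \<subseteq> units H"
  using bis_in src_in by auto

lemma bis_rng_subset: "f \<in> bisections H \<Longrightarrow> rng H ` f \<subseteq> units H"
  using bis_in rng_in by auto

lemma bis_subset: "f \<in> bisections H \<Longrightarrow> g \<in> sets (arrows H) \<Longrightarrow> g \<subseteq> f \<Longrightarrow> g \<in> bisections H"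
  unfolding bisection_iff by (meson subsetD)

lemma bis_units: "B \<in> sets (unit_space H) \<Longrightarrow> B \<in> bisections H"
  by (rule bisectionI[OF _ measurable_unit_arrow _ measurable_unit_arrow])
    (use sets_unit_space_iff src_unit rng_unit in auto)

lemma units_bis: "units H \<in> bisections H"
  by (rule bis_units) (simp add: sets_unit_space_iff units_borel)

lemma bis_ginv:
  assumes "f \<in> bisections H"
  shows "ginv H ` f \<in> bisections H"
proof (rule bisectionE[OF assms])
  fix k l assume f: "f \<in> sets (arrows H)"
    and k: "k \<in> unit_space H \<rightarrow>\<^sub>M arrows H" "\<And>h. h \<in> f \<Longrightarrow> k (src H h) = h"
    and l: "l \<in> unit_space H \<rightarrow>\<^sub>M arrows H" "\<And>h. h \<in> f \<Longrightarrow> l (rng H h) = h"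
  have fs: "f \<subseteq> space (arrows H)" using f by (rule sets.sets_into_space)
  have "ginv H -` f \<inter> space (arrows H) \<in> sets (arrows H)"
    using ginv_borel f by (rule measurable_sets)
  also have "ginv H -` f \<inter> space (arrows H) = ginv H ` f"
    using fs by (auto simp: ginv_in ginv_ginv image_iff subset_eq) (metis ginv_ginv)
  finally have "ginv H ` f \<in> sets (arrows H)" .
  then show ?thesis
    by (rule bisectionI[OF _ measurable_compose[OF l(1) ginv_borel] _ measurable_compose[OF k(1) ginv_borel]])
      (use fs k l in \<open>auto simp: src_ginv rng_ginv subset_eq\<close>)
qed

lemma bis_Un:
  assumes f: "f \<in> bisections H" and g: "g \<in> bisections H"
    and "src H ` f \<inter> src H ` g = {}" "rng H ` f \<inter> rng H ` g = {}"
  shows "f \<union> g \<in> bisections H"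
proof -
  obtain k l where f': "f \<in> sets (arrows H)"
    "k \<in> unit_space H \<rightarrow>\<^sub>M arrows H" "\<And>h. h \<in> f \<Longrightarrow> k (src H h) = h"
    "l \<in> unit_space H \<rightarrow>\<^sub>M arrows H" "\<And>h. h \<in> f \<Longrightarrow> l (rng H h) = h"
    using bisectionE[OF f] by metis
  obtain k' l' where g': "g \<in> sets (arrows H)"
    "k' \<in> unit_space H \<rightarrow>\<^sub>M arrows H" "\<And>h. h \<in> g \<Longrightarrow> k' (src H h) = h"
    "l' \<in> unit_space H \<rightarrow>\<^sub>M arrows H" "\<And>h. h \<in> g \<Longrightarrow> l' (rng H h) = h"
    using bisectionE[OF g] by metis
  have "src H ` f \<inter> space (unit_space H) \<in> sets (unit_space H)"
    "rng H ` f \<inter> space (unit_space H) \<in> sets (unit_space H)"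
    using bis_src_borel[OF f] bis_rng_borel[OF f] by auto
  note m = measurable_If_set[OF f'(2) g'(2) this(1)] measurable_If_set[OF f'(4) g'(4) this(2)]
  show ?thesis
    by (rule bisectionI[OF _ m(1) _ m(2)]) (use f' g' assms(3,4) in auto)
qed

text \<open>Composition is measurable on the composable pairs only; the fallback \<open>w\<close>
  makes it a total measurable map.\<close>

lemma measurable_cmp_partial:
  assumes u: "u \<in> N \<rightarrow>\<^sub>M arrows H" and v: "v \<in> N \<rightarrow>\<^sub>M arrows H" and w: "w \<in> N \<rightarrow>\<^sub>M arrows H"
  shows "(\<lambda>x. if (u x, v x) \<in> composable H then cmp H (u x) (v x) else w x) \<in> N \<rightarrow>\<^sub>M arrows H"
    and "{x \<in> space N. (u x, v x) \<in> composable H} \<in> sets N"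
proof -
  have uv: "(\<lambda>x. (u x, v x)) \<in> N \<rightarrow>\<^sub>M arrows H \<Otimes>\<^sub>M arrows H" using u v by simp
  have "(\<lambda>x. (u x, v x)) -` composable H \<inter> space N \<in> sets N"
    using uv composable_borel by (rule measurable_sets)
  also have "(\<lambda>x. (u x, v x)) -` composable H \<inter> space N = {x \<in> space N. (u x, v x) \<in> composable H}" by auto
  finally show S: "{x \<in> space N. (u x, v x) \<in> composable H} \<in> sets N" .
  have "(\<lambda>x. (u x, v x)) \<in> restrict_space N {x. (u x, v x) \<in> composable H} \<rightarrow>\<^sub>M
      restrict_space (arrows H \<Otimes>\<^sub>M arrows H) (composable H)"
    by (rule measurable_restrict_space3[OF uv]) auto
  from measurable_compose[OF this cmp_borel]
  show "(\<lambda>x. if (u x, v x) \<in> composable H then cmp H (u x) (v x) else w x) \<in> N \<rightarrow>\<^sub>M arrows H"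
    by (subst measurable_If_restrict_space_iff[OF S]) (use w in \<open>auto intro: measurable_restrict_space1\<close>)
qed

text \<open>From its source x a product of \<open>g\<close> and \<open>f\<close> is rebuilt
  uniquely: the right factor must be \<open>k x\<close> and the left factor
  \<open>k' (rng H (k x))\<close>. The product set consists of the arrows for which this
  reconstruction is possible and returns the arrow, which is a Borel condition; from the range one
  argues with \<open>l'\<close> and \<open>l\<close>.\<close>

lemma bis_prod_bis:
  assumes g: "g \<in> bisections H" and f: "f \<in> bisections H"
  shows "bis_prod H g f \<in> bisections H"
proof -
  obtain k l where f': "f \<in> sets (arrows H)"
    "k \<in> unit_space H \<rightarrow>\<^sub>M arrows H" "\<And>h. h \<in> f \<Longrightarrow> k (src H h) = h"
    "l \<in> unit_space H \<rightarrow>\<^sub>M arrows H" "\<And>h. h \<in> f \<Longrightarrow> l (rng H h) = h"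
    using bisectionE[OF f] by metis
  obtain k' l' where g': "g \<in> sets (arrows H)"
    "k' \<in> unit_space H \<rightarrow>\<^sub>M arrows H" "\<And>h. h \<in> g \<Longrightarrow> k' (src H h) = h"
    "l' \<in> unit_space H \<rightarrow>\<^sub>M arrows H" "\<And>h. h \<in> g \<Longrightarrow> l' (rng H h) = h"
    using bisectionE[OF g] by metis
  let ?p = "\<lambda>x. if (k' (rng H (k x)), k x) \<in> composable H then cmp H (k' (rng H (k x))) (k x) else x"
  let ?q = "\<lambda>x. if (l' x, l (src H (l' x))) \<in> composable H then cmp H (l' x) (l (src H (l' x))) else x"
  have m1: "(\<lambda>x. k' (rng H (k x))) \<in> unit_space H \<rightarrow>\<^sub>M arrows H"
    by (intro measurable_compose[OF _ g'(2)] measurable_compose[OF _ rng_borel] f')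
  have p: "?p \<in> unit_space H \<rightarrow>\<^sub>M arrows H"
    by (rule measurable_cmp_partial(1)[OF m1 f'(2) measurable_unit_arrow])
  have m2: "(\<lambda>x. l (src H (l' x))) \<in> unit_space H \<rightarrow>\<^sub>M arrows H"
    by (intro measurable_compose[OF _ f'(4)] measurable_compose[OF _ src_borel] g')
  have q: "?q \<in> unit_space H \<rightarrow>\<^sub>M arrows H"
    by (rule measurable_cmp_partial(1)[OF g'(4) m2 measurable_unit_arrow])
  have in_w: "k (src H h) \<in> f \<and> k' (rng H (k (src H h))) \<in> g \<and>
       (k' (rng H (k (src H h))), k (src H h)) \<in> composable H \<and> ?p (src H h) = h \<and> ?q (rng H h) = h"
    if "h \<in> bis_prod H g f" for h
  proof -
    obtain b a where h: "h = cmp H b a" "b \<in> g" "a \<in> f" "(b, a) \<in> composable H"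
      using \<open>h \<in> bis_prod H g f\<close> unfolding bis_prod_def by blast
    then have "k (src H h) = a" "l' (rng H h) = b"
      using f'(3)[OF h(3)] g'(5)[OF h(2)] by (simp_all add: src_cmp rng_cmp)
    moreover have "src H b = rng H a" using h(4) by (simp add: composable_def)
    then have "k' (rng H a) = b" "l (src H b) = a" using g'(3)[OF h(2)] f'(5)[OF h(3)] by auto
    ultimately show ?thesis using h by simp
  qed
  let ?S1 = "{h \<in> space (arrows H). (k' (rng H (k (src H h))), k (src H h)) \<in> composable H}"
  let ?S2 = "{h \<in> space (arrows H). ?p (src H h) = h}"
  let ?S3 = "(\<lambda>h. k (src H h)) -` f \<inter> space (arrows H)"
  let ?S4 = "(\<lambda>h. k' (rng H (k (src H h)))) -` g \<inter> space (arrows H)"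
  have ks: "(\<lambda>h. k (src H h)) \<in> arrows H \<rightarrow>\<^sub>M arrows H" by (rule measurable_compose[OF src_borel f'(2)])
  have ks': "(\<lambda>h. k' (rng H (k (src H h)))) \<in> arrows H \<rightarrow>\<^sub>M arrows H" by (rule measurable_compose[OF src_borel m1])
  have "?S1 \<in> sets (arrows H)" by (rule measurable_cmp_partial(2)[OF ks' ks ks])
  moreover have "?S2 \<in> sets (arrows H)"
    by (rule standard_borel_sets_Collect_eq[OF standard_borel_arrows measurable_compose[OF src_borel p]]) simp
  moreover have "?S3 \<in> sets (arrows H)" "?S4 \<in> sets (arrows H)"
    using measurable_sets[OF ks f'(1)] measurable_sets[OF ks' g'(1)] by auto
  ultimately have "?S1 \<inter> ?S2 \<inter> ?S3 \<inter> ?S4 \<in> sets (arrows H)" by auto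
  also have "?S1 \<inter> ?S2 \<inter> ?S3 \<inter> ?S4 = bis_prod H g f"
  proof
    show "?S1 \<inter> ?S2 \<inter> ?S3 \<inter> ?S4 \<subseteq> bis_prod H g f"
    proof
      fix h assume h: "h \<in> ?S1 \<inter> ?S2 \<inter> ?S3 \<inter> ?S4"
      then have "h = cmp H (k' (rng H (k (src H h)))) (k (src H h))" by auto
      then show "h \<in> bis_prod H g f" using h unfolding bis_prod_def by blast
    qed
    have "h \<in> space (arrows H)" if "h \<in> bis_prod H g f" for h
      using that cmp_in unfolding bis_prod_def by blast
    then show "bis_prod H g f \<subseteq> ?S1 \<inter> ?S2 \<inter> ?S3 \<inter> ?S4"
    proof (intro subsetI)
      fix h assume h: "h \<in> bis_prod H g f"
      note w = in_w[OF h]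
      have "cmp H (k' (rng H (k (src H h)))) (k (src H h)) = h"
        using w[THEN conjunct2, THEN conjunct2, THEN conjunct2, THEN conjunct1] w by (simp only: if_True simp_thms)
      then show "h \<in> ?S1 \<inter> ?S2 \<inter> ?S3 \<inter> ?S4"
        using w \<open>\<And>h. h \<in> bis_prod H g f \<Longrightarrow> h \<in> space (arrows H)\<close>[OF h] by blast
    qed
  qed
  finally have w: "bis_prod H g f \<in> sets (arrows H)" .
  show ?thesis
  proof (rule bisectionI[OF w p _ q])
    fix h assume "h \<in> bis_prod H g f"
    note w = in_w[OF this, THEN conjunct2, THEN conjunct2, THEN conjunct2]
    show "?p (src H h) = h" by (rule w[THEN conjunct1])
    show "?q (rng H h) = h" by (rule w[THEN conjunct2])
  qed
qed

text \<open>The source set and the range set of such a bisection coincide, so the identity on their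
  common complement completes it.\<close>

lemma full_bisection_isotropy:
  assumes g: "g \<in> bisections H" and eq: "\<And>h. h \<in> g \<Longrightarrow> src H h = rng H h"
  shows "g \<union> (units H - src H ` g) \<in> full_bisections H"
proof -
  have sr: "src H ` g = rng H ` g" using eq by (auto intro!: image_cong)
  have B: "units H - src H ` g \<in> sets (unit_space H)"
    using bis_src_borel[OF g] by (metis sets.compl_sets space_unit_space)
  note su = src_image_units rng_image_units
  note sg = bis_src_subset[OF g]
  have "g \<union> (units H - src H ` g) \<in> bisections H"
    by (rule bis_Un[OF g bis_units[OF B]]) (use sr su[of "units H - src H ` g", OF Diff_subset] in auto)
  moreover have "src H ` (g \<union> (units H - src H ` g)) = units H"
    "rng H ` (g \<union> (units H - src H ` g)) = units H"
    unfolding image_Un using su[of "units H - src H ` g", OF Diff_subset] sr sg by auto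
  ultimately show ?thesis by (simp add: full_bisections_def)
qed

lemma full_bisection_disjoint:
  assumes g: "g \<in> bisections H" and disj: "src H ` g \<inter> rng H ` g = {}"
  shows "g \<union> ginv H ` g \<union> (units H - src H ` g - rng H ` g) \<in> full_bisections H"
proof -
  let ?B = "units H - src H ` g - rng H ` g"
  have B: "?B \<in> sets (unit_space H)"
    using bis_src_borel[OF g] bis_rng_borel[OF g] by (metis sets.Diff sets.compl_sets space_unit_space)
  note su = src_image_units rng_image_units
  have sB: "src H ` ?B = ?B" "rng H ` ?B = ?B" by (rule su, blast)+
  note sg = bis_src_subset[OF g] bis_rng_subset[OF g]
  have gi: "src H ` ginv H ` g = rng H ` g" "rng H ` ginv H ` g = src H ` g"
    unfolding image_image using bis_in[OF g] by (auto intro!: image_cong simp: src_ginv rng_ginv)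
  have gb: "g \<union> ginv H ` g \<in> bisections H"
    by (rule bis_Un[OF g bis_ginv[OF g]]) (use gi disj in auto)
  have "g \<union> ginv H ` g \<union> ?B \<in> bisections H"
    by (rule bis_Un[OF gb bis_units[OF B]]) (unfold image_Un sB gi, auto)
  moreover have "src H ` (g \<union> ginv H ` g \<union> ?B) = units H"
    "rng H ` (g \<union> ginv H ` g \<union> ?B) = units H"
    unfolding image_Un sB gi using sg by auto
  ultimately show ?thesis by (simp add: full_bisections_def)
qed

text \<open>Away from the isotropy, a countable separating family of Borel sets of units cuts a bisection
  into pieces whose sources and ranges are disjoint, and such a piece \<open>g\<close> is contained in
  the involution which exchanges its source and range along \<open>g\<close> and its inverse.\<close>

lemma bisection_full_cover:
  assumes g: "g \<in> bisections H"
  obtains G :: "nat \<Rightarrow> 'h set" where "\<And>n. G n \<in> full_bisections H" "g \<subseteq> (\<Union>n. G n)"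
proof -
  obtain U where U: "sets (arrows H) = sigma_sets (space (arrows H)) (range U)"
    "\<And>n::nat. U n \<subseteq> space (arrows H)"
    "\<And>x y. x \<in> space (arrows H) \<Longrightarrow> y \<in> space (arrows H) \<Longrightarrow> (\<And>n. x \<in> U n \<longleftrightarrow> y \<in> U n) \<Longrightarrow> x = y"
    "{A. \<exists>p\<in>space (arrows H). \<forall>n. n \<in> A \<longleftrightarrow> p \<in> U n} \<in> sigma_sets UNIV (range (\<lambda>n::nat. {A. n \<in> A}))"
    by (rule standard_borel_code[OF standard_borel_arrows]) blast
  have Us: "U n \<in> sets (arrows H)" for n unfolding U(1) by (rule sigma_sets.Basic) simp
  have gs: "g \<in> sets (arrows H)" using g by (simp add: bisection_iff)
  define g0 where "g0 = {h \<in> g. src H h = rng H h}"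
  define p where "p n = {h \<in> g. src H h \<in> U n \<and> rng H h \<notin> U n}" for n
  define q where "q n = {h \<in> g. src H h \<notin> U n \<and> rng H h \<in> U n}" for n
  have m: "src H \<in> arrows H \<rightarrow>\<^sub>M arrows H" "rng H \<in> arrows H \<rightarrow>\<^sub>M arrows H"
    using src_borel rng_borel by (auto intro: measurable_into_arrows)
  have "g0 = g \<inter> {h \<in> space (arrows H). src H h = rng H h}"
    unfolding g0_def using bis_in[OF g] by auto
  then have "g0 \<in> sets (arrows H)"
    using gs standard_borel_sets_Collect_eq[OF standard_borel_arrows m] by auto
  then have g0: "g0 \<in> bisections H" by (rule bis_subset[OF g]) (auto simp: g0_def)
  have "p n = g \<inter> (src H -` U n \<inter> space (arrows H)) - (rng H -` U n \<inter> space (arrows H))" for n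
    unfolding p_def using bis_in[OF g] by auto
  then have "p n \<in> sets (arrows H)" for n
    using gs measurable_sets[OF m(1) Us] measurable_sets[OF m(2) Us] by auto
  then have p: "p n \<in> bisections H" for n by (rule bis_subset[OF g]) (auto simp: p_def)
  have "q n = g \<inter> (rng H -` U n \<inter> space (arrows H)) - (src H -` U n \<inter> space (arrows H))" for n
    unfolding q_def using bis_in[OF g] by auto
  then have "q n \<in> sets (arrows H)" for n
    using gs measurable_sets[OF m(1) Us] measurable_sets[OF m(2) Us] by auto
  then have q: "q n \<in> bisections H" for n by (rule bis_subset[OF g]) (auto simp: q_def)
  define \<F> where "\<F> = insert (g0 \<union> (units H - src H ` g0))
    ((\<lambda>n. p n \<union> ginv H ` p n \<union> (units H - src H ` p n - rng H ` p n)) ` UNIV \<union>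
     (\<lambda>n. q n \<union> ginv H ` q n \<union> (units H - src H ` q n - rng H ` q n)) ` UNIV)"
  have "src H ` p n \<inter> rng H ` p n = {}" "src H ` q n \<inter> rng H ` q n = {}" for n
    unfolding p_def q_def by auto
  note pq = full_bisection_disjoint[OF p this(1)] full_bisection_disjoint[OF q this(2)]
  have g0': "g0 \<union> (units H - src H ` g0) \<in> full_bisections H"
    by (rule full_bisection_isotropy[OF g0]) (simp add: g0_def)
  have full: "\<F> \<subseteq> full_bisections H"
    unfolding \<F>_def by (intro insert_subsetI Un_least image_subsetI g0' pq)
  have cov: "g \<subseteq> \<Union>\<F>"
  proof
    fix h assume h: "h \<in> g"
    have hs: "src H h \<in> space (arrows H)" "rng H h \<in> space (arrows H)"
      using bis_in[OF g h] src_in rng_in units_subset by blast+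
    have "h \<in> g0 \<or> (\<exists>n. h \<in> p n) \<or> (\<exists>n. h \<in> q n)"
      using U(3)[OF hs] h unfolding g0_def p_def q_def by blast
    moreover have "g0 \<subseteq> \<Union>\<F>" unfolding \<F>_def by (rule order_trans[OF Un_upper1 Union_upper]) (rule insertI1)
    moreover have "p n \<subseteq> \<Union>\<F>" for n unfolding \<F>_def
      by (rule order_trans[OF order_trans[OF Un_upper1 Un_upper1] Union_upper])
        (rule insertI2, rule UnI1, rule rangeI)
    moreover have "q n \<subseteq> \<Union>\<F>" for n unfolding \<F>_def
      by (rule order_trans[OF order_trans[OF Un_upper1 Un_upper1] Union_upper])
        (rule insertI2, rule UnI2, rule rangeI)
    ultimately show "h \<in> \<Union>\<F>" by (meson subsetD)
  qed
  have "\<F> \<noteq> {}" unfolding \<F>_def by (rule insert_not_empty)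
  moreover have "countable \<F>" unfolding \<F>_def by (intro countable_insert countable_Un countable_image countableI_type)
  ultimately have ne: "\<F> \<noteq> {}" "countable \<F>" by -
  show ?thesis
  proof (rule that[of "from_nat_into \<F>"])
    show "from_nat_into \<F> n \<in> full_bisections H" for n using full from_nat_into[OF ne(1)] by (rule subsetD)
    show "g \<subseteq> (\<Union>n. from_nat_into \<F> n)" unfolding range_from_nat_into[OF ne] by (rule cov)
  qed
qed

end

section \<open>Patterns of labels\<close>

text \<open>The index \<open>(g, A)\<close> stands for the event that the label at the \<open>g\<close>-neighbour of a base point lies in
  \<open>A\<close>, and \<open>N g\<close> is the set of such neighbours: \<open>{g x}\<close> or \<open>{}\<close> at a unit \<open>x\<close> (\<open>bis_fibre H x\<close>), and
  \<open>{\<sigma> g v}\<close> or \<open>{}\<close> at a vertex \<open>v\<close> of a sofic model (\<open>verts \<sigma> v\<close>). The law \<open>hit_prob\<close> of the set of events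
  that occur under independent labels depends on \<open>N\<close> only through the relation \<open>coinc I N\<close>, which
  makes the two situations comparable.\<close>

definition hits :: "('g \<times> 'k set) set \<Rightarrow> ('g \<Rightarrow> 'p set) \<Rightarrow> ('p \<Rightarrow> 'k) \<Rightarrow> ('g \<times> 'k set) set" where
  "hits I N \<omega> = {i \<in> I. \<exists>k\<in>N (fst i). \<omega> k \<in> snd i}"

definition coinc :: "('g \<times> 'k set) set \<Rightarrow> ('g \<Rightarrow> 'p set) \<Rightarrow> (('g \<times> 'k set) \<times> ('g \<times> 'k set)) set" where
  "coinc I N = {(i, j) \<in> I \<times> I. N (fst i) \<inter> N (fst j) \<noteq> {}}"

text \<open>The labels admissible at a single position: \<open>E\<close> is the set of events that
  read this position, and \<open>a\<close> prescribes which events occur.\<close>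

definition sel_labels :: "'k set \<Rightarrow> ('g \<times> 'k set) set \<Rightarrow> ('g \<times> 'k set) set \<Rightarrow> 'k set" where
  "sel_labels S E a = {c \<in> S. \<forall>i\<in>E. c \<in> snd i \<longleftrightarrow> i \<in> a}"

text \<open>For a coincidence relation the classes stand for the distinct positions, each
  represented by the events that read it.\<close>

definition rel_classes :: "('i \<times> 'i) set \<Rightarrow> 'i set set" where
  "rel_classes R = (\<lambda>i. R `` {i}) ` Domain R"

text \<open>Labels at distinct positions are independent, whence the product over classes. An event
  without a position is outside \<open>Domain R\<close> and cannot occur, whence the value
  0.\<close>

definition hit_prob ::
  "('k set \<Rightarrow> real) \<Rightarrow> 'k set \<Rightarrow> (('g \<times> 'k set) \<times> ('g \<times> 'k set)) set \<Rightarrow> ('g \<times> 'k set) set \<Rightarrow> real" where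
  "hit_prob m S R a = (if a \<subseteq> Domain R then \<Prod>E\<in>rel_classes R. m (sel_labels S E a) else 0)"

lemma hits_subset: "hits I N \<omega> \<subseteq> I"
  by (auto simp: hits_def)

lemma hits_Int: "I' \<subseteq> I \<Longrightarrow> hits I N \<omega> \<inter> I' = hits I' N \<omega>"
  by (auto simp: hits_def)

lemma coinc_subset: "coinc I N \<subseteq> I \<times> I"
  by (auto simp: coinc_def)

text \<open>Prescribing the pattern is a box condition, that is, a separate constraint on the label
  at each position, because every index reads at most one position. An index that reads none is
  never hit; this is the condition on \<open>Domain\<close>.\<close>

lemma hits_eq_iff:
  assumes "\<And>i k k'. i \<in> I \<Longrightarrow> k \<in> N (fst i) \<Longrightarrow> k' \<in> N (fst i) \<Longrightarrow> k = k'"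
    and "a \<subseteq> I" and "\<And>k. k \<in> (\<Union>i\<in>I. N (fst i)) \<Longrightarrow> \<omega> k \<in> S"
  shows "hits I N \<omega> = a \<longleftrightarrow> a \<subseteq> Domain (coinc I N) \<and>
           (\<forall>k\<in>(\<Union>i\<in>I. N (fst i)). \<omega> k \<in> sel_labels S {i \<in> I. k \<in> N (fst i)} a)"
    (is "?l \<longleftrightarrow> ?r")
proof
  assume l: ?l
  have "a \<subseteq> Domain (coinc I N)" using l unfolding hits_def coinc_def Domain_iff by blast
  moreover have "\<omega> k \<in> sel_labels S {i \<in> I. k \<in> N (fst i)} a" if k: "k \<in> (\<Union>i\<in>I. N (fst i))" for k
  proof -
    have "\<omega> k \<in> snd i \<longleftrightarrow> i \<in> a" if "i \<in> I" "k \<in> N (fst i)" for i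
      using assms(1)[OF that(1)] that unfolding l[symmetric] hits_def by blast
    then show ?thesis using assms(3)[OF k] unfolding sel_labels_def by blast
  qed
  ultimately show ?r by blast
next
  assume r: ?r
  have "(\<exists>k\<in>N (fst i). \<omega> k \<in> snd i) \<longleftrightarrow> i \<in> a" if i: "i \<in> I" for i
  proof
    assume "\<exists>k\<in>N (fst i). \<omega> k \<in> snd i"
    then obtain k where k: "k \<in> N (fst i)" "\<omega> k \<in> snd i" by blast
    then have "\<omega> k \<in> sel_labels S {i \<in> I. k \<in> N (fst i)} a" using r i by blast
    then show "i \<in> a" using k i unfolding sel_labels_def by blast
  next
    assume ia: "i \<in> a"
    then obtain j where "(i, j) \<in> coinc I N" using r by blast
    then obtain k where k: "k \<in> N (fst i)" unfolding coinc_def by blast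
    then have "\<omega> k \<in> sel_labels S {i \<in> I. k \<in> N (fst i)} a" using r i by blast
    then show "\<exists>k\<in>N (fst i). \<omega> k \<in> snd i" using k i ia unfolding sel_labels_def by blast
  qed
  then show ?l using assms(2) unfolding hits_def by blast
qed

text \<open>A position is recovered from any event that reads it. Hence positions and classes
  correspond bijectively, which turns the product over classes in \<open>hit_prob\<close> into one
  over positions.\<close>

lemma rel_classes_coinc:
  assumes "\<And>i k k'. i \<in> I \<Longrightarrow> k \<in> N (fst i) \<Longrightarrow> k' \<in> N (fst i) \<Longrightarrow> k = k'"
  shows "rel_classes (coinc I N) = (\<lambda>k. {i \<in> I. k \<in> N (fst i)}) ` (\<Union>i\<in>I. N (fst i))"
    and "inj_on (\<lambda>k. {i \<in> I. k \<in> N (fst i)}) (\<Union>i\<in>I. N (fst i))"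
proof -
  have *: "coinc I N `` {i} = {j \<in> I. k \<in> N (fst j)}" if "i \<in> I" "k \<in> N (fst i)" for i k
  proof -
    have "N (fst i) = {k}" using assms[OF that(1)] that(2) by blast
    then show ?thesis using that(1) unfolding coinc_def by auto
  qed
  show "rel_classes (coinc I N) = (\<lambda>k. {i \<in> I. k \<in> N (fst i)}) ` (\<Union>i\<in>I. N (fst i))"
  proof (intro set_eqI iffI)
    fix E assume "E \<in> rel_classes (coinc I N)"
    then obtain i where i: "i \<in> Domain (coinc I N)" "E = coinc I N `` {i}" unfolding rel_classes_def by blast
    then obtain k where "i \<in> I" "k \<in> N (fst i)" unfolding coinc_def by blast
    then show "E \<in> (\<lambda>k. {i \<in> I. k \<in> N (fst i)}) ` (\<Union>i\<in>I. N (fst i))" using * i(2) by blast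
  next
    fix E assume "E \<in> (\<lambda>k. {i \<in> I. k \<in> N (fst i)}) ` (\<Union>i\<in>I. N (fst i))"
    then obtain i k where i: "i \<in> I" "k \<in> N (fst i)" "E = {i \<in> I. k \<in> N (fst i)}" by blast
    then have "(i, i) \<in> coinc I N" unfolding coinc_def by blast
    moreover have "E = coinc I N `` {i}" unfolding i(3) by (rule *[OF i(1,2), symmetric])
    ultimately show "E \<in> rel_classes (coinc I N)" unfolding rel_classes_def by blast
  qed
  show "inj_on (\<lambda>k. {i \<in> I. k \<in> N (fst i)}) (\<Union>i\<in>I. N (fst i))"
  proof (rule inj_onI)
    fix k k' assume k: "k \<in> (\<Union>i\<in>I. N (fst i))" and e: "{i \<in> I. k \<in> N (fst i)} = {i \<in> I. k' \<in> N (fst i)}"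
    from k obtain i where i: "i \<in> I" "k \<in> N (fst i)" by blast
    then have "k' \<in> N (fst i)" using e by blast
    then show "k = k'" using assms i by blast
  qed
qed

lemma finite_single_positions:
  assumes "\<And>i k k'. i \<in> I \<Longrightarrow> k \<in> N (fst i) \<Longrightarrow> k' \<in> N (fst i) \<Longrightarrow> k = k'" and "finite I"
  shows "finite (\<Union>i\<in>I. N (fst i))" and "card (\<Union>i\<in>I. N (fst i)) \<le> card I"
proof -
  have *: "finite (N (fst i)) \<and> card (N (fst i)) \<le> 1" if "i \<in> I" for i
  proof (cases "N (fst i) = {}")
    case False
    then obtain k where "N (fst i) = {k}" using assms(1)[OF \<open>i \<in> I\<close>] by blast
    then show ?thesis by simp
  qed simp
  then show "finite (\<Union>i\<in>I. N (fst i))" using assms(2) by blast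
  have "card (\<Union>i\<in>I. N (fst i)) \<le> (\<Sum>i\<in>I. card (N (fst i)))" by (rule card_UN_le[OF assms(2)])
  also have "\<dots> \<le> card I" using sum_mono[of I "\<lambda>i. card (N (fst i))" "\<lambda>i. 1"] * by simp
  finally show "card (\<Union>i\<in>I. N (fst i)) \<le> card I" .
qed

lemma hit_prob_coinc:
  assumes "\<And>i k k'. i \<in> I \<Longrightarrow> k \<in> N (fst i) \<Longrightarrow> k' \<in> N (fst i) \<Longrightarrow> k = k'"
  shows "hit_prob m S (coinc I N) a = (if a \<subseteq> Domain (coinc I N)
           then \<Prod>k\<in>(\<Union>i\<in>I. N (fst i)). m (sel_labels S {i \<in> I. k \<in> N (fst i)} a) else 0)"
  by (cases "a \<subseteq> Domain (coinc I N)")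
    (simp_all add: hit_prob_def rel_classes_coinc(1)[of I N, OF assms]
      prod.reindex[OF rel_classes_coinc(2)[of I N, OF assms]])

definition bis_fibre :: "'h gpd \<Rightarrow> 'h \<Rightarrow> 'h set \<Rightarrow> 'h set" where
  "bis_fibre H x g = {h \<in> g. src H h = x}"

definition cyl :: "'h gpd \<Rightarrow> 'k measure \<Rightarrow> 'h set \<Rightarrow> 'k set \<Rightarrow> ('h \<times> ('h \<Rightarrow> 'k)) set" where
  "cyl H K g A = {(x, \<omega>) \<in> bernoulli_units H K. \<exists>h\<in>bis_fibre H x g. \<omega> h \<in> A}"

definition tset ::
  "'h gpd \<Rightarrow> 'k measure \<Rightarrow> ('h set \<times> 'k set) set \<Rightarrow> ('h set \<times> 'k set) set set \<Rightarrow> ('h \<times> ('h \<Rightarrow> 'k)) set" where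
  "tset H K I S = {(x, \<omega>) \<in> bernoulli_units H K. hits I (bis_fibre H x) \<omega> \<in> S}"

locale bernoulli = pmp_discrete_groupoid H \<nu> for H :: "'h gpd" and \<nu> :: "'h measure" +
  fixes \<kappa> :: "'k measure"
  assumes prob_\<kappa>: "prob_space \<kappa>" and sb_\<kappa>: "standard_borel \<kappa>"
begin

abbreviation "B0 \<equiv> bernoulli_units H \<kappa>"
abbreviation "BS \<equiv> bernoulli_unit_space H \<kappa>"
abbreviation "\<mu> \<equiv> bernoulli_measure H \<nu> \<kappa>"
abbreviation "idx \<equiv> bisections H \<times> sets \<kappa>"

lemma space_\<nu>: "space \<nu> = units H"
  using sets_eq_imp_space_eq[OF sets_\<nu>] by (simp add: space_unit_space)

lemma space_BS: "space BS = B0"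
  unfolding bernoulli_unit_space_def by (rule space_measure_of) auto

lemma sets_BS: "sets BS = sigma_sets B0
     ({{(x, \<omega>) \<in> B0. x \<in> B} | B. B \<in> sets (unit_space H)} \<union>
      {{(x, \<omega>) \<in> B0. \<omega> (bis_at H h x) \<in> A} | h A. h \<in> full_bisections H \<and> A \<in> sets \<kappa>})"
  unfolding bernoulli_unit_space_def by (rule sets_measure_of) auto

lemma B0_iff: "(x, \<omega>) \<in> B0 \<longleftrightarrow> x \<in> units H \<and> \<omega> \<in> src_fibre H x \<rightarrow>\<^sub>E space \<kappa>"
  by (auto simp: bernoulli_units_def)

lemma bis_fibre_single:
  "g \<in> bisections H \<Longrightarrow> k \<in> bis_fibre H x g \<Longrightarrow> k' \<in> bis_fibre H x g \<Longrightarrow> k = k'"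
  unfolding bis_fibre_def using bis_src_inj by auto

lemma bis_fibre_subset: "g \<in> bisections H \<Longrightarrow> bis_fibre H x g \<subseteq> src_fibre H x"
  unfolding bis_fibre_def src_fibre_def using bis_in by auto

lemma cyl_subset: "cyl H \<kappa> g A \<subseteq> B0"
  by (auto simp: cyl_def)

lemma tset_subset: "tset H \<kappa> I S \<subseteq> B0"
  by (auto simp: tset_def)

lemma bis_fibre_unit:
  assumes "B \<in> sets (unit_space H)" "x \<in> units H"
  shows "bis_fibre H x B = (if x \<in> B then {x} else {})"
  using assms src_unit unfolding bis_fibre_def sets_unit_space_iff by auto

lemma unit_in_src_fibre: "x \<in> units H \<Longrightarrow> x \<in> src_fibre H x"
  using units_subset src_unit by (auto simp: src_fibre_def)

text \<open>Conditions on the base point alone are cylinders too: the label is unrestricted, and the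
  arrow exists iff the point lies in \<open>B\<close>.\<close>

lemma cyl_unit:
  assumes "B \<in> sets (unit_space H)"
  shows "cyl H \<kappa> B (space \<kappa>) = {(x, \<omega>) \<in> B0. x \<in> B}"
proof -
  have "(x, \<omega>) \<in> cyl H \<kappa> B (space \<kappa>) \<longleftrightarrow> (x, \<omega>) \<in> B0 \<and> x \<in> B" for x \<omega>
    using bis_fibre_unit[OF assms, of x] unit_in_src_fibre[of x]
    by (auto simp: cyl_def B0_iff split: if_splits)
  then show ?thesis by auto
qed

lemma full_bis: "h \<in> full_bisections H \<Longrightarrow> h \<in> bisections H"
  by (simp add: full_bisections_def)

lemma bis_at_full:
  assumes "h \<in> full_bisections H" "x \<in> units H"
  shows "bis_at H h x \<in> h" "src H (bis_at H h x) = x"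
proof -
  have "x \<in> src H ` h" using assms by (simp add: full_bisections_def)
  then obtain h' where h': "h' \<in> h" "src H h' = x" by blast
  then have "bis_at H h x = h'" using bis_at_eq[OF full_bis[OF assms(1)] h'(1)] by simp
  with h' show "bis_at H h x \<in> h" "src H (bis_at H h x) = x" by simp_all
qed

lemma cyl_full:
  assumes h: "h \<in> full_bisections H"
  shows "cyl H \<kappa> h A = {(x, \<omega>) \<in> B0. \<omega> (bis_at H h x) \<in> A}"
proof -
  have "bis_fibre H x h = {bis_at H h x}" if "x \<in> units H" for x
    using bis_at_full[OF h that] bis_fibre_single[OF full_bis[OF h]] unfolding bis_fibre_def by blast
  then have "(x, \<omega>) \<in> cyl H \<kappa> h A \<longleftrightarrow> (x, \<omega>) \<in> B0 \<and> \<omega> (bis_at H h x) \<in> A" for x \<omega>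
    by (auto simp: cyl_def B0_iff)
  then show ?thesis by auto
qed

text \<open>The generators of the sigma-algebra mention full bisections only. If full bisections
  \<open>G n\<close> cover \<open>g\<close>, then at the sources of \<open>g \<inter> G n\<close>
  the label read by \<open>g\<close> is the one read by \<open>G n\<close>.\<close>

lemma cyl_sets:
  assumes g: "g \<in> bisections H" and A: "A \<in> sets \<kappa>"
  shows "cyl H \<kappa> g A \<in> sets BS"
proof -
  obtain G where G: "\<And>n::nat. G n \<in> full_bisections H" "g \<subseteq> (\<Union>n. G n)"
    using bisection_full_cover[OF g] by metis
  have 1: "{(x, \<omega>) \<in> B0. x \<in> B} \<in> sets BS" if "B \<in> sets (unit_space H)" for B
    unfolding sets_BS by (rule sigma_sets.Basic) (use that in blast)
  have 2: "{(x, \<omega>) \<in> B0. \<omega> (bis_at H (G n) x) \<in> A} \<in> sets BS" for n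
    unfolding sets_BS by (rule sigma_sets.Basic) (use G(1) A in blast)
  have 3: "src H ` (g \<inter> G n) \<in> sets (unit_space H)" for n
  proof (rule bis_src_borel[OF bis_subset[OF g]])
    show "g \<inter> G n \<in> sets (arrows H)" using g full_bis[OF G(1)[of n]] by (auto simp: bisection_iff)
  qed simp
  have "(x, \<omega>) \<in> cyl H \<kappa> g A \<longleftrightarrow>
      (\<exists>n. (x, \<omega>) \<in> {(x, \<omega>) \<in> B0. x \<in> src H ` (g \<inter> G n)} \<inter> {(x, \<omega>) \<in> B0. \<omega> (bis_at H (G n) x) \<in> A})" for x \<omega>
  proof
    assume l: "(x, \<omega>) \<in> cyl H \<kappa> g A"
    then obtain h where h: "(x, \<omega>) \<in> B0" "h \<in> g" "src H h = x" "\<omega> h \<in> A"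
      unfolding cyl_def bis_fibre_def by blast
    then obtain n where n: "h \<in> G n" using G(2) by blast
    then have "bis_at H (G n) x = h" using bis_at_eq[OF full_bis[OF G(1)]] h(3) by blast
    then show "\<exists>n. (x, \<omega>) \<in> {(x, \<omega>) \<in> B0. x \<in> src H ` (g \<inter> G n)} \<inter> {(x, \<omega>) \<in> B0. \<omega> (bis_at H (G n) x) \<in> A}"
      using h n by (intro exI[of _ n]) (auto intro!: image_eqI[of _ _ h])
  next
    assume "\<exists>n. (x, \<omega>) \<in> {(x, \<omega>) \<in> B0. x \<in> src H ` (g \<inter> G n)} \<inter> {(x, \<omega>) \<in> B0. \<omega> (bis_at H (G n) x) \<in> A}"
    then obtain n h where n: "(x, \<omega>) \<in> B0" "h \<in> g" "h \<in> G n" "x = src H h" "\<omega> (bis_at H (G n) x) \<in> A" by blast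
    then have "bis_at H (G n) x = h" using bis_at_eq[OF full_bis[OF G(1)]] by blast
    then show "(x, \<omega>) \<in> cyl H \<kappa> g A" using n unfolding cyl_def bis_fibre_def by auto
  qed
  then have "cyl H \<kappa> g A = (\<Union>n. {(x, \<omega>) \<in> B0. x \<in> src H ` (g \<inter> G n)} \<inter> {(x, \<omega>) \<in> B0. \<omega> (bis_at H (G n) x) \<in> A})"
    by (intro set_eqI) (simp only: UN_iff UNIV_I simp_thms bex_UNIV split_paired_all)
  also have "\<dots> \<in> sets BS" using 1[OF 3] 2 by (intro sets.countable_UN image_subsetI sets.Int)
  finally show ?thesis .
qed

lemma tset_singleton:
  assumes "a \<subseteq> I"
  shows "tset H \<kappa> I {a} = B0 \<inter> (\<Inter>i\<in>a. cyl H \<kappa> (fst i) (snd i)) - (\<Union>i\<in>I - a. cyl H \<kappa> (fst i) (snd i))"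
proof -
  have "hits I (bis_fibre H x) \<omega> = a \<longleftrightarrow> (\<forall>i\<in>a. \<exists>h\<in>bis_fibre H x (fst i). \<omega> h \<in> snd i) \<and>
      \<not> (\<exists>i\<in>I - a. \<exists>h\<in>bis_fibre H x (fst i). \<omega> h \<in> snd i)" for x \<omega>
    using assms unfolding hits_def by blast
  then show ?thesis unfolding tset_def cyl_def by auto
qed

lemma tset_UN:
  "tset H \<kappa> I S = (\<Union>a\<in>S \<inter> Pow I. tset H \<kappa> I {a})"
  using hits_subset unfolding tset_def by fastforce

lemma tset_sets:
  assumes I: "finite I" "I \<subseteq> idx"
  shows "tset H \<kappa> I S \<in> sets BS"
proof -
  have c: "cyl H \<kappa> (fst i) (snd i) \<in> sets BS" if "i \<in> I" for i
    using that I(2) by (intro cyl_sets) auto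
  have "tset H \<kappa> I {a} \<in> sets BS" if "a \<subseteq> I" for a
  proof -
    have fin: "finite a" "finite (I - a)" using that I(1) by (auto intro: finite_subset)
    have "B0 \<inter> (\<Inter>i\<in>a. cyl H \<kappa> (fst i) (snd i)) \<in> sets BS"
    proof (cases "a = {}")
      case True then show ?thesis using sets.top[of BS] by (simp add: space_BS)
    next
      case False
      have "(\<Inter>i\<in>a. cyl H \<kappa> (fst i) (snd i)) \<in> sets BS"
        using that c by (intro sets.finite_INT fin False) auto
      then show ?thesis using sets.top[of BS] by (auto simp: space_BS)
    qed
    moreover have "(\<Union>i\<in>I - a. cyl H \<kappa> (fst i) (snd i)) \<in> sets BS"
      using c by (intro sets.finite_UN fin) auto
    ultimately show ?thesis unfolding tset_singleton[OF that] by (rule sets.Diff)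
  qed
  moreover have "finite (S \<inter> Pow I)" using I(1) by auto
  ultimately show ?thesis by (subst tset_UN) (intro sets.finite_UN, auto)
qed

lemma tset_Int: "tset H \<kappa> I S \<inter> tset H \<kappa> I' S' = tset H \<kappa> (I \<union> I') {a. a \<inter> I \<in> S \<and> a \<inter> I' \<in> S'}"
  unfolding tset_def by (auto simp: hits_Int)

lemma tset_Compl: "B0 - tset H \<kappa> I S = tset H \<kappa> I (- S)"
  unfolding tset_def by auto

lemma tset_cyl: "i \<in> I \<Longrightarrow> cyl H \<kappa> (fst i) (snd i) = tset H \<kappa> I {a. i \<in> a}"
  unfolding tset_def cyl_def hits_def by auto

lemma tset_empty: "tset H \<kappa> I {} = {}"
  unfolding tset_def by auto

text \<open>An algebra of sets that generates the sigma-algebra: a complement keeps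
  \<open>I\<close>, while intersections and unions pass to the union of the two index sets. The
  Dynkin argument and the approximation of Borel sets both start from it.\<close>

definition "tsets = {tset H \<kappa> I S | I S. finite I \<and> I \<subseteq> idx}"

lemma sets_BS_tsets: "sets BS = sigma_sets B0 tsets"
proof
  have c: "cyl H \<kappa> g A \<in> tsets" if "g \<in> bisections H" "A \<in> sets \<kappa>" for g A
    using tset_cyl[of "(g, A)" "{(g, A)}"] that unfolding tsets_def by force
  show "sets BS \<subseteq> sigma_sets B0 tsets"
    unfolding sets_BS
  proof (rule sigma_sets_mono, rule subsetI, rule sigma_sets.Basic, elim UnE CollectE exE conjE)
    show "X \<in> tsets" if "X = {(x, \<omega>) \<in> B0. x \<in> B}" "B \<in> sets (unit_space H)" for X B
      unfolding that(1) using c[OF bis_units[OF that(2)] sets.top] cyl_unit[OF that(2)] by simp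
    show "X \<in> tsets" if "X = {(x, \<omega>) \<in> B0. \<omega> (bis_at H h x) \<in> A}" "h \<in> full_bisections H" "A \<in> sets \<kappa>" for X h A
      unfolding that(1) using c[OF full_bis[OF that(2)] that(3)] cyl_full[OF that(2)] by simp
  qed
  show "sigma_sets B0 tsets \<subseteq> sets BS"
    using sets.sigma_sets_subset[of tsets BS] tset_sets unfolding tsets_def space_BS by blast
qed

lemma Int_stable_tsets: "Int_stable tsets"
proof (rule Int_stableI)
  fix X Y assume "X \<in> tsets" "Y \<in> tsets"
  then obtain I S I' S' where X: "X = tset H \<kappa> I S" "finite I" "I \<subseteq> idx"
     and Y: "Y = tset H \<kappa> I' S'" "finite I'" "I' \<subseteq> idx" unfolding tsets_def by blast
  have "X \<inter> Y = tset H \<kappa> (I \<union> I') {a. a \<inter> I \<in> S \<and> a \<inter> I' \<in> S'}" unfolding X Y by (rule tset_Int)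
  moreover have "finite (I \<union> I')" "I \<union> I' \<subseteq> idx" using X Y by auto
  ultimately show "X \<inter> Y \<in> tsets" unfolding tsets_def by blast
qed

definition "fibre_meas x = PiM (src_fibre H x) (\<lambda>_. \<kappa>)"

definition "slice A x = {\<omega>. (x, \<omega>) \<in> A}"

lemma prob_fibre: "prob_space (fibre_meas x)"
  unfolding fibre_meas_def by (rule prob_space_PiM) (rule prob_\<kappa>)

lemma space_fibre: "space (fibre_meas x) = (src_fibre H x \<rightarrow>\<^sub>E space \<kappa>)"
  unfolding fibre_meas_def by (simp add: space_PiM)

lemma sel_sets:
  assumes "finite E" "\<And>i. i \<in> E \<Longrightarrow> snd i \<in> sets \<kappa>"
  shows "sel_labels (space \<kappa>) E a \<in> sets \<kappa>"
  using assms
proof (induction E rule: finite_induct)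
  case empty then show ?case by (simp add: sel_labels_def)
next
  case (insert i E)
  have "sel_labels (space \<kappa>) (insert i E) a = sel_labels (space \<kappa>) E a \<inter> (if i \<in> a then snd i else space \<kappa> - snd i)"
    unfolding sel_labels_def by auto
  then show ?case using insert by auto
qed

text \<open>The positions over \<open>x\<close> are distinct coordinates of a product measure, so
  the box condition of \<open>hits_eq_iff\<close> has the product of the single label measures as
  its probability.\<close>

lemma slice_tset:
  assumes I: "finite I" "I \<subseteq> idx" and x: "x \<in> units H" and a: "a \<subseteq> I"
  shows "slice (tset H \<kappa> I {a}) x \<in> sets (fibre_meas x)"
    and "measure (fibre_meas x) (slice (tset H \<kappa> I {a}) x) =
      hit_prob (measure \<kappa>) (space \<kappa>) (coinc I (bis_fibre H x)) a"
proof -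
  interpret product_prob_space "\<lambda>_. \<kappa>" "src_fibre H x"
    by (simp add: product_prob_space_def product_sigma_finite_def prob_\<kappa> prob_space_imp_sigma_finite product_prob_space_axioms_def)
  let ?N = "bis_fibre H x"
  let ?V = "\<Union>i\<in>I. ?N (fst i)"
  let ?X = "\<lambda>k. sel_labels (space \<kappa>) {i \<in> I. k \<in> ?N (fst i)} a"
  have sg: "k = k'" if "i \<in> I" "k \<in> ?N (fst i)" "k' \<in> ?N (fst i)" for i k k'
    using that I(2) bis_fibre_single by (metis mem_Sigma_iff prod.collapse subsetD)
  have V: "?V \<subseteq> src_fibre H x" using I(2) bis_fibre_subset by fastforce
  have finV: "finite ?V" by (rule finite_single_positions(1)[OF sg I(1)])
  have X: "?X k \<in> sets \<kappa>" for k using I by (intro sel_sets) auto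
  have eq: "slice (tset H \<kappa> I {a}) x = (if a \<subseteq> Domain (coinc I ?N)
      then {\<omega> \<in> space (fibre_meas x). \<forall>k\<in>?V. \<omega> k \<in> ?X k} else {})"
  proof -
    have "\<omega> \<in> slice (tset H \<kappa> I {a}) x \<longleftrightarrow> \<omega> \<in> space (fibre_meas x) \<and> a \<subseteq> Domain (coinc I ?N) \<and> (\<forall>k\<in>?V. \<omega> k \<in> ?X k)" for \<omega>
    proof (cases "\<omega> \<in> space (fibre_meas x)")
      case True
      then have "\<omega> k \<in> space \<kappa>" if "k \<in> ?V" for k using that V unfolding space_fibre by blast
      from hits_eq_iff[of I ?N a \<omega>, OF sg a this] True show ?thesis
        unfolding slice_def tset_def using x by (simp add: B0_iff space_fibre)
    next
      case False
      then show ?thesis unfolding slice_def tset_def by (simp add: B0_iff space_fibre)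
    qed
    then show ?thesis by auto
  qed
  have m: "{\<omega> \<in> space (fibre_meas x). \<forall>k\<in>?V. \<omega> k \<in> ?X k} \<in> sets (fibre_meas x)"
  proof (rule sets.sets_Collect_finite_All[OF _ finV])
    fix k assume "k \<in> ?V"
    then have "k \<in> src_fibre H x" using V by blast
    then have "(\<lambda>\<omega>. \<omega> k) \<in> fibre_meas x \<rightarrow>\<^sub>M \<kappa>" unfolding fibre_meas_def by (rule measurable_component_singleton)
    from measurable_sets[OF this X[of k]] show "{\<omega> \<in> space (fibre_meas x). \<omega> k \<in> ?X k} \<in> sets (fibre_meas x)"
      by (simp add: vimage_def Int_def conj_commute)
  qed
  show "slice (tset H \<kappa> I {a}) x \<in> sets (fibre_meas x)" unfolding eq using m by auto
  have "emeasure (fibre_meas x) {\<omega> \<in> space (fibre_meas x). \<forall>k\<in>?V. \<omega> k \<in> ?X k} = (\<Prod>k\<in>?V. emeasure \<kappa> (?X k))"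
    unfolding fibre_meas_def by (rule emeasure_PiM_Collect[OF V finV X])
  also have "\<dots> = ennreal (\<Prod>k\<in>?V. measure \<kappa> (?X k))"
    by (simp add: finite_measure.emeasure_eq_measure[OF prob_space.finite_measure[OF prob_\<kappa>]] prod_ennreal)
  finally have "measure (fibre_meas x) {\<omega> \<in> space (fibre_meas x). \<forall>k\<in>?V. \<omega> k \<in> ?X k} = (\<Prod>k\<in>?V. measure \<kappa> (?X k))"
    by (simp add: measure_def prod_nonneg)
  moreover have "hit_prob (measure \<kappa>) (space \<kappa>) (coinc I ?N) a =
      (if a \<subseteq> Domain (coinc I ?N) then \<Prod>k\<in>?V. measure \<kappa> (?X k) else 0)"
    by (rule hit_prob_coinc) (rule sg)
  ultimately show "measure (fibre_meas x) (slice (tset H \<kappa> I {a}) x) =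
      hit_prob (measure \<kappa>) (space \<kappa>) (coinc I (bis_fibre H x)) a"
    unfolding eq
    by (cases "a \<subseteq> Domain (coinc I ?N)") (simp_all only: if_True if_False simp_thms measure_empty)
qed

definition "pat_set I R = {x \<in> units H. coinc I (bis_fibre H x) = R}"

text \<open>The arrows of g and g' at x both exist and coincide iff x is a source of the bisection g
  \<inter> g'; the pattern is therefore decided by finitely many Borel sets of units.\<close>

lemma pat_set_sets:
  assumes I: "finite I" "I \<subseteq> idx"
  shows "pat_set I R \<in> sets (unit_space H)"
proof (cases "R \<subseteq> I \<times> I")
  case True
  have b: "src H ` (fst i \<inter> fst j) \<in> sets (unit_space H)" if "i \<in> I" "j \<in> I" for i j
  proof (rule bis_src_borel[OF bis_subset[of "fst i"]])
    show "fst i \<in> bisections H" using that I(2) by auto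
    have "fst i \<in> bisections H" "fst j \<in> bisections H" using that I(2) by auto
    then show "fst i \<inter> fst j \<in> sets (arrows H)" unfolding bisection_iff by blast
  qed simp
  have "pat_set I R = {x \<in> space (unit_space H). \<forall>p\<in>I \<times> I. x \<in> src H ` (fst (fst p) \<inter> fst (snd p)) \<longleftrightarrow> p \<in> R}"
  proof -
    have "coinc I (bis_fibre H x) = R \<longleftrightarrow> (\<forall>p\<in>I \<times> I. x \<in> src H ` (fst (fst p) \<inter> fst (snd p)) \<longleftrightarrow> p \<in> R)" for x
    proof -
      have "bis_fibre H x g \<inter> bis_fibre H x g' \<noteq> {} \<longleftrightarrow> x \<in> src H ` (g \<inter> g')" for g g'
        unfolding bis_fibre_def by auto
      then have "coinc I (bis_fibre H x) = {p \<in> I \<times> I. x \<in> src H ` (fst (fst p) \<inter> fst (snd p))}"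
        by (simp add: coinc_def case_prod_unfold mem_Times_iff)
      then show ?thesis using True by blast
    qed
    then show ?thesis unfolding pat_set_def space_unit_space by simp
  qed
  also have "\<dots> \<in> sets (unit_space H)"
  proof (rule sets.sets_Collect_finite_All)
    show "finite (I \<times> I)" using I(1) by simp
    fix p assume "p \<in> I \<times> I"
    then have "src H ` (fst (fst p) \<inter> fst (snd p)) \<in> sets (unit_space H)" using b by auto
    then show "{x \<in> space (unit_space H). x \<in> src H ` (fst (fst p) \<inter> fst (snd p)) \<longleftrightarrow> p \<in> R} \<in> sets (unit_space H)"
      by (cases "p \<in> R") (simp_all add: sets.sets_into_space Int_absorb1 Collect_conj_eq set_diff_eq[symmetric])
  qed
  finally show ?thesis .
next
  case False
  then have "pat_set I R = {}" unfolding pat_set_def using coinc_subset by blast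
  then show ?thesis by simp
qed

end

section \<open>The Bernoulli measure and the action of bisections\<close>

context bernoulli begin

definition "code I y = hits I (bis_fibre H (fst y)) (snd y)"

lemma tset_code: "tset H \<kappa> I S = {y \<in> B0. code I y \<in> S}"
  unfolding tset_def code_def by auto

lemma coinc_measurable:
  assumes I: "finite I" "I \<subseteq> idx"
  shows "(\<lambda>x. coinc I (bis_fibre H x)) \<in> unit_space H \<rightarrow>\<^sub>M count_space (Pow (I \<times> I))"
proof (subst measurable_count_space_eq2)
  show "finite (Pow (I \<times> I))" using I(1) by simp
  have "(\<lambda>x. coinc I (bis_fibre H x)) -` {R} \<inter> space (unit_space H) = pat_set I R" for R
    unfolding pat_set_def space_unit_space by auto
  then show "(\<lambda>x. coinc I (bis_fibre H x)) \<in> space (unit_space H) \<rightarrow> Pow (I \<times> I) \<and>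
      (\<forall>R\<in>Pow (I \<times> I). (\<lambda>x. coinc I (bis_fibre H x)) -` {R} \<inter> space (unit_space H) \<in> sets (unit_space H))"
    using pat_set_sets[OF I] by (auto simp only: intro!: PowI coinc_subset)
qed

lemma slice_tset_all:
  assumes I: "finite I" "I \<subseteq> idx" and x: "x \<in> units H"
  shows "slice (tset H \<kappa> I S) x \<in> sets (fibre_meas x)"
    and "emeasure (fibre_meas x) (slice (tset H \<kappa> I S) x) =
      ennreal (\<Sum>a\<in>S \<inter> Pow I. hit_prob (measure \<kappa>) (space \<kappa>) (coinc I (bis_fibre H x)) a)"
proof -
  interpret fm: prob_space "fibre_meas x" by (rule prob_fibre)
  have eq: "slice (tset H \<kappa> I S) x = (\<Union>a\<in>S \<inter> Pow I. slice (tset H \<kappa> I {a}) x)"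
    by (subst tset_UN) (auto simp: slice_def)
  have fin: "finite (S \<inter> Pow I)" using I(1) by simp
  have s: "slice (tset H \<kappa> I {a}) x \<in> sets (fibre_meas x)" if "a \<in> S \<inter> Pow I" for a
    using that by (intro slice_tset(1)[OF I x]) auto
  show "slice (tset H \<kappa> I S) x \<in> sets (fibre_meas x)"
    unfolding eq by (rule sets.finite_UN[OF fin s])
  have "measure (fibre_meas x) (slice (tset H \<kappa> I S) x) = (\<Sum>a\<in>S \<inter> Pow I. measure (fibre_meas x) (slice (tset H \<kappa> I {a}) x))"
    unfolding eq
    by (rule fm.finite_measure_finite_Union[OF fin]) (use s in \<open>auto simp: disjoint_family_on_def slice_def tset_def\<close>)
  also have "\<dots> = (\<Sum>a\<in>S \<inter> Pow I. hit_prob (measure \<kappa>) (space \<kappa>) (coinc I (bis_fibre H x)) a)"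
    by (rule sum.cong[OF refl], rule slice_tset(2)[OF I x]) auto
  finally show "emeasure (fibre_meas x) (slice (tset H \<kappa> I S) x) =
      ennreal (\<Sum>a\<in>S \<inter> Pow I. hit_prob (measure \<kappa>) (space \<kappa>) (coinc I (bis_fibre H x)) a)"
    by (simp add: fm.emeasure_eq_measure)
qed

text \<open>The fibre measures live on different product spaces, so measurability in x is proved by
  Dynkin's theorem from \<open>tsets\<close>. On \<open>tsets\<close> the fibre measure is a
  function of the coincidence relation at x, which takes finitely many values, each on a Borel
  set.\<close>

lemma slice_sets:
  assumes A: "A \<in> sets BS"
  shows "(\<forall>x\<in>units H. slice A x \<in> sets (fibre_meas x)) \<and>
     (\<lambda>x. emeasure (fibre_meas x) (slice A x)) \<in> borel_measurable (unit_space H)"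
proof -
  have "tsets \<subseteq> Pow B0" unfolding tsets_def using tset_subset by blast
  from Int_stable_tsets this A[unfolded sets_BS_tsets]
  show ?thesis
  proof (induction rule: sigma_sets_induct_disjoint)
    case (basic A)
    then obtain I S where A: "A = tset H \<kappa> I S" and I: "finite I" "I \<subseteq> idx" unfolding tsets_def by blast
    have "(\<lambda>x. ennreal (\<Sum>a\<in>S \<inter> Pow I. hit_prob (measure \<kappa>) (space \<kappa>) (coinc I (bis_fibre H x)) a))
        \<in> borel_measurable (unit_space H)"
      by (rule measurable_compose[OF coinc_measurable[OF I]]) simp
    also have "?this \<longleftrightarrow> (\<lambda>x. emeasure (fibre_meas x) (slice A x)) \<in> borel_measurable (unit_space H)"
      unfolding A by (rule measurable_cong) (use slice_tset_all(2)[OF I] in \<open>simp add: space_unit_space\<close>)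
    finally show ?case using slice_tset_all(1)[OF I] A by blast
  next
    case empty
    then show ?case by (simp add: slice_def)
  next
    case (compl A)
    have 1: "slice (B0 - A) x = space (fibre_meas x) - slice A x" if "x \<in> units H" for x
      using that unfolding slice_def by (auto simp: B0_iff space_fibre)
    have "(\<lambda>x. 1 - emeasure (fibre_meas x) (slice A x)) \<in> borel_measurable (unit_space H)"
      using compl.IH[THEN conjunct2] by (auto intro: borel_measurable_minus_ennreal)
    also have "?this \<longleftrightarrow> (\<lambda>x. emeasure (fibre_meas x) (slice (B0 - A) x)) \<in> borel_measurable (unit_space H)"
    proof (rule measurable_cong)
      fix x assume "x \<in> space (unit_space H)"
      then have x: "x \<in> units H" by (simp add: space_unit_space)
      interpret fm: prob_space "fibre_meas x" by (rule prob_fibre)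
      show "1 - emeasure (fibre_meas x) (slice A x) = emeasure (fibre_meas x) (slice (B0 - A) x)"
        unfolding 1[OF x] using compl x
        by (subst emeasure_compl) (auto simp: fm.emeasure_space_1)
    qed
    finally show ?case using 1 compl by auto
  next
    case (union A)
    have 1: "slice (\<Union>i. A i) x = (\<Union>i. slice (A i) x)" for x unfolding slice_def by auto
    have "(\<lambda>x. \<Sum>i. emeasure (fibre_meas x) (slice (A i) x)) \<in> borel_measurable (unit_space H)"
      using union.IH[THEN conjunct2] by (rule borel_measurable_suminf_order)
    also have "?this \<longleftrightarrow> (\<lambda>x. emeasure (fibre_meas x) (slice (\<Union>i. A i) x)) \<in> borel_measurable (unit_space H)"
    proof (rule measurable_cong)
      fix x assume "x \<in> space (unit_space H)"
      then have x: "x \<in> units H" by (simp add: space_unit_space)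
      show "(\<Sum>i. emeasure (fibre_meas x) (slice (A i) x)) = emeasure (fibre_meas x) (slice (\<Union>i. A i) x)"
        unfolding 1
      proof (rule suminf_emeasure)
        show "range (\<lambda>i. slice (A i) x) \<subseteq> sets (fibre_meas x)" using union x by auto
        show "disjoint_family (\<lambda>i. slice (A i) x)"
          using union(1) unfolding disjoint_family_on_def slice_def by blast
      qed
    qed
    finally show ?case using 1 union by auto
  qed
qed

lemma sets_\<mu>: "sets \<mu> = sets BS" and space_\<mu>: "space \<mu> = B0"
proof -
  have "sets BS \<subseteq> Pow B0" using sets.space_closed[of BS] by (simp add: space_BS)
  then show "sets \<mu> = sets BS" "space \<mu> = B0"
    unfolding bernoulli_measure_def using sets.sigma_sets_eq[of BS]
    by (simp_all add: sets_measure_of space_measure_of space_BS)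
qed

text \<open>\<open>measure_of\<close> takes the prescribed values only if they are countably
  additive; this rests on the measurability in x proved in \<open>slice_sets\<close>.\<close>

lemma emeasure_\<mu>:
  assumes A: "A \<in> sets BS"
  shows "emeasure \<mu> A = (\<integral>\<^sup>+ x. emeasure (fibre_meas x) (slice A x) \<partial>\<nu>)"
proof -
  let ?f = "\<lambda>A. \<integral>\<^sup>+ x. emeasure (fibre_meas x) (slice A x) \<partial>\<nu>"
  have mm: "(\<lambda>x. emeasure (fibre_meas x) (slice A x)) \<in> borel_measurable \<nu>" if "A \<in> sets BS" for A
    using slice_sets[OF that] measurable_cong_sets[OF sets_\<nu> refl] by blast
  have \<mu>: "\<mu> = measure_of B0 (sets BS) ?f"
    unfolding bernoulli_measure_def fibre_meas_def slice_def by simp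
  show ?thesis
  proof (rule emeasure_measure_of[OF \<mu>])
    show "sets BS \<subseteq> Pow B0" using sets.space_closed[of BS] by (simp add: space_BS)
    show "positive (sets \<mu>) ?f" unfolding positive_def slice_def by simp
    show "countably_additive (sets \<mu>) ?f"
    proof (rule countably_additiveI)
      fix A :: "nat \<Rightarrow> _" assume A: "range A \<subseteq> sets \<mu>" "disjoint_family A"
      have "(\<Sum>i. ?f (A i)) = (\<integral>\<^sup>+ x. (\<Sum>i. emeasure (fibre_meas x) (slice (A i) x)) \<partial>\<nu>)"
        by (rule nn_integral_suminf[symmetric]) (use mm A sets_\<mu> in auto)
      also have "\<dots> = ?f (\<Union>i. A i)"
      proof (rule nn_integral_cong)
        fix x assume "x \<in> space \<nu>"
        then have x: "x \<in> units H" by (simp add: space_\<nu>)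
        have 1: "slice (\<Union>i. A i) x = (\<Union>i. slice (A i) x)" unfolding slice_def by auto
        show "(\<Sum>i. emeasure (fibre_meas x) (slice (A i) x)) = emeasure (fibre_meas x) (slice (\<Union>i. A i) x)"
          unfolding 1
        proof (rule suminf_emeasure)
          show "range (\<lambda>i. slice (A i) x) \<subseteq> sets (fibre_meas x)" using slice_sets A(1) x unfolding sets_\<mu> by blast
          show "disjoint_family (\<lambda>i. slice (A i) x)"
            using A(2) unfolding disjoint_family_on_def slice_def by blast
        qed
      qed
      finally show "(\<Sum>i. ?f (A i)) = ?f (\<Union>i. A i)" .
    qed
  qed (use A sets_\<mu> in simp)
qed

lemma prob_\<mu>: "prob_space \<mu>"
proof (rule prob_spaceI)
  interpret n: prob_space \<nu> by (rule prob_space_\<nu>)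
  have "emeasure (fibre_meas x) (slice B0 x) = 1" if "x \<in> space \<nu>" for x
  proof -
    have "slice B0 x = space (fibre_meas x)" using that by (auto simp: slice_def B0_iff space_fibre space_\<nu>)
    then show ?thesis by (simp add: prob_space.emeasure_space_1[OF prob_fibre])
  qed
  then show "emeasure \<mu> (space \<mu>) = 1"
    using emeasure_\<mu>[OF sets.top] by (simp add: space_\<mu> space_BS n.emeasure_space_1 cong: nn_integral_cong)
qed

text \<open>The fibre law is constant on each \<open>pat_set I R\<close>. The weights of these sets
  are all that \<nu> contributes, so a sofic model only has to reproduce them.\<close>

lemma measure_\<mu>_tset:
  assumes I: "finite I" "I \<subseteq> idx"
  shows "measure \<mu> (tset H \<kappa> I S) =
    (\<Sum>R\<in>Pow (I \<times> I). measure \<nu> (pat_set I R) * (\<Sum>a\<in>S \<inter> Pow I. hit_prob (measure \<kappa>) (space \<kappa>) R a))"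
proof -
  interpret n: prob_space \<nu> by (rule prob_space_\<nu>)
  let ?h = "\<lambda>R. \<Sum>a\<in>S \<inter> Pow I. hit_prob (measure \<kappa>) (space \<kappa>) R a"
  have h0: "?h R \<ge> 0" for R by (intro sum_nonneg) (auto simp: hit_prob_def intro!: prod_nonneg)
  have ps: "pat_set I R \<in> sets \<nu>" for R using pat_set_sets[OF I] sets_\<nu> by simp
  have fin: "finite (Pow (I \<times> I))" using I(1) by simp
  have "emeasure \<mu> (tset H \<kappa> I S) = (\<integral>\<^sup>+ x. ennreal (?h (coinc I (bis_fibre H x))) \<partial>\<nu>)"
    unfolding emeasure_\<mu>[OF tset_sets[OF I]]
    by (rule nn_integral_cong) (use slice_tset_all(2)[OF I] in \<open>simp add: space_\<nu>\<close>)
  also have "\<dots> = (\<integral>\<^sup>+ x. (\<Sum>R\<in>Pow (I \<times> I). ennreal (?h R) * indicator (pat_set I R) x) \<partial>\<nu>)"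
  proof (rule nn_integral_cong)
    fix x assume x: "x \<in> space \<nu>"
    let ?R = "coinc I (bis_fibre H x)"
    have "(\<Sum>R\<in>Pow (I \<times> I). ennreal (?h R) * indicator (pat_set I R) x) = (\<Sum>R\<in>Pow (I \<times> I). if R = ?R then ennreal (?h R) else 0)"
      by (rule sum.cong) (use x in \<open>auto simp: pat_set_def space_\<nu> indicator_def\<close>)
    also have "\<dots> = ennreal (?h ?R)" using fin coinc_subset by (subst sum.delta) auto
    finally show "ennreal (?h ?R) = (\<Sum>R\<in>Pow (I \<times> I). ennreal (?h R) * indicator (pat_set I R) x)" by simp
  qed
  also have "\<dots> = (\<Sum>R\<in>Pow (I \<times> I). ennreal (?h R) * emeasure \<nu> (pat_set I R))"
    by (subst nn_integral_sum) (use ps in \<open>auto intro!: sum.cong nn_integral_cmult_indicator\<close>)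
  also have "\<dots> = ennreal (\<Sum>R\<in>Pow (I \<times> I). measure \<nu> (pat_set I R) * ?h R)"
    using h0 by (subst sum_ennreal[symmetric]) (auto simp: n.emeasure_eq_measure ennreal_mult mult.commute intro!: sum.cong)
  finally have "emeasure \<mu> (tset H \<kappa> I S) = ennreal (\<Sum>R\<in>Pow (I \<times> I). measure \<nu> (pat_set I R) * ?h R)" .
  then show ?thesis using h0 by (simp add: measure_def sum_nonneg)
qed

abbreviation "act \<equiv> bis_act H (bernoulli_gpd H \<kappa>) bernoulli_proj"

lemma translate_in:
  assumes h: "h \<in> space (arrows H)" and w: "\<omega> \<in> src_fibre H (src H h) \<rightarrow>\<^sub>E space \<kappa>"
  shows "translate H h \<omega> \<in> src_fibre H (rng H h) \<rightarrow>\<^sub>E space \<kappa>"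
proof -
  have "cmp H f h \<in> src_fibre H (src H h)" if "f \<in> src_fibre H (rng H h)" for f
  proof -
    have "(f, h) \<in> composable H" using that h unfolding src_fibre_def composable_def by auto
    then show ?thesis unfolding src_fibre_def by (simp add: cmp_in src_cmp)
  qed
  then show ?thesis using w unfolding translate_def by (auto simp: PiE_iff)
qed

lemma translate_ginv:
  assumes h: "h \<in> space (arrows H)" and w: "\<omega> \<in> src_fibre H (src H h) \<rightarrow>\<^sub>E space \<kappa>"
  shows "translate H (ginv H h) (translate H h \<omega>) = \<omega>"
proof
  fix f
  have r: "rng H (ginv H h) = src H h" by (rule rng_ginv[OF h])
  show "translate H (ginv H h) (translate H h \<omega>) f = \<omega> f"
  proof (cases "f \<in> src_fibre H (src H h)")
    case True
    then have c: "(f, ginv H h) \<in> composable H"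
      using h unfolding src_fibre_def composable_def by (auto simp: ginv_in rng_ginv)
    have "cmp H f (ginv H h) \<in> src_fibre H (rng H h)"
      using c h unfolding src_fibre_def by (simp add: cmp_in src_cmp src_ginv)
    moreover have "cmp H (cmp H f (ginv H h)) h = f"
      using cmp_cancel_right[OF c] by (simp add: ginv_ginv[OF h])
    ultimately show ?thesis using True by (simp add: translate_def r)
  next
    case False
    then have "\<omega> f = undefined" using w by (auto simp: PiE_iff extensional_def)
    then show ?thesis using False by (simp add: translate_def r)
  qed
qed

lemma translate_ginv':
  assumes h: "h \<in> space (arrows H)" and w: "\<psi> \<in> src_fibre H (rng H h) \<rightarrow>\<^sub>E space \<kappa>"
  shows "translate H h (translate H (ginv H h) \<psi>) = \<psi>"
  using translate_ginv[OF ginv_in[OF h], of \<psi>] w by (simp add: ginv_ginv[OF h] src_ginv[OF h])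

lemma act_point:
  assumes f: "f \<in> bisections H" and h: "h \<in> f" and w: "(src H h, \<omega>) \<in> B0"
  shows "bis_act_point (bernoulli_gpd H \<kappa>) fst f (src H h, \<omega>) = (rng H h, translate H h \<omega>)"
proof -
  have hs: "h \<in> space (arrows H)" using bis_in[OF f h] .
  have sp: "space (arrows (bernoulli_gpd H \<kappa>)) = bernoulli_arrows H \<kappa>"
    by (simp add: bernoulli_gpd_def)
  have "(THE g. g \<in> space (arrows (bernoulli_gpd H \<kappa>)) \<and> fst g \<in> f \<and> src (bernoulli_gpd H \<kappa>) g = (src H h, \<omega>)) = (h, \<omega>)"
  proof (rule the_equality)
    show "(h, \<omega>) \<in> space (arrows (bernoulli_gpd H \<kappa>)) \<and> fst (h, \<omega>) \<in> f \<and> src (bernoulli_gpd H \<kappa>) (h, \<omega>) = (src H h, \<omega>)"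
      using h hs w unfolding sp by (simp add: bernoulli_gpd_def bernoulli_arrows_def B0_iff)
    fix g assume g: "g \<in> space (arrows (bernoulli_gpd H \<kappa>)) \<and> fst g \<in> f \<and> src (bernoulli_gpd H \<kappa>) g = (src H h, \<omega>)"
    then have "src H (fst g) = src H h" "snd g = \<omega>" by (auto simp: bernoulli_gpd_def case_prod_unfold)
    then show "g = (h, \<omega>)" using g bis_src_inj[OF f _ h] by (cases g) auto
  qed
  then show ?thesis unfolding bis_act_point_def by (simp add: bernoulli_gpd_def)
qed

text \<open>Membership in a translate is tested by moving back along the unique arrow of
  \<open>f\<close> with range \<open>y\<close>. In this form the action is an inverse image on the
  range of \<open>f\<close> and respects set operations.\<close>

lemma act_iff:
  assumes f: "f \<in> bisections H" and P: "P \<subseteq> B0"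
  shows "(y, \<psi>) \<in> act f P \<longleftrightarrow> (y, \<psi>) \<in> B0 \<and> (\<exists>h\<in>f. rng H h = y \<and> (src H h, translate H (ginv H h) \<psi>) \<in> P)"
proof
  assume "(y, \<psi>) \<in> act f P"
  then obtain x where x: "(y, \<psi>) = bis_act_point (bernoulli_gpd H \<kappa>) fst f x" "x \<in> P" "fst x \<in> src H ` f"
    unfolding bis_act_def by blast
  then obtain h where h: "h \<in> f" "fst x = src H h" by blast
  have xe: "x = (src H h, snd x)" using h(2) by (metis prod.collapse)
  have hs: "h \<in> space (arrows H)" using bis_in[OF f h(1)] .
  have b: "(src H h, snd x) \<in> B0" using P x(2) xe by auto
  have e: "y = rng H h" "\<psi> = translate H h (snd x)" using x(1) act_point[OF f h(1) b] xe by auto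
  have w: "snd x \<in> src_fibre H (src H h) \<rightarrow>\<^sub>E space \<kappa>" using b by (simp add: B0_iff)
  have "(y, \<psi>) \<in> B0" unfolding e B0_iff using translate_in[OF hs w] rng_in[OF hs] by simp
  moreover have "translate H (ginv H h) \<psi> = snd x" unfolding e by (rule translate_ginv[OF hs w])
  ultimately show "(y, \<psi>) \<in> B0 \<and> (\<exists>h\<in>f. rng H h = y \<and> (src H h, translate H (ginv H h) \<psi>) \<in> P)"
    using h e(1) x(2) xe by auto
next
  assume r: "(y, \<psi>) \<in> B0 \<and> (\<exists>h\<in>f. rng H h = y \<and> (src H h, translate H (ginv H h) \<psi>) \<in> P)"
  then obtain h where h: "h \<in> f" "rng H h = y" "(src H h, translate H (ginv H h) \<psi>) \<in> P" by blast
  have hs: "h \<in> space (arrows H)" using bis_in[OF f h(1)] .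
  have "translate H h (translate H (ginv H h) \<psi>) = \<psi>"
    by (rule translate_ginv'[OF hs]) (use r h(2) in \<open>simp add: B0_iff\<close>)
  then have "(y, \<psi>) = bis_act_point (bernoulli_gpd H \<kappa>) fst f (src H h, translate H (ginv H h) \<psi>)"
    using act_point[OF f h(1)] h(2,3) P by auto
  then show "(y, \<psi>) \<in> act f P" unfolding bis_act_def using h by force
qed

lemma act_subset: "f \<in> bisections H \<Longrightarrow> P \<subseteq> B0 \<Longrightarrow> act f P \<subseteq> B0"
  using act_iff by auto

lemma act_mono: "P \<subseteq> Q \<Longrightarrow> act f P \<subseteq> act f Q"
  unfolding bis_act_def by auto

lemma act_UN: "act f (\<Union>i\<in>X. P i) = (\<Union>i\<in>X. act f (P i))"
  unfolding bis_act_def by blast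

lemma act_Union: "act f (\<Union>C) = \<Union>(act f ` C)"
  unfolding bis_act_def by blast

lemma act_Un: "act f (P \<union> Q) = act f P \<union> act f Q"
  unfolding bis_act_def by blast

lemma act_empty: "act f {} = {}"
  unfolding bis_act_def by blast

lemma act_Diff:
  assumes f: "f \<in> bisections H" and "P \<subseteq> B0" "Q \<subseteq> B0"
  shows "act f (P - Q) = act f P - act f Q"
proof -
  have "P - Q \<subseteq> B0" using assms by blast
  note a = act_iff[OF f assms(2)] act_iff[OF f assms(3)] act_iff[OF f this]
  have "(y, \<psi>) \<in> act f (P - Q) \<longleftrightarrow> (y, \<psi>) \<in> act f P - act f Q" for y \<psi>
    unfolding Diff_iff[of "(y, \<psi>)" "act f P"] a using bis_rng_inj[OF f] by blast
  then show ?thesis by auto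
qed

lemma act_units:
  assumes "P \<subseteq> B0"
  shows "act (units H) P = P"
proof -
  have t: "translate H (ginv H y) \<psi> = \<psi>" if "(y, \<psi>) \<in> B0" for y \<psi>
  proof -
    have y: "y \<in> units H" "y \<in> space (arrows H)" using that units_subset by (auto simp: B0_iff)
    have gy: "ginv H y = y"
      using cmp_src[OF ginv_in[OF y(2)]] cmp_ginv_left[OF y(2)] y by (simp add: src_ginv rng_unit src_unit)
    have "cmp H f y = f" if "f \<in> src_fibre H y" for f
      using that cmp_src[of f] by (auto simp: src_fibre_def)
    then show ?thesis using that y unfolding translate_def gy
      by (auto simp: B0_iff rng_unit PiE_iff extensional_def restrict_def fun_eq_iff)
  qed
  have "(y, \<psi>) \<in> act (units H) P \<longleftrightarrow> (y, \<psi>) \<in> P" for y \<psi>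
  proof
    assume "(y, \<psi>) \<in> act (units H) P"
    then show "(y, \<psi>) \<in> P" unfolding act_iff[OF units_bis assms] using rng_unit src_unit t by fastforce
  next
    assume a: "(y, \<psi>) \<in> P"
    then have b: "(y, \<psi>) \<in> B0" using assms by blast
    then have "y \<in> units H" by (simp add: B0_iff)
    then show "(y, \<psi>) \<in> act (units H) P" unfolding act_iff[OF units_bis assms]
      using a b t[OF b] rng_unit src_unit by (auto intro!: bexI[of _ y])
  qed
  then show ?thesis by auto
qed

text \<open>After moving back along h in \<open>f\<close>, the label read by g' is the original
  label at the product of g' with the inverse of h.\<close>

lemma act_cyl:
  assumes f: "f \<in> bisections H" and g: "g \<in> bisections H"
  shows "act f (cyl H \<kappa> g A) = cyl H \<kappa> (bis_prod H g (ginv H ` f)) A"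
proof -
  have "(y, \<psi>) \<in> act f (cyl H \<kappa> g A) \<longleftrightarrow> (y, \<psi>) \<in> cyl H \<kappa> (bis_prod H g (ginv H ` f)) A" for y \<psi>
  proof -
    have tr: "translate H (ginv H h) \<psi> g' = \<psi> (cmp H g' (ginv H h))" if "h \<in> f" "g' \<in> g" "src H g' = src H h" for h g'
      using that bis_in[OF f] bis_in[OF g] by (simp add: translate_def src_fibre_def rng_ginv)
    have "(y, \<psi>) \<in> act f (cyl H \<kappa> g A) \<longleftrightarrow> (y, \<psi>) \<in> B0 \<and>
      (\<exists>h\<in>f. rng H h = y \<and> (src H h, translate H (ginv H h) \<psi>) \<in> B0 \<and>
         (\<exists>g'\<in>g. src H g' = src H h \<and> \<psi> (cmp H g' (ginv H h)) \<in> A))"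
    proof -
      have "(src H h, translate H (ginv H h) \<psi>) \<in> cyl H \<kappa> g A \<longleftrightarrow> (src H h, translate H (ginv H h) \<psi>) \<in> B0 \<and>
         (\<exists>g'\<in>g. src H g' = src H h \<and> \<psi> (cmp H g' (ginv H h)) \<in> A)" if "h \<in> f" for h
        unfolding cyl_def bis_fibre_def using tr[OF that] by auto
      then show ?thesis unfolding act_iff[OF f cyl_subset] by blast
    qed
    also have "\<dots> \<longleftrightarrow> (y, \<psi>) \<in> B0 \<and> (\<exists>h\<in>f. rng H h = y \<and> (\<exists>g'\<in>g. src H g' = src H h \<and> \<psi> (cmp H g' (ginv H h)) \<in> A))"
    proof -
      have "(src H h, translate H (ginv H h) \<psi>) \<in> B0" if "(rng H h, \<psi>) \<in> B0" "h \<in> f" for h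
        using translate_in[OF ginv_in[OF bis_in[OF f that(2)]], of \<psi>] that bis_in[OF f that(2)]
        by (simp add: B0_iff src_ginv rng_ginv src_in)
      then show ?thesis by blast
    qed
    also have "\<dots> \<longleftrightarrow> (y, \<psi>) \<in> cyl H \<kappa> (bis_prod H g (ginv H ` f)) A"
    proof
      assume l: "(y, \<psi>) \<in> B0 \<and> (\<exists>h\<in>f. rng H h = y \<and> (\<exists>g'\<in>g. src H g' = src H h \<and> \<psi> (cmp H g' (ginv H h)) \<in> A))"
      then obtain h g' where h: "h \<in> f" "rng H h = y" "g' \<in> g" "src H g' = src H h" "\<psi> (cmp H g' (ginv H h)) \<in> A" by blast
      have c: "(g', ginv H h) \<in> composable H"
        using h bis_in[OF f] bis_in[OF g] by (simp add: composable_def ginv_in rng_ginv)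
      have "cmp H g' (ginv H h) \<in> bis_prod H g (ginv H ` f)" unfolding bis_prod_def using h c by blast
      moreover have "src H (cmp H g' (ginv H h)) = y" using c h bis_in[OF f] by (simp add: src_cmp src_ginv)
      ultimately show "(y, \<psi>) \<in> cyl H \<kappa> (bis_prod H g (ginv H ` f)) A"
        using l h(5) unfolding cyl_def bis_fibre_def by auto
    next
      assume "(y, \<psi>) \<in> cyl H \<kappa> (bis_prod H g (ginv H ` f)) A"
      then obtain k where k: "(y, \<psi>) \<in> B0" "k \<in> bis_prod H g (ginv H ` f)" "src H k = y" "\<psi> k \<in> A"
        unfolding cyl_def bis_fibre_def by blast
      then obtain g' h where h: "h \<in> f" "g' \<in> g" "k = cmp H g' (ginv H h)" "(g', ginv H h) \<in> composable H"
        unfolding bis_prod_def by blast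
      have "src H g' = src H h" using h bis_in[OF f h(1)] by (simp add: composable_def rng_ginv)
      moreover have "rng H h = y" using k(3) h bis_in[OF f h(1)] by (simp add: src_cmp src_ginv)
      ultimately show "(y, \<psi>) \<in> B0 \<and> (\<exists>h\<in>f. rng H h = y \<and> (\<exists>g'\<in>g. src H g' = src H h \<and> \<psi> (cmp H g' (ginv H h)) \<in> A))"
        using k h by blast
    qed
    finally show ?thesis .
  qed
  then show ?thesis by auto
qed

lemma act_B0:
  assumes f: "f \<in> bisections H"
  shows "act f B0 = cyl H \<kappa> (rng H ` f) (space \<kappa>)"
proof -
  have "(src H h, translate H (ginv H h) \<psi>) \<in> B0" if "(rng H h, \<psi>) \<in> B0" "h \<in> f" for h \<psi>
    using translate_in[OF ginv_in[OF bis_in[OF f that(2)]], of \<psi>] that bis_in[OF f that(2)]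
    by (simp add: B0_iff src_ginv rng_ginv src_in)
  then have "(y, \<psi>) \<in> act f B0 \<longleftrightarrow> (y, \<psi>) \<in> B0 \<and> y \<in> rng H ` f" for y \<psi>
    unfolding act_iff[OF f subset_refl] by blast
  then show ?thesis unfolding cyl_unit[OF bis_rng_borel[OF f]] by auto
qed

text \<open>\<open>act_idx f\<close> gives the index of the translated cylinder.
  \<open>act_top f\<close> records membership in the range of \<open>f\<close>, without which a
  point cannot be moved back and lies in no translate.\<close>

definition "act_idx f i = (bis_prod H (fst i) (ginv H ` f), snd i)"
definition "act_top f = (rng H ` f, space \<kappa>)"

lemma act_idx_in: "f \<in> bisections H \<Longrightarrow> i \<in> idx \<Longrightarrow> act_idx f i \<in> idx"
  unfolding act_idx_def by (auto intro!: bis_prod_bis bis_ginv)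

lemma act_top_in: "f \<in> bisections H \<Longrightarrow> act_top f \<in> idx"
  unfolding act_top_def by (auto intro: bis_units bis_rng_borel)

text \<open>The pattern at y shows whether y is in the range of \<open>f\<close> and, if so,
  displays the pattern at the point moved back along \<open>f\<close>.\<close>

lemma act_tset:
  assumes f: "f \<in> bisections H" and I: "I \<subseteq> idx"
    and J: "act_top f \<in> J" "act_idx f ` I \<subseteq> J"
  shows "act f (tset H \<kappa> I S) = tset H \<kappa> J {a. act_top f \<in> a \<and> {i \<in> I. act_idx f i \<in> a} \<in> S}"
proof -
  have cJ: "code J y = {i \<in> J. y \<in> cyl H \<kappa> (fst i) (snd i)}" if "y \<in> B0" for y J
    using that unfolding code_def hits_def cyl_def by auto
  have top: "(y, \<psi>) \<in> cyl H \<kappa> (rng H ` f) (space \<kappa>) \<longleftrightarrow> act_top f \<in> code J (y, \<psi>)" if "(y, \<psi>) \<in> B0" for y \<psi>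
    using J(1) unfolding cJ[OF that] by (simp add: act_top_def)
  have "(y, \<psi>) \<in> act f (tset H \<kappa> I S) \<longleftrightarrow> (y, \<psi>) \<in> tset H \<kappa> J {a. act_top f \<in> a \<and> {i \<in> I. act_idx f i \<in> a} \<in> S}" for y \<psi>
  proof (cases "(y, \<psi>) \<in> B0 \<and> (\<exists>h\<in>f. rng H h = y)")
    case True
    then obtain h where b: "(y, \<psi>) \<in> B0" and h: "h \<in> f" "rng H h = y" by blast
    let ?p = "(src H h, translate H (ginv H h) \<psi>)"
    have iff: "(y, \<psi>) \<in> act f P \<longleftrightarrow> ?p \<in> P" if "P \<subseteq> B0" for P
      unfolding act_iff[OF f that] using b h bis_rng_inj[OF f] by blast
    have pB: "?p \<in> B0"
      using act_iff[OF f subset_refl, of y \<psi>] iff[OF subset_refl] b h act_B0[OF f] cyl_unit[OF bis_rng_borel[OF f]] by auto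
    have "i \<in> I \<Longrightarrow> act_idx f i \<in> code J (y, \<psi>) \<longleftrightarrow> i \<in> code I ?p" for i
    proof -
      assume i: "i \<in> I"
      then have fi: "fst i \<in> bisections H" using I by auto
      have "act_idx f i \<in> code J (y, \<psi>) \<longleftrightarrow> (y, \<psi>) \<in> act f (cyl H \<kappa> (fst i) (snd i))"
        unfolding cJ[OF b] act_cyl[OF f fi] using J(2) i by (auto simp: act_idx_def)
      also have "\<dots> \<longleftrightarrow> ?p \<in> cyl H \<kappa> (fst i) (snd i)" by (rule iff[OF cyl_subset])
      also have "\<dots> \<longleftrightarrow> i \<in> code I ?p" unfolding cJ[OF pB] using i by simp
      finally show ?thesis .
    qed
    then have "{i \<in> I. act_idx f i \<in> code J (y, \<psi>)} = code I ?p"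
      using hits_subset unfolding code_def by fastforce
    moreover have "act_top f \<in> code J (y, \<psi>)"
      unfolding top[OF b, symmetric] using b h cyl_unit[OF bis_rng_borel[OF f]] by auto
    ultimately show ?thesis using iff[OF tset_subset, of I S] b pB by (simp add: tset_code)
  next
    case False
    then have "(y, \<psi>) \<notin> act f (tset H \<kappa> I S)" unfolding act_iff[OF f tset_subset] by blast
    moreover have "act_top f \<notin> code J (y, \<psi>)" if "(y, \<psi>) \<in> B0"
      unfolding top[OF that, symmetric] using False that cyl_unit[OF bis_rng_borel[OF f]] by auto
    ultimately show ?thesis unfolding tset_code by auto
  qed
  then show ?thesis by auto
qed

lemma act_sets:
  assumes f: "f \<in> bisections H" and A: "A \<in> sets BS"
  shows "act f A \<in> sets BS"
proof -
  have tp: "tsets \<subseteq> Pow B0" unfolding tsets_def using tset_subset by blast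
  have sub: "A \<subseteq> B0" if "A \<in> sigma_sets B0 tsets" for A using sigma_sets_into_sp[OF tp that] .
  from A[unfolded sets_BS_tsets] show ?thesis
  proof (induction rule: sigma_sets.induct)
    case (Basic A)
    then obtain I S where A: "A = tset H \<kappa> I S" and I: "finite I" "I \<subseteq> idx" unfolding tsets_def by blast
    have "insert (act_top f) (act_idx f ` I) \<subseteq> idx"
      by (intro insert_subsetI image_subsetI act_top_in[OF f] act_idx_in[OF f]) (use I(2) in blast)
    then show ?case unfolding A
      by (subst act_tset[OF f I(2), of "insert (act_top f) (act_idx f ` I)"])
        (use I(1) in \<open>simp_all add: tset_sets subset_insertI\<close>)
  next
    case Empty
    then show ?case by (simp add: act_empty)
  next
    case (Compl A)
    have "act f B0 \<in> sets BS" unfolding act_B0[OF f] by (intro cyl_sets bis_units bis_rng_borel f sets.top)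
    then show ?case using Compl act_Diff[OF f subset_refl sub] by auto
  next
    case (Union A)
    then show ?case unfolding act_UN by auto
  qed
qed

end

section \<open>Approximation of partitions by patterns\<close>

text \<open>The cells of the relation of lying in the same members of \<S>. This is the coarsest
  partition in which every member of \<S> is a union of blocks, and so it is the object singled out
  by the definite description in \<open>act_partition\<close>.\<close>

definition atoms :: "'a set \<Rightarrow> 'a set set \<Rightarrow> 'a set set" where
  "atoms \<Omega> \<S> = (\<lambda>x. {y \<in> \<Omega>. \<forall>S\<in>\<S>. x \<in> S \<longleftrightarrow> y \<in> S}) ` \<Omega>"

lemma partition_on_atoms: "partition_on \<Omega> (atoms \<Omega> \<S>)"
proof (rule partition_onI)
  show "\<Union>(atoms \<Omega> \<S>) = \<Omega>" unfolding atoms_def by auto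
  show "disjnt p q" if "p \<in> atoms \<Omega> \<S>" "q \<in> atoms \<Omega> \<S>" "p \<noteq> q" for p q
    using that unfolding atoms_def disjnt_def by blast
  show "{} \<notin> atoms \<Omega> \<S>" unfolding atoms_def by blast
qed

lemma atoms_eq: "atoms \<Omega> \<S> = (\<lambda>\<T>. {y \<in> \<Omega>. \<forall>S\<in>\<S>. S \<in> \<T> \<longleftrightarrow> y \<in> S}) ` ((\<lambda>x. {S\<in>\<S>. x \<in> S}) ` \<Omega>)"
  unfolding atoms_def image_image by (rule image_cong) auto

lemma finite_atoms:
  assumes "finite \<S>"
  shows "finite (atoms \<Omega> \<S>)"
proof -
  have "(\<lambda>x. {S\<in>\<S>. x \<in> S}) ` \<Omega> \<subseteq> Pow \<S>" by blast
  from finite_subset[OF this] show ?thesis unfolding atoms_eq using assms by (intro finite_imageI[of "_ ` _"]) simp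
qed

lemma atoms_sets:
  assumes "finite \<S>" "\<S> \<subseteq> sets M" "\<Omega> = space M"
  shows "atoms \<Omega> \<S> \<subseteq> sets M"
proof -
  have "{y \<in> space M. \<forall>S\<in>\<S>. x \<in> S \<longleftrightarrow> y \<in> S} \<in> sets M" for x
  proof (rule sets.sets_Collect_finite_All[OF _ assms(1)])
    fix S assume "S \<in> \<S>"
    then have S: "S \<in> sets M" using assms(2) by blast
    then show "{y \<in> space M. x \<in> S \<longleftrightarrow> y \<in> S} \<in> sets M"
      by (cases "x \<in> S") (simp_all add: sets.sets_into_space Int_absorb1 Collect_conj_eq set_diff_eq[symmetric])
  qed
  then show ?thesis unfolding atoms_def assms(3) by blast
qed

lemma atoms_Union:
  assumes "S \<in> \<S>" "S \<subseteq> \<Omega>"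
  shows "S = \<Union>{A \<in> atoms \<Omega> \<S>. A \<subseteq> S}"
proof
  show "S \<subseteq> \<Union>{A \<in> atoms \<Omega> \<S>. A \<subseteq> S}"
  proof
    fix x assume x: "x \<in> S"
    let ?A = "{y \<in> \<Omega>. \<forall>S\<in>\<S>. x \<in> S \<longleftrightarrow> y \<in> S}"
    have "?A \<in> atoms \<Omega> \<S>" "?A \<subseteq> S" "x \<in> ?A" using x assms unfolding atoms_def by auto
    then show "x \<in> \<Union>{A \<in> atoms \<Omega> \<S>. A \<subseteq> S}" by blast
  qed
qed blast

lemma refines_atoms:
  assumes "partition_on \<Omega> P" "\<And>S. S \<in> \<S> \<Longrightarrow> \<exists>C\<subseteq>P. S = \<Union>C"
  shows "refines \<Omega> P (atoms \<Omega> \<S>)"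
  unfolding refines_def
proof (intro conjI assms(1) partition_on_atoms ballI)
  fix X assume X: "X \<in> P"
  then obtain x where x: "x \<in> X" using partition_onD3[OF assms(1)] by (metis all_not_in_conv)
  have X\<Omega>: "X \<subseteq> \<Omega>" using partition_onD1[OF assms(1)] X by blast
  have "x \<in> S \<longleftrightarrow> y \<in> S" if y: "y \<in> X" and S: "S \<in> \<S>" for y S
  proof -
    obtain C where C: "C \<subseteq> P" "S = \<Union>C" using assms(2)[OF S] by blast
    have "z \<in> S \<longleftrightarrow> X \<in> C" if z: "z \<in> X" for z
    proof
      assume "z \<in> S"
      then obtain Y where Y: "Y \<in> C" "z \<in> Y" using C(2) by blast
      then have "Y = X" using disjointD[OF partition_onD2[OF assms(1)], of Y X] C(1) X z by blast
      then show "X \<in> C" using Y(1) by simp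
    qed (use z C(2) in blast)
    from this[OF x] this[OF y] show ?thesis by simp
  qed
  then have "X \<subseteq> {y \<in> \<Omega>. \<forall>S\<in>\<S>. x \<in> S \<longleftrightarrow> y \<in> S}" using X\<Omega> by blast
  then show "\<exists>Y\<in>atoms \<Omega> \<S>. X \<subseteq> Y" using x X\<Omega> unfolding atoms_def by blast
qed

context bernoulli begin

lemma units_bernoulli: "units (bernoulli_gpd H \<kappa>) = B0"
  by (simp add: bernoulli_gpd_def)

lemma act_partition_eq:
  assumes F: "F \<subseteq> bisections H" and P: "\<Union>P \<subseteq> B0"
  shows "act_partition H (bernoulli_gpd H \<kappa>) bernoulli_proj P F = atoms B0 {act f B | f B. f \<in> F \<and> B \<in> P}"
proof -
  let ?S = "{act f B | f B. f \<in> F \<and> B \<in> P}"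
  let ?adm = "\<lambda>A. partition_on B0 A \<and> (\<forall>f\<in>F. \<forall>B\<in>P. \<exists>C\<subseteq>A. act f B = \<Union>C)"
  have 1: "?adm (atoms B0 ?S)"
  proof (intro conjI partition_on_atoms ballI)
    fix f B assume f: "f \<in> F" and B: "B \<in> P"
    have "act f B \<subseteq> B0" by (rule act_subset) (use F f P B in auto)
    moreover have "act f B \<in> ?S" using f B by blast
    ultimately have "act f B = \<Union>{A \<in> atoms B0 ?S. A \<subseteq> act f B}" by (intro atoms_Union)
    then show "\<exists>C\<subseteq>atoms B0 ?S. act f B = \<Union>C" by (intro exI[of _ "{A \<in> atoms B0 ?S. A \<subseteq> act f B}"]) simp
  qed
  have 2: "refines B0 A (atoms B0 ?S)" if "?adm A" for A
    by (rule refines_atoms) (use that in auto)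
  show ?thesis
    unfolding act_partition_def Let_def units_bernoulli
  proof (rule the_equality)
    show "?adm (atoms B0 ?S) \<and> (\<forall>A'. ?adm A' \<longrightarrow> refines B0 A' (atoms B0 ?S))"
      using 1 2 by blast
    fix A assume "?adm A \<and> (\<forall>A'. ?adm A' \<longrightarrow> refines B0 A' A)"
    then show "A = atoms B0 ?S" using 1 2 refines_asym by blast
  qed
qed

lemma act_partition_props:
  assumes F: "finite F" "F \<subseteq> bisections H" and P: "P \<in> finite_borel_partitions (bernoulli_gpd H \<kappa>) \<mu>"
  defines "N \<equiv> act_partition H (bernoulli_gpd H \<kappa>) bernoulli_proj P F"
  shows "partition_on B0 N" "finite N" "N \<subseteq> sets BS"
    "\<And>f B. f \<in> F \<Longrightarrow> B \<in> P \<Longrightarrow> act f B = \<Union>{A \<in> N. A \<subseteq> act f B}"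
proof -
  let ?S = "{act f B | f B. f \<in> F \<and> B \<in> P}"
  have P': "finite P" "P \<subseteq> sets BS" "partition_on B0 P"
    using P unfolding finite_borel_partitions_def by (auto simp: sets_\<mu> units_bernoulli)
  then have PB: "\<Union>P \<subseteq> B0" using partition_onD1 by blast
  have N: "N = atoms B0 ?S" unfolding N_def by (rule act_partition_eq[OF F(2) PB])
  have S: "?S = (\<lambda>(f, B). act f B) ` (F \<times> P)" by auto
  have fS: "finite ?S" unfolding S using F P' by simp
  show "partition_on B0 N" unfolding N by (rule partition_on_atoms)
  show "finite N" unfolding N by (rule finite_atoms[OF fS])
  have "?S \<subseteq> sets BS" unfolding S using F(2) P'(2) by (auto intro!: act_sets)
  then show "N \<subseteq> sets BS" unfolding N by (rule atoms_sets[OF fS]) (simp add: space_BS)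
  show "act f B = \<Union>{A \<in> N. A \<subseteq> act f B}" if "f \<in> F" "B \<in> P" for f B
    unfolding N
  proof (rule atoms_Union)
    show "act f B \<subseteq> B0" by (rule act_subset) (use F(2) PB that in auto)
  qed (use that in blast)
qed

lemma tset_mono_idx: "I \<subseteq> J \<Longrightarrow> tset H \<kappa> I S = tset H \<kappa> J {a. a \<inter> I \<in> S}"
  unfolding tset_def by (auto simp: hits_Int)

lemma tsetsI: "finite I \<Longrightarrow> I \<subseteq> idx \<Longrightarrow> tset H \<kappa> I S \<in> tsets"
  unfolding tsets_def by (intro CollectI exI conjI) (rule refl)

lemma empty_tsets: "{} \<in> tsets"
  using tsetsI[of "{}" "{}"] by (simp add: tset_empty)

lemma tsets_Un:
  assumes "X \<in> tsets" "Y \<in> tsets" shows "X \<union> Y \<in> tsets"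
proof -
  obtain I S I' S' where X: "X = tset H \<kappa> I S" "finite I" "I \<subseteq> idx"
     and Y: "Y = tset H \<kappa> I' S'" "finite I'" "I' \<subseteq> idx" using assms unfolding tsets_def by blast
  have "X \<union> Y = tset H \<kappa> (I \<union> I') {a. a \<inter> I \<in> S \<or> a \<inter> I' \<in> S'}"
    unfolding X Y tset_def by (auto simp: hits_Int)
  moreover have "finite (I \<union> I')" "I \<union> I' \<subseteq> idx" using X Y by auto
  ultimately show ?thesis using tsetsI by simp
qed

lemma tsets_in_sets: "X \<in> tsets \<Longrightarrow> X \<in> sets BS"
  unfolding tsets_def using tset_sets by blast

lemma sets_BS_sub: "X \<in> sets BS \<Longrightarrow> X \<subseteq> B0"
  using sets.sets_into_space[of X BS] by (simp add: space_BS)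

text \<open>The sets that can be approximated, with the error controlled after translation by all
  members of \<open>F\<close> at once, are closed under complements and countable unions. For
  unions, the part missed by the first \<open>n\<close> sets decreases to the empty set; its
  translates do so as well, because a point is moved back along only one arrow of \<open>f\<close>,
  and continuity from above applies.\<close>

lemma tset_approx:
  assumes A: "A \<in> sets BS" and F: "finite F" "F \<subseteq> bisections H" and e: "\<epsilon> > 0"
  shows "\<exists>X\<in>tsets. \<forall>f\<in>F. measure \<mu> (act f (sym_diff A X)) < \<epsilon>"
proof -
  interpret m: prob_space \<mu> by (rule prob_\<mu>)
  have ms: "act f X \<in> sets \<mu>" if "f \<in> F" "X \<in> sets BS" for f X
    using act_sets that F(2) sets_\<mu> by blast
  from A[unfolded sets_BS_tsets] have "\<forall>\<epsilon>>0. \<exists>X\<in>tsets. \<forall>f\<in>F. measure \<mu> (act f (sym_diff A X)) < \<epsilon>"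
  proof (induction rule: sigma_sets.induct)
    case (Basic A)
    then show ?case by (intro allI impI bexI[of _ A]) (auto simp: act_empty)
  next
    case Empty
    show ?case using empty_tsets by (intro allI impI bexI[of _ "{}"]) (auto simp: act_empty)
  next
    case (Compl A)
    have A: "A \<subseteq> B0" by (rule sets_BS_sub) (use Compl.hyps sets_BS_tsets in simp)
    show ?case
    proof (intro allI impI)
      fix \<epsilon> :: real assume "\<epsilon> > 0"
      with Compl.IH obtain X where X: "X \<in> tsets" "\<forall>f\<in>F. measure \<mu> (act f (sym_diff A X)) < \<epsilon>"
        by (elim allE impE bexE)
      obtain I S where XI: "X = tset H \<kappa> I S" "finite I" "I \<subseteq> idx" using X(1) unfolding tsets_def by auto
      have "B0 - X \<in> tsets" unfolding XI(1) tset_Compl by (rule tsetsI[OF XI(2,3)])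
      moreover have "X \<subseteq> B0" unfolding XI(1) by (rule tset_subset)
      then have "sym_diff (B0 - A) (B0 - X) = sym_diff A X" using A by blast
      ultimately show "\<exists>X\<in>tsets. \<forall>f\<in>F. measure \<mu> (act f (sym_diff (B0 - A) X)) < \<epsilon>" using X(2) by metis
    qed
  next
    case (Union A)
    have As: "A i \<in> sets BS" for i using Union.hyps[of i] sets_BS_tsets by simp
    show ?case
    proof (intro allI impI)
      fix \<epsilon> :: real assume e: "\<epsilon> > 0"
      define D where "D n = (\<Union>i. A i) - (\<Union>i<n. A i)" for n :: nat
      have Ds: "D n \<in> sets BS" for n unfolding D_def using As by auto
      have "\<forall>\<^sub>F n in sequentially. measure \<mu> (act f (D n)) < \<epsilon> / 2" if f: "f \<in> F" for f
      proof -
        have fb: "f \<in> bisections H" using f F(2) by blast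
        have dec: "decseq (\<lambda>n. act f (D n))"
        proof (rule decseq_SucI, rule act_mono)
          show "D (Suc n) \<subseteq> D n" for n unfolding D_def by (auto simp: lessThan_Suc)
        qed
        have lim: "(\<lambda>n. measure \<mu> (act f (D n))) \<longlonglongrightarrow> measure \<mu> (\<Inter>n. act f (D n))"
          by (rule m.finite_Lim_measure_decseq[OF _ dec]) (use ms[OF f Ds] in auto)
        have "(\<Inter>n. act f (D n)) = {}"
        proof (rule ccontr)
          assume "(\<Inter>n. act f (D n)) \<noteq> {}"
          then obtain y \<psi> where y: "\<And>n. (y, \<psi>) \<in> act f (D n)" by auto
          have it: "\<And>n. \<exists>h\<in>f. rng H h = y \<and> (src H h, translate H (ginv H h) \<psi>) \<in> D n"
            using y act_iff[OF fb sets_BS_sub[OF Ds]] by blast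
          then obtain h where h: "h \<in> f" "rng H h = y" by blast
          then have "(src H h, translate H (ginv H h) \<psi>) \<in> D n" for n
            using it[of n] bis_rng_inj[OF fb] by blast
          then show False unfolding D_def by blast
        qed
        then show ?thesis using lim e by (auto dest: order_tendstoD(2)[where a="\<epsilon>/2"])
      qed
      then have "\<forall>\<^sub>F n in sequentially. \<forall>f\<in>F. measure \<mu> (act f (D n)) < \<epsilon> / 2"
        by (simp add: eventually_ball_finite F(1))
      then obtain n where n: "\<And>f. f \<in> F \<Longrightarrow> measure \<mu> (act f (D n)) < \<epsilon> / 2"
        by (auto simp: eventually_sequentially)
      \<comment> \<open>One half of \<epsilon> goes to the tail \<open>D n\<close>, the other half
        is shared by the first \<open>n\<close> sets; \<open>n + 1\<close> avoids a division by
        zero.\<close>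
      have en: "\<epsilon> / (2 * real (n + 1)) > 0" using e by simp
      have "\<exists>X. \<forall>i. X i \<in> tsets \<and> (\<forall>f\<in>F. measure \<mu> (act f (sym_diff (A i) (X i))) < \<epsilon> / (2 * real (n + 1)))"
        using Union.IH[rule_format, OF en] by (intro choice) (simp add: Bex_def)
      then obtain X where X: "\<And>i. X i \<in> tsets"
         "\<And>i f. f \<in> F \<Longrightarrow> measure \<mu> (act f (sym_diff (A i) (X i))) < \<epsilon> / (2 * real (n + 1))" by blast
      have Y: "(\<Union>i<m. X i) \<in> tsets" for m :: nat
      proof (induction m)
        case 0
        show ?case using empty_tsets by simp
      next
        case (Suc m)
        then show ?case using tsets_Un[OF X(1)[of m] Suc] by (simp add: lessThan_Suc)
      qed
      have Xs: "X i \<in> sets BS" for i using X(1) tsets_in_sets by blast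
      have sd: "sym_diff (A i) (X i) \<in> sets BS" for i using As Xs by auto
      have "measure \<mu> (act f (sym_diff (\<Union>i. A i) (\<Union>i<n. X i))) < \<epsilon>" if f: "f \<in> F" for f
      proof -
        have "act f (sym_diff (\<Union>i. A i) (\<Union>i<n. X i)) \<subseteq> act f (D n \<union> (\<Union>i<n. sym_diff (A i) (X i)))"
          by (rule act_mono) (auto simp: D_def)
        also have "\<dots> = act f (D n) \<union> (\<Union>i<n. act f (sym_diff (A i) (X i)))"
          unfolding act_Un act_UN ..
        finally have "measure \<mu> (act f (sym_diff (\<Union>i. A i) (\<Union>i<n. X i))) \<le>
            measure \<mu> (act f (D n) \<union> (\<Union>i<n. act f (sym_diff (A i) (X i))))"
          using ms[OF f Ds] ms[OF f sd] by (intro m.finite_measure_mono) auto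
        also have "\<dots> \<le> measure \<mu> (act f (D n)) + measure \<mu> (\<Union>i<n. act f (sym_diff (A i) (X i)))"
          using ms[OF f Ds] ms[OF f sd] by (intro measure_Un_le) auto
        also have "measure \<mu> (\<Union>i<n. act f (sym_diff (A i) (X i))) \<le> (\<Sum>i<n. measure \<mu> (act f (sym_diff (A i) (X i))))"
          using ms[OF f sd] by (intro m.finite_measure_subadditive_finite) auto
        also have "\<dots> \<le> (\<Sum>i<n. \<epsilon> / (2 * real (n + 1)))"
          by (rule sum_mono) (use X(2)[OF f] in \<open>auto intro: less_imp_le\<close>)
        also have "\<dots> \<le> \<epsilon> / 2" using e by (simp add: field_simps)
        finally show ?thesis using n[OF f] by linarith
      qed
      then show "\<exists>X\<in>tsets. \<forall>f\<in>F. measure \<mu> (act f (sym_diff (\<Union>i. A i) X)) < \<epsilon>"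
        using Y by blast
    qed
  qed
  then show ?thesis using e by blast
qed

text \<open>A finite Borel partition is approximated by one that is read off from finitely many cylinders:
  \<open>T\<close> guesses the block from the code, and \<open>Bad\<close> collects the points where the guess is wrong.\<close>

lemma partition_approx:
  assumes N: "finite N" "N \<subseteq> sets BS" "partition_on B0 N"
    and F: "finite F" "F \<subseteq> bisections H" and e: "\<epsilon> > 0"
    and I0: "finite I0" "I0 \<subseteq> idx"
  obtains I T where "finite I" "I \<subseteq> idx" "I0 \<subseteq> I" "\<And>a. T a \<in> N"
    "{y \<in> B0. y \<notin> T (code I y)} \<in> sets BS"
    "\<And>f. f \<in> F \<Longrightarrow> measure \<mu> (act f {y \<in> B0. y \<notin> T (code I y)}) < \<epsilon>"
proof -
  interpret m: prob_space \<mu> by (rule prob_\<mu>)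
  have ms: "act f X \<in> sets \<mu>" if "f \<in> F" "X \<in> sets BS" for f X
    using act_sets that F(2) sets_\<mu> by blast
  have "B0 \<noteq> {}" using m.not_empty space_\<mu> by simp
  then have Nne: "N \<noteq> {}" using partition_onD1[OF N(3)] by auto
  \<comment> \<open>The wrong guesses are covered by one symmetric difference per block, whose sizes
    are added up.\<close>
  let ?e = "\<epsilon> / real (card N)"
  have ce: "?e > 0" using e Nne N(1) by (simp add: card_gt_0_iff)
  have "\<forall>D\<in>N. \<exists>X\<in>tsets. \<forall>f\<in>F. measure \<mu> (act f (sym_diff D X)) < ?e"
    using tset_approx[OF _ F ce] N(2) by blast
  then obtain X where X: "\<And>D. D \<in> N \<Longrightarrow> X D \<in> tsets"
     "\<And>D f. D \<in> N \<Longrightarrow> f \<in> F \<Longrightarrow> measure \<mu> (act f (sym_diff D (X D))) < ?e" by metis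
  have "\<forall>D\<in>N. \<exists>I S. X D = tset H \<kappa> I S \<and> finite I \<and> I \<subseteq> idx" using X(1) unfolding tsets_def by blast
  then obtain IX SX where IX: "\<And>D. D \<in> N \<Longrightarrow> X D = tset H \<kappa> (IX D) (SX D)" "\<And>D. D \<in> N \<Longrightarrow> finite (IX D)"
     "\<And>D. D \<in> N \<Longrightarrow> IX D \<subseteq> idx" by metis
  define I where "I = I0 \<union> (\<Union>D\<in>N. IX D)"
  define S where "S D = {a. a \<inter> IX D \<in> SX D}" for D
  have XS: "X D = tset H \<kappa> I (S D)" if "D \<in> N" for D
    unfolding IX(1)[OF that] S_def by (rule tset_mono_idx) (use that in \<open>auto simp: I_def\<close>)
  \<comment> \<open>If several approximants claim the code \<open>a\<close>, any one of them is
    taken, and if none does, an arbitrary block. Every point with such a code lies in the symmetric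
    difference of some block and its approximant.\<close>
  define T where "T a = (if \<exists>D\<in>N. a \<in> S D then SOME D. D \<in> N \<and> a \<in> S D else SOME D. D \<in> N)" for a
  have T: "T a \<in> N" for a
  proof (cases "\<exists>D\<in>N. a \<in> S D")
    case True
    then show ?thesis unfolding T_def using someI_ex[of "\<lambda>D. D \<in> N \<and> a \<in> S D"] by auto
  next
    case False
    then show ?thesis unfolding T_def using Nne some_in_eq[of N] by auto
  qed
  have I: "finite I" unfolding I_def using I0 IX(2) N(1) by simp
  have "I \<subseteq> idx" unfolding I_def by (intro Un_least UN_least I0(2) IX(3))
  note I = I this
  let ?Bad = "{y \<in> B0. y \<notin> T (code I y)}"
  have Bad_eq: "?Bad = B0 - (\<Union>D\<in>N. D \<inter> tset H \<kappa> I {a. T a = D})"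
    unfolding tset_code using T by auto
  have Bs: "?Bad \<in> sets BS"
    unfolding Bad_eq using N(1,2) tset_sets[OF I] sets.top[of BS]
    by (intro sets.Diff sets.finite_UN sets.Int) (auto simp: space_BS)
  have sub: "?Bad \<subseteq> (\<Union>D\<in>N. sym_diff D (X D))"
  proof
    fix y assume "y \<in> ?Bad"
    then have y: "y \<in> B0" "y \<notin> T (code I y)" by auto
    obtain D where D: "D \<in> N" "y \<in> D" using y(1) partition_onD1[OF N(3)] by blast
    show "y \<in> (\<Union>D\<in>N. sym_diff D (X D))"
    proof (rule ccontr)
      assume n: "y \<notin> (\<Union>D\<in>N. sym_diff D (X D))"
      have ys: "y \<in> D' \<longleftrightarrow> code I y \<in> S D'" if "D' \<in> N" for D'
        using n that y(1) unfolding XS[OF that] tset_code using XS[OF that] tset_code by auto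
      have "\<exists>D\<in>N. code I y \<in> S D" using D ys by blast
      then have "T (code I y) \<in> N \<and> code I y \<in> S (T (code I y))"
        unfolding T_def using someI_ex[of "\<lambda>D. D \<in> N \<and> code I y \<in> S D"] by auto
      then show False using ys y(2) by blast
    qed
  qed
  have "measure \<mu> (act f ?Bad) < \<epsilon>" if f: "f \<in> F" for f
  proof -
    have sd: "sym_diff D (X D) \<in> sets BS" if "D \<in> N" for D
      using N(2) that tsets_in_sets[OF X(1)[OF that]] by auto
    have "measure \<mu> (act f ?Bad) \<le> measure \<mu> (\<Union>D\<in>N. act f (sym_diff D (X D)))"
      using act_mono[OF sub, of f] ms[OF f sd] N(1) unfolding act_UN by (intro m.finite_measure_mono) auto
    also have "\<dots> \<le> (\<Sum>D\<in>N. measure \<mu> (act f (sym_diff D (X D))))"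
      using ms[OF f sd] N(1) by (intro m.finite_measure_subadditive_finite) auto
    also have "\<dots> < (\<Sum>D\<in>N. ?e)" by (rule sum_strict_mono[OF N(1) Nne]) (use X(2) f in auto)
    also have "\<dots> = \<epsilon>" using Nne N(1) by simp
    finally show ?thesis .
  qed
  then show ?thesis using that[of I T] I T Bs unfolding I_def by auto
qed

end

section \<open>Almost multiplicative maps\<close>

definition mostly :: "nat \<Rightarrow> real \<Rightarrow> (nat \<Rightarrow> bool) \<Rightarrow> bool" where
  "mostly d \<epsilon> P \<longleftrightarrow> real (card {v \<in> {1..d}. \<not> P v}) \<le> \<epsilon> * real d"

lemma mostly_mono:
  assumes "mostly d \<epsilon> P" "\<And>v. v \<in> {1..d} \<Longrightarrow> P v \<Longrightarrow> Q v" "\<epsilon> \<le> \<epsilon>'"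
  shows "mostly d \<epsilon>' Q"
proof -
  have "card {v \<in> {1..d}. \<not> Q v} \<le> card {v \<in> {1..d}. \<not> P v}"
    by (rule card_mono) (use assms(2) in auto)
  moreover have "\<epsilon> * real d \<le> \<epsilon>' * real d" using assms(3) by (simp add: mult_right_mono)
  ultimately show ?thesis using assms(1) unfolding mostly_def by linarith
qed

lemma mostly_conj:
  assumes "mostly d \<epsilon> P" "mostly d \<epsilon>' Q"
  shows "mostly d (\<epsilon> + \<epsilon>') (\<lambda>v. P v \<and> Q v)"
proof -
  have "{v \<in> {1..d}. \<not> (P v \<and> Q v)} = {v \<in> {1..d}. \<not> P v} \<union> {v \<in> {1..d}. \<not> Q v}" by auto
  then have "card {v \<in> {1..d}. \<not> (P v \<and> Q v)} \<le> card {v \<in> {1..d}. \<not> P v} + card {v \<in> {1..d}. \<not> Q v}"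
    by (simp add: card_Un_le)
  then show ?thesis using assms unfolding mostly_def by (simp add: distrib_right)
qed

lemma mostly_ball:
  assumes "finite X" "\<And>x. x \<in> X \<Longrightarrow> mostly d \<epsilon> (P x)"
  shows "mostly d (real (card X) * \<epsilon>) (\<lambda>v. \<forall>x\<in>X. P x v)"
  using assms
proof (induction X rule: finite_induct)
  case empty
  then show ?case by (simp add: mostly_def)
next
  case (insert x X)
  have "mostly d (\<epsilon> + real (card X) * \<epsilon>) (\<lambda>v. P x v \<and> (\<forall>x\<in>X. P x v))"
    by (rule mostly_conj) (use insert in auto)
  then show ?case using insert by (simp add: algebra_simps)
qed

definition partial_inj :: "nat \<Rightarrow> (nat \<times> nat) set \<Rightarrow> bool" where
  "partial_inj d s \<longleftrightarrow> s \<subseteq> {1..d} \<times> {1..d} \<and> (\<forall>i j k. (i, k) \<in> s \<longrightarrow> (j, k) \<in> s \<longrightarrow> i = j) \<and>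
     (\<forall>i j k. (k, i) \<in> s \<longrightarrow> (k, j) \<in> s \<longrightarrow> i = j)"

lemma partial_injD:
  assumes "partial_inj d s"
  shows "s \<subseteq> {1..d} \<times> {1..d}" and "(i, k) \<in> s \<Longrightarrow> (j, k) \<in> s \<Longrightarrow> i = j"
    and "(k, i) \<in> s \<Longrightarrow> (k, j) \<in> s \<Longrightarrow> i = j"
  by (rule assms[unfolded partial_inj_def, THEN conjunct1])
    (rule assms[unfolded partial_inj_def, THEN conjunct2, THEN conjunct1, rule_format]
      assms[unfolded partial_inj_def, THEN conjunct2, THEN conjunct2, rule_format]; assumption)+

text \<open>A partial injection sends distinct vertices with a bad partner to distinct bad partners,
  so exceptional sets do not grow when conditions are transported along it.\<close>

lemma mostly_pull:
  assumes "mostly d \<epsilon> P" "partial_inj d s"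
  shows "mostly d \<epsilon> (\<lambda>v. \<forall>k. (k, v) \<in> s \<longrightarrow> P k)" and "mostly d \<epsilon> (\<lambda>v. \<forall>k. (v, k) \<in> s \<longrightarrow> P k)"
proof -
  let ?A = "{v \<in> {1..d}. \<not> (\<forall>k. (k, v) \<in> s \<longrightarrow> P k)}" and ?B = "{v \<in> {1..d}. \<not> P v}"
  let ?C = "{v \<in> {1..d}. \<not> (\<forall>k. (v, k) \<in> s \<longrightarrow> P k)}"
  have "\<exists>f. \<forall>v\<in>?A. (f v, v) \<in> s \<and> \<not> P (f v)" by (rule bchoice) blast
  then obtain f where f: "\<And>v. v \<in> ?A \<Longrightarrow> (f v, v) \<in> s \<and> \<not> P (f v)" by blast
  have "card ?A \<le> card ?B"
  proof (rule card_inj_on_le[of f])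
    show "inj_on f ?A"
    proof (rule inj_onI)
      fix v w assume vw: "v \<in> ?A" "w \<in> ?A" "f v = f w"
      show "v = w" by (rule partial_injD(3)[OF assms(2), of "f v"]) (use f[OF vw(1)] f[OF vw(2)] vw(3) in auto)
    qed
    show "f ` ?A \<subseteq> ?B"
    proof (rule image_subsetI)
      fix v assume "v \<in> ?A"
      from f[OF this] show "f v \<in> ?B" using partial_injD(1)[OF assms(2)] by blast
    qed
  qed simp
  then show "mostly d \<epsilon> (\<lambda>v. \<forall>k. (k, v) \<in> s \<longrightarrow> P k)" using assms(1) unfolding mostly_def by linarith
  have "\<exists>f. \<forall>v\<in>?C. (v, f v) \<in> s \<and> \<not> P (f v)" by (rule bchoice) blast
  then obtain f where f: "\<And>v. v \<in> ?C \<Longrightarrow> (v, f v) \<in> s \<and> \<not> P (f v)" by blast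
  have "card ?C \<le> card ?B"
  proof (rule card_inj_on_le[of f])
    show "inj_on f ?C"
    proof (rule inj_onI)
      fix v w assume vw: "v \<in> ?C" "w \<in> ?C" "f v = f w"
      show "v = w" by (rule partial_injD(2)[OF assms(2), of _ "f v"]) (use f[OF vw(1)] f[OF vw(2)] vw(3) in auto)
    qed
    show "f ` ?C \<subseteq> ?B"
    proof (rule image_subsetI)
      fix v assume "v \<in> ?C"
      from f[OF this] show "f v \<in> ?B" using partial_injD(1)[OF assms(2)] by blast
    qed
  qed simp
  then show "mostly d \<epsilon> (\<lambda>v. \<forall>k. (v, k) \<in> s \<longrightarrow> P k)" using assms(1) unfolding mostly_def by linarith
qed

lemma partial_inj_bisection:
  assumes "s \<in> bisections (fin_gpd d)"
  shows "partial_inj d s"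
proof -
  have "s \<in> sets (count_space ({1..d} \<times> {1..d}))" "inj_on (src (fin_gpd d)) s" "inj_on (rng (fin_gpd d)) s"
    using assms unfolding bisections_def borel_iso_onto_image_def by (auto simp: fin_gpd_def)
  then show ?thesis unfolding partial_inj_def inj_on_def by (auto simp: fin_gpd_def)
qed

lemma bis_prod_fin_gpd:
  assumes "partial_inj d s" "partial_inj d t"
  shows "bis_prod (fin_gpd d) s t = s O t"
proof -
  note st = partial_injD(1)[OF assms(1)] partial_injD(1)[OF assms(2)]
  show ?thesis
  proof (intro set_eqI iffI)
    fix p assume "p \<in> bis_prod (fin_gpd d) s t"
    then show "p \<in> s O t" unfolding bis_prod_def composable_def fin_gpd_def by auto
  next
    fix p assume "p \<in> s O t"
    then obtain i k l where p: "p = (i, l)" "(i, k) \<in> s" "(k, l) \<in> t" by auto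
    then have "((i, k), (k, l)) \<in> composable (fin_gpd d)" "p = cmp (fin_gpd d) (i, k) (k, l)"
      using st unfolding composable_def fin_gpd_def by auto
    then show "p \<in> bis_prod (fin_gpd d) s t" unfolding bis_prod_def using p by blast
  qed
qed

text \<open>A single map that is almost multiplicative and almost trace preserving on
  \<open>F\<close>. All estimates on the models are deterministic statements about such a map; the
  measures on the space of maps enter only in the final limit.\<close>

locale sofic_map = pmp_discrete_groupoid H \<nu> for H :: "'h gpd" and \<nu> :: "'h measure" +
  fixes d :: nat and \<sigma> :: "'h set \<Rightarrow> (nat \<times> nat) set" and F :: "'h set set" and \<delta> :: real
  assumes d: "d \<ge> 1" and \<sigma>: "\<sigma> \<in> sofic_maps H d"
    and mult: "multiplicative H d F \<delta> \<sigma>" and trace: "trace_preserving H \<nu> d F \<delta> \<sigma>"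
    and F_bis: "F \<subseteq> bisections H"
begin

lemma \<sigma>_partial_inj: "g \<in> bisections H \<Longrightarrow> partial_inj d (\<sigma> g)"
  using \<sigma> unfolding sofic_maps_def by (intro partial_inj_bisection) auto

lemma \<sigma>_single: "g \<in> bisections H \<Longrightarrow> (i, k) \<in> \<sigma> g \<Longrightarrow> (j, k) \<in> \<sigma> g \<Longrightarrow> i = j"
  by (rule partial_injD(2)[OF \<sigma>_partial_inj])

lemma \<sigma>_inj: "g \<in> bisections H \<Longrightarrow> (k, i) \<in> \<sigma> g \<Longrightarrow> (k, j) \<in> \<sigma> g \<Longrightarrow> i = j"
  by (rule partial_injD(3)[OF \<sigma>_partial_inj])

lemma \<sigma>_range: "g \<in> bisections H \<Longrightarrow> (k, i) \<in> \<sigma> g \<Longrightarrow> k \<in> {1..d} \<and> i \<in> {1..d}"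
  using partial_injD(1)[OF \<sigma>_partial_inj] by blast

lemma mostly_mult:
  assumes "s \<in> F" "t \<in> F"
  shows "mostly d \<delta> (\<lambda>v. \<forall>k. (k, v) \<in> \<sigma> (bis_prod H s t) \<longleftrightarrow> (k, v) \<in> \<sigma> s O \<sigma> t)"
proof -
  have b: "s \<in> bisections H" "t \<in> bisections H" using assms F_bis by auto
  let ?D = "sym_diff (\<sigma> (bis_prod H s t)) (\<sigma> s O \<sigma> t)"
  have "fin_card d ?D < \<delta>"
    using mult[unfolded multiplicative_def, rule_format, OF assms]
    by (simp only: bis_prod_fin_gpd[OF \<sigma>_partial_inj[OF b(1)] \<sigma>_partial_inj[OF b(2)]])
  then have c: "real (card ?D) < \<delta> * real d" using d unfolding fin_card_def by (simp add: field_simps)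
  have "?D \<subseteq> {1..d} \<times> {1..d}"
    using partial_injD(1)[OF \<sigma>_partial_inj[OF b(1)]] partial_injD(1)[OF \<sigma>_partial_inj[OF b(2)]] partial_injD(1)[OF \<sigma>_partial_inj[OF bis_prod_bis[OF b]]]
    by blast
  then have fin: "finite ?D" by (rule finite_subset) simp
  have "{v \<in> {1..d}. \<not> (\<forall>k. (k, v) \<in> \<sigma> (bis_prod H s t) \<longleftrightarrow> (k, v) \<in> \<sigma> s O \<sigma> t)} \<subseteq> snd ` ?D" by force
  then have "card {v \<in> {1..d}. \<not> (\<forall>k. (k, v) \<in> \<sigma> (bis_prod H s t) \<longleftrightarrow> (k, v) \<in> \<sigma> s O \<sigma> t)} \<le> card (snd ` ?D)"
    using fin by (intro card_mono) auto
  also have "\<dots> \<le> card ?D" by (rule card_image_le[OF fin])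
  finally show ?thesis using c unfolding mostly_def by linarith
qed

lemma card_trace:
  assumes "s \<in> F"
  shows "\<bar>real (card {v \<in> {1..d}. (v, v) \<in> \<sigma> s}) / real d - measure \<nu> (s \<inter> units H)\<bar> < \<delta>"
proof -
  have "\<sigma> s \<inter> units (fin_gpd d) = (\<lambda>v. (v, v)) ` {v \<in> {1..d}. (v, v) \<in> \<sigma> s}"
    by (auto simp: fin_gpd_def)
  then have "card (\<sigma> s \<inter> units (fin_gpd d)) = card {v \<in> {1..d}. (v, v) \<in> \<sigma> s}"
    by (simp add: card_image inj_on_def)
  then show ?thesis using trace assms unfolding trace_preserving_def fin_trace_def gpd_trace_def by auto
qed

lemma \<delta>_nonneg: "s \<in> F \<Longrightarrow> 0 \<le> \<delta>"
  using card_trace[of s] by linarith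

lemma bis_prod_units_right:
  assumes g: "g \<in> bisections H" and C: "C \<subseteq> units H"
  shows "bis_prod H g C = {h \<in> g. src H h \<in> C}"
proof (intro set_eqI iffI)
  fix h assume "h \<in> bis_prod H g C"
  then obtain a x where h: "h = cmp H a x" "a \<in> g" "x \<in> C" "(a, x) \<in> composable H" unfolding bis_prod_def by blast
  have "src H a = x" using h C by (auto simp: composable_def rng_unit)
  moreover from this have "h = a" using h(1) cmp_src[OF bis_in[OF g h(2)]] by simp
  ultimately show "h \<in> {h \<in> g. src H h \<in> C}" using h by simp
next
  fix h assume "h \<in> {h \<in> g. src H h \<in> C}"
  then have h: "h \<in> g" "src H h \<in> C" by auto
  have "(h, src H h) \<in> composable H" unfolding composable_def
    using bis_in[OF g h(1)] src_in units_subset by (auto simp: rng_unit)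
  then show "h \<in> bis_prod H g C"
    unfolding bis_prod_def using h cmp_src[OF bis_in[OF g h(1)]] by force
qed

lemma bis_prod_ginv_left:
  assumes g: "g \<in> bisections H"
  shows "bis_prod H (ginv H ` g) g = src H ` g"
proof (intro set_eqI iffI)
  fix x assume "x \<in> bis_prod H (ginv H ` g) g"
  then obtain a b where x: "x = cmp H (ginv H a) b" "a \<in> g" "b \<in> g" "(ginv H a, b) \<in> composable H" unfolding bis_prod_def by blast
  have "rng H a = rng H b" using x bis_in[OF g] by (auto simp: composable_def src_ginv)
  then have "a = b" using bis_rng_inj[OF g] x by blast
  then show "x \<in> src H ` g" using x cmp_ginv_left[OF bis_in[OF g x(3)]] by simp
next
  fix x assume "x \<in> src H ` g"
  then obtain h where h: "h \<in> g" "x = src H h" by blast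
  have "(ginv H h, h) \<in> composable H" using bis_in[OF g h(1)] by (simp add: composable_def ginv_in src_ginv)
  then show "x \<in> bis_prod H (ginv H ` g) g"
    unfolding bis_prod_def using h cmp_ginv_left[OF bis_in[OF g h(1)]] by force
qed

lemma bis_prod_ginv_right:
  assumes g: "g \<in> bisections H"
  shows "bis_prod H g (ginv H ` g) = rng H ` g"
proof -
  have "ginv H ` ginv H ` g = g" using bis_in[OF g] by (force simp: image_image ginv_ginv)
  moreover have "src H ` ginv H ` g = rng H ` g"
    using bis_in[OF g] by (auto simp: image_image src_ginv intro!: image_cong)
  ultimately show ?thesis using bis_prod_ginv_left[OF bis_ginv[OF g]] by simp
qed

text \<open>A set \<open>e\<close> of units satisfies e e = e, and a partial injection that agrees
  with its square at a vertex fixes that vertex.\<close>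

lemma mostly_diag:
  assumes "e \<in> F" "e \<subseteq> units H"
  shows "mostly d \<delta> (\<lambda>v. \<forall>k. (k, v) \<in> \<sigma> e \<longrightarrow> k = v)"
proof -
  have eb: "e \<in> bisections H" using assms F_bis by auto
  have ee: "bis_prod H e e = e" unfolding bis_prod_units_right[OF eb assms(2)] using assms(2) src_unit by auto
  show ?thesis
  proof (rule mostly_mono[OF mostly_mult[OF assms(1) assms(1), unfolded ee] _ order_refl], intro allI impI)
    fix v k assume m: "\<forall>k. (k, v) \<in> \<sigma> e \<longleftrightarrow> (k, v) \<in> \<sigma> e O \<sigma> e" and k: "(k, v) \<in> \<sigma> e"
    then obtain m where m: "(k, m) \<in> \<sigma> e" "(m, v) \<in> \<sigma> e" by blast
    have "m = v" by (rule \<sigma>_inj[OF eb m(1) k])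
    then show "k = v" using \<sigma>_single[OF eb k] m(2) by simp
  qed
qed

text \<open>Since g equals g times its source, a vertex moved by \<open>\<sigma> g\<close> is also
  moved by the image of the source, which is nearly diagonal.\<close>

lemma mostly_src:
  assumes g: "g \<in> F" and e: "src H ` g \<in> F"
  shows "mostly d (2 * \<delta>) (\<lambda>v. \<forall>k. (k, v) \<in> \<sigma> g \<longrightarrow> (v, v) \<in> \<sigma> (src H ` g))"
proof -
  have gb: "g \<in> bisections H" using g F_bis by auto
  have p: "bis_prod H g (src H ` g) = g" unfolding bis_prod_units_right[OF gb bis_src_subset[OF gb]] by auto
  show ?thesis
    by (rule mostly_mono[OF mostly_conj[OF mostly_mult[OF g e] mostly_diag[OF e bis_src_subset[OF gb]]]], unfold p) auto
qed

text \<open>The inverse of g times g is the source of g. By \<open>mostly_src\<close> a vertex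
  \<open>v\<close> moved by \<open>\<sigma> g\<close> is mostly fixed by the image of the source,
  hence returns to itself under the product of the two images; the intermediate vertex can only be
  the image of \<open>v\<close>.\<close>

lemma mostly_ginv:
  assumes g: "g \<in> F" and e: "src H ` g \<in> F" and i: "ginv H ` g \<in> F"
  shows "mostly d (3 * \<delta>) (\<lambda>v. \<forall>k. (k, v) \<in> \<sigma> g \<longrightarrow> (v, k) \<in> \<sigma> (ginv H ` g))"
proof -
  have gb: "g \<in> bisections H" using g F_bis by auto
  show ?thesis
  proof (rule mostly_mono[OF mostly_conj[OF mostly_mult[OF i g] mostly_src[OF g e]]], unfold bis_prod_ginv_left[OF gb])
    fix v assume v: "(\<forall>k. (k, v) \<in> \<sigma> (src H ` g) \<longleftrightarrow> (k, v) \<in> \<sigma> (ginv H ` g) O \<sigma> g) \<and>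
       (\<forall>k. (k, v) \<in> \<sigma> g \<longrightarrow> (v, v) \<in> \<sigma> (src H ` g))"
    show "\<forall>k. (k, v) \<in> \<sigma> g \<longrightarrow> (v, k) \<in> \<sigma> (ginv H ` g)"
    proof (intro allI impI)
      fix k assume k: "(k, v) \<in> \<sigma> g"
      then have "(v, v) \<in> \<sigma> (ginv H ` g) O \<sigma> g" using v by blast
      then obtain m where "(v, m) \<in> \<sigma> (ginv H ` g)" "(m, v) \<in> \<sigma> g" by blast
      then show "(v, k) \<in> \<sigma> (ginv H ` g)" using \<sigma>_single[OF gb k] by blast
    qed
  qed simp
qed

text \<open>The hypothesis gives g C = g' C for a bisection u = g C whose source is
  \<open>C\<close>. A vertex fixed by \<open>\<sigma> C\<close> is then moved by the image of u, and
  multiplicativity, applied to u = g C and to u = g' C, identifies its image with both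
  neighbours.\<close>

lemma mostly_coincide:
  assumes g: "g \<in> F" and g': "g' \<in> F" and C: "C \<in> F" "C \<subseteq> units H"
    and u: "bis_prod H g C \<in> F" "ginv H ` bis_prod H g C \<in> F"
    and eq: "\<And>x. x \<in> C \<Longrightarrow> bis_fibre H x g \<inter> bis_fibre H x g' \<noteq> {}"
  shows "mostly d (3 * \<delta>) (\<lambda>v. (v, v) \<in> \<sigma> C \<longrightarrow> (\<exists>k. (k, v) \<in> \<sigma> g \<and> (k, v) \<in> \<sigma> g'))"
proof -
  have b: "g \<in> bisections H" "g' \<in> bisections H" "C \<in> bisections H" "bis_prod H g C \<in> bisections H"
    using F_bis assms by auto
  have e1: "bis_prod H g C = {h \<in> g. src H h \<in> C}" "bis_prod H g' C = {h \<in> g'. src H h \<in> C}"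
    using bis_prod_units_right[OF b(1) C(2)] bis_prod_units_right[OF b(2) C(2)] by auto
  have "h \<in> g' \<longleftrightarrow> h \<in> g" if "src H h \<in> C" for h
    using eq[OF that] bis_src_inj[OF b(1), of h] bis_src_inj[OF b(2), of h] unfolding bis_fibre_def by fastforce
  then have e2: "bis_prod H g' C = bis_prod H g C" unfolding e1 by auto
  have e3: "src H ` bis_prod H g C = C" using eq unfolding e1 bis_fibre_def by fastforce
  note m = mostly_conj[OF mostly_mult[OF u(2,1)] mostly_conj[OF mostly_mult[OF g C(1)] mostly_mult[OF g' C(1)]],
      unfolded bis_prod_ginv_left[OF b(4)] e2 e3]
  show ?thesis
  proof (rule mostly_mono[OF m], intro impI)
    fix v assume v: "(\<forall>k. (k, v) \<in> \<sigma> C \<longleftrightarrow> (k, v) \<in> \<sigma> (ginv H ` bis_prod H g C) O \<sigma> (bis_prod H g C)) \<and>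
       (\<forall>k. (k, v) \<in> \<sigma> (bis_prod H g C) \<longleftrightarrow> (k, v) \<in> \<sigma> g O \<sigma> C) \<and>
       (\<forall>k. (k, v) \<in> \<sigma> (bis_prod H g C) \<longleftrightarrow> (k, v) \<in> \<sigma> g' O \<sigma> C)" and vC: "(v, v) \<in> \<sigma> C"
    then obtain k where "(k, v) \<in> \<sigma> (bis_prod H g C)" by blast
    then have "(k, v) \<in> \<sigma> g O \<sigma> C" "(k, v) \<in> \<sigma> g' O \<sigma> C" using v by blast+
    then have "(k, v) \<in> \<sigma> g" "(k, v) \<in> \<sigma> g'" using \<sigma>_single[OF b(3) vC] by blast+
    then show "\<exists>k. (k, v) \<in> \<sigma> g \<and> (k, v) \<in> \<sigma> g'" by blast
  qed simp
qed

text \<open>If the two neighbours of \<open>v\<close> coincide, then \<open>v\<close> is mostly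
  fixed by the image of w, the product of the inverse of g with g' C. This w contains no unit
  because g and g' disagree on \<open>C\<close>, so its trace is 0 and trace preservation makes such
  fixed points rare. The constant is 1 + 1 for two products, 3 for the inverse and 1 for the
  trace.\<close>

lemma mostly_distinct:
  assumes g: "g \<in> F" "src H ` g \<in> F" "ginv H ` g \<in> F" and g': "g' \<in> F" and C: "C \<in> F" "C \<subseteq> units H"
    and u: "bis_prod H g' C \<in> F" and w: "bis_prod H (ginv H ` g) (bis_prod H g' C) \<in> F"
    and ne: "\<And>x. x \<in> C \<Longrightarrow> bis_fibre H x g \<inter> bis_fibre H x g' = {}"
  shows "mostly d (6 * \<delta>) (\<lambda>v. (v, v) \<in> \<sigma> C \<longrightarrow> \<not> (\<exists>k. (k, v) \<in> \<sigma> g \<and> (k, v) \<in> \<sigma> g'))"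
proof -
  let ?q = "bis_prod H g' C" and ?w = "bis_prod H (ginv H ` g) (bis_prod H g' C)"
  have b: "g \<in> bisections H" "g' \<in> bisections H" using F_bis assms by auto
  have q: "?q = {h \<in> g'. src H h \<in> C}" by (rule bis_prod_units_right[OF b(2) C(2)])
  have "?w \<inter> units H = {}"
  proof (rule ccontr)
    assume "?w \<inter> units H \<noteq> {}"
    then obtain h k where h: "cmp H (ginv H h) k \<in> units H" "h \<in> g" "k \<in> g'" "src H k \<in> C" "(ginv H h, k) \<in> composable H"
      unfolding q unfolding bis_prod_def by blast
    have hk: "h \<in> space (arrows H)" "k \<in> space (arrows H)" using bis_in b h by blast+
    have r: "rng H h = rng H k" using h(5) hk by (simp add: composable_def src_ginv)
    let ?x = "cmp H (ginv H h) k"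
    have x: "?x = src H k" using src_cmp[OF h(5)] src_unit[OF h(1)] by simp
    have x': "?x = src H h" using rng_cmp[OF h(5)] rng_unit[OF h(1)] hk by (simp add: rng_ginv)
    have "(h, ginv H h) \<in> composable H" using hk by (simp add: composable_def ginv_in rng_ginv)
    from cmp_assoc[OF this h(5)] have "cmp H h ?x = cmp H (rng H h) k" using hk by (simp add: cmp_ginv_right)
    then have "h = k" using cmp_src[OF hk(1)] rng_cmp_left[OF hk(2)] x' r by simp
    then show False using ne[OF h(4)] h unfolding bis_fibre_def by blast
  qed
  then have "\<bar>real (card {v \<in> {1..d}. (v, v) \<in> \<sigma> ?w}) / real d\<bar> < \<delta>" using card_trace[OF w] by simp
  then have t: "mostly d \<delta> (\<lambda>v. (v, v) \<notin> \<sigma> ?w)"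
    unfolding mostly_def using d by (simp add: field_simps)
  note m = mostly_conj[OF mostly_conj[OF mostly_mult[OF g' C(1)] mostly_mult[OF g(3) u]] mostly_conj[OF mostly_ginv[OF g] t]]
  show ?thesis
  proof (rule mostly_mono[OF m], intro impI notI)
    fix v assume v: "((\<forall>k. (k, v) \<in> \<sigma> ?q \<longleftrightarrow> (k, v) \<in> \<sigma> g' O \<sigma> C) \<and>
       (\<forall>k. (k, v) \<in> \<sigma> ?w \<longleftrightarrow> (k, v) \<in> \<sigma> (ginv H ` g) O \<sigma> ?q)) \<and>
       (\<forall>k. (k, v) \<in> \<sigma> g \<longrightarrow> (v, k) \<in> \<sigma> (ginv H ` g)) \<and> (v, v) \<notin> \<sigma> ?w"
      and vC: "(v, v) \<in> \<sigma> C" and "\<exists>k. (k, v) \<in> \<sigma> g \<and> (k, v) \<in> \<sigma> g'"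
    then obtain k where k: "(k, v) \<in> \<sigma> g" "(k, v) \<in> \<sigma> g'" by blast
    have "(k, v) \<in> \<sigma> ?q" using v k(2) vC by blast
    moreover have "(v, k) \<in> \<sigma> (ginv H ` g)" using v k(1) by blast
    ultimately have "(v, v) \<in> \<sigma> ?w" using v by blast
    then show False using v by blast
  qed simp
qed

text \<open>The model version of \<open>act_cyl\<close> and \<open>act_top\<close>: the g-neighbour
  of \<open>v\<close> is the neighbour of its image \<open>u\<close> under the product of g with the
  inverse of f, and \<open>u\<close> is such an image iff the image of the range of f is defined at
  \<open>u\<close>. The statement on inverses is known at most \<open>v\<close>;
  \<open>mostly_pull\<close> carries it over to most \<open>u\<close>.\<close>

lemma mostly_equivariant:
  assumes f: "f \<in> F" "src H ` f \<in> F" "ginv H ` f \<in> F" "rng H ` f \<in> F" and G: "finite G" "G \<subseteq> F"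
  shows "mostly d (real (card G) * \<delta> + 5 * \<delta>) (\<lambda>u. ((\<exists>v. (u, v) \<in> \<sigma> f) \<longleftrightarrow> (\<exists>k. (k, u) \<in> \<sigma> (rng H ` f))) \<and>
     (\<forall>v. (u, v) \<in> \<sigma> f \<longrightarrow> (\<forall>g\<in>G. \<forall>k. (k, v) \<in> \<sigma> g \<longleftrightarrow> (k, u) \<in> \<sigma> (bis_prod H g (ginv H ` f)))))"
proof -
  have b: "f \<in> bisections H" "ginv H ` f \<in> bisections H" using F_bis f by auto
  have m1: "mostly d (3 * \<delta>) (\<lambda>u. \<forall>v. (u, v) \<in> \<sigma> f \<longrightarrow> (\<forall>k. (k, v) \<in> \<sigma> f \<longrightarrow> (v, k) \<in> \<sigma> (ginv H ` f)))"
    by (rule mostly_pull(2)[OF mostly_ginv[OF f(1,2,3)] \<sigma>_partial_inj[OF b(1)]])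
  have m2: "mostly d (real (card G) * \<delta>) (\<lambda>u. \<forall>g\<in>G. \<forall>k. (k, u) \<in> \<sigma> (bis_prod H g (ginv H ` f)) \<longleftrightarrow> (k, u) \<in> \<sigma> g O \<sigma> (ginv H ` f))"
    by (rule mostly_ball[OF G(1)]) (rule mostly_mult, use G(2) f in auto)
  note m = mostly_conj[OF mostly_conj[OF m1 m2] mostly_conj[OF mostly_mult[OF f(1,3), unfolded bis_prod_ginv_right[OF b(1)]]
       mostly_diag[OF f(4) bis_rng_subset[OF b(1)]]]]
  show ?thesis
  proof (rule mostly_mono[OF m], intro conjI allI impI ballI)
    fix u assume u: "((\<forall>v. (u, v) \<in> \<sigma> f \<longrightarrow> (\<forall>k. (k, v) \<in> \<sigma> f \<longrightarrow> (v, k) \<in> \<sigma> (ginv H ` f))) \<and>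
       (\<forall>g\<in>G. \<forall>k. (k, u) \<in> \<sigma> (bis_prod H g (ginv H ` f)) \<longleftrightarrow> (k, u) \<in> \<sigma> g O \<sigma> (ginv H ` f))) \<and>
       (\<forall>k. (k, u) \<in> \<sigma> (rng H ` f) \<longleftrightarrow> (k, u) \<in> \<sigma> f O \<sigma> (ginv H ` f)) \<and>
       (\<forall>k. (k, u) \<in> \<sigma> (rng H ` f) \<longrightarrow> k = u)"
    show "(\<exists>v. (u, v) \<in> \<sigma> f) \<longleftrightarrow> (\<exists>k. (k, u) \<in> \<sigma> (rng H ` f))" using u by blast
    fix v g k assume v: "(u, v) \<in> \<sigma> f" and g: "g \<in> G"
    have "(v, u) \<in> \<sigma> (ginv H ` f)" using u v by blast
    then have "(k, u) \<in> \<sigma> g O \<sigma> (ginv H ` f) \<longleftrightarrow> (k, v) \<in> \<sigma> g" using \<sigma>_single[OF b(2)] by blast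
    then show "(k, v) \<in> \<sigma> g \<longleftrightarrow> (k, u) \<in> \<sigma> (bis_prod H g (ginv H ` f))" using u g by blast
  qed (simp add: algebra_simps)
qed

lemma mostly_units:
  assumes U: "units H \<in> F"
  shows "mostly d \<delta> (\<lambda>v. (v, v) \<in> \<sigma> (units H))"
proof -
  interpret n: prob_space \<nu> by (rule prob_space_\<nu>)
  have "space \<nu> = units H" using sets_eq_imp_space_eq[OF sets_\<nu>] by (simp add: space_unit_space)
  then have "measure \<nu> (units H) = 1" using n.prob_space by simp
  then have 1: "\<bar>real (card {v \<in> {1..d}. (v, v) \<in> \<sigma> (units H)}) / real d - 1\<bar> < \<delta>"
    using card_trace[OF U] by simp
  have "{v \<in> {1..d}. (v, v) \<notin> \<sigma> (units H)} = {1..d} - {v \<in> {1..d}. (v, v) \<in> \<sigma> (units H)}" by auto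
  then have "real (card {v \<in> {1..d}. (v, v) \<notin> \<sigma> (units H)}) = real d - real (card {v \<in> {1..d}. (v, v) \<in> \<sigma> (units H)})"
  proof -
    let ?S = "{v \<in> {1..d}. (v, v) \<in> \<sigma> (units H)}"
    assume e: "{v \<in> {1..d}. (v, v) \<notin> \<sigma> (units H)} = {1..d} - ?S"
    have "?S \<subseteq> {1..d}" by blast
    then have "card ({1..d} - ?S) = card {1..d} - card ?S" "card ?S \<le> card {1..d}"
      by (auto intro!: card_Diff_subset card_mono intro: finite_subset simp del: card_atLeastAtMost)
    then show ?thesis unfolding e by simp
  qed
  then show ?thesis unfolding mostly_def using 1 d by (simp add: field_simps abs_less_iff)
qed

end

section \<open>Random labelings of the vertices\<close>

text \<open>Two families have the same total, so an excess at \<open>x\<close> must be balanced by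
  deficits elsewhere, which the lower bounds limit.\<close>

lemma sum_lower_bounds_close:
  fixes c n :: "'a \<Rightarrow> real"
  assumes "finite X" "sum c X = sum n X" "\<And>x. x \<in> X \<Longrightarrow> n x - \<eta> \<le> c x" "0 \<le> \<eta>" "x \<in> X"
  shows "\<bar>c x - n x\<bar> \<le> real (card X) * \<eta>"
proof -
  have "(\<Sum>y\<in>X - {x}. n y - \<eta>) \<le> (\<Sum>y\<in>X - {x}. c y)" by (rule sum_mono) (use assms(3) in auto)
  then have "sum n (X - {x}) - real (card (X - {x})) * \<eta> \<le> sum c (X - {x})" by (simp add: sum_subtractf)
  moreover have "sum c X = c x + sum c (X - {x})" "sum n X = n x + sum n (X - {x})"
    using assms(1,5) by (simp_all add: sum.remove)
  moreover have "real (card (X - {x})) * \<eta> \<le> real (card X) * \<eta>"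
    using assms(1,4) by (intro mult_right_mono) (auto intro: card_mono)
  moreover have "1 * \<eta> \<le> real (card X) * \<eta>"
    using assms(1,4,5) by (intro mult_right_mono) (auto simp: Suc_le_eq card_gt_0_iff)
  moreover have "n x - \<eta> \<le> c x" using assms(3,5) by blast
  ultimately show ?thesis using assms(2) unfolding abs_le_iff by linarith
qed

text \<open>The points of \<open>K\<close> represent the cells cut out by \<open>\<S>\<close>, so that labelings become a finite
  probability space.\<close>

definition is_model :: "'k measure \<Rightarrow> 'k set set \<Rightarrow> 'k set \<Rightarrow> ('k \<Rightarrow> real) \<Rightarrow> bool" where
  "is_model M \<S> K w \<longleftrightarrow> finite K \<and> K \<subseteq> space M \<and> (\<forall>c. 0 \<le> w c) \<and>
     (\<forall>A\<in>sets M. (\<forall>x\<in>space M. \<forall>y\<in>space M. (\<forall>S\<in>\<S>. x \<in> S \<longleftrightarrow> y \<in> S) \<longrightarrow> x \<in> A \<longrightarrow> y \<in> A) \<longrightarrow>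
        (\<Sum>c\<in>K \<inter> A. w c) = measure M A)"

lemma is_modelD:
  assumes "is_model M \<S> K w"
  shows "finite K" "K \<subseteq> space M" "0 \<le> w c"
    "A \<in> sets M \<Longrightarrow> (\<And>x y. x \<in> space M \<Longrightarrow> y \<in> space M \<Longrightarrow> (\<And>S. S \<in> \<S> \<Longrightarrow> x \<in> S \<longleftrightarrow> y \<in> S) \<Longrightarrow> x \<in> A \<Longrightarrow> y \<in> A)
      \<Longrightarrow> (\<Sum>c\<in>K \<inter> A. w c) = measure M A"
proof -
  note m = assms[unfolded is_model_def]
  show "finite K" "K \<subseteq> space M" "0 \<le> w c" using m by simp_all
  assume A: "A \<in> sets M" and inv: "\<And>x y. x \<in> space M \<Longrightarrow> y \<in> space M \<Longrightarrow> (\<And>S. S \<in> \<S> \<Longrightarrow> x \<in> S \<longleftrightarrow> y \<in> S) \<Longrightarrow> x \<in> A \<Longrightarrow> y \<in> A"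
  have "\<forall>x\<in>space M. \<forall>y\<in>space M. (\<forall>S\<in>\<S>. x \<in> S \<longleftrightarrow> y \<in> S) \<longrightarrow> x \<in> A \<longrightarrow> y \<in> A"
  proof (intro ballI impI)
    fix x y assume h: "x \<in> space M" "y \<in> space M" "\<forall>S\<in>\<S>. x \<in> S \<longleftrightarrow> y \<in> S" "x \<in> A"
    show "y \<in> A" by (rule inv[OF h(1,2) bspec[OF h(3)] h(4)])
  qed
  then show "(\<Sum>c\<in>K \<inter> A. w c) = measure M A"
    by (rule m[THEN conjunct2, THEN conjunct2, THEN conjunct2, THEN bspec, OF A, THEN mp])
qed

lemma ex_model:
  assumes "prob_space M" "finite \<S>" "\<S> \<subseteq> sets M"
  obtains K w where "is_model M \<S> K w"
proof -
  interpret prob_space M by fact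
  define cell where "cell x = {y \<in> space M. \<forall>S\<in>\<S>. x \<in> S \<longleftrightarrow> y \<in> S}" for x
  let ?\<Gamma> = "atoms (space M) \<S>"
  have \<Gamma>: "?\<Gamma> = cell ` space M" unfolding atoms_def cell_def ..
  have fin: "finite ?\<Gamma>" by (rule finite_atoms[OF assms(2)])
  have meas: "?\<Gamma> \<subseteq> sets M" by (rule atoms_sets[OF assms(2,3)]) simp
  define r where "r b = (SOME x. x \<in> b)" for b :: "'a set"
  have ne: "b \<noteq> {}" if "b \<in> ?\<Gamma>" for b using that partition_onD3[OF partition_on_atoms] by blast
  have r: "r b \<in> b" if "b \<in> ?\<Gamma>" for b unfolding r_def using ne[OF that] by (simp add: some_in_eq)
  have sp: "b \<subseteq> space M" if "b \<in> ?\<Gamma>" for b using that unfolding \<Gamma> cell_def by blast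
  have cell_r: "cell (r b) = b" if b: "b \<in> ?\<Gamma>" for b
  proof -
    obtain x where x: "b = cell x" using b unfolding \<Gamma> by blast
    have "r b \<in> cell x" using r[OF b] x by simp
    then show ?thesis unfolding x cell_def by auto
  qed
  define w where "w c = measure M (cell c)" for c
  have "is_model M \<S> (r ` ?\<Gamma>) w" unfolding is_model_def
  proof (intro conjI ballI impI allI)
    show "finite (r ` ?\<Gamma>)" using fin by simp
    show "r ` ?\<Gamma> \<subseteq> space M" using r sp by blast
    show "0 \<le> w c" for c unfolding w_def by simp
    fix A assume A: "A \<in> sets M" and inv: "\<forall>x\<in>space M. \<forall>y\<in>space M. (\<forall>S\<in>\<S>. x \<in> S \<longleftrightarrow> y \<in> S) \<longrightarrow> x \<in> A \<longrightarrow> y \<in> A"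
    let ?B = "{b \<in> ?\<Gamma>. b \<subseteq> A}"
    have sub: "b \<subseteq> A" if "b \<in> ?\<Gamma>" "x \<in> b" "x \<in> A" for b x
    proof
      fix y assume y: "y \<in> b"
      have "\<forall>S\<in>\<S>. x \<in> S \<longleftrightarrow> y \<in> S" using that(1,2) y unfolding \<Gamma> cell_def by blast
      then show "y \<in> A" using inv that sp[OF that(1)] y by blast
    qed
    have "r ` ?\<Gamma> \<inter> A = r ` ?B" using r sub by blast
    moreover have "inj_on r ?B" by (rule inj_onI) (metis (no_types, lifting) cell_r mem_Collect_eq)
    ultimately have "(\<Sum>c\<in>r ` ?\<Gamma> \<inter> A. w c) = (\<Sum>b\<in>?B. w (r b))" by (simp add: sum.reindex)
    also have "\<dots> = (\<Sum>b\<in>?B. measure M b)" by (rule sum.cong) (auto simp: w_def cell_r)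
    also have "\<dots> = measure M (\<Union>b\<in>?B. b)"
    proof (rule finite_measure_finite_Union[symmetric])
      show "disjoint_family_on (\<lambda>b. b) ?B"
        using disjointD[OF partition_onD2[OF partition_on_atoms]] unfolding disjoint_family_on_def by blast
    qed (use fin meas in auto)
    also have "(\<Union>b\<in>?B. b) = A"
    proof
      show "A \<subseteq> (\<Union>b\<in>?B. b)"
      proof
        fix x assume x: "x \<in> A"
        have "cell x \<in> ?\<Gamma>" "x \<in> cell x" unfolding \<Gamma> cell_def using x sets.sets_into_space[OF A] by auto
        then show "x \<in> (\<Union>b\<in>?B. b)" using sub x by blast
      qed
    qed blast
    finally show "(\<Sum>c\<in>r ` ?\<Gamma> \<inter> A. w c) = measure M A" .
  qed
  then show ?thesis using that by blast
qed

definition prod_weight :: "nat \<Rightarrow> ('k \<Rightarrow> real) \<Rightarrow> (nat \<Rightarrow> 'k) \<Rightarrow> real" where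
  "prod_weight d w z = (\<Prod>v\<in>{1..d}. w (z v))"

lemma prod_weight_nonneg: "(\<And>c. 0 \<le> w c) \<Longrightarrow> 0 \<le> prod_weight d w z"
  unfolding prod_weight_def by (simp add: prod_nonneg)

lemma prob_box:
  assumes K: "finite K" and one: "sum w K = 1" and V: "V \<subseteq> {1..d}"
  shows "(\<Sum>z\<in>{1..d} \<rightarrow>\<^sub>E K. prod_weight d w z * of_bool (\<forall>k\<in>V. z k \<in> X k)) = (\<Prod>k\<in>V. \<Sum>c\<in>K \<inter> X k. w c)"
proof -
  have "(\<Sum>z\<in>{1..d} \<rightarrow>\<^sub>E K. prod_weight d w z * of_bool (\<forall>k\<in>V. z k \<in> X k)) =
      (\<Sum>z\<in>{1..d} \<rightarrow>\<^sub>E K. \<Prod>k\<in>{1..d}. w (z k) * of_bool (k \<in> V \<longrightarrow> z k \<in> X k))"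
  proof (rule sum.cong[OF refl])
    fix z
    have "(of_bool (\<forall>k\<in>V. z k \<in> X k) :: real) = (\<Prod>k\<in>{1..d}. of_bool (k \<in> V \<longrightarrow> z k \<in> X k))"
    proof (cases "\<forall>k\<in>V. z k \<in> X k")
      case False
      then obtain k where "k \<in> {1..d}" "k \<in> V" "z k \<notin> X k" using V by blast
      then have "\<exists>k\<in>{1..d}. (of_bool (k \<in> V \<longrightarrow> z k \<in> X k) :: real) = 0" by auto
      then have "(\<Prod>k\<in>{1..d}. of_bool (k \<in> V \<longrightarrow> z k \<in> X k) :: real) = 0" by (intro prod_zero) auto
      with False show ?thesis by simp
    qed simp
    then show "prod_weight d w z * of_bool (\<forall>k\<in>V. z k \<in> X k) = (\<Prod>k\<in>{1..d}. w (z k) * of_bool (k \<in> V \<longrightarrow> z k \<in> X k))"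
      unfolding prod_weight_def prod.distrib by simp
  qed
  also have "\<dots> = (\<Prod>k\<in>{1..d}. \<Sum>c\<in>K. w c * of_bool (k \<in> V \<longrightarrow> c \<in> X k))"
    by (rule prod_sum_PiE[symmetric]) (use K in auto)
  also have "\<dots> = (\<Prod>k\<in>{1..d}. if k \<in> V then \<Sum>c\<in>K \<inter> X k. w c else 1)"
  proof (rule prod.cong[OF refl])
    fix k
    have "(\<Sum>c\<in>K. w c * of_bool (c \<in> X k)) = (\<Sum>c\<in>K \<inter> X k. w c)"
    proof -
      have "(\<Sum>c\<in>K. w c * of_bool (c \<in> X k)) = (\<Sum>c\<in>K. if c \<in> X k then w c else 0)" by (rule sum.cong) auto
      then show ?thesis by (simp add: sum.inter_restrict[OF K])
    qed
    then show "(\<Sum>c\<in>K. w c * of_bool (k \<in> V \<longrightarrow> c \<in> X k)) = (if k \<in> V then \<Sum>c\<in>K \<inter> X k. w c else 1)"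
      using one by simp
  qed
  also have "\<dots> = (\<Prod>k\<in>{1..d} \<inter> V. \<Sum>c\<in>K \<inter> X k. w c)" by (subst prod.inter_restrict) auto
  also have "{1..d} \<inter> V = V" using V by blast
  finally show ?thesis .
qed

text \<open>Chebyshev's inequality for a sum of indicator-like variables most of which are pairwise
  uncorrelated: each pair in \<open>D\<close> adds at most 1 to the variance, so the variance is of
  order d and not of order d squared.\<close>

lemma finite_chebyshev:
  fixes Y :: "nat \<Rightarrow> 'z \<Rightarrow> real"
  assumes Z: "finite Z" and W0: "\<And>z. z \<in> Z \<Longrightarrow> 0 \<le> W z" and W1: "sum W Z = 1"
    and Y: "\<And>v z. 0 \<le> Y v z \<and> Y v z \<le> 1"
    and p: "\<And>v. v \<in> {1..d} \<Longrightarrow> p v = (\<Sum>z\<in>Z. W z * Y v z)"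
    and D: "D \<subseteq> {1..d} \<times> {1..d}" "real (card D) \<le> c * real d"
    and ind: "\<And>u v. u \<in> {1..d} \<Longrightarrow> v \<in> {1..d} \<Longrightarrow> (u, v) \<notin> D \<Longrightarrow> (\<Sum>z\<in>Z. W z * (Y u z * Y v z)) = p u * p v"
    and d: "d \<ge> 1" and e: "\<epsilon> > 0"
  shows "(\<Sum>z\<in>{z \<in> Z. \<epsilon> * real d < \<bar>(\<Sum>v\<in>{1..d}. Y v z) - (\<Sum>v\<in>{1..d}. p v)\<bar>}. W z) \<le> c / (\<epsilon>\<^sup>2 * real d)"
proof -
  let ?V = "{1..d}"
  let ?S = "\<lambda>z. \<Sum>v\<in>?V. Y v z" and ?P = "\<Sum>v\<in>?V. p v"
  let ?B = "{z \<in> Z. \<epsilon> * real d < \<bar>?S z - ?P\<bar>}"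
  have p0: "0 \<le> p v" if "v \<in> ?V" for v
    unfolding p[OF that] by (rule sum_nonneg) (use W0 Y in auto)
  have ES: "(\<Sum>z\<in>Z. W z * ?S z) = ?P"
    unfolding sum_distrib_left by (subst sum.swap) (simp add: p)
  have ESS: "(\<Sum>z\<in>Z. W z * (?S z * ?S z)) = (\<Sum>u\<in>?V. \<Sum>v\<in>?V. \<Sum>z\<in>Z. W z * (Y u z * Y v z))"
  proof -
    have "(\<Sum>z\<in>Z. W z * (?S z * ?S z)) = (\<Sum>z\<in>Z. \<Sum>u\<in>?V. \<Sum>v\<in>?V. W z * (Y u z * Y v z))"
      by (rule sum.cong[OF refl]) (subst sum_product, simp only: sum_distrib_left)
    also have "\<dots> = (\<Sum>u\<in>?V. \<Sum>z\<in>Z. \<Sum>v\<in>?V. W z * (Y u z * Y v z))" by (rule sum.swap)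
    also have "\<dots> = (\<Sum>u\<in>?V. \<Sum>v\<in>?V. \<Sum>z\<in>Z. W z * (Y u z * Y v z))"
      by (rule sum.cong[OF refl]) (rule sum.swap)
    finally show ?thesis .
  qed
  have "(\<Sum>z\<in>Z. W z * (?S z - ?P)\<^sup>2) = (\<Sum>z\<in>Z. W z * (?S z * ?S z) - 2 * ?P * (W z * ?S z) + ?P\<^sup>2 * W z)"
    by (rule sum.cong) (simp_all add: power2_eq_square algebra_simps)
  also have "\<dots> = (\<Sum>z\<in>Z. W z * (?S z * ?S z)) - 2 * ?P * (\<Sum>z\<in>Z. W z * ?S z) + ?P\<^sup>2 * sum W Z"
    by (simp only: sum.distrib sum_subtractf sum_distrib_left[symmetric])
  also have "\<dots> = (\<Sum>z\<in>Z. W z * (?S z * ?S z)) - ?P * ?P" unfolding ES W1 by (simp add: power2_eq_square)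
  also have "\<dots> = (\<Sum>u\<in>?V. \<Sum>v\<in>?V. (\<Sum>z\<in>Z. W z * (Y u z * Y v z)) - p u * p v)"
    by (simp only: ESS sum_product[of p _ p] sum_subtractf)
  also have "\<dots> = (\<Sum>q\<in>?V \<times> ?V. (\<Sum>z\<in>Z. W z * (Y (fst q) z * Y (snd q) z)) - p (fst q) * p (snd q))"
    by (simp add: sum.cartesian_product case_prod_unfold)
  also have "\<dots> \<le> (\<Sum>q\<in>?V \<times> ?V. if q \<in> D then 1 else 0)"
  proof (rule sum_mono)
    fix q assume q: "q \<in> ?V \<times> ?V"
    show "(\<Sum>z\<in>Z. W z * (Y (fst q) z * Y (snd q) z)) - p (fst q) * p (snd q) \<le> (if q \<in> D then 1 else 0)"
    proof (cases "q \<in> D")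
      case True
      have "(\<Sum>z\<in>Z. W z * (Y (fst q) z * Y (snd q) z)) \<le> (\<Sum>z\<in>Z. W z * 1)"
        by (intro sum_mono mult_left_mono W0) (use Y in \<open>auto intro!: mult_le_one\<close>)
      moreover have "0 \<le> p (fst q) * p (snd q)" using q p0 by (auto intro!: mult_nonneg_nonneg)
      ultimately show ?thesis using True W1 by simp
    next
      case False
      then show ?thesis using ind[of "fst q" "snd q"] q by auto
    qed
  qed
  also have "\<dots> = real (card D)"
    using D(1) by (simp add: sum.If_cases Int_absorb1)
  also have "\<dots> \<le> c * real d" by (rule D(2))
  finally have var: "(\<Sum>z\<in>Z. W z * (?S z - ?P)\<^sup>2) \<le> c * real d" .
  have "(\<Sum>z\<in>?B. W z) * (\<epsilon> * real d)\<^sup>2 = (\<Sum>z\<in>?B. W z * (\<epsilon> * real d)\<^sup>2)" by (simp add: sum_distrib_right)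
  also have "\<dots> \<le> (\<Sum>z\<in>?B. W z * (?S z - ?P)\<^sup>2)"
  proof (intro sum_mono mult_left_mono)
    fix z assume z: "z \<in> ?B"
    then have "(\<epsilon> * real d)\<^sup>2 \<le> \<bar>?S z - ?P\<bar>\<^sup>2" using e by (intro power_mono) auto
    then show "(\<epsilon> * real d)\<^sup>2 \<le> (?S z - ?P)\<^sup>2" by simp
    show "0 \<le> W z" using z W0 by auto
  qed
  also have "\<dots> \<le> (\<Sum>z\<in>Z. W z * (?S z - ?P)\<^sup>2)"
    by (rule sum_mono2) (use Z W0 in auto)
  also note var
  finally have "(\<Sum>z\<in>?B. W z) * (\<epsilon> * real d)\<^sup>2 \<le> c * real d" .
  then have "(\<Sum>z\<in>?B. W z) \<le> c * real d / (\<epsilon> * real d)\<^sup>2"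
    using e d by (subst pos_le_divide_eq) auto
  also have "\<dots> = c / (\<epsilon>\<^sup>2 * real d)" using d by (simp add: power2_eq_square field_simps)
  finally show ?thesis .
qed

definition verts :: "('h set \<Rightarrow> (nat \<times> nat) set) \<Rightarrow> nat \<Rightarrow> 'h set \<Rightarrow> nat set" where
  "verts \<sigma> v g = {k. (k, v) \<in> \<sigma> g}"

context bernoulli begin

lemma sum_pat_set:
  assumes "finite I" "I \<subseteq> idx"
  shows "(\<Sum>R\<in>Pow (I \<times> I). measure \<nu> (pat_set I R)) = 1"
proof -
  interpret n: prob_space \<nu> by (rule prob_space_\<nu>)
  have "(\<Sum>R\<in>Pow (I \<times> I). measure \<nu> (pat_set I R)) = measure \<nu> (\<Union>R\<in>Pow (I \<times> I). pat_set I R)"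
    by (rule n.finite_measure_finite_Union[symmetric])
      (use assms pat_set_sets[OF assms] sets_\<nu> in \<open>auto simp: disjoint_family_on_def pat_set_def\<close>)
  also have "(\<Union>R\<in>Pow (I \<times> I). pat_set I R) = space \<nu>"
    using coinc_subset unfolding pat_set_def space_\<nu> by blast
  finally show ?thesis using n.prob_space by simp
qed

text \<open>For C = \<open>pat_set I R\<close>, trace preservation provides about \<nu>(C) d
  vertices fixed by the image of C. Most of them have pattern \<open>R\<close>, by
  \<open>mostly_coincide\<close> for pairs in \<open>R\<close> and \<open>mostly_distinct\<close>
  for the other pairs. This yields lower bounds only; since the patterns partition the vertices as
  well as the units, \<open>sum_lower_bounds_close\<close> makes them two-sided.\<close>

lemma local_stats:
  assumes I: "finite I" "I \<subseteq> idx" and e: "\<epsilon> > 0"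
  obtains F0 \<delta>0 where "finite F0" "F0 \<subseteq> bisections H" "\<delta>0 > 0"
    "\<And>d \<sigma> F \<delta> R. sofic_map H \<nu> d \<sigma> F \<delta> \<Longrightarrow> F0 \<subseteq> F \<Longrightarrow> \<delta> \<le> \<delta>0 \<Longrightarrow> R \<in> Pow (I \<times> I) \<Longrightarrow>
      \<bar>real (card {v \<in> {1..d}. coinc I (verts \<sigma> v) = R}) / real d - measure \<nu> (pat_set I R)\<bar> \<le> \<epsilon>"
proof -
  define G where "G = fst ` I"
  define \<C> where "\<C> = pat_set I ` Pow (I \<times> I)"
  define U where "U = (\<lambda>(g, C). bis_prod H g C) ` (G \<times> \<C>)"
  \<comment> \<open>All bisections to which \<open>mostly_coincide\<close> and
    \<open>mostly_distinct\<close> refer below, for \<open>C\<close> running over all pattern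
    sets.\<close>
  define F0 where "F0 = G \<union> (\<lambda>g. src H ` g) ` G \<union> (\<lambda>g. ginv H ` g) ` G \<union> \<C> \<union> U \<union> (\<lambda>u. ginv H ` u) ` U
     \<union> (\<lambda>(g, u). bis_prod H (ginv H ` g) u) ` (G \<times> U)"
  have fin: "finite G" "finite \<C>" "finite U" unfolding U_def G_def \<C>_def using I(1) by auto
  have Gb: "g \<in> bisections H" if "g \<in> G" for g using that I(2) unfolding G_def by auto
  have Cs: "C \<in> sets (unit_space H)" if "C \<in> \<C>" for C using that pat_set_sets[OF I] unfolding \<C>_def by blast
  have Cb: "C \<in> bisections H" if "C \<in> \<C>" for C by (rule bis_units[OF Cs[OF that]])
  have Ub: "u \<in> bisections H" if "u \<in> U" for u using that bis_prod_bis[OF Gb Cb] unfolding U_def by auto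
  have F0: "finite F0" unfolding F0_def using fin by simp
  have F0b: "F0 \<subseteq> bisections H" unfolding F0_def
    by (intro Un_least image_subsetI subsetI)
      (auto intro: Gb Cb Ub bis_ginv bis_units[OF bis_src_borel] bis_prod_bis)
  define n where "n = real (card (I \<times> I))"
  define M where "M = real (card (Pow (I \<times> I)))"
  have M: "M > 0" unfolding M_def using I(1) by (simp add: card_Pow)
  have n: "n \<ge> 0" unfolding n_def by simp
  \<comment> \<open>Each of the \<open>n\<close> pairs of indices costs at most
    \<open>6 * \<delta>\<close> and the trace costs \<open>\<delta>\<close>; the factor
    \<open>M\<close>, the number of relations, is lost in
    \<open>sum_lower_bounds_close\<close>.\<close>
  define \<delta>0 where "\<delta>0 = \<epsilon> / (M * (6 * n + 1))"
  have \<delta>0: "\<delta>0 > 0" unfolding \<delta>0_def using e M n by (intro divide_pos_pos mult_pos_pos) auto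
  show ?thesis
  proof (rule that[OF F0 F0b \<delta>0])
    fix d \<sigma> F \<delta> R
    assume sm: "sofic_map H \<nu> d \<sigma> F \<delta>" and FF: "F0 \<subseteq> F" and \<delta>: "\<delta> \<le> \<delta>0" and R: "R \<in> Pow (I \<times> I)"
    interpret sm: sofic_map H \<nu> d \<sigma> F \<delta> by (rule sm)
    let ?c = "\<lambda>R. real (card {v \<in> {1..d}. coinc I (verts \<sigma> v) = R}) / real d"
    let ?n = "\<lambda>R. measure \<nu> (pat_set I R)"
    have dpos: "real d > 0" using sm.d by simp
    have lower: "?n R - \<epsilon> / M \<le> ?c R" if R: "R \<in> Pow (I \<times> I)" for R
    proof -
      let ?C = "pat_set I R"
      have CC: "?C \<in> \<C>" using R unfolding \<C>_def by blast
      have CF: "?C \<in> F" using CC FF unfolding F0_def by blast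
      have Cu: "?C \<subseteq> units H" unfolding pat_set_def by blast
      have mem: "g \<in> F" "src H ` g \<in> F" "ginv H ` g \<in> F" "bis_prod H g ?C \<in> F" "ginv H ` bis_prod H g ?C \<in> F"
        if "g \<in> G" for g
        by (rule subsetD[OF FF], use that CC in \<open>force simp: F0_def U_def\<close>)+
      have mem2: "bis_prod H (ginv H ` g) (bis_prod H g' ?C) \<in> F" if "g \<in> G" "g' \<in> G" for g g'
        by (rule subsetD[OF FF], use that CC in \<open>force simp: F0_def U_def\<close>)
      have \<delta>n: "0 \<le> \<delta>" by (rule sm.\<delta>_nonneg[OF CF])
      have "mostly d (6 * \<delta>) (\<lambda>v. (v, v) \<in> \<sigma> ?C \<longrightarrow> (p \<in> R \<longleftrightarrow> verts \<sigma> v (fst (fst p)) \<inter> verts \<sigma> v (fst (snd p)) \<noteq> {}))"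
        if p: "p \<in> I \<times> I" for p
      proof -
        have g: "fst (fst p) \<in> G" "fst (snd p) \<in> G" using p unfolding G_def by auto
        have pr: "p \<in> R \<longleftrightarrow> bis_fibre H x (fst (fst p)) \<inter> bis_fibre H x (fst (snd p)) \<noteq> {}" if "x \<in> ?C" for x
          using that p unfolding pat_set_def coinc_def by (auto simp: case_prod_unfold)
        show ?thesis
        proof (cases "p \<in> R")
          case True
          have "mostly d (3 * \<delta>) (\<lambda>v. (v, v) \<in> \<sigma> ?C \<longrightarrow> (\<exists>k. (k, v) \<in> \<sigma> (fst (fst p)) \<and> (k, v) \<in> \<sigma> (fst (snd p))))"
            by (rule sm.mostly_coincide[OF mem(1)[OF g(1)] mem(1)[OF g(2)] CF Cu mem(4,5)[OF g(1)]]) (use pr True in blast)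
          then show ?thesis by (rule mostly_mono) (use \<delta>n True in \<open>auto simp: verts_def\<close>)
        next
          case False
          have "mostly d (6 * \<delta>) (\<lambda>v. (v, v) \<in> \<sigma> ?C \<longrightarrow> \<not> (\<exists>k. (k, v) \<in> \<sigma> (fst (fst p)) \<and> (k, v) \<in> \<sigma> (fst (snd p))))"
            by (rule sm.mostly_distinct[OF mem(1-3)[OF g(1)] mem(1)[OF g(2)] CF Cu mem(4)[OF g(2)] mem2[OF g]]) (use pr False in blast)
          then show ?thesis by (rule mostly_mono) (use False in \<open>auto simp: verts_def\<close>)
        qed
      qed
      then have m: "mostly d (n * (6 * \<delta>)) (\<lambda>v. \<forall>p\<in>I \<times> I. (v, v) \<in> \<sigma> ?C \<longrightarrow>
          (p \<in> R \<longleftrightarrow> verts \<sigma> v (fst (fst p)) \<inter> verts \<sigma> v (fst (snd p)) \<noteq> {}))"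
        unfolding n_def using I(1) by (intro mostly_ball) auto
      have m: "mostly d (n * (6 * \<delta>)) (\<lambda>v. (v, v) \<in> \<sigma> ?C \<longrightarrow> coinc I (verts \<sigma> v) = R)"
      proof (rule mostly_mono[OF m _ order_refl], intro impI)
        fix v assume a: "\<forall>p\<in>I \<times> I. (v, v) \<in> \<sigma> ?C \<longrightarrow>
          (p \<in> R \<longleftrightarrow> verts \<sigma> v (fst (fst p)) \<inter> verts \<sigma> v (fst (snd p)) \<noteq> {})" and vC: "(v, v) \<in> \<sigma> ?C"
        have "coinc I (verts \<sigma> v) = {p \<in> I \<times> I. verts \<sigma> v (fst (fst p)) \<inter> verts \<sigma> v (fst (snd p)) \<noteq> {}}"
          by (simp add: coinc_def case_prod_unfold mem_Times_iff)
        also have "\<dots> = R" using a vC R by blast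
        finally show "coinc I (verts \<sigma> v) = R" .
      qed
      have "{v \<in> {1..d}. (v, v) \<in> \<sigma> ?C} \<subseteq> {v \<in> {1..d}. coinc I (verts \<sigma> v) = R} \<union>
          {v \<in> {1..d}. \<not> ((v, v) \<in> \<sigma> ?C \<longrightarrow> coinc I (verts \<sigma> v) = R)}" by blast
      then have "card {v \<in> {1..d}. (v, v) \<in> \<sigma> ?C} \<le> card ({v \<in> {1..d}. coinc I (verts \<sigma> v) = R} \<union>
          {v \<in> {1..d}. \<not> ((v, v) \<in> \<sigma> ?C \<longrightarrow> coinc I (verts \<sigma> v) = R)})" by (intro card_mono) auto
      also have "\<dots> \<le> card {v \<in> {1..d}. coinc I (verts \<sigma> v) = R} +
          card {v \<in> {1..d}. \<not> ((v, v) \<in> \<sigma> ?C \<longrightarrow> coinc I (verts \<sigma> v) = R)}" by (rule card_Un_le)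
      finally have "real (card {v \<in> {1..d}. (v, v) \<in> \<sigma> ?C}) \<le> real (card {v \<in> {1..d}. coinc I (verts \<sigma> v) = R}) + n * (6 * \<delta>) * real d"
        using m unfolding mostly_def by linarith
      then have "real (card {v \<in> {1..d}. (v, v) \<in> \<sigma> ?C}) / real d \<le> ?c R + n * (6 * \<delta>)"
        using dpos by (simp add: field_simps)
      moreover have "?C \<inter> units H = ?C" using Cu by blast
      then have "?n R - \<delta> < real (card {v \<in> {1..d}. (v, v) \<in> \<sigma> ?C}) / real d"
        using sm.card_trace[OF CF] by (simp add: abs_less_iff)
      moreover have "\<delta> + n * (6 * \<delta>) \<le> \<epsilon> / M"
      proof -
        have "\<delta> + n * (6 * \<delta>) = \<delta> * (6 * n + 1)" by (simp add: algebra_simps)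
        also have "\<dots> \<le> \<delta>0 * (6 * n + 1)" using \<delta> n by (intro mult_right_mono) auto
        also have "\<dots> = \<epsilon> / M" unfolding \<delta>0_def using n by simp
        finally show ?thesis .
      qed
      ultimately show ?thesis by linarith
    qed
    have "(\<Sum>R\<in>Pow (I \<times> I). card {v \<in> {1..d}. coinc I (verts \<sigma> v) = R}) = card {1..d}"
    proof -
      have "(\<Sum>R\<in>Pow (I \<times> I). card {v \<in> {1..d}. coinc I (verts \<sigma> v) = R}) =
          card (\<Union>R\<in>Pow (I \<times> I). {v \<in> {1..d}. coinc I (verts \<sigma> v) = R})"
        by (rule card_UN_disjoint[symmetric]) (use I(1) in auto)
      also have "(\<Union>R\<in>Pow (I \<times> I). {v \<in> {1..d}. coinc I (verts \<sigma> v) = R}) = {1..d}" using coinc_subset by blast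
      finally show ?thesis .
    qed
    then have "(\<Sum>R\<in>Pow (I \<times> I). real (card {v \<in> {1..d}. coinc I (verts \<sigma> v) = R})) = real d"
      by (simp flip: of_nat_sum)
    then have "(\<Sum>R\<in>Pow (I \<times> I). ?c R) = 1" using dpos by (simp add: sum_divide_distrib[symmetric])
    then have s: "(\<Sum>R\<in>Pow (I \<times> I). ?c R) = (\<Sum>R\<in>Pow (I \<times> I). ?n R)" using sum_pat_set[OF I] by simp
    have "\<bar>?c R - ?n R\<bar> \<le> real (card (Pow (I \<times> I))) * (\<epsilon> / M)"
      by (rule sum_lower_bounds_close[OF _ s lower _ R]) (use I(1) e M in auto)
    also have "\<dots> = \<epsilon>" using M unfolding M_def by simp
    finally show "\<bar>?c R - ?n R\<bar> \<le> \<epsilon>" .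
  qed
qed

end

lemma hit_prob_bounds:
  assumes "\<And>A. 0 \<le> m A \<and> m A \<le> 1"
  shows "0 \<le> hit_prob m S R a" "hit_prob m S R a \<le> 1"
  using assms unfolding hit_prob_def by (auto intro!: prod_nonneg prod_le_1)

lemma sum_UN_le:
  fixes f :: "'a \<Rightarrow> real"
  assumes "finite A" "\<And>i. i \<in> A \<Longrightarrow> finite (B i)" "\<And>x. 0 \<le> f x"
  shows "sum f (\<Union>i\<in>A. B i) \<le> (\<Sum>i\<in>A. sum f (B i))"
  using assms(1,2)
proof (induction A rule: finite_induct)
  case (insert i A)
  have "sum f (B i \<union> (\<Union>i\<in>A. B i)) \<le> sum f (B i) + sum f (\<Union>i\<in>A. B i)"
    using insert sum.union_inter[of "B i" "\<Union>i\<in>A. B i" f] sum_nonneg[of "B i \<inter> (\<Union>i\<in>A. B i)" f] assms(3) by auto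
  then show ?case using insert by auto
qed simp

context bernoulli begin

text \<open>These label sets are unions of cells cut out by the label sets in \<open>I\<close>. The
  finite model therefore gives them their exact measure, and passing to finitely many labels causes
  no error in pattern probabilities.\<close>

lemma measure_\<kappa>_sel_model:
  assumes m: "is_model \<kappa> (snd ` I) K w" and I: "finite I" "I \<subseteq> idx" and E: "E \<subseteq> I"
  shows "(\<Sum>c\<in>K \<inter> sel_labels (space \<kappa>) E a. w c) = measure \<kappa> (sel_labels (space \<kappa>) E a)"
proof (rule is_modelD(4)[OF m])
  show "sel_labels (space \<kappa>) E a \<in> sets \<kappa>" by (rule sel_sets) (use E I in \<open>auto intro: finite_subset\<close>)
  show "y \<in> sel_labels (space \<kappa>) E a"
    if "x \<in> space \<kappa>" "y \<in> space \<kappa>" "\<And>S. S \<in> snd ` I \<Longrightarrow> x \<in> S \<longleftrightarrow> y \<in> S" "x \<in> sel_labels (space \<kappa>) E a" for x y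
  proof -
    have "x \<in> snd i \<longleftrightarrow> y \<in> snd i" if "i \<in> E" for i
      using \<open>\<And>S. S \<in> snd ` I \<Longrightarrow> x \<in> S \<longleftrightarrow> y \<in> S\<close>[of "snd i"] that E by blast
    then show ?thesis using \<open>x \<in> sel_labels (space \<kappa>) E a\<close> \<open>y \<in> space \<kappa>\<close> unfolding sel_labels_def by blast
  qed
qed

lemma sum_model:
  assumes m: "is_model \<kappa> \<S> K w"
  shows "sum w K = 1"
proof -
  interpret k: prob_space \<kappa> by (rule prob_\<kappa>)
  have "(\<Sum>c\<in>K \<inter> space \<kappa>. w c) = measure \<kappa> (space \<kappa>)" by (rule is_modelD(4)[OF m]) auto
  moreover have "K \<inter> space \<kappa> = K" using is_modelD(2)[OF m] by blast
  ultimately show ?thesis by (simp add: k.prob_space)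
qed

definition "good_labels d \<sigma> I \<epsilon> z \<longleftrightarrow> (\<forall>a\<in>Pow I.
   \<bar>real (card {v \<in> {1..d}. hits I (verts \<sigma> v) z = a}) / real d - measure \<mu> (tset H \<kappa> I {a})\<bar> \<le> \<epsilon>)"

text \<open>The mean of a pattern frequency is a combination of the hit probabilities with the local
  statistics of \<sigma> as weights, hence close to the measure of the corresponding set. For the
  variance, two vertices are independent unless they share a neighbour; a vertex has at most
  \<open>card I\<close> neighbours, each of which is a neighbour of at most \<open>card I\<close>
  vertices, so at most \<open>(card I)\<^sup>2 * d\<close> pairs are dependent.\<close>

lemma concentration:
  assumes I: "finite I" "I \<subseteq> idx" and e: "\<epsilon> > 0"
  obtains F0 \<delta>0 d0 where "finite F0" "F0 \<subseteq> bisections H" "\<delta>0 > 0"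
    "\<And>d \<sigma> F \<delta> K w. sofic_map H \<nu> d \<sigma> F \<delta> \<Longrightarrow> F0 \<subseteq> F \<Longrightarrow> \<delta> \<le> \<delta>0 \<Longrightarrow> d0 \<le> d \<Longrightarrow> is_model \<kappa> (snd ` I) K w \<Longrightarrow>
      (\<Sum>z\<in>{z \<in> {1..d} \<rightarrow>\<^sub>E K. \<not> good_labels d \<sigma> I \<epsilon> z}. prod_weight d w z) \<le> 1 / 2"
proof -
  interpret k: prob_space \<kappa> by (rule prob_\<kappa>)
  define n where "n = real (card I)"
  define M where "M = real (card (Pow (I \<times> I)))"
  define L where "L = real (card (Pow I))"
  have M: "M > 0" unfolding M_def using I(1) by (simp add: card_Pow)
  have L: "L > 0" unfolding L_def using I(1) by (simp add: card_Pow)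
  have e': "\<epsilon> / (2 * M) > 0" using e M by simp
  obtain F0 \<delta>0 where F0: "finite F0" "F0 \<subseteq> bisections H" "\<delta>0 > 0"
    and ls: "\<And>d \<sigma> F \<delta> R. sofic_map H \<nu> d \<sigma> F \<delta> \<Longrightarrow> F0 \<subseteq> F \<Longrightarrow> \<delta> \<le> \<delta>0 \<Longrightarrow> R \<in> Pow (I \<times> I) \<Longrightarrow>
      \<bar>real (card {v \<in> {1..d}. coinc I (verts \<sigma> v) = R}) / real d - measure \<nu> (pat_set I R)\<bar> \<le> \<epsilon> / (2 * M)"
    by (rule local_stats[OF I e']) (rule that)
  define q :: "(('h set \<times> 'k set) \<times> 'h set \<times> 'k set) set \<Rightarrow> ('h set \<times> 'k set) set \<Rightarrow> real"
    where "q = hit_prob (measure \<kappa>) (space \<kappa>)"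
  have q: "0 \<le> q R a" "q R a \<le> 1" for R a unfolding q_def by (rule hit_prob_bounds, simp)+
  \<comment> \<open>With this many vertices the Chebyshev bounds for the \<open>L\<close> patterns
    add up to at most 1/2.\<close>
  define d0 where "d0 = nat \<lceil>2 * (L * (n\<^sup>2 / (\<epsilon> / 2)\<^sup>2))\<rceil>"
  show ?thesis
  proof (rule that[OF F0])
    fix d \<sigma> F \<delta> K w
    assume sm: "sofic_map H \<nu> d \<sigma> F \<delta>" and FF: "F0 \<subseteq> F" and \<delta>: "\<delta> \<le> \<delta>0" and d0: "d0 \<le> d"
      and m: "is_model \<kappa> (snd ` I) K w"
    interpret sm: sofic_map H \<nu> d \<sigma> F \<delta> by (rule sm)
    let ?Z = "{1..d} \<rightarrow>\<^sub>E K"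
    let ?V = "\<lambda>v. \<Union>i\<in>I. verts \<sigma> v (fst i)"
    let ?X = "\<lambda>v a k. sel_labels (space \<kappa>) {i \<in> I. k \<in> verts \<sigma> v (fst i)} a"
    have d1: "d \<ge> 1" by (rule sm.d)
    have K: "finite K" "K \<subseteq> space \<kappa>" and w: "0 \<le> w c" for c using is_modelD[OF m] by auto
    have w1: "sum w K = 1" by (rule sum_model[OF m])
    have finZ: "finite ?Z" using K by (intro finite_PiE) auto
    have Ib: "fst i \<in> bisections H" if "i \<in> I" for i using I(2) that by auto
    have sg: "k = k'" if "i \<in> I" "k \<in> verts \<sigma> v (fst i)" "k' \<in> verts \<sigma> v (fst i)" for v i k k'
      using sm.\<sigma>_single[OF Ib[OF that(1)]] that unfolding verts_def by blast
    have V: "?V v \<subseteq> {1..d}" for v using sm.\<sigma>_range[OF Ib] unfolding verts_def by blast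
    have finV: "finite (?V v)" for v using V finite_subset by blast
    have cardV: "card (?V v) \<le> card I" for v
      by (rule finite_single_positions(2)[OF _ I(1)]) (rule sg)
    have pw1: "sum (prod_weight d w) ?Z = 1"
      using prob_box[OF K(1) w1, of "{}" d] by simp
    have box: "hits I (verts \<sigma> v) z = a \<longleftrightarrow> a \<subseteq> Domain (coinc I (verts \<sigma> v)) \<and> (\<forall>k\<in>?V v. z k \<in> ?X v a k)"
      if "z \<in> ?Z" "a \<subseteq> I" for z a v
    proof (rule hits_eq_iff[OF _ that(2)])
      show "z k \<in> space \<kappa>" if "k \<in> ?V v" for k using that V[of v] \<open>z \<in> ?Z\<close> K(2) by blast
    qed (rule sg)
    have qv: "q (coinc I (verts \<sigma> v)) a = (if a \<subseteq> Domain (coinc I (verts \<sigma> v)) then \<Prod>k\<in>?V v. measure \<kappa> (?X v a k) else 0)" for v a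
      unfolding q_def by (rule hit_prob_coinc) (rule sg)
    have wsel: "(\<Sum>c\<in>K \<inter> ?X v a k. w c) = measure \<kappa> (?X v a k)" for v a k
      by (rule measure_\<kappa>_sel_model[OF m I]) blast
    have pv: "q (coinc I (verts \<sigma> v)) a = (\<Sum>z\<in>?Z. prod_weight d w z * of_bool (hits I (verts \<sigma> v) z = a))" if a: "a \<subseteq> I" for v a
    proof (cases "a \<subseteq> Domain (coinc I (verts \<sigma> v))")
      case True
      have "(\<Sum>z\<in>?Z. prod_weight d w z * of_bool (hits I (verts \<sigma> v) z = a)) = (\<Sum>z\<in>?Z. prod_weight d w z * of_bool (\<forall>k\<in>?V v. z k \<in> ?X v a k))"
        by (rule sum.cong[OF refl]) (simp only: box[OF _ a] True simp_thms)
      also have "\<dots> = (\<Prod>k\<in>?V v. measure \<kappa> (?X v a k))"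
        unfolding prob_box[OF K(1) w1 V] wsel ..
      finally show ?thesis unfolding qv using True by (simp only: if_True)
    next
      case False
      have "(\<Sum>z\<in>?Z. prod_weight d w z * of_bool (hits I (verts \<sigma> v) z = a)) = (\<Sum>z\<in>?Z. 0)"
        by (rule sum.cong[OF refl]) (simp only: box[OF _ a] False simp_thms of_bool_eq mult_zero_right)
      then show ?thesis unfolding qv using False by (simp only: if_False sum.neutral_const)
    qed
    define D where "D = {(u, v) \<in> {1..d} \<times> {1..d}. ?V u \<inter> ?V v \<noteq> {}}"
    have cD: "real (card D) \<le> n\<^sup>2 * real d"
    proof -
      \<comment> \<open>The vertex whose neighbour along \<open>fst i\<close> is \<open>k\<close>,
        unique by injectivity; a dependent pair is thus determined by \<open>u\<close>, a shared
        neighbour and an index.\<close>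
      define g where "g u k i = (THE v. (k, v) \<in> \<sigma> (fst i))" for u :: nat and k and i :: "'h set \<times> 'k set"
      have "D \<subseteq> (\<Union>u\<in>{1..d}. (\<lambda>(k, i). (u, g u k i)) ` (?V u \<times> I))"
      proof
        fix p assume "p \<in> D"
        then obtain u v k where p: "p = (u, v)" "u \<in> {1..d}" "v \<in> {1..d}" "k \<in> ?V u" "k \<in> ?V v" unfolding D_def by blast
        obtain i where i: "i \<in> I" "(k, v) \<in> \<sigma> (fst i)" using p(5) unfolding verts_def by blast
        have "g u k i = v" unfolding g_def using i(2) sm.\<sigma>_inj[OF Ib[OF i(1)]] by blast
        then show "p \<in> (\<Union>u\<in>{1..d}. (\<lambda>(k, i). (u, g u k i)) ` (?V u \<times> I))" using p i by force
      qed
      then have "card D \<le> card (\<Union>u\<in>{1..d}. (\<lambda>(k, i). (u, g u k i)) ` (?V u \<times> I))"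
        using finV I(1) by (intro card_mono) auto
      also have "\<dots> \<le> (\<Sum>u\<in>{1..d}. card ((\<lambda>(k, i). (u, g u k i)) ` (?V u \<times> I)))" by (rule card_UN_le) simp
      also have "\<dots> \<le> (\<Sum>u\<in>{1..d}. card I * card I)"
      proof (rule sum_mono)
        fix u
        have "card ((\<lambda>(k, i). (u, g u k i)) ` (?V u \<times> I)) \<le> card (?V u \<times> I)"
          using finV I(1) by (intro card_image_le) auto
        also have "\<dots> \<le> card I * card I" unfolding card_cartesian_product using cardV by (intro mult_right_mono) auto
        finally show "card ((\<lambda>(k, i). (u, g u k i)) ` (?V u \<times> I)) \<le> card I * card I" .
      qed
      finally have "card D \<le> d * (card I * card I)" by simp
      then have "real (card D) \<le> real (d * (card I * card I))" by (simp only: of_nat_le_iff)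
      then show ?thesis unfolding n_def by (simp add: power2_eq_square mult.commute)
    qed
    have ind: "(\<Sum>z\<in>?Z. prod_weight d w z * (of_bool (hits I (verts \<sigma> u) z = a) * of_bool (hits I (verts \<sigma> v) z = a))) =
        q (coinc I (verts \<sigma> u)) a * q (coinc I (verts \<sigma> v)) a"
      if a: "a \<subseteq> I" and uv: "u \<in> {1..d}" "v \<in> {1..d}" "(u, v) \<notin> D" for u v a
    proof (cases "a \<subseteq> Domain (coinc I (verts \<sigma> u)) \<and> a \<subseteq> Domain (coinc I (verts \<sigma> v))")
      case True
      have disj: "?V u \<inter> ?V v = {}" using uv unfolding D_def by blast
      \<comment> \<open>The two box conditions concern disjoint sets of positions and are glued into
        one, whose probability factors.\<close>
      let ?Y = "\<lambda>k. if k \<in> ?V u then ?X u a k else ?X v a k"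
      have "(\<Sum>z\<in>?Z. prod_weight d w z * (of_bool (hits I (verts \<sigma> u) z = a) * of_bool (hits I (verts \<sigma> v) z = a))) =
          (\<Sum>z\<in>?Z. prod_weight d w z * of_bool (\<forall>k\<in>?V u \<union> ?V v. z k \<in> ?Y k))"
      proof (rule sum.cong[OF refl])
        fix z assume z: "z \<in> ?Z"
        have "(hits I (verts \<sigma> u) z = a \<and> hits I (verts \<sigma> v) z = a) \<longleftrightarrow> (\<forall>k\<in>?V u \<union> ?V v. z k \<in> ?Y k)"
        proof -
          have "(\<forall>k\<in>?V v. z k \<in> ?X v a k) \<longleftrightarrow> (\<forall>k\<in>?V v. z k \<in> ?Y k)"
          proof (rule ball_cong[OF refl])
            fix k assume "k \<in> ?V v"
            then have "k \<notin> ?V u" using disj by blast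
            then show "z k \<in> ?X v a k \<longleftrightarrow> z k \<in> ?Y k" by (simp only: if_False)
          qed
          moreover have "(\<forall>k\<in>?V u. z k \<in> ?X u a k) \<longleftrightarrow> (\<forall>k\<in>?V u. z k \<in> ?Y k)"
            by (rule ball_cong[OF refl]) (simp only: if_True)
          ultimately show ?thesis unfolding box[OF z a] using True by (simp only: simp_thms ball_Un)
        qed
        then show "prod_weight d w z * (of_bool (hits I (verts \<sigma> u) z = a) * of_bool (hits I (verts \<sigma> v) z = a)) =
            prod_weight d w z * of_bool (\<forall>k\<in>?V u \<union> ?V v. z k \<in> ?Y k)"
          by (simp only: of_bool_conj[symmetric])
      qed
      also have "\<dots> = (\<Prod>k\<in>?V u \<union> ?V v. \<Sum>c\<in>K \<inter> ?Y k. w c)"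
        by (rule prob_box[OF K(1) w1]) (use V in blast)
      also have "\<dots> = (\<Prod>k\<in>?V u. \<Sum>c\<in>K \<inter> ?Y k. w c) * (\<Prod>k\<in>?V v. \<Sum>c\<in>K \<inter> ?Y k. w c)"
        by (rule prod.union_disjoint[OF finV finV disj])
      also have "(\<Prod>k\<in>?V u. \<Sum>c\<in>K \<inter> ?Y k. w c) = (\<Prod>k\<in>?V u. measure \<kappa> (?X u a k))"
        by (rule prod.cong[OF refl]) (simp only: if_True wsel)
      also have "(\<Prod>k\<in>?V v. \<Sum>c\<in>K \<inter> ?Y k. w c) = (\<Prod>k\<in>?V v. measure \<kappa> (?X v a k))"
      proof (rule prod.cong[OF refl])
        fix k assume "k \<in> ?V v"
        then have "k \<notin> ?V u" using disj by blast
        then show "(\<Sum>c\<in>K \<inter> ?Y k. w c) = measure \<kappa> (?X v a k)" by (simp only: if_False wsel)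
      qed
      finally show ?thesis unfolding qv using True by (simp only: if_True)
    next
      case False
      have "(\<Sum>z\<in>?Z. prod_weight d w z * (of_bool (hits I (verts \<sigma> u) z = a) * of_bool (hits I (verts \<sigma> v) z = a))) = (\<Sum>z\<in>?Z. 0)"
        by (rule sum.cong[OF refl]) (use False box[OF _ a] in auto)
      moreover have "q (coinc I (verts \<sigma> u)) a = 0 \<or> q (coinc I (verts \<sigma> v)) a = 0"
        unfolding qv using False by auto
      ultimately show ?thesis by auto
    qed
    let ?P = "\<lambda>a. \<Sum>v\<in>{1..d}. q (coinc I (verts \<sigma> v)) a"
    let ?S = "\<lambda>a z. \<Sum>v\<in>{1..d}. of_bool (hits I (verts \<sigma> v) z = a) :: real"
    let ?B = "\<lambda>a. {z \<in> ?Z. \<epsilon> / 2 * real d < \<bar>?S a z - ?P a\<bar>}"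
    have cheb: "(\<Sum>z\<in>?B a. prod_weight d w z) \<le> n\<^sup>2 / ((\<epsilon> / 2)\<^sup>2 * real d)" if a: "a \<in> Pow I" for a
    proof (rule finite_chebyshev[OF finZ _ pw1 _ _ _ cD])
      show "D \<subseteq> {1..d} \<times> {1..d}" unfolding D_def by blast
    qed (use a e d1 pv ind prod_weight_nonneg[OF w] in auto)
    have mean: "\<bar>?P a / real d - measure \<mu> (tset H \<kappa> I {a})\<bar> \<le> \<epsilon> / 2" if a: "a \<in> Pow I" for a
    proof -
      have "?P a = (\<Sum>R\<in>Pow (I \<times> I). \<Sum>v\<in>{v \<in> {1..d}. coinc I (verts \<sigma> v) = R}. q (coinc I (verts \<sigma> v)) a)"
        by (rule sum.group[symmetric]) (use I(1) coinc_subset in auto)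
      also have "\<dots> = (\<Sum>R\<in>Pow (I \<times> I). real (card {v \<in> {1..d}. coinc I (verts \<sigma> v) = R}) * q R a)"
        by (rule sum.cong[OF refl]) simp
      finally have 1: "?P a / real d = (\<Sum>R\<in>Pow (I \<times> I). real (card {v \<in> {1..d}. coinc I (verts \<sigma> v) = R}) / real d * q R a)"
        by (simp add: sum_divide_distrib)
      have "{a} \<inter> Pow I = {a}" using a by blast
      then have 2: "measure \<mu> (tset H \<kappa> I {a}) = (\<Sum>R\<in>Pow (I \<times> I). measure \<nu> (pat_set I R) * q R a)"
        unfolding measure_\<mu>_tset[OF I] q_def by simp
      have "\<bar>?P a / real d - measure \<mu> (tset H \<kappa> I {a})\<bar> =
         \<bar>\<Sum>R\<in>Pow (I \<times> I). (real (card {v \<in> {1..d}. coinc I (verts \<sigma> v) = R}) / real d - measure \<nu> (pat_set I R)) * q R a\<bar>"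
        unfolding 1 2 by (simp add: sum_subtractf left_diff_distrib)
      also have "\<dots> \<le> (\<Sum>R\<in>Pow (I \<times> I). \<bar>(real (card {v \<in> {1..d}. coinc I (verts \<sigma> v) = R}) / real d - measure \<nu> (pat_set I R)) * q R a\<bar>)"
        by (rule sum_abs)
      also have "\<dots> \<le> (\<Sum>R\<in>Pow (I \<times> I). \<epsilon> / (2 * M))"
      proof (rule sum_mono)
        fix R assume R: "R \<in> Pow (I \<times> I)"
        have "\<bar>(real (card {v \<in> {1..d}. coinc I (verts \<sigma> v) = R}) / real d - measure \<nu> (pat_set I R)) * q R a\<bar> \<le>
            (\<epsilon> / (2 * M)) * 1"
          unfolding abs_mult using ls[OF sm FF \<delta> R] q[of R a] e M by (intro mult_mono) auto
        then show "\<bar>(real (card {v \<in> {1..d}. coinc I (verts \<sigma> v) = R}) / real d - measure \<nu> (pat_set I R)) * q R a\<bar> \<le> \<epsilon> / (2 * M)" by simp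
      qed
      also have "\<dots> = \<epsilon> / 2" using M unfolding M_def by simp
      finally show ?thesis .
    qed
    have card_S: "?S a z = real (card {v \<in> {1..d}. hits I (verts \<sigma> v) z = a})" for a z
      by (simp add: of_bool_def sum.If_cases Int_def)
    have "{z \<in> ?Z. \<not> good_labels d \<sigma> I \<epsilon> z} \<subseteq> (\<Union>a\<in>Pow I. ?B a)"
    proof
      fix z assume z: "z \<in> {z \<in> ?Z. \<not> good_labels d \<sigma> I \<epsilon> z}"
      then obtain a where a: "a \<in> Pow I" "\<epsilon> < \<bar>?S a z / real d - measure \<mu> (tset H \<kappa> I {a})\<bar>"
        unfolding good_labels_def card_S by (auto simp: not_le)
      have "\<epsilon> / 2 < \<bar>?S a z / real d - ?P a / real d\<bar>" using a(2) mean[OF a(1)] by linarith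
      also have "\<dots> = \<bar>?S a z - ?P a\<bar> / real d" by (simp add: diff_divide_distrib[symmetric] abs_divide)
      finally have "\<epsilon> / 2 * real d < \<bar>?S a z - ?P a\<bar>" using d1 by (simp add: field_simps)
      then show "z \<in> (\<Union>a\<in>Pow I. ?B a)" using a(1) z by blast
    qed
    then have "(\<Sum>z\<in>{z \<in> ?Z. \<not> good_labels d \<sigma> I \<epsilon> z}. prod_weight d w z) \<le> (\<Sum>z\<in>(\<Union>a\<in>Pow I. ?B a). prod_weight d w z)"
      using finZ I(1) prod_weight_nonneg[OF w] by (intro sum_mono2) auto
    also have "\<dots> \<le> (\<Sum>a\<in>Pow I. \<Sum>z\<in>?B a. prod_weight d w z)"
      using finZ I(1) prod_weight_nonneg[OF w] by (intro sum_UN_le) auto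
    also have "\<dots> \<le> (\<Sum>a\<in>Pow I. n\<^sup>2 / ((\<epsilon> / 2)\<^sup>2 * real d))" by (rule sum_mono) (rule cheb)
    also have "\<dots> = L * (n\<^sup>2 / (\<epsilon> / 2)\<^sup>2) / real d" unfolding L_def by simp
    also have "\<dots> \<le> 1 / 2"
    proof -
      have "2 * (L * (n\<^sup>2 / (\<epsilon> / 2)\<^sup>2)) \<le> real d" using d0 unfolding d0_def by linarith
      moreover have "x / real d \<le> 1 / 2" if "2 * x \<le> real d" for x using that d1 by (simp add: field_simps)
      ultimately show ?thesis by blast
    qed
    finally show "(\<Sum>z\<in>{z \<in> ?Z. \<not> good_labels d \<sigma> I \<epsilon> z}. prod_weight d w z) \<le> 1 / 2" .
  qed
qed

lemma good_labels_set:
  assumes I: "finite I" "I \<subseteq> idx" and g: "good_labels d \<sigma> I \<epsilon> z" and d: "d \<ge> 1" and e: "\<epsilon> \<ge> 0"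
  shows "\<bar>real (card {v \<in> {1..d}. hits I (verts \<sigma> v) z \<in> S}) / real d - measure \<mu> (tset H \<kappa> I S)\<bar> \<le> real (card (Pow I)) * \<epsilon>"
proof -
  interpret m: prob_space \<mu> by (rule prob_\<mu>)
  have fin: "finite (S \<inter> Pow I)" using I(1) by simp
  have "{v \<in> {1..d}. hits I (verts \<sigma> v) z \<in> S} = (\<Union>a\<in>S \<inter> Pow I. {v \<in> {1..d}. hits I (verts \<sigma> v) z = a})"
    using hits_subset by blast
  then have 1: "real (card {v \<in> {1..d}. hits I (verts \<sigma> v) z \<in> S}) = (\<Sum>a\<in>S \<inter> Pow I. real (card {v \<in> {1..d}. hits I (verts \<sigma> v) z = a}))"
    using fin by (subst of_nat_sum[symmetric], subst card_UN_disjoint[symmetric]) auto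
  have 2: "measure \<mu> (tset H \<kappa> I S) = (\<Sum>a\<in>S \<inter> Pow I. measure \<mu> (tset H \<kappa> I {a}))"
  proof (subst tset_UN, rule m.finite_measure_finite_Union[OF fin])
    show "(\<lambda>a. tset H \<kappa> I {a}) ` (S \<inter> Pow I) \<subseteq> m.events" using tset_sets[OF I] sets_\<mu> by blast
    show "disjoint_family_on (\<lambda>a. tset H \<kappa> I {a}) (S \<inter> Pow I)" by (auto simp: disjoint_family_on_def tset_def)
  qed
  have "\<bar>real (card {v \<in> {1..d}. hits I (verts \<sigma> v) z \<in> S}) / real d - measure \<mu> (tset H \<kappa> I S)\<bar> =
     \<bar>\<Sum>a\<in>S \<inter> Pow I. real (card {v \<in> {1..d}. hits I (verts \<sigma> v) z = a}) / real d - measure \<mu> (tset H \<kappa> I {a})\<bar>"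
    unfolding 1 2 by (simp add: sum_subtractf sum_divide_distrib)
  also have "\<dots> \<le> (\<Sum>a\<in>S \<inter> Pow I. \<bar>real (card {v \<in> {1..d}. hits I (verts \<sigma> v) z = a}) / real d - measure \<mu> (tset H \<kappa> I {a})\<bar>)"
    by (rule sum_abs)
  also have "\<dots> \<le> (\<Sum>a\<in>S \<inter> Pow I. \<epsilon>)" by (rule sum_mono) (use g in \<open>auto simp: good_labels_def\<close>)
  also have "\<dots> = real (card (S \<inter> Pow I)) * \<epsilon>" by simp
  also have "\<dots> \<le> real (card (Pow I)) * \<epsilon>" using I(1) e by (intro mult_right_mono) (auto intro: card_mono)
  finally show ?thesis .
qed

end

section \<open>Counting labelings\<close>

lemma prod_by_value:
  fixes g :: "'a \<Rightarrow> real"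
  assumes Y: "finite Y" and y: "\<And>v. v \<in> {1..d::nat} \<Longrightarrow> y v \<in> Y"
  shows "(\<Prod>v\<in>{1..d}. g (y v)) = (\<Prod>c\<in>Y. g c ^ card {v \<in> {1..d}. y v = c})"
proof -
  have "(\<Prod>v\<in>{1..d}. g (y v)) = (\<Prod>c\<in>Y. \<Prod>v\<in>{v \<in> {1..d}. y v = c}. g (y v))"
    by (rule prod.group[symmetric]) (use Y y in auto)
  also have "\<dots> = (\<Prod>c\<in>Y. g c ^ card {v \<in> {1..d}. y v = c})"
    by (rule prod.cong[OF refl]) simp
  finally show ?thesis .
qed

text \<open>Both counting bounds below compare the number of labelings in question with the total weight
  of a product weight for which each of them is heavy.\<close>

lemma card_hamming_ball:
  assumes Y: "finite Y" and y0: "y0 \<in> {1..d} \<rightarrow>\<^sub>E Y" and t: "0 < t" "t \<le> 1"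
  shows "real (card {y \<in> {1..d} \<rightarrow>\<^sub>E Y. real (card {v \<in> {1..d}. y v \<noteq> y0 v}) \<le> \<theta> * real d})
     \<le> exp (real d * (\<theta> * ln (1 / t) + t * real (card Y)))"
proof -
  let ?B = "{y \<in> {1..d} \<rightarrow>\<^sub>E Y. real (card {v \<in> {1..d}. y v \<noteq> y0 v}) \<le> \<theta> * real d}"
  \<comment> \<open>Weight 1 for an agreement with \<open>y0\<close> and \<open>t\<close> for a
    disagreement: members of the ball weigh at least t to the power \<theta> d, and the total weight
    is at most (1 + t |Y|) to the power d.\<close>
  let ?w = "\<lambda>y. \<Prod>v\<in>{1..d}. if y v = y0 v then 1 else t"
  have fin: "finite ({1..d} \<rightarrow>\<^sub>E Y)" using Y by (intro finite_PiE) auto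
  have w: "?w y = t ^ card {v \<in> {1..d}. y v \<noteq> y0 v}" for y
  proof -
    have "?w y = (\<Prod>v\<in>{v \<in> {1..d}. y v \<noteq> y0 v}. t)"
      by (subst prod.inter_filter) (auto intro!: prod.cong)
    then show ?thesis by simp
  qed
  have "exp (- (real d * (\<theta> * ln (1 / t)))) \<le> ?w y" if "y \<in> ?B" for y
  proof -
    let ?n = "card {v \<in> {1..d}. y v \<noteq> y0 v}"
    have "real ?n * ln (1 / t) \<le> \<theta> * real d * ln (1 / t)" using that t by (intro mult_right_mono) auto
    then have "exp (- (real d * (\<theta> * ln (1 / t)))) \<le> exp (real ?n * ln t)"
      using t by (simp add: ln_div algebra_simps)
    also have "\<dots> = t ^ ?n" using t by (simp add: exp_of_nat_mult)
    finally show ?thesis unfolding w .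
  qed
  then have "(\<Sum>y\<in>?B. exp (- (real d * (\<theta> * ln (1 / t))))) \<le> (\<Sum>y\<in>?B. ?w y)" by (rule sum_mono)
  also have "\<dots> \<le> (\<Sum>y\<in>{1..d} \<rightarrow>\<^sub>E Y. ?w y)"
    by (rule sum_mono2) (use fin t in \<open>auto intro!: prod_nonneg\<close>)
  also have "\<dots> = (\<Prod>v\<in>{1..d}. \<Sum>c\<in>Y. if c = y0 v then 1 else t)"
    by (rule prod_sum_PiE[symmetric]) (use Y in auto)
  also have "\<dots> \<le> (\<Prod>v\<in>{1..d}. exp (t * real (card Y)))"
  proof (rule prod_mono, intro conjI)
    fix v assume v: "v \<in> {1..d}"
    show "0 \<le> (\<Sum>c\<in>Y. if c = y0 v then 1 else t)" using t by (intro sum_nonneg) auto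
    have "(\<Sum>c\<in>Y. if c = y0 v then 1 else t) \<le> (\<Sum>c\<in>Y. (if c = y0 v then 1 else 0) + t)"
      using t by (intro sum_mono) auto
    also have "\<dots> \<le> 1 + t * real (card Y)" using Y by (simp add: sum.distrib)
    also have "\<dots> \<le> exp (t * real (card Y))" by (rule exp_ge_add_one_self)
    finally show "(\<Sum>c\<in>Y. if c = y0 v then 1 else t) \<le> exp (t * real (card Y))" .
  qed
  also have "\<dots> = exp (real d * (t * real (card Y)))" by (simp add: exp_of_nat_mult)
  finally have "real (card ?B) * exp (- (real d * (\<theta> * ln (1 / t)))) \<le> exp (real d * (t * real (card Y)))" by simp
  then have "real (card ?B) * exp (- (real d * (\<theta> * ln (1 / t)))) * exp (real d * (\<theta> * ln (1 / t))) \<le>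
      exp (real d * (t * real (card Y))) * exp (real d * (\<theta> * ln (1 / t)))"
    by (rule mult_right_mono) (rule exp_ge_zero)
  moreover have "exp (- (real d * (\<theta> * ln (1 / t)))) * exp (real d * (\<theta> * ln (1 / t))) = 1"
    by (simp only: exp_add[symmetric] left_minus exp_zero)
  ultimately show ?thesis
    by (simp only: mult.assoc mult_1_right exp_add[symmetric] distrib_left add.commute)
qed

lemma card_type_class:
  assumes Y: "finite Y" and q: "\<And>c. c \<in> Y \<Longrightarrow> 0 < q c" "sum q Y \<le> 1" and d: "\<delta> \<ge> 0"
  shows "real (card {y \<in> {1..d} \<rightarrow>\<^sub>E Y. \<forall>c\<in>Y. real (card {v \<in> {1..d}. y v = c}) \<le> (p c + \<delta>) * real d})
     \<le> exp (real d * (\<Sum>c\<in>Y. (p c + \<delta>) * - ln (q c)))"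
proof -
  let ?B = "{y \<in> {1..d} \<rightarrow>\<^sub>E Y. \<forall>c\<in>Y. real (card {v \<in> {1..d}. y v = c}) \<le> (p c + \<delta>) * real d}"
  let ?h = "\<Sum>c\<in>Y. (p c + \<delta>) * - ln (q c)"
  have fin: "finite ({1..d} \<rightarrow>\<^sub>E Y)" using Y by (intro finite_PiE) auto
  have q1: "q c \<le> 1" if "c \<in> Y" for c
    using member_le_sum[of c Y q] that q Y by (force intro: less_imp_le)
  \<comment> \<open>The frequencies are bounded from above and \<open>ln (q c) \<le> 0\<close>, so
    each logarithm is counted at most as often as in the exponent.\<close>
  have "exp (- (real d * ?h)) \<le> (\<Prod>v\<in>{1..d}. q (y v))" if y: "y \<in> ?B" for y
  proof -
    have "- (real d * ?h) = (\<Sum>c\<in>Y. (p c + \<delta>) * real d * ln (q c))"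
      by (simp add: sum_distrib_left sum_negf[symmetric] algebra_simps)
    also have "\<dots> \<le> (\<Sum>c\<in>Y. real (card {v \<in> {1..d}. y v = c}) * ln (q c))"
      using y q q1 by (intro sum_mono mult_right_mono_neg) auto
    finally have "exp (- (real d * ?h)) \<le> exp (\<Sum>c\<in>Y. real (card {v \<in> {1..d}. y v = c}) * ln (q c))" by simp
    also have "\<dots> = (\<Prod>c\<in>Y. q c ^ card {v \<in> {1..d}. y v = c})"
      using q by (simp add: exp_sum Y exp_of_nat_mult)
    also have "\<dots> = (\<Prod>v\<in>{1..d}. q (y v))" by (rule prod_by_value[symmetric]) (use Y y in auto)
    finally show ?thesis .
  qed
  then have "(\<Sum>y\<in>?B. exp (- (real d * ?h))) \<le> (\<Sum>y\<in>?B. \<Prod>v\<in>{1..d}. q (y v))" by (rule sum_mono)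
  also have "\<dots> \<le> (\<Sum>y\<in>{1..d} \<rightarrow>\<^sub>E Y. \<Prod>v\<in>{1..d}. q (y v))"
  proof (rule sum_mono2[OF fin])
    fix y assume "y \<in> ({1..d} \<rightarrow>\<^sub>E Y) - ?B"
    then have "y v \<in> Y" if "v \<in> {1..d}" for v using that by blast
    then show "0 \<le> (\<Prod>v\<in>{1..d}. q (y v))" using q(1) by (intro prod_nonneg) (simp add: less_imp_le)
  qed blast
  also have "\<dots> = (\<Prod>v\<in>{1..d}. \<Sum>c\<in>Y. q c)" by (rule prod_sum_PiE[symmetric]) (use Y in auto)
  also have "\<dots> \<le> 1" using q by (intro prod_le_1) (auto intro!: sum_nonneg simp: less_imp_le)
  finally have "real (card ?B) * exp (- (real d * ?h)) \<le> 1" by simp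
  then have "real (card ?B) * exp (- (real d * ?h)) * exp (real d * ?h) \<le> 1 * exp (real d * ?h)"
    by (rule mult_right_mono) (rule exp_ge_zero)
  moreover have "exp (- (real d * ?h)) * exp (real d * ?h) = 1" by (simp only: exp_add[symmetric] left_minus exp_zero)
  ultimately show ?thesis by (simp only: mult.assoc mult_1_right mult_1)
qed

text \<open>The weight of a labeling with roughly the right frequencies is at most exp (- d H), up
  to the error \<delta>. If a label of weight 0 occurs, the product vanishes; if it does not occur,
  it contributes nothing, in accordance with \<open>ln 0 = 0\<close>.\<close>

lemma prod_type_le:
  assumes Y: "finite Y" and y: "\<And>v. v \<in> {1..d} \<Longrightarrow> y v \<in> Y" and p: "\<And>c. c \<in> Y \<Longrightarrow> 0 \<le> p c \<and> p c \<le> 1"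
    and n: "\<And>c. c \<in> Y \<Longrightarrow> (p c - \<delta>) * real d \<le> real (card {v \<in> {1..d}. y v = c})"
  shows "(\<Prod>v\<in>{1..d}. p (y v)) \<le> exp (- (real d * (\<Sum>c\<in>Y. (p c - \<delta>) * - ln (p c))))"
proof (cases "\<exists>v\<in>{1..d}. p (y v) = 0")
  case True
  then have e: "(\<Prod>v\<in>{1..d}. p (y v)) = 0" by (intro prod_zero) auto
  show ?thesis unfolding e by (rule exp_ge_zero)
next
  case False
  let ?n = "\<lambda>c. card {v \<in> {1..d}. y v = c}"
  have "(\<Prod>v\<in>{1..d}. p (y v)) = (\<Prod>c\<in>Y. p c ^ ?n c)" by (rule prod_by_value[OF Y y])
  also have "\<dots> = (\<Prod>c\<in>Y. exp (real (?n c) * ln (p c)))"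
  proof (rule prod.cong[OF refl])
    fix c assume c: "c \<in> Y"
    show "p c ^ ?n c = exp (real (?n c) * ln (p c))"
    proof (cases "p c = 0")
      case True
      then have "{v \<in> {1..d}. y v = c} = {}" using False by blast
      then show ?thesis by (simp only: card.empty) simp
    next
      case False
      then have "0 < p c" using p[OF c] by linarith
      then show ?thesis by (simp add: exp_of_nat_mult)
    qed
  qed
  also have "\<dots> = exp (\<Sum>c\<in>Y. real (?n c) * ln (p c))" by (simp add: exp_sum Y)
  also have "\<dots> \<le> exp (- (real d * (\<Sum>c\<in>Y. (p c - \<delta>) * - ln (p c))))"
  proof (subst exp_le_cancel_iff)
    have "(\<Sum>c\<in>Y. real (?n c) * ln (p c)) \<le> (\<Sum>c\<in>Y. (p c - \<delta>) * real d * ln (p c))"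
    proof (rule sum_mono)
      fix c assume c: "c \<in> Y"
      have "ln (p c) \<le> 0" using p[OF c] by (cases "p c = 0") auto
      then show "real (?n c) * ln (p c) \<le> (p c - \<delta>) * real d * ln (p c)"
        using n[OF c] by (intro mult_right_mono_neg) auto
    qed
    also have "\<dots> = - (real d * (\<Sum>c\<in>Y. (p c - \<delta>) * - ln (p c)))"
      by (simp add: sum_distrib_left sum_negf[symmetric] algebra_simps)
    finally show "(\<Sum>c\<in>Y. real (?n c) * ln (p c)) \<le> - (real d * (\<Sum>c\<in>Y. (p c - \<delta>) * - ln (p c)))" .
  qed
  finally show ?thesis .
qed

definition part_entropy :: "'k measure \<Rightarrow> 'k set set \<Rightarrow> real" where
  "part_entropy \<kappa> \<alpha> = (\<Sum>A\<in>\<alpha>. - (measure \<kappa> A * ln (measure \<kappa> A)))"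

lemma sigma_sets_partition:
  assumes N: "finite N" "partition_on \<Omega> N"
  shows "sigma_sets \<Omega> N = \<Union> ` Pow N"
proof
  have U: "\<Union>N = \<Omega>" using partition_onD1[OF N(2)] by simp
  have compl: "\<Omega> - \<Union>C = \<Union>(N - C)" if "C \<subseteq> N" for C
  proof
    show "\<Omega> - \<Union>C \<subseteq> \<Union>(N - C)" using U by blast
    show "\<Union>(N - C) \<subseteq> \<Omega> - \<Union>C"
    proof
      fix x assume "x \<in> \<Union>(N - C)"
      then obtain D where D: "D \<in> N" "D \<notin> C" "x \<in> D" by blast
      have "x \<notin> D'" if "D' \<in> C" for D'
        using disjointD[OF partition_onD2[OF N(2)], of D D'] D that \<open>C \<subseteq> N\<close> by blast
      then show "x \<in> \<Omega> - \<Union>C" using D U by blast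
    qed
  qed
  show "sigma_sets \<Omega> N \<subseteq> \<Union> ` Pow N"
  proof
    fix X assume "X \<in> sigma_sets \<Omega> N"
    then have "\<exists>C\<subseteq>N. X = \<Union>C"
    proof (induction rule: sigma_sets.induct)
      case (Basic a)
      then show ?case by (intro exI[of _ "{a}"]) simp
    next
      case Empty
      show ?case by (intro exI[of _ "{}"]) simp
    next
      case (Compl a)
      then obtain C where "C \<subseteq> N" "a = \<Union>C" by blast
      then show ?case using compl by (intro exI[of _ "N - C"]) auto
    next
      case (Union a)
      then obtain C where C: "\<And>i. C i \<subseteq> N" "\<And>i. a i = \<Union>(C i)" by metis
      have "(\<Union>i. a i) = \<Union>(\<Union>i. C i)" unfolding C(2) by blast
      then show ?case using C(1) by (intro exI[of _ "\<Union>i. C i"]) blast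
    qed
    then show "X \<in> \<Union> ` Pow N" by blast
  qed
  show "\<Union> ` Pow N \<subseteq> sigma_sets \<Omega> N"
  proof (rule image_subsetI)
    fix C assume "C \<in> Pow N"
    then have "countable C" using N(1) by (auto intro: countable_finite finite_subset)
    then show "\<Union>C \<in> sigma_sets \<Omega> N"
      using \<open>C \<in> Pow N\<close> by (intro sigma_sets_UNION) (auto intro: sigma_sets.Basic)
  qed
qed

lemma finite_set_homs:
  assumes "finite \<Sigma>"
  shows "finite (set_homs G \<Sigma> d)"
  by (rule finite_subset[of _ "\<Sigma> \<rightarrow>\<^sub>E Pow {1..d}"]) (use assms in \<open>auto simp: set_homs_def intro!: finite_PiE\<close>)

context bernoulli begin

definition "base_partition \<alpha> \<longleftrightarrow> finite \<alpha> \<and> \<alpha> \<subseteq> sets \<kappa> \<and> partition_on (space \<kappa>) \<alpha>"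

text \<open>The pull-back of \<alpha> along the coordinate at the unit, which sends (x, \<omega>) to
  \<omega> x.\<close>

definition "lift_part \<alpha> = cyl H \<kappa> (units H) ` \<alpha>"

lemma units_sets: "units H \<in> sets (unit_space H)"
  using sets.top[of "unit_space H"] by (simp add: space_unit_space)

lemma cyl_units: "cyl H \<kappa> (units H) A = {(x, \<omega>) \<in> B0. \<omega> x \<in> A}"
proof -
  have "(x, \<omega>) \<in> cyl H \<kappa> (units H) A \<longleftrightarrow> (x, \<omega>) \<in> B0 \<and> \<omega> x \<in> A" for x \<omega>
    using bis_fibre_unit[OF units_sets, of x] by (auto simp: cyl_def B0_iff)
  then show ?thesis by auto
qed

lemma measure_cyl_units:
  assumes A: "A \<in> sets \<kappa>"
  shows "measure \<mu> (cyl H \<kappa> (units H) A) = measure \<kappa> A"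
proof -
  interpret n: prob_space \<nu> by (rule prob_space_\<nu>)
  interpret k: prob_space \<kappa> by (rule prob_\<kappa>)
  have "emeasure (fibre_meas x) (slice (cyl H \<kappa> (units H) A) x) = emeasure \<kappa> A" if "x \<in> units H" for x
  proof -
    interpret product_prob_space "\<lambda>_. \<kappa>" "src_fibre H x"
      by (simp add: product_prob_space_def product_sigma_finite_def prob_\<kappa> prob_space_imp_sigma_finite product_prob_space_axioms_def)
    have "slice (cyl H \<kappa> (units H) A) x = {\<omega> \<in> space (PiM (src_fibre H x) (\<lambda>_. \<kappa>)). \<omega> x \<in> A}"
      unfolding slice_def cyl_units using that by (auto simp: B0_iff space_PiM)
    then show ?thesis unfolding fibre_meas_def
      using emeasure_PiM_Collect_single[of x A] unit_in_src_fibre[OF that] A by simp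
  qed
  then have "(\<integral>\<^sup>+ x. emeasure (fibre_meas x) (slice (cyl H \<kappa> (units H) A) x) \<partial>\<nu>) = (\<integral>\<^sup>+ x. emeasure \<kappa> A \<partial>\<nu>)"
    by (intro nn_integral_cong) (simp add: space_\<nu>)
  then have "emeasure \<mu> (cyl H \<kappa> (units H) A) = emeasure \<kappa> A"
    unfolding emeasure_\<mu>[OF cyl_sets[OF units_bis A]] by (simp add: n.emeasure_space_1)
  then show ?thesis by (simp add: measure_def)
qed

lemma B0_value: "(x, \<omega>) \<in> B0 \<Longrightarrow> \<omega> x \<in> space \<kappa>"
  using unit_in_src_fibre[of x] by (auto simp: B0_iff)

lemma cyl_units_ne:
  assumes "A \<noteq> {}" "A \<subseteq> space \<kappa>"
  shows "cyl H \<kappa> (units H) A \<noteq> {}"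
proof -
  interpret n: prob_space \<nu> by (rule prob_space_\<nu>)
  obtain x where x: "x \<in> units H" using n.not_empty space_\<nu> by auto
  obtain c where c: "c \<in> A" using assms by blast
  have "(x, \<lambda>h\<in>src_fibre H x. c) \<in> cyl H \<kappa> (units H) A"
    unfolding cyl_units B0_iff using x c assms(2) unit_in_src_fibre[OF x] by auto
  then show ?thesis by blast
qed

lemma lift_part_fbp:
  assumes "base_partition \<alpha>"
  shows "lift_part \<alpha> \<in> finite_borel_partitions (bernoulli_gpd H \<kappa>) \<mu>"
proof -
  have a: "finite \<alpha>" "\<alpha> \<subseteq> sets \<kappa>" "partition_on (space \<kappa>) \<alpha>" using assms unfolding base_partition_def by auto
  have "partition_on B0 (lift_part \<alpha>)"
  proof (rule partition_onI)
    show "\<Union>(lift_part \<alpha>) = B0"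
      unfolding lift_part_def cyl_units using B0_value partition_onD1[OF a(3)] by fastforce
    show "{} \<notin> lift_part \<alpha>"
      unfolding lift_part_def using cyl_units_ne partition_onD3[OF a(3)] sets.sets_into_space a(2) by (metis imageE subsetD)
    fix X Y assume "X \<in> lift_part \<alpha>" "Y \<in> lift_part \<alpha>" "X \<noteq> Y"
    then obtain A B where AB: "X = cyl H \<kappa> (units H) A" "Y = cyl H \<kappa> (units H) B" "A \<in> \<alpha>" "B \<in> \<alpha>" "A \<noteq> B"
      unfolding lift_part_def by blast
    then have "A \<inter> B = {}" using disjointD[OF partition_onD2[OF a(3)]] by blast
    then show "disjnt X Y" unfolding AB cyl_units disjnt_def by auto
  qed
  moreover have "lift_part \<alpha> \<subseteq> sets \<mu>" unfolding lift_part_def sets_\<mu> using cyl_sets[OF units_bis] a(2) by blast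
  moreover have "finite (lift_part \<alpha>)" unfolding lift_part_def using a(1) by simp
  ultimately show ?thesis unfolding finite_borel_partitions_def units_bernoulli by blast
qed

end

section \<open>The lower bound\<close>

text \<open>The equation expresses that \<open>X\<close> is a union of blocks of \<open>N\<close>
  without naming a subfamily; it is the form in which this property is used in both bounds.\<close>

lemma saturatedD:
  assumes "X = \<Union>{D \<in> N. D \<subseteq> X}" "a \<in> X"
  obtains D where "D \<in> N" "D \<subseteq> X" "a \<in> D"
proof -
  have "a \<in> \<Union>{D \<in> N. D \<subseteq> X}" by (rule subst[OF assms(1), of "\<lambda>Y. a \<in> Y"]) (rule assms(2))
  then show ?thesis using that by blast
qed

lemma partition_cell_iff:
  assumes N: "partition_on \<Omega> N" and X: "X = \<Union>{D \<in> N. D \<subseteq> X}" and D: "D \<in> N" and xy: "x \<in> D" "y \<in> D"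
  shows "x \<in> X \<longleftrightarrow> y \<in> X"
proof -
  have "b \<in> X" if "a \<in> X" "a \<in> D" "b \<in> D" for a b
  proof -
    obtain D' where D': "D' \<in> N" "D' \<subseteq> X" "a \<in> D'" by (rule saturatedD[OF X \<open>a \<in> X\<close>])
    then have "D' = D" using disjointD[OF partition_onD2[OF N], of D D'] D that by blast
    then show ?thesis using D' that by blast
  qed
  then show ?thesis using xy by blast
qed

lemma refines_Union:
  assumes "refines \<Omega> P Q" "Y \<in> Q"
  shows "Y = \<Union>{B \<in> P. B \<subseteq> Y}"
proof
  have P: "partition_on \<Omega> P" and Q: "partition_on \<Omega> Q" and r: "\<forall>X\<in>P. \<exists>Y\<in>Q. X \<subseteq> Y"
    using assms(1) unfolding refines_def by auto
  show "Y \<subseteq> \<Union>{B \<in> P. B \<subseteq> Y}"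
  proof
    fix y assume y: "y \<in> Y"
    then have "y \<in> \<Union>P" using partition_onD1[OF P] partition_onD1[OF Q] assms(2) by blast
    then obtain B where B: "B \<in> P" "y \<in> B" by blast
    then obtain Y' where Y': "Y' \<in> Q" "B \<subseteq> Y'" using r by blast
    then have "Y' = Y" using disjointD[OF partition_onD2[OF Q], of Y' Y] assms(2) B y by blast
    then show "y \<in> \<Union>{B \<in> P. B \<subseteq> Y}" using B Y' by blast
  qed
qed blast

lemma (in finite_measure) measure_sym_diff:
  assumes "A \<in> sets M" "B \<in> sets M"
  shows "\<bar>measure M A - measure M B\<bar> \<le> measure M (sym_diff A B)"
proof -
  have "measure M C \<le> measure M D + measure M (sym_diff A B)" if "C \<subseteq> D \<union> sym_diff A B" "D \<in> sets M" "C \<in> sets M" for C D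
  proof -
    have "measure M C \<le> measure M (D \<union> sym_diff A B)" using that assms by (intro finite_measure_mono) auto
    also have "\<dots> \<le> measure M D + measure M (sym_diff A B)" using that assms by (intro measure_Un_le) auto
    finally show ?thesis .
  qed
  moreover have "A \<subseteq> B \<union> sym_diff A B" "B \<subseteq> A \<union> sym_diff A B" by blast+
  ultimately have "measure M A \<le> measure M B + measure M (sym_diff A B)" "measure M B \<le> measure M A + measure M (sym_diff A B)"
    using assms by blast+
  then show ?thesis by linarith
qed

text \<open>Absorbs a constant factor exp (- l) into the exponent: of the loss \<open>e\<close> the
  amount \<open>3 * e / 8\<close> is spent elsewhere, and the remaining five eighths of
  \<open>D * e\<close> exceed \<open>l\<close>.\<close>

lemma exponent_slack:
  fixes D h e l :: real
  assumes "2 * l \<le> D * e" "0 \<le> D * e"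
  shows "D * (h - e) \<le> - l + D * (h - 3 * e / 8)"
proof -
  define x y where "x = D * e" and "y = D * h"
  have e1: "D * (h - e) = y - x" unfolding x_def y_def by (rule right_diff_distrib)
  have e2: "D * (h - 3 * e / 8) = y - 3 * x / 8"
    unfolding x_def y_def by (simp add: right_diff_distrib)
  have "2 * l \<le> x" "0 \<le> x" using assms unfolding x_def by simp_all
  then show ?thesis unfolding e1 e2 by linarith
qed

context bernoulli begin

lemma code_Int: "I \<subseteq> J \<Longrightarrow> code J y \<inter> I = code I y"
  unfolding code_def by (rule hits_Int)

lemma units_code: "(units H, A) \<in> J \<Longrightarrow> y \<in> B0 \<Longrightarrow> (units H, A) \<in> code J y \<longleftrightarrow> y \<in> cyl H \<kappa> (units H) A"
  unfolding code_def hits_def cyl_def by auto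

text \<open>A random labeling \<open>z\<close> of the vertices by points of \<open>K\<close> turns codes into homomorphisms: a vertex \<open>v\<close>
  belongs to the image of \<open>X\<close> iff the block guessed from its code meets \<open>X\<close>.\<close>

lemma lower_count:
  assumes \<alpha>: "base_partition \<alpha>"
    and P: "P \<in> finite_borel_partitions (bernoulli_gpd H \<kappa>) \<mu>" "refines B0 P (lift_part \<alpha>)"
    and F: "finite F" "F \<subseteq> bisections H" "units H \<in> F" and \<delta>: "\<delta> > 0" and \<epsilon>: "\<epsilon> > 0"
  obtains F0 \<delta>0 d0 where "finite F0" "F0 \<subseteq> bisections H" "\<delta>0 > 0"
    "\<And>d \<sigma> F' \<delta>'. sofic_map H \<nu> d \<sigma> F' \<delta>' \<Longrightarrow> F0 \<subseteq> F' \<Longrightarrow> \<delta>' \<le> \<delta>0 \<Longrightarrow> d0 \<le> d \<Longrightarrow>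
      exp (real d * (part_entropy \<kappa> \<alpha> - \<epsilon>)) \<le>
        real (approx_homs_count H (bernoulli_gpd H \<kappa>) \<mu> bernoulli_proj d (lift_part \<alpha>) P F \<delta> \<sigma>)"
proof -
  interpret m: prob_space \<mu> by (rule prob_\<mu>)
  interpret k: prob_space \<kappa> by (rule prob_\<kappa>)

  \<comment> \<open>Saturated sets: unions of blocks of the generated partition\<close>
  define N where "N = act_partition H (bernoulli_gpd H \<kappa>) bernoulli_proj P F"
  note Np = act_partition_props[OF F(1,2) P(1), folded N_def]
  have a: "finite \<alpha>" "\<alpha> \<subseteq> sets \<kappa>" "partition_on (space \<kappa>) \<alpha>" using \<alpha> unfolding base_partition_def by auto
  have Pp: "finite P" "P \<subseteq> sets BS" "partition_on B0 P"
    using P(1) unfolding finite_borel_partitions_def by (auto simp: sets_\<mu> units_bernoulli)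
  let ?sat = "\<lambda>X. X = \<Union>{D \<in> N. D \<subseteq> X}"
  have sat_P: "?sat B" if "B \<in> P" for B
    using Np(4)[OF F(3) that] act_units[of B] sets_BS_sub Pp(2) that by auto
  have sat_Q: "?sat (cyl H \<kappa> (units H) A)" if "A \<in> \<alpha>" for A
  proof -
    let ?Y = "cyl H \<kappa> (units H) A"
    have 1: "?Y = \<Union>{B \<in> P. B \<subseteq> ?Y}"
      by (rule refines_Union[OF P(2)]) (use that in \<open>auto simp: lift_part_def\<close>)
    show ?thesis
    proof
      show "?Y \<subseteq> \<Union>{D \<in> N. D \<subseteq> ?Y}"
      proof
        fix y assume "y \<in> ?Y"
        then obtain B where B: "B \<in> P" "B \<subseteq> ?Y" "y \<in> B" by (rule saturatedD[OF 1])
        obtain D where "D \<in> N" "D \<subseteq> B" "y \<in> D" by (rule saturatedD[OF sat_P[OF B(1)] B(3)])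
        then show "y \<in> \<Union>{D \<in> N. D \<subseteq> ?Y}" using B by blast
      qed
    qed blast
  qed
  have sat_N: "?sat D" if "D \<in> N" for D using that by blast
  have sat_act: "?sat (act f B)" if "f \<in> F" "B \<in> P" for f B using Np(4)[OF that] .

  \<comment> \<open>Constants\<close>
  define \<Lambda> where "\<Lambda> = (\<Sum>A\<in>\<alpha>. - ln (measure \<kappa> A))"
  have ln0: "ln (measure \<kappa> A) \<le> 0" for A by (cases "measure \<kappa> A = 0") (auto simp: zero_less_measure_iff)
  have \<Lambda>0: "\<Lambda> \<ge> 0" unfolding \<Lambda>_def by (intro sum_nonneg) (use ln0 in simp)
  define t where "t = min 1 (\<epsilon> / (8 * (real (card \<alpha>) + 1)))"
  have t: "0 < t" "t \<le> 1" unfolding t_def using \<epsilon> by auto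
  have t\<alpha>: "t * real (card \<alpha>) \<le> \<epsilon> / 8"
  proof -
    have "t * real (card \<alpha>) \<le> \<epsilon> / (8 * (real (card \<alpha>) + 1)) * (real (card \<alpha>) + 1)"
      unfolding t_def using \<epsilon> by (intro mult_mono) auto
    also have "\<dots> = \<epsilon> / 8" using \<epsilon> by (simp add: field_simps)
    finally show ?thesis .
  qed
  define Lt where "Lt = ln (1 / t)"
  have Lt0: "Lt \<ge> 0" unfolding Lt_def using t by simp
  \<comment> \<open>One summand for each multiple of \<tau> that arises below:
    \<open>2 * \<tau>\<close> per block of \<open>N\<close> for frequencies,
    \<open>4 * \<tau>\<close> per block of \<open>P\<close> for equivariance, the Hamming radius
    times \<open>Lt\<close>, and \<open>2 * \<Lambda>\<close> from the deviation of label
    frequencies. Each of these is then at most \<open>min \<delta> \<epsilon> / 8\<close>.\<close>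
  define C where "C = 1 + 2 * real (card N) + 4 * real (card P) + 6 * real (card \<alpha>) * Lt + 2 * \<Lambda>"
  have C1: "C \<ge> 1" unfolding C_def using Lt0 \<Lambda>0 by simp
  define \<tau> where "\<tau> = min \<delta> \<epsilon> / (8 * C)"
  have \<tau>: "\<tau> > 0" unfolding \<tau>_def using C1 \<delta> \<epsilon> by simp
  have C\<tau>: "C * \<tau> = min \<delta> \<epsilon> / 8" unfolding \<tau>_def using C1 by simp
  have c\<tau>: "c * \<tau> \<le> min \<delta> \<epsilon> / 8" if "c \<le> C" for c
    using mult_right_mono[OF that, of \<tau>] \<tau> C\<tau> by simp

  \<comment> \<open>Guessing the block of a point from its code\<close>
  obtain I T where I: "finite I" "I \<subseteq> idx" and T: "\<And>a. T a \<in> N"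
    and Bad: "{y \<in> B0. y \<notin> T (code I y)} \<in> sets BS"
      "\<And>f. f \<in> F \<Longrightarrow> measure \<mu> (act f {y \<in> B0. y \<notin> T (code I y)}) < \<tau>"
    using partition_approx[OF Np(2,3,1) F(1,2) \<tau>, of "{}"] by auto
  let ?Bad = "{y \<in> B0. y \<notin> T (code I y)}"
  have Bad_units: "measure \<mu> ?Bad < \<tau>" using Bad(2)[OF F(3)] act_units[of ?Bad] by auto
  define r where "r D = (SOME y. y \<in> D)" for D :: "('h \<times> ('h \<Rightarrow> 'k)) set"
  have r: "r D \<in> D" if "D \<in> N" for D
    unfolding r_def using partition_onD3[OF Np(1)] that by (simp add: some_in_eq) metis
  have NB: "D \<subseteq> B0" if "D \<in> N" for D using partition_onD1[OF Np(1)] that by blast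
  have rT: "r (T a) \<in> B0" for a using r[OF T] NB[OF T] by blast
  \<comment> \<open>Off \<open>?Bad\<close> the guessed block contains \<open>y\<close>, and a union
    of blocks does not distinguish \<open>y\<close> from the representative of this block.\<close>
  have guess: "r (T (code I y)) \<in> X \<longleftrightarrow> y \<in> X" if "?sat X" "y \<in> B0" "y \<notin> ?Bad" for X y
    by (rule partition_cell_iff[OF Np(1) that(1) T r[OF T]]) (use that in blast)

  \<comment> \<open>The index set and the demands on the sofic map\<close>
  define G where "G = fst ` I"
  \<comment> \<open>The pattern on \<open>J\<close> at a vertex determines the guess there, the
    guess at each vertex from which it is reached by a member of \<open>F\<close>, and, where the
    image of the units is diagonal, the block of \<alpha> that contains its own label.\<close>
  define J where "J = I \<union> (\<Union>f\<in>F. insert (act_top f) (act_idx f ` I)) \<union> (\<lambda>A. (units H, A)) ` \<alpha>"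
  have IJ: "I \<subseteq> J" unfolding J_def by blast
  have J: "finite J" unfolding J_def using I(1) F(1) a(1) by simp
  have "J \<subseteq> idx" unfolding J_def
    by (intro Un_least UN_least insert_subsetI image_subsetI I(2) act_top_in act_idx_in SigmaI units_bis)
      (use F(2) I(2) a(2) in blast)+
  note J = J this
  define L where "L = real (card (Pow J))"
  have L: "L > 0" unfolding L_def using J(1) by (simp add: card_Pow)
  have e1: "\<tau> / L > 0" using \<tau> L by simp
  obtain F1 \<delta>1 d1 where F1: "finite F1" "F1 \<subseteq> bisections H" "\<delta>1 > 0"
    and conc: "\<And>d \<sigma> F \<delta> K w. sofic_map H \<nu> d \<sigma> F \<delta> \<Longrightarrow> F1 \<subseteq> F \<Longrightarrow> \<delta> \<le> \<delta>1 \<Longrightarrow> d1 \<le> d \<Longrightarrow> is_model \<kappa> (snd ` J) K w \<Longrightarrow>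
      (\<Sum>z\<in>{z \<in> {1..d} \<rightarrow>\<^sub>E K. \<not> good_labels d \<sigma> J (\<tau> / L) z}. prod_weight d w z) \<le> 1 / 2"
    by (rule concentration[OF J e1]) (rule that)
  define F0 where "F0 = F1 \<union> G \<union> F \<union> (\<lambda>f. src H ` f) ` F \<union> (\<lambda>f. ginv H ` f) ` F \<union> (\<lambda>f. rng H ` f) ` F"
  \<comment> \<open>The denominator dominates \<open>card G + 5\<close>, the loss in
    \<open>mostly_equivariant\<close>.\<close>
  define \<delta>0 where "\<delta>0 = min \<delta>1 (\<tau> / (real (card G) + 6))"
  \<comment> \<open>The second bound lets \<open>exponent_slack\<close> absorb the factor 1/2 that
    comes from the weight of the good labelings.\<close>
  define d0 where "d0 = max d1 (nat \<lceil>2 * ln 2 / \<epsilon>\<rceil>)"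
  have Gb: "G \<subseteq> bisections H" unfolding G_def using I(2) by auto
  have finG: "finite G" unfolding G_def using I(1) by simp
  show ?thesis
  proof (rule that[of F0 \<delta>0 d0])
    show "finite F0" unfolding F0_def using F1 F(1) finG by simp
    show "F0 \<subseteq> bisections H" unfolding F0_def
      by (intro Un_least image_subsetI F1 Gb F(2) bis_units[OF bis_src_borel] bis_ginv bis_units[OF bis_rng_borel])
        (use F(2) in blast)+
    show "\<delta>0 > 0" unfolding \<delta>0_def using F1 \<tau> by simp

    \<comment> \<open>Labelings of a given model with good statistics\<close>
    fix d \<sigma> F' \<delta>'
    assume sm: "sofic_map H \<nu> d \<sigma> F' \<delta>'" and F'0: "F0 \<subseteq> F'" and \<delta>'0: "\<delta>' \<le> \<delta>0" and d0: "d0 \<le> d"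
    interpret sm: sofic_map H \<nu> d \<sigma> F' \<delta>' by (rule sm)
    have d: "d \<ge> 1" "real d > 0" using sm.d by auto
    have FF': "f \<in> F'" "src H ` f \<in> F'" "ginv H ` f \<in> F'" "rng H ` f \<in> F'" if "f \<in> F" for f
      using F'0 that unfolding F0_def by auto
    have GF': "G \<subseteq> F'" using F'0 unfolding F0_def by auto
    have \<delta>'n: "0 \<le> \<delta>'" by (rule sm.\<delta>_nonneg[OF FF'(1)[OF F(3)]])
    have \<delta>'\<tau>: "real (card G) * \<delta>' + 5 * \<delta>' \<le> \<tau>" "\<delta>' \<le> \<tau>"
    proof -
      have "(real (card G) + 6) * \<delta>' \<le> (real (card G) + 6) * (\<tau> / (real (card G) + 6))"
        using \<delta>'0 unfolding \<delta>0_def by (intro mult_left_mono) auto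
      also have "\<dots> = \<tau>" by (simp add: add_nonneg_eq_0_iff)
      finally have "real (card G) * \<delta>' + 6 * \<delta>' \<le> \<tau>" by (simp add: algebra_simps)
      moreover have "0 \<le> real (card G) * \<delta>'" using \<delta>'n by simp
      ultimately show "real (card G) * \<delta>' + 5 * \<delta>' \<le> \<tau>" "\<delta>' \<le> \<tau>" using \<delta>'n by linarith+
    qed
    have Jsets: "snd ` J \<subseteq> sets \<kappa>" using J(2) by auto
    obtain K w where model: "is_model \<kappa> (snd ` J) K w"
      using ex_model[OF prob_\<kappa> finite_imageI[OF J(1)] Jsets] by blast
    note K = is_modelD(1,2)[OF model] and w = is_modelD(3)[OF model]
    have w1: "sum w K = 1" by (rule sum_model[OF model])
    let ?Z = "{1..d} \<rightarrow>\<^sub>E K"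
    have finZ: "finite ?Z" using K by (intro finite_PiE) auto
    define Gd where "Gd = {z \<in> ?Z. good_labels d \<sigma> J (\<tau> / L) z}"
    have finGd: "finite Gd" unfolding Gd_def using finZ by simp
    have WGd: "1 / 2 \<le> sum (prod_weight d w) Gd"
    proof -
      have "sum (prod_weight d w) ?Z = 1" using prob_box[OF K(1) w1, of "{}" d] by simp
      moreover have "sum (prod_weight d w) ?Z = sum (prod_weight d w) Gd + sum (prod_weight d w) {z \<in> ?Z. \<not> good_labels d \<sigma> J (\<tau> / L) z}"
        unfolding Gd_def by (subst sum.union_disjoint[symmetric]) (use finZ in \<open>auto intro!: sum.cong\<close>)
      moreover have "(\<Sum>z\<in>{z \<in> ?Z. \<not> good_labels d \<sigma> J (\<tau> / L) z}. prod_weight d w z) \<le> 1 / 2"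
        by (rule conc[OF sm _ _ _ model]) (use F'0 \<delta>'0 d0 in \<open>auto simp: F0_def \<delta>0_def d0_def\<close>)
      ultimately show ?thesis by linarith
    qed
    have zK: "z v \<in> space \<kappa>" if "z \<in> Gd" "v \<in> {1..d}" for z v
      using that K(2) unfolding Gd_def by blast
    have cnt: "\<bar>real (card {v \<in> {1..d}. hits J (verts \<sigma> v) z \<in> S}) / real d - measure \<mu> (tset H \<kappa> J S)\<bar> \<le> \<tau>"
      if "z \<in> Gd" for z S
    proof -
      have "\<bar>real (card {v \<in> {1..d}. hits J (verts \<sigma> v) z \<in> S}) / real d - measure \<mu> (tset H \<kappa> J S)\<bar>
          \<le> real (card (Pow J)) * (\<tau> / L)"
        by (rule good_labels_set[OF J]) (use that d e1 in \<open>auto simp: Gd_def\<close>)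
      also have "\<dots> = \<tau>" using L unfolding L_def by simp
      finally show ?thesis .
    qed
    have hJI: "hits J (verts \<sigma> v) z \<inter> I = hits I (verts \<sigma> v) z" for v z by (rule hits_Int[OF IJ])

    \<comment> \<open>Homomorphisms defined by labelings\<close>
    define \<Sigma> where "\<Sigma> = sigma_sets B0 N"
    have \<Sigma>: "\<Sigma> = \<Union> ` Pow N" unfolding \<Sigma>_def by (rule sigma_sets_partition[OF Np(2,1)])
    have sat\<Sigma>: "X \<in> \<Sigma>" if "?sat X" for X
        unfolding \<Sigma> by (rule image_eqI[where x="{D \<in> N. D \<subseteq> X}"]) (rule that, blast)
    \<comment> \<open>Each vertex is sent to the representative of its guessed block, so that
      \<open>\<phi> z\<close> is an inverse image map and preserves unions and
      intersections.\<close>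
    define pt where "pt z v = r (T (hits I (verts \<sigma> v) z))" for z v
    define \<phi> where "\<phi> z = (\<lambda>X\<in>\<Sigma>. {v \<in> {1..d}. pt z v \<in> X})" for z
    have \<phi>: "\<phi> z X = {v \<in> {1..d}. pt z v \<in> X}" if "?sat X" for z X
      unfolding \<phi>_def using sat\<Sigma>[OF that] by simp
    have hom: "\<phi> z \<in> set_homs (bernoulli_gpd H \<kappa>) \<Sigma> d" for z
    proof -
      have U: "X \<union> Y \<in> \<Sigma>" "X \<inter> Y \<in> \<Sigma>" if "X \<in> \<Sigma>" "Y \<in> \<Sigma>" for X Y
      proof -
        interpret sa: sigma_algebra B0 \<Sigma>
          unfolding \<Sigma>_def by (rule sigma_algebra_sigma_sets) (use NB in blast)
        show "X \<union> Y \<in> \<Sigma>" "X \<inter> Y \<in> \<Sigma>" using that by auto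
      qed
      have E: "{} \<in> \<Sigma>" "B0 \<in> \<Sigma>" unfolding \<Sigma>_def by (auto intro: sigma_sets.Empty sigma_sets_top)
      show ?thesis unfolding set_homs_def units_bernoulli
      proof (intro CollectI conjI ballI)
        show "\<phi> z \<in> \<Sigma> \<rightarrow>\<^sub>E Pow {1..d}" unfolding \<phi>_def by auto
        show "\<phi> z (X \<union> Y) = \<phi> z X \<union> \<phi> z Y" if "X \<in> \<Sigma>" "Y \<in> \<Sigma>" for X Y
          using that U[OF that] unfolding \<phi>_def by auto
        show "\<phi> z (X \<inter> Y) = \<phi> z X \<inter> \<phi> z Y" if "X \<in> \<Sigma>" "Y \<in> \<Sigma>" for X Y
          using that U[OF that] unfolding \<phi>_def by auto
        show "\<phi> z {} = {}" "\<phi> z B0 = {1..d}" using E rT unfolding \<phi>_def pt_def by auto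
      qed
    qed

    \<comment> \<open>Frequencies of blocks and equivariance\<close>
    have ms: "tset H \<kappa> J S \<in> sets \<mu>" for S using tset_sets[OF J] sets_\<mu> by simp
    have Bad\<mu>: "act f ?Bad \<in> sets \<mu>" "?Bad \<in> sets \<mu>" if "f \<in> F" for f
      using act_sets[OF _ Bad(1), of f] Bad(1) F(2) that sets_\<mu> by auto
    have tset_r: "tset H \<kappa> J {a. r (T (a \<inter> I)) \<in> X} = {y \<in> B0. r (T (code I y)) \<in> X}" for X
      unfolding tset_code using code_Int[OF IJ] by auto
    have meas: "\<bar>real (card (\<phi> z D)) / real d - measure \<mu> D\<bar> \<le> 2 * \<tau>" if z: "z \<in> Gd" and D: "D \<in> N" for z D
    proof -
      let ?S = "{a. r (T (a \<inter> I)) \<in> D}"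
      have eD: "\<phi> z D = {v \<in> {1..d}. hits J (verts \<sigma> v) z \<in> ?S}"
        unfolding \<phi>[OF sat_N[OF D]] pt_def by (simp add: hJI)
      have "\<bar>real (card (\<phi> z D)) / real d - measure \<mu> (tset H \<kappa> J ?S)\<bar> \<le> \<tau>" unfolding eD by (rule cnt[OF z])
      moreover have "\<bar>measure \<mu> (tset H \<kappa> J ?S) - measure \<mu> D\<bar> \<le> \<tau>"
      proof -
        have Ds: "D \<in> sets \<mu>" using Np(3) D sets_\<mu> by blast
        have "sym_diff (tset H \<kappa> J ?S) D \<subseteq> ?Bad" unfolding tset_r using guess[OF sat_N[OF D]] NB[OF D] by blast
        then have "measure \<mu> (sym_diff (tset H \<kappa> J ?S) D) \<le> measure \<mu> ?Bad"
          using Bad\<mu>(2)[OF F(3)] by (intro m.finite_measure_mono)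
        then show ?thesis using m.measure_sym_diff[OF ms[of ?S] Ds] Bad_units by linarith
      qed
      ultimately show ?thesis by linarith
    qed
    have equi: "real (card (sym_diff (fin_act (\<sigma> f) (\<phi> z B)) (\<phi> z (act f B)))) / real d \<le> 4 * \<tau>"
      if z: "z \<in> Gd" and f: "f \<in> F" and B: "B \<in> P" for z f B
    proof -
      have fb: "f \<in> bisections H" using f F(2) by blast
      \<comment> \<open>Both sides are read off from the pattern on \<open>J\<close> at a vertex:
        \<open>?S1\<close> asks whether the guess at the preimage under \<open>f\<close> lies in
        \<open>B\<close>, \<open>?S2\<close> whether the guess at the vertex itself lies in the
        translate of \<open>B\<close>. In the shift the two conditions differ only on
        \<open>?Bad\<close> and its translate, and good statistics carry this over to the
        vertices.\<close>
      let ?S1 = "{a. act_top f \<in> a \<and> {i \<in> I. act_idx f i \<in> a} \<in> {a. r (T a) \<in> B}}"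
      let ?S2 = "{a. r (T (a \<inter> I)) \<in> act f B}"
      let ?pr = "\<lambda>u. ((\<exists>v. (u, v) \<in> \<sigma> f) \<longleftrightarrow> (\<exists>k. (k, u) \<in> \<sigma> (rng H ` f))) \<and>
         (\<forall>v. (u, v) \<in> \<sigma> f \<longrightarrow> (\<forall>g\<in>G. \<forall>k. (k, v) \<in> \<sigma> g \<longleftrightarrow> (k, u) \<in> \<sigma> (bis_prod H g (ginv H ` f))))"
      have mo: "mostly d \<tau> ?pr"
        by (rule mostly_mono[OF sm.mostly_equivariant[OF FF'[OF f] finG GF'] _ \<delta>'\<tau>(1)])
      have topJ: "act_top f \<in> J" "act_idx f ` I \<subseteq> J" unfolding J_def using f by auto
      have iff: "u \<in> fin_act (\<sigma> f) (\<phi> z B) \<longleftrightarrow> hits J (verts \<sigma> u) z \<in> ?S1" if u: "?pr u" "u \<in> {1..d}" for u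
      proof -
        have top: "act_top f \<in> hits J (verts \<sigma> u) z \<longleftrightarrow> (\<exists>v. (u, v) \<in> \<sigma> f)"
        proof -
          have rb: "rng H ` f \<in> bisections H" by (rule bis_units[OF bis_rng_borel[OF fb]])
          have "z k \<in> space \<kappa>" if "(k, u) \<in> \<sigma> (rng H ` f)" for k using zK[OF z] sm.\<sigma>_range[OF rb that] by blast
          then have "act_top f \<in> hits J (verts \<sigma> u) z \<longleftrightarrow> (\<exists>k. (k, u) \<in> \<sigma> (rng H ` f))"
            using topJ(1) unfolding hits_def act_top_def verts_def by auto
          then show ?thesis using u(1) by blast
        qed
        have idx: "{i \<in> I. act_idx f i \<in> hits J (verts \<sigma> u) z} = hits I (verts \<sigma> v) z" if v: "(u, v) \<in> \<sigma> f" for v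
        proof -
          have "act_idx f i \<in> hits J (verts \<sigma> u) z \<longleftrightarrow> (\<exists>k\<in>verts \<sigma> v (fst i). z k \<in> snd i)" if i: "i \<in> I" for i
          proof -
            have "fst i \<in> G" unfolding G_def using i by blast
            then have "(k, v) \<in> \<sigma> (fst i) \<longleftrightarrow> (k, u) \<in> \<sigma> (bis_prod H (fst i) (ginv H ` f))" for k
              using u(1) v by blast
            moreover have "act_idx f i \<in> J" using topJ(2) i by blast
            ultimately show ?thesis unfolding hits_def verts_def by (simp add: act_idx_def)
          qed
          then show ?thesis unfolding hits_def[of I] by blast
        qed
        have "u \<in> fin_act (\<sigma> f) (\<phi> z B) \<longleftrightarrow> (\<exists>v. (u, v) \<in> \<sigma> f \<and> r (T (hits I (verts \<sigma> v) z)) \<in> B)"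
          unfolding \<phi>[OF sat_P[OF B]] fin_act_def pt_def using sm.\<sigma>_range[OF fb] by blast
        also have "\<dots> \<longleftrightarrow> (\<exists>v. (u, v) \<in> \<sigma> f) \<and> r (T {i \<in> I. act_idx f i \<in> hits J (verts \<sigma> u) z}) \<in> B"
          using idx by auto
        finally show ?thesis unfolding top[symmetric] by simp
      qed
      have sub1: "fin_act (\<sigma> f) (\<phi> z B) \<subseteq> {1..d}" unfolding fin_act_def using sm.\<sigma>_range[OF fb] by blast
      have eq2: "\<phi> z (act f B) = {u \<in> {1..d}. hits J (verts \<sigma> u) z \<in> ?S2}"
        unfolding \<phi>[OF sat_act[OF f B]] pt_def by (simp add: hJI)
      have "sym_diff (fin_act (\<sigma> f) (\<phi> z B)) (\<phi> z (act f B)) \<subseteq>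
          {u \<in> {1..d}. \<not> ?pr u} \<union> {u \<in> {1..d}. hits J (verts \<sigma> u) z \<in> sym_diff ?S1 ?S2}"
      proof
        fix u assume u: "u \<in> sym_diff (fin_act (\<sigma> f) (\<phi> z B)) (\<phi> z (act f B))"
        then have ud: "u \<in> {1..d}" using sub1 unfolding eq2 by blast
        show "u \<in> {u \<in> {1..d}. \<not> ?pr u} \<union> {u \<in> {1..d}. hits J (verts \<sigma> u) z \<in> sym_diff ?S1 ?S2}"
        proof (cases "?pr u")
          case True
          have "(u \<in> fin_act (\<sigma> f) (\<phi> z B)) \<noteq> (u \<in> \<phi> z (act f B))" using u by blast
          then have "(hits J (verts \<sigma> u) z \<in> ?S1) \<noteq> (hits J (verts \<sigma> u) z \<in> ?S2)"
            unfolding iff[OF True ud] eq2 using ud by blast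
          then show ?thesis using ud by blast
        next
          case False
          then show ?thesis using ud by blast
        qed
      qed
      then have "card (sym_diff (fin_act (\<sigma> f) (\<phi> z B)) (\<phi> z (act f B))) \<le>
          card ({u \<in> {1..d}. \<not> ?pr u} \<union> {u \<in> {1..d}. hits J (verts \<sigma> u) z \<in> sym_diff ?S1 ?S2})"
        by (intro card_mono) auto
      also have "\<dots> \<le> card {u \<in> {1..d}. \<not> ?pr u} + card {u \<in> {1..d}. hits J (verts \<sigma> u) z \<in> sym_diff ?S1 ?S2}"
        by (rule card_Un_le)
      finally have c1: "real (card (sym_diff (fin_act (\<sigma> f) (\<phi> z B)) (\<phi> z (act f B)))) \<le>
          \<tau> * real d + real (card {u \<in> {1..d}. hits J (verts \<sigma> u) z \<in> sym_diff ?S1 ?S2})"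
        using mo unfolding mostly_def by linarith
      have "measure \<mu> (tset H \<kappa> J (sym_diff ?S1 ?S2)) \<le> 2 * \<tau>"
      proof -
        let ?X = "tset H \<kappa> I {a. r (T a) \<in> B}"
        have BB: "B \<subseteq> B0" using sets_BS_sub Pp(2) B by blast
        have t1: "tset H \<kappa> J ?S1 = act f ?X" by (rule act_tset[OF fb I(2) topJ, symmetric])
        have "?X - B \<subseteq> ?Bad" "B - ?X \<subseteq> ?Bad" unfolding tset_code using guess[OF sat_P[OF B]] BB by blast+
        from act_mono[OF this(1), of f] act_mono[OF this(2), of f]
        have s1: "act f ?X - act f B \<subseteq> act f ?Bad" "act f B - act f ?X \<subseteq> act f ?Bad"
          unfolding act_Diff[OF fb tset_subset BB] act_Diff[OF fb BB tset_subset] .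
        have s2: "tset H \<kappa> J ?S2 - act f B \<subseteq> ?Bad" "act f B - tset H \<kappa> J ?S2 \<subseteq> ?Bad"
          unfolding tset_r using guess[OF sat_act[OF f B]] act_subset[OF fb BB] by blast+
        have "tset H \<kappa> J (sym_diff ?S1 ?S2) = sym_diff (tset H \<kappa> J ?S1) (tset H \<kappa> J ?S2)"
          unfolding tset_code by blast
        also have "\<dots> \<subseteq> act f ?Bad \<union> ?Bad" unfolding t1 using s1 s2 by blast
        finally have "measure \<mu> (tset H \<kappa> J (sym_diff ?S1 ?S2)) \<le> measure \<mu> (act f ?Bad \<union> ?Bad)"
          using Bad\<mu>[OF f] by (intro m.finite_measure_mono) auto
        also have "\<dots> \<le> measure \<mu> (act f ?Bad) + measure \<mu> ?Bad" using Bad\<mu>[OF f] by (intro measure_Un_le)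
        finally show ?thesis using Bad(2)[OF f] Bad_units by linarith
      qed
      then have "real (card {u \<in> {1..d}. hits J (verts \<sigma> u) z \<in> sym_diff ?S1 ?S2}) / real d \<le> 3 * \<tau>"
        using cnt[OF z, of "sym_diff ?S1 ?S2"] by linarith
      then have "real (card {u \<in> {1..d}. hits J (verts \<sigma> u) z \<in> sym_diff ?S1 ?S2}) \<le> 3 * \<tau> * real d"
        using d by (simp add: field_simps)
      then have "real (card (sym_diff (fin_act (\<sigma> f) (\<phi> z B)) (\<phi> z (act f B)))) \<le> 4 * \<tau> * real d" using c1 by linarith
      then show ?thesis using d by (simp add: field_simps)
    qed
    have md: "min \<delta> \<epsilon> / 8 < \<delta>" using \<delta> \<epsilon> by auto
    have approx: "\<phi> z \<in> approx_homs H (bernoulli_gpd H \<kappa>) \<mu> bernoulli_proj d \<sigma> P F \<delta>" if z: "z \<in> Gd" for z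
      unfolding approx_homs_def N_def[symmetric] units_bernoulli
    proof (intro CollectI conjI ballI)
      show "\<phi> z \<in> set_homs (bernoulli_gpd H \<kappa>) (sigma_sets B0 N) d" using hom \<Sigma>_def by simp
      fix f assume f: "f \<in> F"
      have "(\<Sum>B\<in>P. real (card (sym_diff (fin_act (\<sigma> f) (\<phi> z B)) (\<phi> z (act f B)))) / real d) \<le> (\<Sum>B\<in>P. 4 * \<tau>)"
        by (rule sum_mono) (rule equi[OF z f])
      also have "\<dots> = (4 * real (card P)) * \<tau>" by simp
      also have "\<dots> \<le> min \<delta> \<epsilon> / 8" by (rule c\<tau>) (use Lt0 \<Lambda>0 in \<open>simp add: C_def\<close>)
      finally show "(\<Sum>B\<in>P. real (card (sym_diff (fin_act (\<sigma> f) (\<phi> z B)) (\<phi> z (act f B)))) / real d) < \<delta>" using md by linarith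
    next
      have "(\<Sum>B\<in>N. \<bar>real (card (\<phi> z B)) / real d - measure \<mu> B\<bar>) \<le> (\<Sum>B\<in>N. 2 * \<tau>)"
        by (rule sum_mono) (rule meas[OF z])
      also have "\<dots> = (2 * real (card N)) * \<tau>" by simp
      also have "\<dots> \<le> min \<delta> \<epsilon> / 8" by (rule c\<tau>) (use Lt0 \<Lambda>0 in \<open>simp add: C_def\<close>)
      finally show "(\<Sum>B\<in>N. \<bar>real (card (\<phi> z B)) / real d - measure \<mu> B\<bar>) < \<delta>" using md by linarith
    qed

    \<comment> \<open>Reading the labels off the homomorphism\<close>
    have uF: "units H \<in> F'" by (rule FF'(1)[OF F(3)])
    have mu: "mostly d \<tau> (\<lambda>v. (v, v) \<in> \<sigma> (units H))"
      by (rule mostly_mono[OF sm.mostly_units[OF uF] _ \<delta>'\<tau>(2)])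
    have uhit: "(units H, A) \<in> hits J (verts \<sigma> v) z \<longleftrightarrow> z v \<in> A" if "(v, v) \<in> \<sigma> (units H)" "A \<in> \<alpha>" for v A z
    proof -
      have "verts \<sigma> v (units H) = {v}" unfolding verts_def using sm.\<sigma>_single[OF units_bis that(1)] that(1) by blast
      moreover have "(units H, A) \<in> J" unfolding J_def using that(2) by blast
      ultimately show ?thesis unfolding hits_def by simp
    qed
    \<comment> \<open>Up to \<tau> for vertices where the image of the units is not diagonal, \<tau>
      for wrong guesses and \<tau> for the statistics.\<close>
    have close: "real (card {v \<in> {1..d}. (v \<in> \<phi> z (cyl H \<kappa> (units H) A)) \<noteq> (z v \<in> A)}) \<le> 3 * \<tau> * real d"
      if z: "z \<in> Gd" and A: "A \<in> \<alpha>" for z A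
    proof -
      let ?Q = "cyl H \<kappa> (units H) A"
      let ?S = "{a. (r (T (a \<inter> I)) \<in> ?Q) \<noteq> ((units H, A) \<in> a)}"
      have uJ: "(units H, A) \<in> J" unfolding J_def using A by blast
      have "tset H \<kappa> J ?S \<subseteq> ?Bad"
        unfolding tset_code using guess[OF sat_Q[OF A]] units_code[OF uJ] by (auto simp: code_Int[OF IJ])
      then have "measure \<mu> (tset H \<kappa> J ?S) \<le> measure \<mu> ?Bad"
        using Bad\<mu>(2)[OF F(3)] by (intro m.finite_measure_mono)
      then have "real (card {v \<in> {1..d}. hits J (verts \<sigma> v) z \<in> ?S}) / real d \<le> 2 * \<tau>"
        using cnt[OF z, of ?S] Bad_units by linarith
      then have c: "real (card {v \<in> {1..d}. hits J (verts \<sigma> v) z \<in> ?S}) \<le> 2 * \<tau> * real d"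
        using d by (simp add: field_simps)
      have "{v \<in> {1..d}. (v \<in> \<phi> z ?Q) \<noteq> (z v \<in> A)} \<subseteq>
          {v \<in> {1..d}. (v, v) \<notin> \<sigma> (units H)} \<union> {v \<in> {1..d}. hits J (verts \<sigma> v) z \<in> ?S}"
        unfolding \<phi>[OF sat_Q[OF A]] pt_def using uhit[OF _ A, of _ z] by (auto simp: hJI)
      then have "card {v \<in> {1..d}. (v \<in> \<phi> z ?Q) \<noteq> (z v \<in> A)} \<le>
          card ({v \<in> {1..d}. (v, v) \<notin> \<sigma> (units H)} \<union> {v \<in> {1..d}. hits J (verts \<sigma> v) z \<in> ?S})"
        by (intro card_mono) auto
      also have "\<dots> \<le> card {v \<in> {1..d}. (v, v) \<notin> \<sigma> (units H)} + card {v \<in> {1..d}. hits J (verts \<sigma> v) z \<in> ?S}"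
        by (rule card_Un_le)
      finally show ?thesis using c mu unfolding mostly_def by linarith
    qed
    have freq: "(measure \<kappa> A - 2 * \<tau>) * real d \<le> real (card {v \<in> {1..d}. z v \<in> A})"
      if z: "z \<in> Gd" and A: "A \<in> \<alpha>" for z A
    proof -
      let ?S = "{a. (units H, A) \<in> a}"
      have uJ: "(units H, A) \<in> J" unfolding J_def using A by blast
      have "tset H \<kappa> J ?S = cyl H \<kappa> (units H) A" using tset_cyl[OF uJ] by simp
      then have "measure \<mu> (tset H \<kappa> J ?S) = measure \<kappa> A" using measure_cyl_units A a(2) by auto
      then have "measure \<kappa> A - \<tau> \<le> real (card {v \<in> {1..d}. hits J (verts \<sigma> v) z \<in> ?S}) / real d"
        using cnt[OF z, of ?S] by linarith
      then have c: "(measure \<kappa> A - \<tau>) * real d \<le> real (card {v \<in> {1..d}. hits J (verts \<sigma> v) z \<in> ?S})"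
        using d by (simp add: field_simps)
      have "{v \<in> {1..d}. hits J (verts \<sigma> v) z \<in> ?S} \<subseteq> {v \<in> {1..d}. (v, v) \<notin> \<sigma> (units H)} \<union> {v \<in> {1..d}. z v \<in> A}"
        using uhit[OF _ A, of _ z] by auto
      then have "card {v \<in> {1..d}. hits J (verts \<sigma> v) z \<in> ?S} \<le>
          card ({v \<in> {1..d}. (v, v) \<notin> \<sigma> (units H)} \<union> {v \<in> {1..d}. z v \<in> A})" by (intro card_mono) auto
      also have "\<dots> \<le> card {v \<in> {1..d}. (v, v) \<notin> \<sigma> (units H)} + card {v \<in> {1..d}. z v \<in> A}" by (rule card_Un_le)
      finally show ?thesis using c mu unfolding mostly_def by (simp add: algebra_simps)
    qed

    \<comment> \<open>Weight of the labelings with a given restriction\<close>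
    define nm where "nm z = (\<lambda>v\<in>{1..d}. THE A. A \<in> \<alpha> \<and> z v \<in> A)" for z
    have nm: "nm z v \<in> \<alpha> \<and> z v \<in> nm z v \<and> (\<forall>A\<in>\<alpha>. z v \<in> A \<longleftrightarrow> A = nm z v)" if v: "v \<in> {1..d}" and z: "z \<in> Gd" for z v
    proof -
      have "z v \<in> \<Union>\<alpha>" using zK[OF z v] partition_onD1[OF a(3)] by simp
      then obtain A where A: "A \<in> \<alpha>" "z v \<in> A" by blast
      have uniq: "A' = A" if "A' \<in> \<alpha>" "z v \<in> A'" for A'
        using disjointD[OF partition_onD2[OF a(3)], of A' A] A that by blast
      have "(THE A. A \<in> \<alpha> \<and> z v \<in> A) = A" by (rule the_equality) (use A uniq in blast)+
      then have "nm z v = A" unfolding nm_def using v by simp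
      then show ?thesis using A uniq by blast
    qed
    have nmE: "nm z \<in> {1..d} \<rightarrow>\<^sub>E \<alpha>" if "z \<in> Gd" for z
      using nm[OF _ that] unfolding nm_def by auto
    define R where "R z = restrict (\<phi> z) (part_sigma (bernoulli_gpd H \<kappa>) (lift_part \<alpha>))" for z
    \<comment> \<open>Three losses of \<epsilon>/8: the radius and the alphabet size in the Hamming
      ball, and the deviation of the frequencies.\<close>
    define b where "b = exp (real d * (3 * \<epsilon> / 8 - part_entropy \<kappa> \<alpha>))"
    have cls: "sum (prod_weight d w) {z \<in> Gd. R z = R z0} \<le> b" if z0: "z0 \<in> Gd" for z0
    proof -
      \<comment> \<open>Two labelings with the same restriction are compared, each being misread at
        a proportion of at most \<open>3 * \<tau>\<close> of the vertices for every block of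
        \<alpha>.\<close>
      define \<theta> where "\<theta> = 6 * real (card \<alpha>) * \<tau>"
      let ?Ball = "{y \<in> {1..d} \<rightarrow>\<^sub>E \<alpha>. real (card {v \<in> {1..d}. y v \<noteq> nm z0 v}) \<le> \<theta> * real d}"
      let ?Y = "{y \<in> ?Ball. \<forall>A\<in>\<alpha>. (measure \<kappa> A - 2 * \<tau>) * real d \<le> real (card {v \<in> {1..d}. y v = A})}"
      have "finite ({1..d} \<rightarrow>\<^sub>E \<alpha>)" using a(1) by (intro finite_PiE) auto
      then have finB: "finite ?Ball" by (rule rev_finite_subset) blast
      then have finY: "finite ?Y" by (rule rev_finite_subset) blast
      have nmY: "nm z \<in> ?Y" if z: "z \<in> Gd" "R z = R z0" for z
      proof -
        have same: "\<phi> z (cyl H \<kappa> (units H) A) = \<phi> z0 (cyl H \<kappa> (units H) A)" if "A \<in> \<alpha>" for A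
        proof -
          have "cyl H \<kappa> (units H) A \<in> part_sigma (bernoulli_gpd H \<kappa>) (lift_part \<alpha>)"
            by (rule sigma_sets.Basic) (use that in \<open>auto simp: lift_part_def\<close>)
          then show ?thesis using fun_cong[OF z(2), of "cyl H \<kappa> (units H) A"] unfolding R_def by simp
        qed
        let ?D = "\<lambda>z A. {v \<in> {1..d}. (v \<in> \<phi> z (cyl H \<kappa> (units H) A)) \<noteq> (z v \<in> A)}"
        \<comment> \<open>If the names at \<open>v\<close> differ, the block \<open>nm z v\<close>
          contains \<open>z v\<close> but not \<open>z0 v\<close>, while \<open>\<phi> z\<close> and
          \<open>\<phi> z0\<close> agree on the cylinder of this block; so one of the two labelings
          is misread at \<open>v\<close>.\<close>
        have "{v \<in> {1..d}. nm z v \<noteq> nm z0 v} \<subseteq> (\<Union>A\<in>\<alpha>. ?D z A \<union> ?D z0 A)"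
        proof
          fix v assume "v \<in> {v \<in> {1..d}. nm z v \<noteq> nm z0 v}"
          then have v: "v \<in> {1..d}" "nm z v \<noteq> nm z0 v" by auto
          have A: "nm z v \<in> \<alpha>" "z v \<in> nm z v" using nm[OF v(1) z(1)] by auto
          have "z0 v \<notin> nm z v" using nm[OF v(1) z0] A(1) v(2) by blast
          then have "v \<in> ?D z (nm z v) \<union> ?D z0 (nm z v)" using v(1) A same[OF A(1)] by blast
          then show "v \<in> (\<Union>A\<in>\<alpha>. ?D z A \<union> ?D z0 A)" using A(1) by blast
        qed
        then have "card {v \<in> {1..d}. nm z v \<noteq> nm z0 v} \<le> card (\<Union>A\<in>\<alpha>. ?D z A \<union> ?D z0 A)"
          using a(1) by (intro card_mono) auto
        also have "\<dots> \<le> (\<Sum>A\<in>\<alpha>. card (?D z A \<union> ?D z0 A))" by (rule card_UN_le[OF a(1)])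
        also have "\<dots> \<le> (\<Sum>A\<in>\<alpha>. card (?D z A) + card (?D z0 A))" by (rule sum_mono) (rule card_Un_le)
        finally have "real (card {v \<in> {1..d}. nm z v \<noteq> nm z0 v}) \<le> real (\<Sum>A\<in>\<alpha>. card (?D z A) + card (?D z0 A))"
          by (simp only: of_nat_le_iff)
        also have "\<dots> = (\<Sum>A\<in>\<alpha>. real (card (?D z A)) + real (card (?D z0 A)))" by simp
        also have "\<dots> \<le> (\<Sum>A\<in>\<alpha>. 3 * \<tau> * real d + 3 * \<tau> * real d)"
          by (intro sum_mono add_mono close z(1) z0)
        also have "\<dots> = \<theta> * real d" unfolding \<theta>_def by simp
        finally have "nm z \<in> ?Ball" using nmE[OF z(1)] by blast
        moreover have "(measure \<kappa> A - 2 * \<tau>) * real d \<le> real (card {v \<in> {1..d}. nm z v = A})" if "A \<in> \<alpha>" for A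
        proof -
          have "{v \<in> {1..d}. nm z v = A} = {v \<in> {1..d}. z v \<in> A}" using nm[OF _ z(1)] that by blast
          then show ?thesis using freq[OF z(1) that] by simp
        qed
        ultimately show ?thesis by blast
      qed
      have "{z \<in> Gd. R z = R z0} \<subseteq> (\<Union>y\<in>?Y. {z \<in> ?Z. \<forall>v\<in>{1..d}. z v \<in> y v})"
      proof
        fix z assume z: "z \<in> {z \<in> Gd. R z = R z0}"
        then have "nm z \<in> ?Y" "z \<in> ?Z" "\<forall>v\<in>{1..d}. z v \<in> nm z v" using nmY[of z] nm[of _ z] by (auto simp: Gd_def)
        then show "z \<in> (\<Union>y\<in>?Y. {z \<in> ?Z. \<forall>v\<in>{1..d}. z v \<in> y v})" by blast
      qed
      then have "sum (prod_weight d w) {z \<in> Gd. R z = R z0} \<le> sum (prod_weight d w) (\<Union>y\<in>?Y. {z \<in> ?Z. \<forall>v\<in>{1..d}. z v \<in> y v})"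
        by (intro sum_mono2 finite_UN_I finY finite_Collect_conjI disjI1 prod_weight_nonneg w finZ) (use finZ in simp)
      also have "\<dots> \<le> (\<Sum>y\<in>?Y. sum (prod_weight d w) {z \<in> ?Z. \<forall>v\<in>{1..d}. z v \<in> y v})"
        by (rule sum_UN_le[OF finY _ prod_weight_nonneg[OF w]]) (use finZ in simp)
      also have "\<dots> \<le> (\<Sum>y\<in>?Y. exp (- (real d * (\<Sum>A\<in>\<alpha>. (measure \<kappa> A - 2 * \<tau>) * - ln (measure \<kappa> A)))))"
      proof (rule sum_mono)
        fix y assume y: "y \<in> ?Y"
        have yv: "y v \<in> \<alpha>" if "v \<in> {1..d}" for v using y that by blast
        have "sum (prod_weight d w) {z \<in> ?Z. \<forall>v\<in>{1..d}. z v \<in> y v} = (\<Sum>z\<in>?Z. prod_weight d w z * of_bool (\<forall>v\<in>{1..d}. z v \<in> y v))"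
        proof -
          have "(\<Sum>z\<in>?Z. prod_weight d w z * of_bool (\<forall>v\<in>{1..d}. z v \<in> y v)) = (\<Sum>z\<in>?Z. if \<forall>v\<in>{1..d}. z v \<in> y v then prod_weight d w z else 0)"
            by (rule sum.cong) auto
          then show ?thesis by (simp only: sum.inter_filter[OF finZ])
        qed
        also have "\<dots> = (\<Prod>v\<in>{1..d}. \<Sum>c\<in>K \<inter> y v. w c)" by (rule prob_box[OF K(1) w1 subset_refl])
        also have "\<dots> = (\<Prod>v\<in>{1..d}. measure \<kappa> (y v))"
        proof (rule prod.cong[OF refl])
          fix v assume v: "v \<in> {1..d}"
          show "(\<Sum>c\<in>K \<inter> y v. w c) = measure \<kappa> (y v)"
          proof (rule is_modelD(4)[OF model])
            show "y v \<in> sets \<kappa>" using yv[OF v] a(2) by blast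
            have "(units H, y v) \<in> J" unfolding J_def using yv[OF v] by blast
            then have "y v \<in> snd ` J" by force
            then show "c' \<in> y v" if "\<And>S. S \<in> snd ` J \<Longrightarrow> c \<in> S \<longleftrightarrow> c' \<in> S" "c \<in> y v" for c c' using that by blast
          qed
        qed
        also have "\<dots> \<le> exp (- (real d * (\<Sum>A\<in>\<alpha>. (measure \<kappa> A - 2 * \<tau>) * - ln (measure \<kappa> A))))"
          by (rule prod_type_le[OF a(1) yv]) (use y in auto)
        finally show "sum (prod_weight d w) {z \<in> ?Z. \<forall>v\<in>{1..d}. z v \<in> y v} \<le> exp (- (real d * (\<Sum>A\<in>\<alpha>. (measure \<kappa> A - 2 * \<tau>) * - ln (measure \<kappa> A))))" .
      qed
      also have "(\<Sum>A\<in>\<alpha>. (measure \<kappa> A - 2 * \<tau>) * - ln (measure \<kappa> A)) = part_entropy \<kappa> \<alpha> - 2 * \<Lambda> * \<tau>"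
        unfolding part_entropy_def \<Lambda>_def
        by (simp add: left_diff_distrib sum_subtractf sum_distrib_left sum_distrib_right sum_negf algebra_simps)
      also have "(\<Sum>y\<in>?Y. exp (- (real d * (part_entropy \<kappa> \<alpha> - 2 * \<Lambda> * \<tau>)))) = real (card ?Y) * exp (- (real d * (part_entropy \<kappa> \<alpha> - 2 * \<Lambda> * \<tau>)))"
        by simp
      also have "\<dots> \<le> exp (real d * (\<theta> * ln (1 / t) + t * real (card \<alpha>))) * exp (- (real d * (part_entropy \<kappa> \<alpha> - 2 * \<Lambda> * \<tau>)))"
      proof (rule mult_right_mono)
        have "real (card ?Y) \<le> real (card ?Ball)" using finB by (intro of_nat_mono card_mono) auto
        also have "\<dots> \<le> exp (real d * (\<theta> * ln (1 / t) + t * real (card \<alpha>)))"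
          by (rule card_hamming_ball[OF a(1) nmE[OF z0] t])
        finally show "real (card ?Y) \<le> exp (real d * (\<theta> * ln (1 / t) + t * real (card \<alpha>)))" .
      qed simp
      also have "\<dots> = exp (real d * (\<theta> * Lt + t * real (card \<alpha>) - part_entropy \<kappa> \<alpha> + 2 * \<Lambda> * \<tau>))"
        unfolding Lt_def exp_add[symmetric] by (simp add: algebra_simps)
      also have "\<dots> \<le> b"
      proof -
        have "(6 * real (card \<alpha>) * Lt) * \<tau> \<le> min \<delta> \<epsilon> / 8" by (rule c\<tau>) (use Lt0 \<Lambda>0 in \<open>simp add: C_def\<close>)
        then have "\<theta> * Lt \<le> \<epsilon> / 8" unfolding \<theta>_def by (simp add: mult.assoc mult.commute[of Lt])
        moreover have "(2 * \<Lambda>) * \<tau> \<le> min \<delta> \<epsilon> / 8" by (rule c\<tau>) (use Lt0 \<Lambda>0 in \<open>simp add: C_def\<close>)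
        then have "2 * \<Lambda> * \<tau> \<le> \<epsilon> / 8" by simp
        ultimately show ?thesis unfolding b_def exp_le_cancel_iff
          using t\<alpha> d by (intro mult_left_mono) auto
      qed
      finally show ?thesis .
    qed

    \<comment> \<open>Counting the restrictions\<close>
    have "sum (prod_weight d w) Gd = (\<Sum>\<rho>\<in>R ` Gd. sum (prod_weight d w) {z \<in> Gd. R z = \<rho>})" by (rule sum.image_gen[OF finGd])
    also have "\<dots> \<le> (\<Sum>\<rho>\<in>R ` Gd. b)" by (rule sum_mono) (use cls in auto)
    also have "\<dots> = real (card (R ` Gd)) * b" by simp
    \<comment> \<open>The good labelings weigh at least 1/2 together, and those with a common
      restriction at most \<open>b\<close>.\<close>
    finally have half: "1 / 2 \<le> real (card (R ` Gd)) * b" using WGd by linarith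
    have "card (R ` Gd) \<le> approx_homs_count H (bernoulli_gpd H \<kappa>) \<mu> bernoulli_proj d (lift_part \<alpha>) P F \<delta> \<sigma>"
      unfolding approx_homs_count_def
    proof (rule card_mono)
      have "finite (sigma_sets B0 N)" unfolding sigma_sets_partition[OF Np(2,1)] using Np(2) by simp
      then have "finite (set_homs (bernoulli_gpd H \<kappa>) (sigma_sets B0 N) d)" by (rule finite_set_homs)
      then show "finite ((\<lambda>\<phi>. restrict \<phi> (part_sigma (bernoulli_gpd H \<kappa>) (lift_part \<alpha>))) `
          approx_homs H (bernoulli_gpd H \<kappa>) \<mu> bernoulli_proj d \<sigma> P F \<delta>)"
        unfolding approx_homs_def N_def[symmetric] units_bernoulli by simp
      show "R ` Gd \<subseteq> (\<lambda>\<phi>. restrict \<phi> (part_sigma (bernoulli_gpd H \<kappa>) (lift_part \<alpha>))) `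
          approx_homs H (bernoulli_gpd H \<kappa>) \<mu> bernoulli_proj d \<sigma> P F \<delta>"
        unfolding R_def using approx by blast
    qed
    then have le: "real (card (R ` Gd)) \<le> real (approx_homs_count H (bernoulli_gpd H \<kappa>) \<mu> bernoulli_proj d (lift_part \<alpha>) P F \<delta> \<sigma>)"
      by simp
    have "exp (real d * (part_entropy \<kappa> \<alpha> - \<epsilon>)) \<le> 1 / 2 * exp (real d * (part_entropy \<kappa> \<alpha> - 3 * \<epsilon> / 8))"
    proof -
      have "2 * ln 2 / \<epsilon> \<le> real d" using d0 unfolding d0_def by linarith
      then have "2 * ln 2 \<le> real d * \<epsilon>" using \<epsilon> by (simp add: field_simps)
      then have "real d * (part_entropy \<kappa> \<alpha> - \<epsilon>) \<le> - ln 2 + real d * (part_entropy \<kappa> \<alpha> - 3 * \<epsilon> / 8)"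
        by (rule exponent_slack) (use \<epsilon> in simp)
      then have "exp (real d * (part_entropy \<kappa> \<alpha> - \<epsilon>)) \<le> exp (- ln 2 + real d * (part_entropy \<kappa> \<alpha> - 3 * \<epsilon> / 8))" by simp
      moreover have "exp (- ln 2 :: real) = 1 / 2" by (simp add: exp_minus)
      ultimately show ?thesis by (simp only: exp_add)
    qed
    also have "\<dots> \<le> real (card (R ` Gd)) * b * exp (real d * (part_entropy \<kappa> \<alpha> - 3 * \<epsilon> / 8))"
      using half by (intro mult_right_mono) auto
    also have "\<dots> = real (card (R ` Gd)) * exp (real d * (3 * \<epsilon> / 8 - part_entropy \<kappa> \<alpha>) + real d * (part_entropy \<kappa> \<alpha> - 3 * \<epsilon> / 8))"
      unfolding b_def exp_add by simp
    also have "\<dots> = real (card (R ` Gd))" by (simp add: algebra_simps)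
    also note le
    finally show "exp (real d * (part_entropy \<kappa> \<alpha> - \<epsilon>)) \<le>
        real (approx_homs_count H (bernoulli_gpd H \<kappa>) \<mu> bernoulli_proj d (lift_part \<alpha>) P F \<delta> \<sigma>)" .
  qed
qed

end

section \<open>The upper bound\<close>

lemma saturatedI:
  assumes N: "partition_on \<Omega> N" and X: "X \<subseteq> \<Omega>"
    and "\<And>D x y. D \<in> N \<Longrightarrow> x \<in> D \<Longrightarrow> y \<in> D \<Longrightarrow> x \<in> X \<Longrightarrow> y \<in> X"
  shows "X = \<Union>{D \<in> N. D \<subseteq> X}"
proof
  show "X \<subseteq> \<Union>{D \<in> N. D \<subseteq> X}"
  proof
    fix x assume x: "x \<in> X"
    then obtain D where D: "D \<in> N" "x \<in> D" using X partition_onD1[OF N] by blast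
    then have "D \<subseteq> X" using assms(3)[OF D _ x] by blast
    then show "x \<in> \<Union>{D \<in> N. D \<subseteq> X}" using D by blast
  qed
qed blast

text \<open>The images of the blocks are disjoint and cover all vertices, so each vertex lies in the
  image of exactly one block. A point chosen in that block presents the homomorphism as an inverse
  image map.\<close>

lemma hom_points:
  assumes N: "finite N" "partition_on (units G) N"
    and \<phi>: "\<phi> \<in> set_homs G (sigma_sets (units G) N) d"
  obtains pt where "\<And>v. v \<in> {1..d} \<Longrightarrow> pt v \<in> units G"
    "\<And>X. X = \<Union>{D \<in> N. D \<subseteq> X} \<Longrightarrow> \<phi> X = {v \<in> {1..d}. pt v \<in> X}"
proof -
  let ?\<Sigma> = "sigma_sets (units G) N"
  have \<Sigma>: "?\<Sigma> = \<Union> ` Pow N" by (rule sigma_sets_partition[OF N])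
  have U: "\<Union>C \<in> ?\<Sigma>" if "C \<subseteq> N" for C unfolding \<Sigma> using that by blast
  have hom: "\<phi> \<in> ?\<Sigma> \<rightarrow>\<^sub>E Pow {1..d}" "\<And>A B. A \<in> ?\<Sigma> \<Longrightarrow> B \<in> ?\<Sigma> \<Longrightarrow> \<phi> (A \<union> B) = \<phi> A \<union> \<phi> B"
    "\<And>A B. A \<in> ?\<Sigma> \<Longrightarrow> B \<in> ?\<Sigma> \<Longrightarrow> \<phi> (A \<inter> B) = \<phi> A \<inter> \<phi> B" "\<phi> {} = {}" "\<phi> (units G) = {1..d}"
    using \<phi> unfolding set_homs_def by auto
  have \<phi>U: "\<phi> (\<Union>C) = (\<Union>D\<in>C. \<phi> D)" if "C \<subseteq> N" for C
  proof -
    have "finite C" using that N(1) finite_subset by blast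
    then show ?thesis using that
    proof (induction C rule: finite_induct)
      case empty then show ?case using hom(4) by simp
    next
      case (insert D C)
      have "\<phi> (D \<union> \<Union>C) = \<phi> D \<union> \<phi> (\<Union>C)"
        by (rule hom(2)) (use insert.prems U[of C] in \<open>auto intro: sigma_sets.Basic\<close>)
      then show ?case using insert by simp
    qed
  qed
  have disj: "\<phi> D \<inter> \<phi> D' = {}" if "D \<in> N" "D' \<in> N" "D \<noteq> D'" for D D'
  proof -
    have "D \<inter> D' = {}" using disjointD[OF partition_onD2[OF N(2)]] that by blast
    moreover have "\<phi> (D \<inter> D') = \<phi> D \<inter> \<phi> D'" by (rule hom(3)) (use that in \<open>auto intro: sigma_sets.Basic\<close>)
    ultimately show ?thesis using hom(4) by simp
  qed
  have all: "(\<Union>D\<in>N. \<phi> D) = {1..d}" using \<phi>U[of N] hom(5) partition_onD1[OF N(2)] by simp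
  have "\<exists>D. \<forall>v\<in>{1..d}. D v \<in> N \<and> v \<in> \<phi> (D v)" by (rule bchoice) (use all in blast)
  then obtain D where D: "\<And>v. v \<in> {1..d} \<Longrightarrow> D v \<in> N \<and> v \<in> \<phi> (D v)" by blast
  define pt where "pt v = (SOME y. y \<in> D v)" for v
  have pt: "pt v \<in> D v" if "v \<in> {1..d}" for v
    unfolding pt_def using partition_onD3[OF N(2)] D[OF that] by (metis someI_ex all_not_in_conv)
  have "\<phi> X = {v \<in> {1..d}. pt v \<in> X}" if X: "X = \<Union>{D \<in> N. D \<subseteq> X}" for X
  proof -
    have 1: "\<phi> X = (\<Union>D\<in>{D \<in> N. D \<subseteq> X}. \<phi> D)"
      using \<phi>U[of "{D \<in> N. D \<subseteq> X}"] X by auto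
    have "v \<in> \<phi> X \<longleftrightarrow> pt v \<in> X" if v: "v \<in> {1..d}" for v
    proof
      assume "v \<in> \<phi> X"
      then obtain E where E: "E \<in> N" "E \<subseteq> X" "v \<in> \<phi> E" unfolding 1 by blast
      then have "E = D v" using disj[OF E(1), of "D v"] D[OF v] by blast
      then show "pt v \<in> X" using pt[OF v] E by blast
    next
      assume "pt v \<in> X"
      then obtain E where E: "E \<in> N" "E \<subseteq> X" "pt v \<in> E" by (rule saturatedD[OF X])
      then have "E = D v" using disjointD[OF partition_onD2[OF N(2)], of E "D v"] D[OF v] pt[OF v] by blast
      then show "v \<in> \<phi> X" unfolding 1 using E D[OF v] by blast
    qed
    moreover have "\<phi> X \<subseteq> {1..d}" unfolding 1 using all by blast
    ultimately show ?thesis by blast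
  qed
  moreover have "pt v \<in> units G" if "v \<in> {1..d}" for v using pt[OF that] D[OF that] partition_onD1[OF N(2)] by blast
  ultimately show ?thesis using that by blast
qed

lemma refines_atoms_generator:
  assumes "partition_on \<Omega> Q" "Q \<subseteq> \<S>"
  shows "refines \<Omega> (atoms \<Omega> \<S>) Q"
  unfolding refines_def
proof (intro conjI partition_on_atoms assms(1) ballI)
  fix X assume "X \<in> atoms \<Omega> \<S>"
  then obtain x where x: "x \<in> \<Omega>" "X = {y \<in> \<Omega>. \<forall>S\<in>\<S>. x \<in> S \<longleftrightarrow> y \<in> S}" unfolding atoms_def by blast
  obtain q where q: "q \<in> Q" "x \<in> q" using x(1) partition_onD1[OF assms(1)] by blast
  have "q \<in> \<S>" using q(1) assms(2) by blast
  then have "X \<subseteq> q" unfolding x(2) using q(2) by blast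
  then show "\<exists>Y\<in>Q. X \<subseteq> Y" using q(1) by blast
qed

context bernoulli begin

text \<open>Closeness of the frequencies is summed over all blocks, so it bounds every union of
  blocks with the same \<delta>, however many blocks are involved.\<close>

lemma card_hom_le:
  assumes N: "finite N" "N \<subseteq> sets BS" "partition_on B0 N"
    and pt: "\<And>X. X = \<Union>{D \<in> N. D \<subseteq> X} \<Longrightarrow> \<phi> X = {v \<in> {1..d}. pt v \<in> X}"
    and close: "(\<Sum>B\<in>N. \<bar>real (card (\<phi> B)) / real d - measure \<mu> B\<bar>) < \<delta>"
    and X: "X = \<Union>{D \<in> N. D \<subseteq> X}" and d: "d \<ge> 1"
  shows "real (card {v \<in> {1..d}. pt v \<in> X}) \<le> (measure \<mu> X + \<delta>) * real d"
proof -
  interpret m: prob_space \<mu> by (rule prob_\<mu>)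
  let ?C = "{D \<in> N. D \<subseteq> X}"
  have fin: "finite ?C" using N(1) by simp
  have \<mu>X: "measure \<mu> X = (\<Sum>D\<in>?C. measure \<mu> D)"
  proof -
    have "measure \<mu> (\<Union>D\<in>?C. D) = (\<Sum>D\<in>?C. measure \<mu> D)"
    proof (rule m.finite_measure_finite_Union[OF fin])
      show "(\<lambda>D. D) ` ?C \<subseteq> sets \<mu>" using N(2) sets_\<mu> by auto
      show "disjoint_family_on (\<lambda>D. D) ?C"
        using disjointD[OF partition_onD2[OF N(3)]] unfolding disjoint_family_on_def by blast
    qed
    then show ?thesis using X by simp
  qed
  have sub: "{v \<in> {1..d}. pt v \<in> X} \<subseteq> (\<Union>D\<in>?C. \<phi> D)"
  proof
    fix v assume v: "v \<in> {v \<in> {1..d}. pt v \<in> X}"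
    then obtain D where D: "D \<in> N" "D \<subseteq> X" "pt v \<in> D" using saturatedD[OF X, of "pt v"] by blast
    have "D = \<Union>{D' \<in> N. D' \<subseteq> D}" using D(1) by blast
    from pt[OF this] show "v \<in> (\<Union>D\<in>?C. \<phi> D)" using D v by blast
  qed
  have fin\<phi>: "finite (\<phi> D)" if "D \<in> N" for D
  proof -
    have "D = \<Union>{D' \<in> N. D' \<subseteq> D}" using that by blast
    from pt[OF this] show ?thesis by simp
  qed
  have "card {v \<in> {1..d}. pt v \<in> X} \<le> card (\<Union>D\<in>?C. \<phi> D)"
    by (rule card_mono[OF _ sub]) (use fin fin\<phi> in auto)
  also have "\<dots> \<le> (\<Sum>D\<in>?C. card (\<phi> D))" by (rule card_UN_le[OF fin])
  finally have "real (card {v \<in> {1..d}. pt v \<in> X}) \<le> (\<Sum>D\<in>?C. real (card (\<phi> D)))"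
    by (simp only: of_nat_sum[symmetric] of_nat_le_iff)
  then have "real (card {v \<in> {1..d}. pt v \<in> X}) / real d \<le> (\<Sum>D\<in>?C. real (card (\<phi> D))) / real d"
    by (rule divide_right_mono) simp
  also have "\<dots> = (\<Sum>D\<in>?C. real (card (\<phi> D)) / real d)" by (rule sum_divide_distrib)
  also have "\<dots> \<le> (\<Sum>D\<in>?C. measure \<mu> D + \<bar>real (card (\<phi> D)) / real d - measure \<mu> D\<bar>)"
    by (rule sum_mono) linarith
  also have "\<dots> = measure \<mu> X + (\<Sum>D\<in>?C. \<bar>real (card (\<phi> D)) / real d - measure \<mu> D\<bar>)"
    unfolding \<mu>X by (rule sum.distrib)
  also have "(\<Sum>D\<in>?C. \<bar>real (card (\<phi> D)) / real d - measure \<mu> D\<bar>) \<le> (\<Sum>B\<in>N. \<bar>real (card (\<phi> B)) / real d - measure \<mu> B\<bar>)"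
    by (rule sum_mono2) (use N(1) in auto)
  finally have "real (card {v \<in> {1..d}. pt v \<in> X}) / real d \<le> measure \<mu> X + \<delta>" using close by linarith
  then show ?thesis using d by (simp add: field_simps)
qed

lemma bis_prod_units_left:
  assumes g: "g \<in> bisections H"
  shows "bis_prod H (units H) g = g"
proof (intro set_eqI iffI)
  fix h assume "h \<in> bis_prod H (units H) g"
  then obtain x a where h: "h = cmp H x a" "x \<in> units H" "a \<in> g" "(x, a) \<in> composable H" unfolding bis_prod_def by blast
  have "x = rng H a" using h(2,4) by (simp add: composable_def src_unit)
  then show "h \<in> g" using h(1,3) rng_cmp_left[OF bis_in[OF g h(3)]] by simp
next
  fix h assume h: "h \<in> g"
  have "(rng H h, h) \<in> composable H" unfolding composable_def
    using bis_in[OF g h] rng_in units_subset by (auto simp: src_unit)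
  moreover have "h = cmp H (rng H h) h" using rng_cmp_left[OF bis_in[OF g h]] by simp
  ultimately show "h \<in> bis_prod H (units H) g"
    unfolding bis_prod_def using h rng_in[OF bis_in[OF g h]] by blast
qed

lemma cyl_as_act:
  assumes g: "g \<in> bisections H"
  shows "cyl H \<kappa> g A = act (ginv H ` g) (cyl H \<kappa> (units H) A)"
proof -
  have "ginv H ` ginv H ` g = g" using bis_in[OF g] by (force simp: image_image ginv_ginv)
  then show ?thesis using act_cyl[OF bis_ginv[OF g] units_bis, of A] bis_prod_units_left[OF g] by simp
qed

text \<open>An approximate homomorphism is determined up to a small Hamming error by its values on the
  partition by the coordinate at the unit, since a cylinder over \<open>g\<close> is a translate of one over the units.
  The bound holds for every \<open>\<sigma>\<close>.\<close>

lemma upper_count: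
  assumes Q: "Q \<in> finite_borel_partitions (bernoulli_gpd H \<kappa>) \<mu>" and \<epsilon>: "\<epsilon> > 0"
  obtains \<alpha> P F \<delta> where "base_partition \<alpha>" "P \<in> finite_borel_partitions (bernoulli_gpd H \<kappa>) \<mu>"
    "refines B0 P Q" "finite F" "F \<subseteq> bisections H" "units H \<in> F" "\<delta> > 0"
    "\<And>d \<sigma>. d \<ge> 1 \<Longrightarrow> \<sigma> \<in> sofic_maps H d \<Longrightarrow>
      real (approx_homs_count H (bernoulli_gpd H \<kappa>) \<mu> bernoulli_proj d Q P F \<delta> \<sigma>)
        \<le> exp (real d * (part_entropy \<kappa> \<alpha> + \<epsilon>))"
proof -
  interpret m: prob_space \<mu> by (rule prob_\<mu>)
  interpret k: prob_space \<kappa> by (rule prob_\<kappa>)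
  have Qp: "finite Q" "Q \<subseteq> sets BS" "partition_on B0 Q"
    using Q unfolding finite_borel_partitions_def by (auto simp: sets_\<mu> units_bernoulli)

  \<comment> \<open>Constants\<close>
  define t where "t = min 1 (\<epsilon> / (8 * (real (card Q) + 1)))"
  have t: "0 < t" "t \<le> 1" unfolding t_def using \<epsilon> by auto
  have tQ: "t * real (card Q) \<le> \<epsilon> / 8"
  proof -
    have "t * real (card Q) \<le> \<epsilon> / (8 * (real (card Q) + 1)) * (real (card Q) + 1)"
      unfolding t_def using \<epsilon> by (intro mult_mono) auto
    also have "\<dots> = \<epsilon> / 8" using \<epsilon> by (simp add: field_simps)
    finally show ?thesis .
  qed
  define Lt where "Lt = ln (1 / t)"
  have Lt0: "Lt \<ge> 0" unfolding Lt_def using t by simp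
  \<comment> \<open>The Hamming radius will be \<open>2 * \<tau>\<close>, and the corresponding
    exponent \<open>2 * \<tau> * ln (1 / t)\<close> must be small for the \<open>t\<close> already
    chosen.\<close>
  define \<tau> where "\<tau> = \<epsilon> / (16 * (Lt + 1))"
  have \<tau>: "\<tau> > 0" unfolding \<tau>_def using \<epsilon> Lt0 by simp
  have \<tau>L: "2 * \<tau> * Lt \<le> \<epsilon> / 8"
  proof -
    have "2 * \<tau> * Lt \<le> 2 * \<tau> * (Lt + 1)" using \<tau> by (intro mult_left_mono) auto
    also have "\<dots> = \<epsilon> / 8" unfolding \<tau>_def using Lt0 by (simp add: field_simps)
    finally show ?thesis .
  qed
  have uf: "finite {units H}" "{units H} \<subseteq> bisections H" using units_bis by auto

  \<comment> \<open>The code, the label partition, the refinement and the window\<close>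
  obtain I T where I: "finite I" "I \<subseteq> idx" and T: "\<And>a. T a \<in> Q"
    and Bad: "{y \<in> B0. y \<notin> T (code I y)} \<in> sets BS"
      "\<And>f. f \<in> {units H} \<Longrightarrow> measure \<mu> (act f {y \<in> B0. y \<notin> T (code I y)}) < \<tau>"
    using partition_approx[OF Qp uf \<tau>, of "{}"] by auto
  let ?Bad = "{y \<in> B0. y \<notin> T (code I y)}"
  have Bad_units: "measure \<mu> ?Bad < \<tau>" using Bad(2) act_units[of ?Bad] by auto
  \<comment> \<open>The code of a point depends on the label at each position only through its block
    of \<alpha>.\<close>
  define \<alpha> where "\<alpha> = atoms (space \<kappa>) (snd ` I)"
  have sndI: "finite (snd ` I)" "snd ` I \<subseteq> sets \<kappa>" using I by auto
  have a: "finite \<alpha>" "\<alpha> \<subseteq> sets \<kappa>" "partition_on (space \<kappa>) \<alpha>"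
    unfolding \<alpha>_def using finite_atoms[OF sndI(1)] atoms_sets[OF sndI refl] partition_on_atoms by auto
  then have \<alpha>: "base_partition \<alpha>" unfolding base_partition_def by simp
  have lp: "finite (lift_part \<alpha>)" "lift_part \<alpha> \<subseteq> sets BS" "partition_on B0 (lift_part \<alpha>)"
    using lift_part_fbp[OF \<alpha>] unfolding finite_borel_partitions_def by (auto simp: sets_\<mu> units_bernoulli)
  \<comment> \<open>The coarsest common refinement of \<open>Q\<close> and of the partition by the
    coordinate at the unit.\<close>
  define P where "P = atoms B0 (Q \<union> lift_part \<alpha>)"
  have finQl: "finite (Q \<union> lift_part \<alpha>)" "Q \<union> lift_part \<alpha> \<subseteq> sets BS" using Qp lp by auto
  have Pp: "finite P" "P \<subseteq> sets BS" "partition_on B0 P"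
    unfolding P_def using finite_atoms[OF finQl(1)] atoms_sets[OF finQl] partition_on_atoms by (auto simp: space_BS)
  have P: "P \<in> finite_borel_partitions (bernoulli_gpd H \<kappa>) \<mu>"
    unfolding finite_borel_partitions_def using Pp by (simp add: sets_\<mu> units_bernoulli)
  have PQ: "refines B0 P Q" unfolding P_def by (rule refines_atoms_generator[OF Qp(3)]) simp
  have Pl: "refines B0 P (lift_part \<alpha>)" unfolding P_def by (rule refines_atoms_generator[OF lp(3)]) simp
  \<comment> \<open>Inverses, because the cylinder over g is the translate of a cylinder over the
    units by the inverse of g.\<close>
  define F where "F = insert (units H) ((\<lambda>i. ginv H ` fst i) ` I)"
  have F: "finite F" "F \<subseteq> bisections H" "units H \<in> F"
    unfolding F_def using I units_bis bis_ginv by auto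

  \<comment> \<open>Saturated sets\<close>
  define N where "N = act_partition H (bernoulli_gpd H \<kappa>) bernoulli_proj P F"
  note Np = act_partition_props[OF F(1,2) P, folded N_def]
  let ?sat = "\<lambda>X. X = \<Union>{D \<in> N. D \<subseteq> X}"
  have satUn: "?sat (\<Union>\<X>)" if "\<And>X. X \<in> \<X> \<Longrightarrow> ?sat X" for \<X>
  proof
    show "\<Union>\<X> \<subseteq> \<Union>{D \<in> N. D \<subseteq> \<Union>\<X>}"
    proof
      fix x assume "x \<in> \<Union>\<X>"
      then obtain X where X: "X \<in> \<X>" "x \<in> X" by blast
      have sX: "?sat X" by (rule that[OF X(1)])
      obtain D where "D \<in> N" "D \<subseteq> X" "x \<in> D" by (rule saturatedD[OF sX X(2)])
      then show "x \<in> \<Union>{D \<in> N. D \<subseteq> \<Union>\<X>}" using X by blast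
    qed
  qed blast
  have sat_act: "?sat (act f B)" if "f \<in> F" "B \<in> P" for f B using Np(4)[OF that] .
  have sat_P: "?sat B" if "B \<in> P" for B
    using sat_act[OF F(3) that] act_units[of B] sets_BS_sub Pp(2) that by auto
  have sat_Q: "?sat q" if "q \<in> Q" for q
  proof -
    have "?sat (\<Union>{B \<in> P. B \<subseteq> q})" by (rule satUn) (use sat_P in blast)
    then show ?thesis using refines_Union[OF PQ that] by simp
  qed
  let ?Y = "\<lambda>S. cyl H \<kappa> (units H) S"
  have Y\<alpha>: "?Y S = \<Union>(?Y ` {A \<in> \<alpha>. A \<subseteq> S})" if "S \<in> snd ` I" for S
  proof -
    have "S = \<Union>{A \<in> \<alpha>. A \<subseteq> S}"
      unfolding \<alpha>_def by (rule atoms_Union[OF that]) (use sndI that sets.sets_into_space in blast)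
    then have "(x, \<omega>) \<in> ?Y S \<longleftrightarrow> (x, \<omega>) \<in> \<Union>(?Y ` {A \<in> \<alpha>. A \<subseteq> S})" for x \<omega>
      unfolding cyl_units by auto
    then show ?thesis by auto
  qed
  have YP: "?Y A = \<Union>{B \<in> P. B \<subseteq> ?Y A}" if "A \<in> \<alpha>" for A
    by (rule refines_Union[OF Pl]) (use that in \<open>auto simp: lift_part_def\<close>)
  have YSP: "?Y S = \<Union>{B \<in> P. B \<subseteq> ?Y S}" if S: "S \<in> snd ` I" for S
  proof (rule saturatedI[OF Pp(3) cyl_subset])
    fix B x y assume B: "B \<in> P" "x \<in> B" "y \<in> B" "x \<in> ?Y S"
    then obtain A where A: "A \<in> \<alpha>" "A \<subseteq> S" "x \<in> ?Y A" unfolding Y\<alpha>[OF S] by blast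
    have "y \<in> ?Y A" using partition_cell_iff[OF Pp(3) YP[OF A(1)] B(1-3)] A(3) by simp
    then show "y \<in> ?Y S" unfolding Y\<alpha>[OF S] using A by blast
  qed
  have sat_Y: "?sat (?Y A)" if "A \<in> \<alpha>" for A
  proof -
    have "?sat (\<Union>{B \<in> P. B \<subseteq> ?Y A})" by (rule satUn) (use sat_P in blast)
    then show ?thesis using YP[OF that] by simp
  qed
  have Ib: "fst i \<in> bisections H" "ginv H ` fst i \<in> F" "snd i \<in> snd ` I" if "i \<in> I" for i
    using that I(2) unfolding F_def by auto
  have cylP: "cyl H \<kappa> (fst i) (snd i) = (\<Union>B\<in>{B \<in> P. B \<subseteq> ?Y (snd i)}. act (ginv H ` fst i) B)" if "i \<in> I" for i
    unfolding cyl_as_act[OF Ib(1)[OF that]] act_Union[symmetric] using YSP[OF Ib(3)[OF that]] by simp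
  have sat_cyl: "?sat (cyl H \<kappa> (fst i) (snd i))" if "i \<in> I" for i
    unfolding cylP[OF that] by (rule satUn) (use sat_act Ib(2)[OF that] in blast)
  have code_cyl: "code I y = {i \<in> I. y \<in> cyl H \<kappa> (fst i) (snd i)}" if "y \<in> B0" for y
    using that unfolding code_def hits_def cyl_def by auto
  have NB: "D \<subseteq> B0" if "D \<in> N" for D using partition_onD1[OF Np(1)] that by blast
  \<comment> \<open>The code and membership in a block of \<open>Q\<close> are constant on the
    blocks of \<open>N\<close>; therefore approximate homomorphisms also control the frequency of
    wrong guesses.\<close>
  have sat_Bad: "?sat ?Bad"
  proof (rule saturatedI[OF Np(1)])
    fix D x y assume D: "D \<in> N" "x \<in> D" "y \<in> D" and x: "x \<in> ?Bad"
    have B: "x \<in> B0" "y \<in> B0" using D NB by auto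
    have "x \<in> cyl H \<kappa> (fst i) (snd i) \<longleftrightarrow> y \<in> cyl H \<kappa> (fst i) (snd i)" if "i \<in> I" for i
      by (rule partition_cell_iff[OF Np(1) sat_cyl[OF that] D])
    then have "code I x = code I y" unfolding code_cyl[OF B(1)] code_cyl[OF B(2)] by blast
    moreover have "x \<in> T (code I y) \<longleftrightarrow> y \<in> T (code I y)"
      by (rule partition_cell_iff[OF Np(1) sat_Q[OF T] D])
    ultimately show "y \<in> ?Bad" using x B(2) by auto
  qed blast

  \<comment> \<open>Smoothed label frequencies and the choice of \<delta>\<close>
  define n where "n = real (card \<alpha>)"
  define \<eta> where "\<eta> = \<epsilon> / (8 * (n + 1))"
  have n0: "n \<ge> 0" unfolding n_def by simp
  have \<eta>: "\<eta> > 0" unfolding \<eta>_def using \<epsilon> n0 by simp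
  have n\<eta>: "n * \<eta> \<le> \<epsilon> / 8"
  proof -
    have "n * \<eta> \<le> (n + 1) * \<eta>" using \<eta> by (intro mult_right_mono) auto
    also have "\<dots> = \<epsilon> / 8" unfolding \<eta>_def using n0 by (simp add: field_simps)
    finally show ?thesis .
  qed
  define p where "p A = measure \<kappa> A" for A
  \<comment> \<open>The measures of the blocks, made strictly positive as
    \<open>card_type_class\<close> requires and normalised to total 1. The cost in the exponent is
    at most \<open>n * \<eta>\<close>.\<close>
  define q where "q A = (p A + \<eta>) / (1 + n * \<eta>)" for A
  have p0: "0 \<le> p A" "p A \<le> 1" for A unfolding p_def by auto
  have q0: "0 < q A" for A unfolding q_def using p0(1)[of A] \<eta> n0 by (intro divide_pos_pos add_nonneg_pos add_pos_nonneg) auto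
  have sump: "sum p \<alpha> = 1"
  proof -
    have "measure \<kappa> (\<Union>A\<in>\<alpha>. A) = (\<Sum>A\<in>\<alpha>. measure \<kappa> A)"
      by (rule k.finite_measure_finite_Union)
        (use a disjointD[OF partition_onD2[OF a(3)]] in \<open>auto simp: disjoint_family_on_def\<close>)
    then show ?thesis unfolding p_def using partition_onD1[OF a(3)] k.prob_space by simp
  qed
  have n\<eta>1: "1 + n * \<eta> > 0" using n0 \<eta> by (intro add_pos_nonneg mult_nonneg_nonneg) auto
  have sumq: "sum q \<alpha> \<le> 1"
  proof -
    have "sum q \<alpha> = (sum p \<alpha> + n * \<eta>) / (1 + n * \<eta>)"
      unfolding q_def n_def by (simp add: sum_divide_distrib[symmetric] sum.distrib)
    then show ?thesis using n\<eta>1 sump by simp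
  qed
  have lnq: "- ln (q A) \<ge> 0" if "A \<in> \<alpha>" for A
  proof -
    have "q A \<le> sum q \<alpha>" by (rule member_le_sum[OF that]) (use q0 a(1) in \<open>auto intro: less_imp_le\<close>)
    then show ?thesis using sumq q0[of A] by simp
  qed
  define \<Lambda> where "\<Lambda> = (\<Sum>A\<in>\<alpha>. - ln (q A))"
  have \<Lambda>0: "\<Lambda> \<ge> 0" unfolding \<Lambda>_def by (intro sum_nonneg lnq)
  have ent: "(\<Sum>A\<in>\<alpha>. p A * - ln (q A)) \<le> part_entropy \<kappa> \<alpha> + n * \<eta>"
  proof -
    have "p A * - ln (q A) \<le> - (p A * ln (p A)) + p A * (n * \<eta>)" for A
    proof (cases "p A = 0")
      case False
      then have pp: "p A > 0" using p0(1)[of A] by linarith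
      have "ln (p A) \<le> ln (p A + \<eta>)" using pp \<eta> by simp
      moreover have "ln (q A) = ln (p A + \<eta>) - ln (1 + n * \<eta>)"
        unfolding q_def using pp \<eta> n\<eta>1 by (simp add: ln_div)
      moreover have "ln (1 + n * \<eta>) \<le> n * \<eta>" using n0 \<eta> by (intro ln_add_one_self_le_self) auto
      ultimately have "- ln (q A) \<le> - ln (p A) + n * \<eta>" by linarith
      then have "p A * - ln (q A) \<le> p A * (- ln (p A) + n * \<eta>)" using pp by (intro mult_left_mono) auto
      then show ?thesis by (simp add: algebra_simps)
    qed simp
    then have "(\<Sum>A\<in>\<alpha>. p A * - ln (q A)) \<le> (\<Sum>A\<in>\<alpha>. - (p A * ln (p A)) + p A * (n * \<eta>))" by (intro sum_mono)
    also have "\<dots> = part_entropy \<kappa> \<alpha> + sum p \<alpha> * (n * \<eta>)"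
      unfolding part_entropy_def p_def sum.distrib sum_distrib_right ..
    finally show ?thesis using sump by simp
  qed
  \<comment> \<open>The first bound pays for the equivariance errors of the \<open>card I\<close>
    translates and for the frequency error of \<open>?Bad\<close>, the second for the frequency
    errors weighted by the logarithms of \<open>q\<close>.\<close>
  define \<delta> where "\<delta> = min (\<tau> / (real (card I) + 1)) (\<epsilon> / (8 * (\<Lambda> + 1)))"
  have \<delta>: "\<delta> > 0" unfolding \<delta>_def using \<tau> \<epsilon> \<Lambda>0 by simp
  have \<delta>\<tau>: "real (card I) * \<delta> + \<delta> \<le> \<tau>"
  proof -
    have "(real (card I) + 1) * \<delta> \<le> (real (card I) + 1) * (\<tau> / (real (card I) + 1))"
      unfolding \<delta>_def by (intro mult_left_mono) auto
    also have "\<dots> = \<tau>" by (simp add: add_nonneg_eq_0_iff)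
    finally show ?thesis by (simp add: algebra_simps)
  qed
  have \<delta>\<Lambda>: "\<delta> * \<Lambda> \<le> \<epsilon> / 8"
  proof -
    have "\<delta> * \<Lambda> \<le> \<epsilon> / (8 * (\<Lambda> + 1)) * (\<Lambda> + 1)"
      using \<Lambda>0 \<epsilon> unfolding \<delta>_def by (intro mult_mono) auto
    also have "\<dots> = \<epsilon> / 8" using \<Lambda>0 by (simp add: field_simps)
    finally show ?thesis .
  qed
  show ?thesis
  proof (rule that[OF \<alpha> P PQ F \<delta>])

    \<comment> \<open>Encoding approximate homomorphisms\<close>
    fix d \<sigma> assume d: "d \<ge> 1" and \<sigma>: "\<sigma> \<in> sofic_maps H d"
    have \<sigma>r: "s \<in> bisections H \<Longrightarrow> \<sigma> s \<subseteq> {1..d} \<times> {1..d}" for s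
      using \<sigma> partial_injD(1)[OF partial_inj_bisection] unfolding sofic_maps_def by blast
    \<comment> \<open>The predicted code at \<open>v\<close>: event \<open>i\<close> is predicted
      iff the image of the inverse of \<open>fst i\<close> carries to \<open>v\<close> a vertex
      whose label block lies in \<open>snd i\<close>. It depends on \<sigma> and the label blocks
      \<open>y\<close> but not on the homomorphism, so each \<open>y\<close> has a single prediction
      \<open>pred y\<close>.\<close>
    define c where "c y v = {i \<in> I. v \<in> fin_act (\<sigma> (ginv H ` fst i)) {u \<in> {1..d}. y u \<subseteq> snd i}}" for y :: "nat \<Rightarrow> 'k set" and v
    define pred where "pred y = (\<lambda>v\<in>{1..d}. T (c y v))" for y
    define Types where "Types = {y \<in> {1..d} \<rightarrow>\<^sub>E \<alpha>. \<forall>A\<in>\<alpha>. real (card {v \<in> {1..d}. y v = A}) \<le> (p A + \<delta>) * real d}"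
    \<comment> \<open>The radius is \<tau> for failures of equivariance and of frequencies, plus
      \<tau> for the measure of \<open>?Bad\<close>.\<close>
    define Ball where "Ball y = {l \<in> {1..d} \<rightarrow>\<^sub>E Q. real (card {v \<in> {1..d}. l v \<noteq> pred y v}) \<le> (2 * \<tau>) * real d}" for y
    define lab where "lab l = (\<lambda>X\<in>sigma_sets B0 Q. {v \<in> {1..d}. l v \<subseteq> X})" for l :: "nat \<Rightarrow> ('h \<times> ('h \<Rightarrow> 'k)) set"
    have finTypes: "finite Types" unfolding Types_def
      by (rule finite_subset[of _ "{1..d} \<rightarrow>\<^sub>E \<alpha>"]) (use a(1) in \<open>auto intro!: finite_PiE\<close>)
    have finBall: "finite (Ball y)" for y unfolding Ball_def
      by (rule finite_subset[of _ "{1..d} \<rightarrow>\<^sub>E Q"]) (use Qp(1) in \<open>auto intro!: finite_PiE\<close>)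
    let ?\<H> = "approx_homs H (bernoulli_gpd H \<kappa>) \<mu> bernoulli_proj d \<sigma> P F \<delta>"
    have main: "restrict \<phi> (sigma_sets B0 Q) \<in> lab ` (\<Union>y\<in>Types. Ball y)" if \<phi>: "\<phi> \<in> ?\<H>" for \<phi>
    proof -
      have h: "\<phi> \<in> set_homs (bernoulli_gpd H \<kappa>) (sigma_sets (units (bernoulli_gpd H \<kappa>)) N) d"
        and eq: "\<And>f. f \<in> F \<Longrightarrow> (\<Sum>B\<in>P. real (card (sym_diff (fin_act (\<sigma> f) (\<phi> B)) (\<phi> (act f B)))) / real d) < \<delta>"
        and ms: "(\<Sum>B\<in>N. \<bar>real (card (\<phi> B)) / real d - measure \<mu> B\<bar>) < \<delta>"
        using \<phi> unfolding approx_homs_def N_def[symmetric] by auto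
      obtain pt where ptB: "\<And>v. v \<in> {1..d} \<Longrightarrow> pt v \<in> B0"
        and pt: "\<And>X. ?sat X \<Longrightarrow> \<phi> X = {v \<in> {1..d}. pt v \<in> X}"
        by (rule hom_points[OF Np(2) Np(1)[folded units_bernoulli] h, unfolded units_bernoulli]) (rule that)
      have ch: "real (card {v \<in> {1..d}. pt v \<in> X}) \<le> (measure \<mu> X + \<delta>) * real d" if "?sat X" for X
        by (rule card_hom_le[OF Np(2,3,1) _ ms that d]) (rule pt)
      define y where "y = (\<lambda>v\<in>{1..d}. THE A. A \<in> \<alpha> \<and> pt v \<in> ?Y A)"
      have y: "y v \<in> \<alpha> \<and> pt v \<in> ?Y (y v) \<and> (\<forall>A\<in>\<alpha>. pt v \<in> ?Y A \<longleftrightarrow> A = y v)" if v: "v \<in> {1..d}" for v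
      proof -
        obtain x \<omega> where x: "pt v = (x, \<omega>)" by (cases "pt v")
        have b: "(x, \<omega>) \<in> B0" using ptB[OF v] x by simp
        then have "\<omega> x \<in> \<Union>\<alpha>" using B0_value partition_onD1[OF a(3)] by simp
        then obtain A where A: "A \<in> \<alpha>" "\<omega> x \<in> A" by blast
        have uniq: "A' = A" if "A' \<in> \<alpha>" "\<omega> x \<in> A'" for A'
          using disjointD[OF partition_onD2[OF a(3)], of A' A] A that by blast
        have iff: "pt v \<in> ?Y A' \<longleftrightarrow> \<omega> x \<in> A'" for A' unfolding x cyl_units using b by simp
        have "(THE A. A \<in> \<alpha> \<and> pt v \<in> ?Y A) = A" unfolding iff by (rule the_equality) (use A uniq in blast)+
        then have "y v = A" unfolding y_def using v by simp
        then show ?thesis unfolding iff using A uniq by blast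
      qed
      have yE: "y \<in> {1..d} \<rightarrow>\<^sub>E \<alpha>" using y unfolding y_def by auto
      have yT: "y \<in> Types" unfolding Types_def
      proof (intro CollectI conjI yE ballI)
        fix A assume A: "A \<in> \<alpha>"
        have "{v \<in> {1..d}. y v = A} = {v \<in> {1..d}. pt v \<in> ?Y A}" using y A by blast
        then show "real (card {v \<in> {1..d}. y v = A}) \<le> (p A + \<delta>) * real d"
          using ch[OF sat_Y[OF A]] measure_cyl_units A a(2) unfolding p_def by auto
      qed
      have yS: "pt v \<in> ?Y S \<longleftrightarrow> y v \<subseteq> S" if v: "v \<in> {1..d}" and S: "S \<in> snd ` I" for v S
      proof
        assume "pt v \<in> ?Y S"
        then obtain A where A: "A \<in> \<alpha>" "A \<subseteq> S" "pt v \<in> ?Y A" unfolding Y\<alpha>[OF S] by blast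
        then have "A = y v" using y[OF v] by blast
        then show "y v \<subseteq> S" using A by simp
      next
        assume "y v \<subseteq> S"
        then show "pt v \<in> ?Y S" unfolding Y\<alpha>[OF S] using y[OF v] by blast
      qed
      define ql where "ql = (\<lambda>v\<in>{1..d}. THE q. q \<in> Q \<and> pt v \<in> q)"
      have ql: "ql v \<in> Q \<and> pt v \<in> ql v \<and> (\<forall>q\<in>Q. pt v \<in> q \<longleftrightarrow> q = ql v)" if v: "v \<in> {1..d}" for v
      proof -
        obtain q where q: "q \<in> Q" "pt v \<in> q" using ptB[OF v] partition_onD1[OF Qp(3)] by blast
        have uniq: "q' = q" if "q' \<in> Q" "pt v \<in> q'" for q'
          using disjointD[OF partition_onD2[OF Qp(3)], of q' q] q that by blast
        have "(THE q. q \<in> Q \<and> pt v \<in> q) = q" by (rule the_equality) (use q uniq in blast)+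
        then have "ql v = q" unfolding ql_def using v by simp
        then show ?thesis using q uniq by blast
      qed
      have qlE: "ql \<in> {1..d} \<rightarrow>\<^sub>E Q" using ql unfolding ql_def by auto
      let ?f = "\<lambda>i. ginv H ` fst i"
      let ?E = "\<lambda>i B. sym_diff (fin_act (\<sigma> (?f i)) (\<phi> B)) (\<phi> (act (?f i) B))"
      have finE: "finite (?E i B)" if "i \<in> I" "B \<in> P" for i B
      proof -
        have "fin_act (\<sigma> (?f i)) (\<phi> B) \<subseteq> {1..d}" unfolding fin_act_def using \<sigma>r[OF bis_ginv[OF Ib(1)[OF that(1)]]] by blast
        then have "finite (fin_act (\<sigma> (?f i)) (\<phi> B))" by (rule finite_subset) simp
        moreover have "finite (\<phi> (act (?f i) B))" unfolding pt[OF sat_act[OF Ib(2)[OF that(1)] that(2)]] by simp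
        ultimately show ?thesis by simp
      qed
      have Esum: "real (card (\<Union>B\<in>P. ?E i B)) \<le> \<delta> * real d" if i: "i \<in> I" for i
      proof -
        have "card (\<Union>B\<in>P. ?E i B) \<le> (\<Sum>B\<in>P. card (?E i B))" by (rule card_UN_le[OF Pp(1)])
        then have "real (card (\<Union>B\<in>P. ?E i B)) \<le> (\<Sum>B\<in>P. real (card (?E i B)))"
          by (simp only: of_nat_sum[symmetric] of_nat_le_iff)
        also have "\<dots> = (\<Sum>B\<in>P. real (card (?E i B)) / real d) * real d"
          using d by (simp add: sum_divide_distrib[symmetric])
        also have "\<dots> \<le> \<delta> * real d" using eq[OF Ib(2)[OF i]] by (intro mult_right_mono) auto
        finally show ?thesis .
      qed
      \<comment> \<open>The unit cylinder over \<open>snd i\<close> is a union of blocks of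
        \<open>P\<close>. Outside the exceptional set, membership in the translate of each of these
        blocks may be replaced by membership in the image of its vertex set under \<sigma>.\<close>
      have agree: "pt v \<in> cyl H \<kappa> (fst i) (snd i) \<longleftrightarrow> v \<in> fin_act (\<sigma> (?f i)) {u \<in> {1..d}. y u \<subseteq> snd i}"
        if i: "i \<in> I" and v: "v \<in> {1..d}" "v \<notin> (\<Union>B\<in>P. ?E i B)" for i v
      proof -
        let ?C = "{B \<in> P. B \<subseteq> ?Y (snd i)}"
        have "pt v \<in> cyl H \<kappa> (fst i) (snd i) \<longleftrightarrow> (\<exists>B\<in>?C. pt v \<in> act (?f i) B)" unfolding cylP[OF i] by blast
        also have "\<dots> \<longleftrightarrow> (\<exists>B\<in>?C. v \<in> \<phi> (act (?f i) B))"
          using pt[OF sat_act[OF Ib(2)[OF i]]] v(1) by auto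
        also have "\<dots> \<longleftrightarrow> (\<exists>B\<in>?C. v \<in> fin_act (\<sigma> (?f i)) (\<phi> B))" using v(2) by blast
        also have "\<dots> \<longleftrightarrow> v \<in> fin_act (\<sigma> (?f i)) (\<Union>B\<in>?C. \<phi> B)" unfolding fin_act_def by blast
        also have "(\<Union>B\<in>?C. \<phi> B) = {u \<in> {1..d}. y u \<subseteq> snd i}"
        proof -
          have "u \<in> (\<Union>B\<in>?C. \<phi> B) \<longleftrightarrow> u \<in> {1..d} \<and> pt u \<in> \<Union>?C" for u
            using pt[OF sat_P] by auto
          moreover have "\<Union>?C = ?Y (snd i)" by (rule YSP[OF Ib(3)[OF i], symmetric])
          ultimately have "u \<in> (\<Union>B\<in>?C. \<phi> B) \<longleftrightarrow> u \<in> {1..d} \<and> pt u \<in> ?Y (snd i)" for u by (simp only:)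
          then have "u \<in> (\<Union>B\<in>?C. \<phi> B) \<longleftrightarrow> u \<in> {1..d} \<and> y u \<subseteq> snd i" for u
            using yS[OF _ Ib(3)[OF i]] by blast
          then show ?thesis by blast
        qed
        finally show ?thesis .
      qed
      \<comment> \<open>Where the equivariance errors vanish, the predicted code is the true code;
        then the guess can be wrong only in \<open>?Bad\<close>.\<close>
      have "{v \<in> {1..d}. ql v \<noteq> pred y v} \<subseteq> (\<Union>i\<in>I. \<Union>B\<in>P. ?E i B) \<union> {v \<in> {1..d}. pt v \<in> ?Bad}"
      proof
        fix v assume "v \<in> {v \<in> {1..d}. ql v \<noteq> pred y v}"
        then have v1: "v \<in> {1..d}" "ql v \<noteq> pred y v" by blast+
        moreover have "pred y v = T (c y v)" unfolding pred_def by (rule restrict_apply'[OF v1(1)])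
        ultimately have v: "v \<in> {1..d}" "ql v \<noteq> T (c y v)" by simp_all
        show "v \<in> (\<Union>i\<in>I. \<Union>B\<in>P. ?E i B) \<union> {v \<in> {1..d}. pt v \<in> ?Bad}"
        proof (rule ccontr)
          assume n: "v \<notin> (\<Union>i\<in>I. \<Union>B\<in>P. ?E i B) \<union> {v \<in> {1..d}. pt v \<in> ?Bad}"
          have "v \<notin> (\<Union>B\<in>P. ?E i B)" if "i \<in> I" for i
            by (rule contra_subsetD[OF _ n], rule le_supI1) (rule UN_upper[OF that])
          from agree[OF _ v(1) this]
          have "pt v \<in> cyl H \<kappa> (fst i) (snd i) \<longleftrightarrow> i \<in> c y v" if "i \<in> I" for i
            using that unfolding c_def by simp
          then have "code I (pt v) = c y v" unfolding code_cyl[OF ptB[OF v(1)]] c_def by blast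
          moreover have "pt v \<in> T (code I (pt v))" using contra_subsetD[OF Un_upper2 n] v(1) ptB[OF v(1)] by simp
          ultimately show False using ql[OF v(1)] T v(2) by auto
        qed
      qed
      then have "card {v \<in> {1..d}. ql v \<noteq> pred y v} \<le> card ((\<Union>i\<in>I. \<Union>B\<in>P. ?E i B) \<union> {v \<in> {1..d}. pt v \<in> ?Bad})"
        using finE I(1) Pp(1) by (intro card_mono finite_UnI finite_UN_I) auto
      also have "\<dots> \<le> card (\<Union>i\<in>I. \<Union>B\<in>P. ?E i B) + card {v \<in> {1..d}. pt v \<in> ?Bad}" by (rule card_Un_le)
      also have "\<dots> \<le> (\<Sum>i\<in>I. card (\<Union>B\<in>P. ?E i B)) + card {v \<in> {1..d}. pt v \<in> ?Bad}"
        by (intro add_right_mono card_UN_le I(1))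
      finally have "real (card {v \<in> {1..d}. ql v \<noteq> pred y v}) \<le> real ((\<Sum>i\<in>I. card (\<Union>B\<in>P. ?E i B)) + card {v \<in> {1..d}. pt v \<in> ?Bad})"
        by (simp only: of_nat_le_iff)
      also have "\<dots> = (\<Sum>i\<in>I. real (card (\<Union>B\<in>P. ?E i B))) + real (card {v \<in> {1..d}. pt v \<in> ?Bad})"
        by (simp only: of_nat_add of_nat_sum)
      also have "\<dots> \<le> (\<Sum>i\<in>I. \<delta> * real d) + (measure \<mu> ?Bad + \<delta>) * real d"
        by (intro add_mono sum_mono Esum ch[OF sat_Bad])
      also have "\<dots> = (real (card I) * \<delta> + \<delta> + measure \<mu> ?Bad) * real d" by (simp add: algebra_simps)
      also have "\<dots> \<le> (2 * \<tau>) * real d" using \<delta>\<tau> Bad_units by (intro mult_right_mono) auto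
      finally have qB: "ql \<in> Ball y" unfolding Ball_def using qlE by blast
      have "restrict \<phi> (sigma_sets B0 Q) = lab ql"
      proof
        fix X
        show "restrict \<phi> (sigma_sets B0 Q) X = lab ql X"
        proof (cases "X \<in> sigma_sets B0 Q")
          case True
          then obtain C where C: "C \<subseteq> Q" "X = \<Union>C" unfolding sigma_sets_partition[OF Qp(1,3)] by blast
          have "?sat X" unfolding C(2) by (rule satUn) (use sat_Q C(1) in blast)
          from pt[OF this] have "\<phi> X = {v \<in> {1..d}. pt v \<in> X}" .
          moreover have "pt v \<in> X \<longleftrightarrow> ql v \<subseteq> X" if v: "v \<in> {1..d}" for v
          proof
            assume "pt v \<in> X"
            then obtain q where "q \<in> C" "pt v \<in> q" unfolding C(2) by blast
            then show "ql v \<subseteq> X" using ql[OF v] C by blast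
          qed (use ql[OF v] in blast)
          ultimately show ?thesis using True unfolding lab_def by auto
        next
          case False
          then show ?thesis unfolding lab_def by simp
        qed
      qed
      then show ?thesis using qB yT by blast
    qed

    \<comment> \<open>Counting the encodings\<close>
    have "approx_homs_count H (bernoulli_gpd H \<kappa>) \<mu> bernoulli_proj d Q P F \<delta> \<sigma> \<le> card (lab ` (\<Union>y\<in>Types. Ball y))"
      unfolding approx_homs_count_def units_bernoulli
      by (rule card_mono) (use finTypes finBall main in auto)
    also have "\<dots> \<le> card (\<Union>y\<in>Types. Ball y)" by (rule card_image_le) (use finTypes finBall in auto)
    also have "\<dots> \<le> (\<Sum>y\<in>Types. card (Ball y))" by (rule card_UN_le[OF finTypes])
    finally have "real (approx_homs_count H (bernoulli_gpd H \<kappa>) \<mu> bernoulli_proj d Q P F \<delta> \<sigma>) \<le> (\<Sum>y\<in>Types. real (card (Ball y)))"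
      by (simp only: of_nat_sum[symmetric] of_nat_le_iff)
    also have "\<dots> \<le> (\<Sum>y\<in>Types. exp (real d * (2 * \<tau> * Lt + t * real (card Q))))"
    proof (rule sum_mono)
      fix y
      have "pred y \<in> {1..d} \<rightarrow>\<^sub>E Q" unfolding pred_def using T by auto
      from card_hamming_ball[OF Qp(1) this t, of "2 * \<tau>"]
      show "real (card (Ball y)) \<le> exp (real d * (2 * \<tau> * Lt + t * real (card Q)))"
        unfolding Ball_def Lt_def .
    qed
    also have "\<dots> = real (card Types) * exp (real d * (2 * \<tau> * Lt + t * real (card Q)))" by simp
    also have "\<dots> \<le> exp (real d * (\<Sum>A\<in>\<alpha>. (p A + \<delta>) * - ln (q A))) * exp (real d * (2 * \<tau> * Lt + t * real (card Q)))"
      unfolding Types_def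
      by (intro mult_right_mono card_type_class[OF a(1) q0 sumq]) (use \<delta> in auto)
    also have "\<dots> = exp (real d * ((\<Sum>A\<in>\<alpha>. (p A + \<delta>) * - ln (q A)) + (2 * \<tau> * Lt + t * real (card Q))))"
      by (simp only: exp_add distrib_left)
    also have "\<dots> \<le> exp (real d * (part_entropy \<kappa> \<alpha> + \<epsilon>))"
    proof (subst exp_le_cancel_iff, rule mult_left_mono)
      have "(\<Sum>A\<in>\<alpha>. (p A + \<delta>) * - ln (q A)) = (\<Sum>A\<in>\<alpha>. p A * - ln (q A)) + \<delta> * \<Lambda>"
        unfolding \<Lambda>_def by (simp only: distrib_right sum.distrib sum_distrib_left)
      then show "(\<Sum>A\<in>\<alpha>. (p A + \<delta>) * - ln (q A)) + (2 * \<tau> * Lt + t * real (card Q)) \<le> part_entropy \<kappa> \<alpha> + \<epsilon>"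
        using ent n\<eta> \<delta>\<Lambda> \<tau>L tQ \<epsilon> by linarith
    qed simp
    finally show "real (approx_homs_count H (bernoulli_gpd H \<kappa>) \<mu> bernoulli_proj d Q P F \<delta> \<sigma>)
        \<le> exp (real d * (part_entropy \<kappa> \<alpha> + \<epsilon>))" .
  qed
qed

end

section \<open>Entropy of the base space\<close>

lemma standard_borel_singleton:
  assumes "standard_borel M" "x \<in> space M"
  shows "{x} \<in> sets M"
proof -
  have "{y \<in> space M. y = x} \<in> sets M"
    by (rule standard_borel_sets_Collect_eq[OF assms(1)]) (use assms(2) in auto)
  moreover have "{y \<in> space M. y = x} = {x}" using assms(2) by blast
  ultimately show ?thesis by simp
qed

lemma entropy_term_nonneg: "0 \<le> x \<Longrightarrow> x \<le> 1 \<Longrightarrow> 0 \<le> - (x * ln x)" for x :: real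
  by (cases "x = 0") (auto simp: mult_nonneg_nonpos)

context prob_space begin

lemma measure_finite_singletons:
  assumes "finite F" "\<And>k. k \<in> F \<Longrightarrow> {k} \<in> sets M"
  shows "F \<in> sets M" "measure M F = (\<Sum>k\<in>F. measure M {k})"
proof -
  have "(\<Union>k\<in>F. {k}) \<in> sets M" using assms by (intro sets.finite_UN) auto
  then show "F \<in> sets M" by simp
  have "measure M (\<Union>k\<in>F. {k}) = (\<Sum>k\<in>F. measure M {k})"
    by (rule finite_measure_finite_Union) (use assms in \<open>auto simp: disjoint_family_on_def\<close>)
  then show "measure M F = (\<Sum>k\<in>F. measure M {k})" by simp
qed

lemma finite_subset_of_countable_full:
  assumes K: "countable_full M K" and sing: "\<And>k. k \<in> K \<Longrightarrow> {k} \<in> sets M"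
    and A: "A \<in> sets M" and e: "\<epsilon> > 0"
  obtains F where "finite F" "F \<subseteq> A \<inter> K" "measure M A - \<epsilon> \<le> (\<Sum>k\<in>F. measure M {k})"
proof -
  have KM: "K \<in> sets M" "measure M K = 1"
    using K unfolding countable_full_def by (auto intro: ccontr simp: measure_notin_sets)
  have cK: "countable K" using K unfolding countable_full_def by simp
  have Kne: "K \<noteq> {}" using KM by auto
  define G where "G n = A \<inter> from_nat_into K ` {..n}" for n :: nat
  have GK: "from_nat_into K n \<in> K" for n using from_nat_into[OF Kne] .
  have Gf: "finite (G n)" "G n \<subseteq> A \<inter> K" for n unfolding G_def using GK by auto
  have Gs: "G n \<in> sets M" for n by (rule measure_finite_singletons(1)[OF Gf(1)]) (use Gf(2)[of n] sing in blast)
  have inc: "incseq G" unfolding G_def incseq_def by auto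
  have "(\<Union>n. G n) = A \<inter> K"
  proof
    show "A \<inter> K \<subseteq> (\<Union>n. G n)"
    proof
      fix x assume x: "x \<in> A \<inter> K"
      then have "x \<in> range (from_nat_into K)" using range_from_nat_into[OF Kne cK] by simp
      then obtain n where "x = from_nat_into K n" by blast
      then show "x \<in> (\<Union>n. G n)" unfolding G_def using x by blast
    qed
  qed (use Gf(2) in blast)
  moreover have "(\<lambda>n. measure M (G n)) \<longlonglongrightarrow> measure M (\<Union>n. G n)"
    by (rule finite_Lim_measure_incseq[OF _ inc]) (use Gs in auto)
  moreover have "measure M (A \<inter> K) = measure M A"
  proof -
    have "measure M A = measure M (A \<inter> K) + measure M (A - K)"
      using finite_measure_Union[of "A \<inter> K" "A - K"] A KM by (simp add: Int_Diff_Un Int_Diff_disjoint)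
    moreover have "measure M (A - K) \<le> measure M (space M - K)"
      using A KM sets.sets_into_space[OF A] by (intro finite_measure_mono) auto
    moreover have "measure M (space M - K) = 0" using prob_compl[OF KM(1)] KM(2) by simp
    ultimately show ?thesis using measure_nonneg[of M "A - K"] by linarith
  qed
  ultimately have "(\<lambda>n. measure M (G n)) \<longlonglongrightarrow> measure M A" by simp
  then have "\<forall>\<^sub>F n in sequentially. measure M A - \<epsilon> < measure M (G n)" by (rule order_tendstoD(1)) (use e in simp)
  then obtain n where "measure M A - \<epsilon> < measure M (G n)" by (auto simp: eventually_sequentially)
  moreover have "measure M (G n) = (\<Sum>k\<in>G n. measure M {k})"
    by (rule measure_finite_singletons(2)[OF Gf(1)]) (use Gf(2)[of n] sing in blast)
  ultimately have "measure M A - \<epsilon> \<le> (\<Sum>k\<in>G n. measure M {k})" by linarith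
  then show ?thesis by (rule that[OF Gf])
qed

end

context bernoulli begin

text \<open>Each block is exhausted up to \<eta> by finitely many atoms k of \<kappa>, and an atom
  of positive measure in the block A satisfies - ln \<kappa>(A) \<le> - ln \<kappa>({k}). Replacing
  the logarithm of the block by those of its atoms can only increase the sum.\<close>

lemma part_entropy_le_base:
  assumes \<alpha>: "base_partition \<alpha>"
  shows "ereal (part_entropy \<kappa> \<alpha>) \<le> base_entropy \<kappa>"
proof (cases "\<exists>K. countable_full \<kappa> K")
  case False
  show ?thesis unfolding base_entropy_def if_not_P[OF False] by simp
next
  case True
  interpret k: prob_space \<kappa> by (rule prob_\<kappa>)
  obtain K where K: "countable_full \<kappa> K" using True by blast
  have Ks: "K \<subseteq> space \<kappa>" using K unfolding countable_full_def by simp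
  have sing: "{k} \<in> sets \<kappa>" if "k \<in> K" for k using standard_borel_singleton[OF sb_\<kappa>] Ks that by blast
  let ?f = "\<lambda>k. - (measure \<kappa> {k} * ln (measure \<kappa> {k}))"
  have f0: "0 \<le> ?f k" for k by (rule entropy_term_nonneg) auto
  have base: "base_entropy \<kappa> = (SUP F\<in>{F. finite F \<and> F \<subseteq> K}. \<Sum>k\<in>F. ereal (?f k))"
    unfolding base_entropy_eq[OF prob_\<kappa> K] by (rule nonneg_infsum_complete) (use f0 in simp)
  have a: "finite \<alpha>" "\<alpha> \<subseteq> sets \<kappa>" "partition_on (space \<kappa>) \<alpha>" using \<alpha> unfolding base_partition_def by auto
  have ln0: "ln (measure \<kappa> A) \<le> 0" for A by (cases "measure \<kappa> A = 0") (auto simp: zero_less_measure_iff)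
  define \<Lambda> where "\<Lambda> = (\<Sum>A\<in>\<alpha>. - ln (measure \<kappa> A))"
  have \<Lambda>0: "\<Lambda> \<ge> 0" unfolding \<Lambda>_def by (intro sum_nonneg) (use ln0 in simp)
  show ?thesis
  proof (rule ereal_le_epsilon2)
    fix e :: real assume e: "0 < e"
    \<comment> \<open>The missing mass of a block is weighted by its logarithm, so the total loss is
      \<open>\<eta> * \<Lambda> \<le> e\<close>.\<close>
    define \<eta> where "\<eta> = e / (\<Lambda> + 1)"
    have \<eta>: "\<eta> > 0" unfolding \<eta>_def using e \<Lambda>0 by simp
    have \<eta>e: "\<eta> * \<Lambda> \<le> e" unfolding \<eta>_def using e \<Lambda>0 by (simp add: field_simps)
    have "\<exists>F. finite F \<and> F \<subseteq> A \<inter> K \<and> measure \<kappa> A - \<eta> \<le> (\<Sum>k\<in>F. measure \<kappa> {k})" if "A \<in> \<alpha>" for A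
      using k.finite_subset_of_countable_full[OF K sing _ \<eta>, of A] that a(2) by (metis subsetD)
    then obtain F where F: "\<And>A. A \<in> \<alpha> \<Longrightarrow> finite (F A)" "\<And>A. A \<in> \<alpha> \<Longrightarrow> F A \<subseteq> A \<inter> K"
      "\<And>A. A \<in> \<alpha> \<Longrightarrow> measure \<kappa> A - \<eta> \<le> (\<Sum>k\<in>F A. measure \<kappa> {k})" by metis
    have "part_entropy \<kappa> \<alpha> - \<eta> * \<Lambda> = (\<Sum>A\<in>\<alpha>. (measure \<kappa> A - \<eta>) * - ln (measure \<kappa> A))"
      unfolding part_entropy_def \<Lambda>_def by (simp add: left_diff_distrib sum_subtractf sum_distrib_left sum_negf)
    also have "\<dots> \<le> (\<Sum>A\<in>\<alpha>. (\<Sum>k\<in>F A. ?f k))"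
    proof (rule sum_mono)
      fix A assume A: "A \<in> \<alpha>"
      have "(measure \<kappa> A - \<eta>) * - ln (measure \<kappa> A) \<le> (\<Sum>k\<in>F A. measure \<kappa> {k}) * - ln (measure \<kappa> A)"
        using F(3)[OF A] ln0[of A] by (intro mult_right_mono) auto
      also have "\<dots> = (\<Sum>k\<in>F A. measure \<kappa> {k} * - ln (measure \<kappa> A))" by (rule sum_distrib_right)
      also have "\<dots> \<le> (\<Sum>k\<in>F A. ?f k)"
      proof (rule sum_mono)
        fix k assume k: "k \<in> F A"
        show "measure \<kappa> {k} * - ln (measure \<kappa> A) \<le> ?f k"
        proof (cases "measure \<kappa> {k} = 0")
          case False
          then have pos: "measure \<kappa> {k} > 0" by (simp add: zero_less_measure_iff)
          moreover have "measure \<kappa> {k} \<le> measure \<kappa> A"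
            using k F(2)[OF A] A a(2) by (intro k.finite_measure_mono) auto
          ultimately have "ln (measure \<kappa> {k}) \<le> ln (measure \<kappa> A)" by simp
          then show ?thesis using pos by simp
        qed simp
      qed
      finally show "(measure \<kappa> A - \<eta>) * - ln (measure \<kappa> A) \<le> (\<Sum>k\<in>F A. ?f k)" .
    qed
    also have "\<dots> = (\<Sum>k\<in>(\<Union>A\<in>\<alpha>. F A). ?f k)"
    proof (rule sum.UNION_disjoint[symmetric])
      show "\<forall>A\<in>\<alpha>. \<forall>B\<in>\<alpha>. A \<noteq> B \<longrightarrow> F A \<inter> F B = {}"
        using F(2) disjointD[OF partition_onD2[OF a(3)]] by blast
    qed (use a(1) F(1) in auto)
    finally have 1: "part_entropy \<kappa> \<alpha> \<le> (\<Sum>k\<in>(\<Union>A\<in>\<alpha>. F A). ?f k) + e" using \<eta>e by linarith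
    have "ereal (\<Sum>k\<in>(\<Union>A\<in>\<alpha>. F A). ?f k) \<le> base_entropy \<kappa>"
      unfolding base sum_ereal[symmetric]
      by (rule SUP_upper) (use a(1) F(1,2) in auto)
    then have "ereal (\<Sum>k\<in>(\<Union>A\<in>\<alpha>. F A). ?f k) + ereal e \<le> base_entropy \<kappa> + ereal e" by (rule add_right_mono)
    moreover have "ereal (part_entropy \<kappa> \<alpha>) \<le> ereal (\<Sum>k\<in>(\<Union>A\<in>\<alpha>. F A). ?f k) + ereal e" using 1 by simp
    ultimately show "ereal (part_entropy \<kappa> \<alpha>) \<le> base_entropy \<kappa> + ereal e" by (rule order_trans[rotated])
  qed
qed

lemma base_partition_atoms:
  assumes "finite \<S>" "\<S> \<subseteq> sets \<kappa>"
  shows "base_partition (atoms (space \<kappa>) \<S>)"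
  unfolding base_partition_def using finite_atoms[OF assms(1)] atoms_sets[OF assms refl] partition_on_atoms by blast

lemma sum_le_part_entropy:
  assumes "base_partition \<alpha>" "\<beta> \<subseteq> \<alpha>"
  shows "(\<Sum>A\<in>\<beta>. - (measure \<kappa> A * ln (measure \<kappa> A))) \<le> part_entropy \<kappa> \<alpha>"
proof -
  interpret k: prob_space \<kappa> by (rule prob_\<kappa>)
  show ?thesis unfolding part_entropy_def
    by (rule sum_mono2) (use assms entropy_term_nonneg in \<open>auto simp: base_partition_def\<close>)
qed

text \<open>On the diffuse part \<open>D\<close>, the expected measure of the cell containing a random point tends to \<open>0\<close> as the
  partition is refined along a separating sequence; by \<open>ln x \<le> ln s + x / s - 1\<close> the entropy is then large.\<close>

lemma diffuse_entropy:
  assumes no: "\<not> (\<exists>K. countable_full \<kappa> K)"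
  obtains \<alpha> where "base_partition \<alpha>" "c \<le> part_entropy \<kappa> \<alpha>"
proof -
  interpret k: prob_space \<kappa> by (rule prob_\<kappa>)
  \<comment> \<open>The set of atoms is countable; since no countable set has full measure, its
    complement \<open>D\<close> has positive measure.\<close>
  define Ka where "Ka = {x \<in> space \<kappa>. measure \<kappa> {x} \<noteq> 0}"
  have cKa: "countable Ka" unfolding Ka_def by (rule countable_subset[OF _ k.countable_support]) blast
  have sing: "{x} \<in> sets \<kappa>" if "x \<in> space \<kappa>" for x by (rule standard_borel_singleton[OF sb_\<kappa> that])
  have "Ka \<in> sets \<kappa>" by (rule sets.countable[OF _ cKa]) (use sing in \<open>auto simp: Ka_def\<close>)
  moreover define D where "D = space \<kappa> - Ka"
  ultimately have D: "D \<in> sets \<kappa>" "measure \<kappa> D = 1 - measure \<kappa> Ka" by (auto simp: k.prob_compl)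
  define c0 where "c0 = measure \<kappa> D"
  have "measure \<kappa> Ka \<noteq> 1" using no cKa unfolding countable_full_def Ka_def by blast
  then have c0: "c0 > 0" unfolding c0_def D(2) using k.prob_le_1[of Ka] by linarith
  obtain U where U: "sets \<kappa> = sigma_sets (space \<kappa>) (range U)" "\<And>n::nat. U n \<subseteq> space \<kappa>"
    "\<And>x y. x \<in> space \<kappa> \<Longrightarrow> y \<in> space \<kappa> \<Longrightarrow> (\<And>n. x \<in> U n \<longleftrightarrow> y \<in> U n) \<Longrightarrow> x = y"
    "{A. \<exists>p\<in>space \<kappa>. \<forall>n. n \<in> A \<longleftrightarrow> p \<in> U n} \<in> sigma_sets UNIV (range (\<lambda>n::nat. {A. n \<in> A}))"
    by (rule standard_borel_code[OF sb_\<kappa>]) blast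
  have Us: "U n \<in> sets \<kappa>" for n unfolding U(1) by (rule sigma_sets.Basic) simp
  define \<alpha> where "\<alpha> n = atoms (space \<kappa>) (insert D (U ` {..<n}))" for n :: nat
  have bp: "base_partition (\<alpha> n)" for n
    unfolding \<alpha>_def by (rule base_partition_atoms) (use D Us in auto)
  define \<beta> where "\<beta> n = {b \<in> \<alpha> n. b \<subseteq> D}" for n
  have fin\<beta>: "finite (\<beta> n)" for n using bp unfolding \<beta>_def base_partition_def by simp
  have \<beta>s: "b \<in> sets \<kappa>" if "b \<in> \<beta> n" for b n using bp[of n] that unfolding \<beta>_def base_partition_def by auto
  define cell where "cell n x = {y \<in> space \<kappa>. \<forall>S\<in>insert D (U ` {..<n}). x \<in> S \<longleftrightarrow> y \<in> S}" for n x
  have cell_in: "cell n x \<in> \<beta> n" if "x \<in> D" for n x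
    using that sets.sets_into_space[OF D(1)] unfolding cell_def \<beta>_def \<alpha>_def atoms_def by auto
  have cell_unique: "b = cell n x" if "b \<in> \<beta> n" "x \<in> b" for b n x
    using that unfolding cell_def \<beta>_def \<alpha>_def atoms_def by auto
  have in_cell: "x \<in> cell n x" if "x \<in> D" for n x
    using that sets.sets_into_space[OF D(1)] unfolding cell_def by auto
  \<comment> \<open>On \<open>D\<close> this is the measure of the cell that contains x, and its
    integral is the sum of the squared cell measures. The cells shrink to single points of measure
    0, so dominated convergence sends this sum to 0.\<close>
  define f where "f n x = (\<Sum>b\<in>\<beta> n. measure \<kappa> b * indicator b x)" for n and x
  have f: "f n x = (if x \<in> D then measure \<kappa> (cell n x) else 0)" for n x
  proof (cases "x \<in> D")
    case True
    have "f n x = (\<Sum>b\<in>\<beta> n. if b = cell n x then measure \<kappa> (cell n x) else 0)"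
      unfolding f_def
    proof (rule sum.cong[OF refl])
      fix b assume b: "b \<in> \<beta> n"
      show "measure \<kappa> b * indicator b x = (if b = cell n x then measure \<kappa> (cell n x) else 0)"
      proof (cases "x \<in> b")
        case True
        have "b = cell n x" by (rule cell_unique[OF b True])
        then show ?thesis using True by simp
      next
        case False
        then have "b \<noteq> cell n x" using in_cell[OF \<open>x \<in> D\<close>, of n] by blast
        then show ?thesis using False by simp
      qed
    qed
    also have "\<dots> = measure \<kappa> (cell n x)" using fin\<beta>[of n] cell_in[OF True, of n] by simp
    finally show ?thesis using True by simp
  next
    case False
    have "f n x = 0" unfolding f_def
      by (rule sum.neutral) (use False in \<open>auto simp: \<beta>_def indicator_def\<close>)
    then show ?thesis using False by simp
  qed
  have lim: "(\<lambda>n. f n x) \<longlonglongrightarrow> 0" for x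
  proof (cases "x \<in> D")
    case True
    have xs: "x \<in> space \<kappa>" using True sets.sets_into_space[OF D(1)] by blast
    have dec: "decseq (\<lambda>n. cell n x)" unfolding decseq_def cell_def by auto
    have "(\<lambda>n. measure \<kappa> (cell n x)) \<longlonglongrightarrow> measure \<kappa> (\<Inter>n. cell n x)"
      by (rule k.finite_Lim_measure_decseq[OF _ dec]) (use \<beta>s[OF cell_in[OF True]] in blast)
    also have "(\<Inter>n. cell n x) = {x}"
    proof
      show "(\<Inter>n. cell n x) \<subseteq> {x}"
      proof
        fix y assume y: "y \<in> (\<Inter>n. cell n x)"
        have "x \<in> U n \<longleftrightarrow> y \<in> U n" for n using INT_D[OF y UNIV_I, of "Suc n"] unfolding cell_def by auto
        moreover have "y \<in> space \<kappa>" using y unfolding cell_def by auto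
        ultimately have "x = y" using U(3)[OF xs] by blast
        then show "y \<in> {x}" by simp
      qed
    qed (use in_cell[OF True] in blast)
    also have "measure \<kappa> {x} = 0" using True xs unfolding D_def Ka_def by blast
    finally show ?thesis unfolding f using True by simp
  next
    case False
    then show ?thesis unfolding f by simp
  qed
  have int: "(\<lambda>n. \<integral>x. f n x \<partial>\<kappa>) \<longlonglongrightarrow> (\<integral>x. 0 \<partial>\<kappa>)"
  proof (rule integral_dominated_convergence[where w="\<lambda>x. 1"])
    show "f n \<in> borel_measurable \<kappa>" for n unfolding f_def using \<beta>s by (intro borel_measurable_sum) simp
    show "AE x in \<kappa>. (\<lambda>n. f n x) \<longlonglongrightarrow> 0" using lim by simp
    show "AE x in \<kappa>. norm (f n x) \<le> 1" for n unfolding f by simp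
  qed auto
  have val: "(\<integral>x. f n x \<partial>\<kappa>) = (\<Sum>b\<in>\<beta> n. measure \<kappa> b * measure \<kappa> b)" for n
  proof -
    have "(\<integral>x. f n x \<partial>\<kappa>) = (\<Sum>b\<in>\<beta> n. \<integral>x. measure \<kappa> b * indicator b x \<partial>\<kappa>)"
      unfolding f_def using \<beta>s by (intro Bochner_Integration.integral_sum) (auto intro!: integrable_real_indicator simp: k.emeasure_eq_measure)
    also have "\<dots> = (\<Sum>b\<in>\<beta> n. measure \<kappa> b * measure \<kappa> b)"
      by (rule sum.cong[OF refl]) (use \<beta>s sets.sets_into_space in \<open>auto simp: Int_absorb2\<close>)
    finally show ?thesis .
  qed
  \<comment> \<open>Chosen so that \<open>- c0 * ln s = c\<close>: the lower bounds for the summands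
    then add up to c + c0 minus the sum of squares divided by \<open>s\<close>, and the latter is
    less than c0.\<close>
  define s where "s = exp (- c / c0)"
  have s: "s > 0" unfolding s_def by simp
  have "\<forall>\<^sub>F n in sequentially. (\<integral>x. f n x \<partial>\<kappa>) < c0 * s"
    by (rule order_tendstoD(2)[OF int]) (use c0 s in simp)
  then obtain n where n: "(\<Sum>b\<in>\<beta> n. measure \<kappa> b * measure \<kappa> b) < c0 * s"
    unfolding val by (auto simp: eventually_sequentially)
  have sum\<beta>: "(\<Sum>b\<in>\<beta> n. measure \<kappa> b) = c0"
  proof -
    have "measure \<kappa> (\<Union>b\<in>\<beta> n. b) = (\<Sum>b\<in>\<beta> n. measure \<kappa> b)"
    proof (rule k.finite_measure_finite_Union[OF fin\<beta>])
      show "disjoint_family_on (\<lambda>b. b) (\<beta> n)"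
        using disjointD[OF partition_onD2[OF partition_on_atoms]] unfolding disjoint_family_on_def \<beta>_def \<alpha>_def by blast
    qed (use \<beta>s in auto)
    moreover have "(\<Union>b\<in>\<beta> n. b) = D"
    proof
      show "D \<subseteq> (\<Union>b\<in>\<beta> n. b)" using cell_in in_cell by blast
    qed (auto simp: \<beta>_def)
    ultimately show ?thesis unfolding c0_def by simp
  qed
  have "c \<le> (\<Sum>b\<in>\<beta> n. - (measure \<kappa> b * ln (measure \<kappa> b)))"
  proof -
    have summand: "x * (c / c0 + 1) - x * x / s \<le> - (x * ln x)" if "0 \<le> x" for x :: real
    proof (cases "x = 0")
      case False
      then have x: "x > 0" using that by simp
      have "ln (x / s) \<le> x / s - 1" using x s by (intro ln_le_minus_one) simp
      moreover have "ln (x / s) = ln x + c / c0" using x s by (simp add: ln_div s_def)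
      ultimately have "c / c0 + 1 - x / s \<le> - ln x" by linarith
      then have "x * (c / c0 + 1 - x / s) \<le> x * - ln x" using x by (intro mult_left_mono) auto
      then show ?thesis by (simp add: right_diff_distrib)
    qed simp
    have "c \<le> c0 * (c / c0 + 1) - (\<Sum>b\<in>\<beta> n. measure \<kappa> b * measure \<kappa> b) / s"
    proof -
      have "(\<Sum>b\<in>\<beta> n. measure \<kappa> b * measure \<kappa> b) / s \<le> c0" using n s by (simp add: field_simps)
      moreover have "c0 * (c / c0 + 1) = c + c0" using c0 by (simp add: field_simps)
      ultimately show ?thesis by linarith
    qed
    also have "\<dots> = (\<Sum>b\<in>\<beta> n. measure \<kappa> b * (c / c0 + 1) - measure \<kappa> b * measure \<kappa> b / s)"
      by (simp only: sum_subtractf sum_distrib_right[symmetric] sum_divide_distrib[symmetric] sum\<beta>)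
    also have "\<dots> \<le> (\<Sum>b\<in>\<beta> n. - (measure \<kappa> b * ln (measure \<kappa> b)))" by (rule sum_mono) (rule summand, simp)
    finally show ?thesis .
  qed
  also have "\<dots> \<le> part_entropy \<kappa> (\<alpha> n)" by (rule sum_le_part_entropy[OF bp]) (auto simp: \<beta>_def)
  finally show ?thesis using that[OF bp] by blast
qed

text \<open>With a countable set of full measure, a finite partial sum of the series already exceeds
  \<open>c\<close>, and its atoms become singleton blocks of a finite partition; all other blocks
  contribute nonnegative terms.\<close>

lemma base_entropy_approx:
  assumes "ereal c < base_entropy \<kappa>"
  obtains \<alpha> where "base_partition \<alpha>" "c \<le> part_entropy \<kappa> \<alpha>"
proof (cases "\<exists>K. countable_full \<kappa> K")
  case False
  from diffuse_entropy[OF this] show ?thesis using that by blast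
next
  case True
  interpret k: prob_space \<kappa> by (rule prob_\<kappa>)
  obtain K where K: "countable_full \<kappa> K" using True by blast
  have Ks: "K \<subseteq> space \<kappa>" using K unfolding countable_full_def by simp
  have sing: "{k} \<in> sets \<kappa>" if "k \<in> K" for k using standard_borel_singleton[OF sb_\<kappa>] Ks that by blast
  let ?f = "\<lambda>k. - (measure \<kappa> {k} * ln (measure \<kappa> {k}))"
  have f0: "0 \<le> ?f k" for k by (rule entropy_term_nonneg) auto
  have "base_entropy \<kappa> = (SUP F\<in>{F. finite F \<and> F \<subseteq> K}. \<Sum>k\<in>F. ereal (?f k))"
    unfolding base_entropy_eq[OF prob_\<kappa> K] by (rule nonneg_infsum_complete) (use f0 in simp)
  then have "ereal c < (SUP F\<in>{F. finite F \<and> F \<subseteq> K}. \<Sum>k\<in>F. ereal (?f k))" using assms by (simp only:)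
  then obtain F where "F \<in> {F. finite F \<and> F \<subseteq> K}" and F3: "ereal c < (\<Sum>k\<in>F. ereal (?f k))"
    unfolding less_SUP_iff by (elim bexE)
  then have F: "finite F" "F \<subseteq> K" by blast+
  let ?\<alpha> = "atoms (space \<kappa>) ((\<lambda>k. {k}) ` F)"
  have bp: "base_partition ?\<alpha>" by (rule base_partition_atoms) (use F sing in auto)
  have sub: "(\<lambda>k. {k}) ` F \<subseteq> ?\<alpha>"
  proof (rule image_subsetI)
    fix k assume k: "k \<in> F"
    have "{k} = {y \<in> space \<kappa>. \<forall>S\<in>(\<lambda>k. {k}) ` F. k \<in> S \<longleftrightarrow> y \<in> S}" using k F(2) Ks by auto
    then show "{k} \<in> ?\<alpha>" unfolding atoms_def using k F(2) Ks by blast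
  qed
  have "c < (\<Sum>k\<in>F. ?f k)" using F3 by simp
  also have "(\<Sum>k\<in>F. ?f k) = (\<Sum>A\<in>(\<lambda>k. {k}) ` F. - (measure \<kappa> A * ln (measure \<kappa> A)))"
    by (subst sum.reindex) (auto simp: inj_on_def)
  also have "\<dots> \<le> part_entropy \<kappa> ?\<alpha>" by (rule sum_le_part_entropy[OF bp sub])
  finally show ?thesis using that[OF bp] by simp
qed

end

section \<open>Limits along a bias and $L^p$-norms\<close>

lemma eventually_net_filter:
  assumes "directed_set J le"
  shows "eventually P (net_filter J le) \<longleftrightarrow> (\<exists>j\<in>J. \<forall>j'\<in>J. le j j' \<longrightarrow> P j')"
proof -
  note D = assms[unfolded directed_set_def]
  note dir = D[THEN conjunct1] D[THEN conjunct2, THEN conjunct2, THEN conjunct2, rule_format]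
    D[THEN conjunct2, THEN conjunct2, THEN conjunct1, rule_format]
  have "eventually P (net_filter J le) \<longleftrightarrow> (\<exists>j\<in>J. eventually P (principal {j' \<in> J. le j j'}))"
    unfolding net_filter_def
  proof (rule eventually_INF_base[OF dir(1)])
    fix a b assume ab: "a \<in> J" "b \<in> J"
    then obtain k where k: "k \<in> J" "le a k" "le b k" using dir(2) by blast
    have "{j' \<in> J. le k j'} \<subseteq> {j' \<in> J. le a j'} \<inter> {j' \<in> J. le b j'}" using dir(3) k ab by blast
    then show "\<exists>x\<in>J. principal {j' \<in> J. le x j'} \<le> inf (principal {j' \<in> J. le a j'}) (principal {j' \<in> J. le b j'})"
      using k(1) by (intro bexI[of _ k]) auto
  qed
  then show ?thesis by (auto simp: eventually_principal)
qed

lemma net_filter_ne_bot: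
  assumes "directed_set J le"
  shows "net_filter J le \<noteq> bot"
proof
  assume "net_filter J le = bot"
  then have "eventually (\<lambda>_. False) (net_filter J le)" by simp
  then obtain j where "j \<in> J" "\<forall>j'\<in>J. \<not> le j j'" unfolding eventually_net_filter[OF assms] by blast
  moreover have "\<forall>i\<in>J. le i i" using assms unfolding directed_set_def by (elim conjE)
  ultimately show False by blast
qed

text \<open>\<open>Lim\<close> is a definite description, so convergence must be established: a
  value strictly between the lower and the upper limit would split the index set into two parts, one
  of which belongs to the ultrafilter and contradicts one of the limits.\<close>

lemma ultrafilter_Lim:
  fixes \<Phi> :: "'j \<Rightarrow> ereal"
  assumes ne: "U \<noteq> bot" and ultra: "\<And>A. eventually (\<lambda>j. j \<in> A) U \<or> eventually (\<lambda>j. j \<notin> A) U"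
  shows "Lim U \<Phi> = Limsup U \<Phi>" "Liminf U \<Phi> = Limsup U \<Phi>"
proof -
  show eq: "Liminf U \<Phi> = Limsup U \<Phi>"
  proof (rule antisym[OF Liminf_le_Limsup[OF ne]], rule ccontr)
    assume "\<not> Limsup U \<Phi> \<le> Liminf U \<Phi>"
    then have "Liminf U \<Phi> < Limsup U \<Phi>" by (simp only: not_le)
    from dense[OF this] obtain c where c: "Liminf U \<Phi> < c \<and> c < Limsup U \<Phi>" by (elim exE)
    from ultra[of "{j. \<Phi> j \<le> c}"] show False
    proof
      assume "eventually (\<lambda>j. j \<in> {j. \<Phi> j \<le> c}) U"
      then have "Limsup U \<Phi> \<le> c" by (intro Limsup_bounded) simp
      then show False using c leD by blast
    next
      assume "eventually (\<lambda>j. j \<notin> {j. \<Phi> j \<le> c}) U"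
      then have "c \<le> Liminf U \<Phi>" by (intro Liminf_bounded) (auto elim: eventually_mono)
      then show False using c leD by blast
    qed
  qed
  have "(\<Phi> \<longlongrightarrow> Limsup U \<Phi>) U" unfolding tendsto_iff_Liminf_eq_Limsup[OF ne] using eq by simp
  then show "Lim U \<Phi> = Limsup U \<Phi>" by (rule tendsto_Lim[OF ne])
qed

lemma eventually_bias:
  assumes "directed_set J le" "is_bias J le (Ultra U)" "eventually P (net_filter J le)"
  shows "eventually P U"
proof -
  obtain j where j: "j \<in> J" "\<forall>j'\<in>J. le j j' \<longrightarrow> P j'" using assms(3) unfolding eventually_net_filter[OF assms(1)] by blast
  then have "eventually (\<lambda>j'. j' \<in> {j' \<in> J. le j j'}) U" using assms(2) by simp
  then show ?thesis by (rule eventually_mono) (use j(2) in blast)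
qed

text \<open>Every bias limit is bounded by what holds eventually along the net, because an
  ultrafilter bias contains all tails. Eventual bounds thus handle the three kinds of bias
  together.\<close>

lemma bias_lim_le:
  assumes dir: "directed_set J le" and b: "is_bias J le \<beta>" and ev: "eventually (\<lambda>j. \<Phi> j \<le> c) (net_filter J le)"
  shows "bias_lim J le \<beta> \<Phi> \<le> c"
proof (cases \<beta>)
  case Minus
  then show ?thesis using Liminf_le_Limsup[OF net_filter_ne_bot[OF dir], of \<Phi>] Limsup_bounded[OF ev] by simp
next
  case Plus
  then show ?thesis using Limsup_bounded[OF ev] by simp
next
  case (Ultra U)
  have "Limsup U \<Phi> \<le> c" using eventually_bias[OF dir _ ev] b Ultra by (intro Limsup_bounded) blast
  moreover have "Lim U \<Phi> = Limsup U \<Phi>" by (rule ultrafilter_Lim(1)) (use b Ultra in auto)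
  ultimately show ?thesis using Ultra by simp
qed

lemma bias_lim_ge:
  assumes dir: "directed_set J le" and b: "is_bias J le \<beta>" and ev: "eventually (\<lambda>j. c \<le> \<Phi> j) (net_filter J le)"
  shows "c \<le> bias_lim J le \<beta> \<Phi>"
proof (cases \<beta>)
  case Minus
  then show ?thesis using Liminf_bounded[OF ev] by simp
next
  case Plus
  then show ?thesis using Liminf_le_Limsup[OF net_filter_ne_bot[OF dir], of \<Phi>] Liminf_bounded[OF ev] by simp
next
  case (Ultra U)
  have "c \<le> Liminf U \<Phi>" using eventually_bias[OF dir _ ev] b Ultra by (intro Liminf_bounded) blast
  moreover have "Lim U \<Phi> = Liminf U \<Phi>" using b Ultra ultrafilter_Lim[of U \<Phi>] by auto
  ultimately show ?thesis using Ultra by simp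
qed

lemma (in prob_space) Lp_norm_le:
  fixes f :: "'a \<Rightarrow> real"
  assumes p: "1 \<le> p" and f: "f \<in> borel_measurable M" and b: "\<And>x. x \<in> space M \<Longrightarrow> 0 \<le> f x \<and> f x \<le> m"
  shows "Lp_norm p M f \<le> ereal m"
proof -
  obtain x0 where "x0 \<in> space M" using not_empty by blast
  then have m: "0 \<le> m" using b by force
  show ?thesis
  proof (cases "p = \<infinity>")
    case True
    have "esssup M (\<lambda>x. ereal \<bar>f x\<bar>) \<le> ereal m"
      using f b by (intro esssup_I AE_I2) auto
    then show ?thesis unfolding Lp_norm_def using True by simp
  next
    case False
    define q where "q = enn2real p"
    have q: "q \<ge> 1" unfolding q_def using p False by (simp add: enn2real_leI) (metis enn2real_1 enn2real_mono infinity_ennreal_def less_top)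
    let ?I = "\<integral>\<^sup>+ x. ennreal (\<bar>f x\<bar> powr q) \<partial>M"
    have "?I \<le> (\<integral>\<^sup>+ x. ennreal (m powr q) \<partial>M)"
      by (rule nn_integral_mono) (use b q in \<open>auto intro!: ennreal_leI powr_mono2\<close>)
    also have "\<dots> = ennreal (m powr q)" by (simp add: emeasure_space_1)
    finally have I: "?I \<le> ennreal (m powr q)" .
    then have "?I \<noteq> \<infinity>" using ennreal_less_top[of "m powr q"] by (metis infinity_ennreal_def leD top_greatest order_antisym)
    moreover have "enn2real ?I \<le> m powr q" using I by (intro enn2real_leI) auto
    then have "enn2real ?I powr (1 / q) \<le> (m powr q) powr (1 / q)" using q by (intro powr_mono2) auto
    moreover have "(m powr q) powr (1 / q) = m" using m q by (simp add: powr_powr)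
    ultimately show ?thesis unfolding Lp_norm_def using False by (simp add: q_def[symmetric])
  qed
qed

text \<open>The p-th power integral is at least m to the power p times 1/2, and the p-th root of 1/2
  is at least 1/2. The resulting constant does not depend on p.\<close>

lemma (in prob_space) Lp_norm_ge:
  fixes f :: "'a \<Rightarrow> real"
  assumes p: "1 \<le> p" and E: "E \<in> sets M" "1 / 2 \<le> measure M E" and b: "\<And>x. x \<in> E \<Longrightarrow> m \<le> f x" and m: "0 < m"
  shows "ereal (m / 2) \<le> Lp_norm p M f"
proof (cases "p = \<infinity>")
  case True
  have "ereal m \<le> esssup M (\<lambda>x. ereal \<bar>f x\<bar>)"
  proof (rule ccontr)
    assume n: "\<not> ereal m \<le> esssup M (\<lambda>x. ereal \<bar>f x\<bar>)"
    have "AE x in M. x \<notin> E"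
      using esssup_AE[where f="\<lambda>x. ereal \<bar>f x\<bar>" and M=M]
    proof eventually_elim
      fix x assume "ereal \<bar>f x\<bar> \<le> esssup M (\<lambda>x. ereal \<bar>f x\<bar>)"
      then have "ereal \<bar>f x\<bar> < ereal m" by (rule le_less_trans) (use n in \<open>simp only: not_le\<close>)
      then show "x \<notin> E" using b[of x] by auto
    qed
    then have "measure M E = 0" using E(1) by (simp add: prob_eq_0)
    then show False using E(2) by simp
  qed
  moreover have "ereal (m / 2) \<le> ereal m" using m by simp
  ultimately have "ereal (m / 2) \<le> esssup M (\<lambda>x. ereal \<bar>f x\<bar>)" by (rule order_trans[rotated])
  then show ?thesis unfolding Lp_norm_def if_P[OF True] .
next
  case False
  define q where "q = enn2real p"
  have q: "q \<ge> 1" unfolding q_def using p False by (simp add: enn2real_leI) (metis enn2real_1 enn2real_mono infinity_ennreal_def less_top)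
  let ?I = "\<integral>\<^sup>+ x. ennreal (\<bar>f x\<bar> powr q) \<partial>M"
  have "ennreal (m powr q * (1 / 2)) \<le> ennreal (m powr q) * emeasure M E"
    proof -
    have "m powr q * (1 / 2) \<le> m powr q * measure M E" by (rule mult_left_mono[OF E(2)]) simp
    then show ?thesis unfolding emeasure_eq_measure by (subst ennreal_mult[symmetric]) (auto intro!: ennreal_leI)
  qed
  also have "\<dots> = (\<integral>\<^sup>+ x. ennreal (m powr q) * indicator E x \<partial>M)"
    using E(1) by (simp add: nn_integral_cmult_indicator)
  also have "\<dots> \<le> ?I"
  proof (rule nn_integral_mono)
    fix x
    show "ennreal (m powr q) * indicator E x \<le> ennreal (\<bar>f x\<bar> powr q)"
    proof (cases "x \<in> E")
      case True
      then have "m \<le> \<bar>f x\<bar>" using b[of x] by linarith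
      then have "m powr q \<le> \<bar>f x\<bar> powr q" using m q by (intro powr_mono2) auto
      then show ?thesis using True by (simp add: ennreal_leI)
    qed simp
  qed
  finally have I: "ennreal (m powr q * (1 / 2)) \<le> ?I" .
  show ?thesis
  proof (cases "?I = \<infinity>")
    case True
    then show ?thesis unfolding Lp_norm_def using False by (simp add: q_def[symmetric])
  next
    case fin: False
    have "m powr q * (1 / 2) \<le> enn2real ?I"
      using enn2real_mono[OF I] fin m by (simp add: less_top)
    then have "(m powr q * (1 / 2)) powr (1 / q) \<le> enn2real ?I powr (1 / q)"
      using q by (intro powr_mono2) auto
    moreover have "(m powr q * (1 / 2)) powr (1 / q) = m * (1 / 2) powr (1 / q)"
      using m q by (simp only: powr_mult powr_powr) simp
    moreover have "(1 / 2 :: real) powr 1 \<le> (1 / 2) powr (1 / q)"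
      using q by (intro powr_mono') auto
    then have "m * (1 / 2) \<le> m * (1 / 2) powr (1 / q)" using m by (intro mult_left_mono) auto
    ultimately have "m / 2 \<le> enn2real ?I powr (1 / q)" by simp
    then show ?thesis unfolding Lp_norm_def using False fin by (simp add: q_def[symmetric])
  qed
qed

lemma elog_div_le:
  assumes "L \<le> ereal (exp (real d * c))" "d \<ge> 1"
  shows "elog L / ereal (real d) \<le> ereal c"
proof (cases "L \<le> 0")
  case True
  then show ?thesis using assms(2) by (simp add: elog_def)
next
  case False
  then obtain x where x: "L = ereal x" "x > 0" using assms(1) by (cases L) auto
  have "x \<le> exp (real d * c)" using assms(1) x by simp
  then have "ln x \<le> ln (exp (real d * c))" using x(2) by (subst ln_le_cancel_iff) auto
  then have "ln x \<le> real d * c" by simp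
  then have "ln x / real d \<le> c" using assms(2) by (simp add: field_simps)
  then show ?thesis unfolding elog_def x(1) using x(2) assms(2) by simp
qed

lemma elog_div_ge:
  assumes "ereal (exp (real d * c)) \<le> L" "d \<ge> 1"
  shows "ereal c \<le> elog L / ereal (real d)"
proof (cases "L = \<infinity>")
  case True
  then show ?thesis using assms(2) by (simp add: elog_def)
next
  case False
  have "0 < ereal (exp (real d * c))" by simp
  then have "0 < L" using assms(1) by (rule less_le_trans)
  then obtain x where x: "L = ereal x" "x > 0" using False by (cases L) auto
  have "exp (real d * c) \<le> x" using assms(1) x by simp
  then have "real d * c \<le> ln x" using x(2) by (simp add: ln_ge_iff)
  then have "c \<le> ln x / real d" using assms(2) by (simp add: field_simps)
  then show ?thesis unfolding elog_def x(1) using x(2) assms(2) by simp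
qed

section \<open>The entropy of the Bernoulli shift\<close>

lemma finite_bisections_fin_gpd: "finite (bisections (fin_gpd d))"
proof (rule finite_subset)
  show "bisections (fin_gpd d) \<subseteq> Pow ({1..d} \<times> {1..d})" using partial_injD(1)[OF partial_inj_bisection] by blast
qed simp

lemma space_sofic_maps_borel: "space (sofic_maps_borel H d) = sofic_maps H d"
  unfolding sofic_maps_borel_def by (rule space_measure_of) auto

text \<open>There are only finitely many restrictions to \<open>F\<close>, since the finite groupoid
  has finitely many bisections; every inverse image is therefore a finite union of generators of the
  sigma-algebra.\<close>

lemma local_function_measurable:
  fixes c :: "('h set \<Rightarrow> (nat \<times> nat) set) \<Rightarrow> 'b::topological_space"
  assumes F: "finite F" "F \<subseteq> bisections H" and M: "sets M = sets (sofic_maps_borel H d)"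
    and loc: "\<And>\<sigma> \<sigma>'. (\<And>f. f \<in> F \<Longrightarrow> \<sigma> f = \<sigma>' f) \<Longrightarrow> c \<sigma> = c \<sigma>'"
  shows "c \<in> M \<rightarrow>\<^sub>M borel"
proof (rule measurableI)
  have sp: "space M = sofic_maps H d" using sets_eq_imp_space_eq[OF M] space_sofic_maps_borel by metis
  fix B :: "'b set" assume "B \<in> sets borel"
  let ?S = "{\<sigma> \<in> sofic_maps H d. c \<sigma> \<in> B}"
  let ?R = "(\<lambda>\<sigma>. restrict \<sigma> F) ` ?S"
  let ?cyl = "\<lambda>\<rho>. {\<sigma>' \<in> sofic_maps H d. restrict \<sigma>' F = \<rho>}"
  have "?R \<subseteq> F \<rightarrow>\<^sub>E bisections (fin_gpd d)" unfolding sofic_maps_def using F(2) by auto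
  then have fin: "finite ?R" by (rule finite_subset) (intro finite_PiE F(1) finite_bisections_fin_gpd)
  have "?cyl \<rho> \<in> sets M" if r: "\<rho> \<in> ?R" for \<rho>
  proof -
    obtain \<sigma> where \<sigma>: "\<sigma> \<in> sofic_maps H d" "\<rho> = restrict \<sigma> F" using r by blast
    then have "?cyl \<rho> \<in> {{\<sigma>' \<in> sofic_maps H d. restrict \<sigma>' F = restrict \<sigma> F} | \<sigma> F.
        \<sigma> \<in> sofic_maps H d \<and> finite F \<and> F \<subseteq> bisections H}" using F by blast
    then show ?thesis unfolding M sofic_maps_borel_def by (subst sets_measure_of) (auto intro: sigma_sets.Basic)
  qed
  then have "(\<Union>\<rho>\<in>?R. ?cyl \<rho>) \<in> sets M" by (rule sets.finite_UN[OF fin])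
  also have "(\<Union>\<rho>\<in>?R. ?cyl \<rho>) = ?S"
  proof
    show "(\<Union>\<rho>\<in>?R. ?cyl \<rho>) \<subseteq> ?S"
    proof
      fix \<sigma>' assume "\<sigma>' \<in> (\<Union>\<rho>\<in>?R. ?cyl \<rho>)"
      then obtain \<sigma> where s: "\<sigma>' \<in> sofic_maps H d" "c \<sigma> \<in> B" "restrict \<sigma>' F = restrict \<sigma> F" by blast
      have "c \<sigma>' = c \<sigma>" by (rule loc) (metis s(3) restrict_apply')
      then show "\<sigma>' \<in> ?S" using s by simp
    qed
  qed blast
  also have "?S = c -` B \<inter> space M" unfolding sp by blast
  finally show "c -` B \<inter> space M \<in> sets M" .
qed simp

lemma approx_homs_count_local:
  assumes "\<And>f. f \<in> F \<Longrightarrow> \<sigma> f = \<sigma>' f"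
  shows "approx_homs_count H G \<mu> \<pi> d Q P F \<delta> \<sigma> = approx_homs_count H G \<mu> \<pi> d Q P F \<delta> \<sigma>'"
  unfolding approx_homs_count_def approx_homs_def using assms by (simp cong: ball_cong)

locale bernoulli_sofic = bernoulli H \<nu> \<kappa> + sofic_approximation H \<nu> J le d \<P>
  for H :: "'h gpd" and \<nu> :: "'h measure" and \<kappa> :: "'k measure" and J :: "'j set"
    and le :: "'j \<Rightarrow> 'j \<Rightarrow> bool" and d :: "'j \<Rightarrow> nat" and \<P> :: "'j \<Rightarrow> ('h set \<Rightarrow> (nat \<times> nat) set) measure" +
  fixes \<beta> :: "'j bias" and p :: ennreal
  assumes bias: "is_bias J le \<beta>" and p: "1 \<le> p"
begin

lemma measure_entropy_le:
  "measure_entropy H (bernoulli_gpd H \<kappa>) \<mu> bernoulli_proj J le d \<P> \<beta> p \<le> base_entropy \<kappa>"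
  unfolding measure_entropy_def
proof (rule SUP_least)
  fix Q assume Q: "Q \<in> finite_borel_partitions (bernoulli_gpd H \<kappa>) \<mu>"
  show "(INF P\<in>{P \<in> finite_borel_partitions (bernoulli_gpd H \<kappa>) \<mu>. refines (units (bernoulli_gpd H \<kappa>)) P Q}.
      partition_entropy H (bernoulli_gpd H \<kappa>) \<mu> bernoulli_proj J le d \<P> \<beta> p Q P) \<le> base_entropy \<kappa>"
  proof (rule ereal_le_epsilon2)
    fix \<epsilon> :: real assume \<epsilon>: "0 < \<epsilon>"
    obtain \<alpha> P F \<delta> where \<alpha>: "base_partition \<alpha>" and P: "P \<in> finite_borel_partitions (bernoulli_gpd H \<kappa>) \<mu>"
      "refines B0 P Q" and F: "finite F" "F \<subseteq> bisections H" "units H \<in> F" and \<delta>: "\<delta> > 0"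
      and le: "\<And>d \<sigma>. d \<ge> 1 \<Longrightarrow> \<sigma> \<in> sofic_maps H d \<Longrightarrow>
        real (approx_homs_count H (bernoulli_gpd H \<kappa>) \<mu> bernoulli_proj d Q P F \<delta> \<sigma>)
          \<le> exp (real d * (part_entropy \<kappa> \<alpha> + \<epsilon>))"
      by (rule upper_count[OF Q \<epsilon>]) (rule that)
    let ?c = "\<lambda>j \<sigma>. real (approx_homs_count H (bernoulli_gpd H \<kappa>) \<mu> bernoulli_proj (d j) Q P F \<delta> \<sigma>)"
    have "partition_entropy H (bernoulli_gpd H \<kappa>) \<mu> bernoulli_proj J le d \<P> \<beta> p Q P \<le>
        bias_lim J le \<beta> (\<lambda>j. elog (Lp_norm p (\<P> j) (?c j)) / ereal (real (d j)))"
      unfolding partition_entropy_def by (rule INF_lower2[of F], use F in blast, rule INF_lower) (use \<delta> in simp)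
    also have "\<dots> \<le> ereal (part_entropy \<kappa> \<alpha> + \<epsilon>)"
    proof (rule bias_lim_le[OF directed bias])
      have "elog (Lp_norm p (\<P> j) (?c j)) / ereal (real (d j)) \<le> ereal (part_entropy \<kappa> \<alpha> + \<epsilon>)" if j: "j \<in> J" for j
      proof (rule elog_div_le[OF _ d_pos[OF j]])
        interpret pj: prob_space "\<P> j" by (rule prob_space_\<P>[OF j])
        have sp: "space (\<P> j) = sofic_maps H (d j)"
          using sets_eq_imp_space_eq[OF sets_\<P>[OF j]] space_sofic_maps_borel by metis
        show "Lp_norm p (\<P> j) (?c j) \<le> ereal (exp (real (d j) * (part_entropy \<kappa> \<alpha> + \<epsilon>)))"
        proof (rule pj.Lp_norm_le[OF p])
          show "?c j \<in> borel_measurable (\<P> j)"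
            by (rule local_function_measurable[OF F(1,2) sets_\<P>[OF j]]) (rule arg_cong[where f=real], rule approx_homs_count_local, blast)
        qed (use le[OF d_pos[OF j]] sp in auto)
      qed
      moreover obtain j0 where "j0 \<in> J" using directed unfolding directed_set_def by blast
      ultimately show "\<forall>\<^sub>F j in net_filter J le. elog (Lp_norm p (\<P> j) (?c j)) / ereal (real (d j)) \<le> ereal (part_entropy \<kappa> \<alpha> + \<epsilon>)"
        unfolding eventually_net_filter[OF directed] by blast
    qed
    also have "\<dots> = ereal (part_entropy \<kappa> \<alpha>) + ereal \<epsilon>" by simp
    also have "\<dots> \<le> base_entropy \<kappa> + ereal \<epsilon>" by (rule add_right_mono[OF part_entropy_le_base[OF \<alpha>]])
    finally have "partition_entropy H (bernoulli_gpd H \<kappa>) \<mu> bernoulli_proj J le d \<P> \<beta> p Q P \<le> base_entropy \<kappa> + ereal \<epsilon>" .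
    then show "(INF P\<in>{P \<in> finite_borel_partitions (bernoulli_gpd H \<kappa>) \<mu>. refines (units (bernoulli_gpd H \<kappa>)) P Q}.
      partition_entropy H (bernoulli_gpd H \<kappa>) \<mu> bernoulli_proj J le d \<P> \<beta> p Q P) \<le> base_entropy \<kappa> + ereal \<epsilon>"
      by (rule INF_lower2[rotated]) (use P in \<open>simp add: units_bernoulli\<close>)
  qed
qed

text \<open>The maps that are multiplicative and trace preserving on the set required by
  \<open>lower_count\<close> eventually have probability at least 1/2, and on them the count is
  exponentially large. One \<epsilon> is lost in the count; the other absorbs the factor 1/2 of
  \<open>Lp_norm_ge\<close> once d is large.\<close>

lemma partition_entropy_ge:
  assumes \<alpha>: "base_partition \<alpha>"
    and P: "P \<in> finite_borel_partitions (bernoulli_gpd H \<kappa>) \<mu>" "refines B0 P (lift_part \<alpha>)" and \<epsilon>: "\<epsilon> > 0"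
  shows "ereal (part_entropy \<kappa> \<alpha> - 2 * \<epsilon>) \<le>
    partition_entropy H (bernoulli_gpd H \<kappa>) \<mu> bernoulli_proj J le d \<P> \<beta> p (lift_part \<alpha>) P"
  unfolding partition_entropy_def
proof (intro INF_greatest bias_lim_ge[OF directed bias])
  fix F \<delta> assume "F \<in> {F. finite F \<and> F \<subseteq> bisections H \<and> units H \<in> F}" and "\<delta> \<in> {0::real<..}"
  then have F: "finite F" "F \<subseteq> bisections H" "units H \<in> F" and \<delta>: "\<delta> > 0" by auto
  obtain F0 \<delta>0 d0 where F0: "finite F0" "F0 \<subseteq> bisections H" "\<delta>0 > 0"
    and low: "\<And>d \<sigma> F' \<delta>'. sofic_map H \<nu> d \<sigma> F' \<delta>' \<Longrightarrow> F0 \<subseteq> F' \<Longrightarrow> \<delta>' \<le> \<delta>0 \<Longrightarrow> d0 \<le> d \<Longrightarrow>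
      exp (real d * (part_entropy \<kappa> \<alpha> - \<epsilon>)) \<le>
        real (approx_homs_count H (bernoulli_gpd H \<kappa>) \<mu> bernoulli_proj d (lift_part \<alpha>) P F \<delta> \<sigma>)"
    by (rule lower_count[OF \<alpha> P F \<delta> \<epsilon>]) (rule that)
  let ?c = "\<lambda>j \<sigma>. real (approx_homs_count H (bernoulli_gpd H \<kappa>) \<mu> bernoulli_proj (d j) (lift_part \<alpha>) P F \<delta> \<sigma>)"
  let ?T = "\<lambda>j. {\<sigma> \<in> space (\<P> j). trace_preserving H \<nu> (d j) F0 \<delta>0 \<sigma>}"
  have 1: "\<forall>\<^sub>F j in net_filter J le. 1 / 2 < measure (\<P> j) (?T j)"
    by (rule order_tendstoD(1)[OF asymp_trace_preserving[OF F0]]) simp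
  have 2: "\<forall>\<^sub>F j in net_filter J le. AE \<sigma> in \<P> j. multiplicative H (d j) F0 \<delta>0 \<sigma>"
    unfolding eventually_net_filter[OF directed] using asymp_multiplicative[OF F0] .
  have 3: "\<forall>\<^sub>F j in net_filter J le. max d0 (nat \<lceil>ln 2 / \<epsilon>\<rceil>) \<le> d j"
    using d_tendsto unfolding filterlim_at_top by blast
  have 4: "\<forall>\<^sub>F j in net_filter J le. j \<in> J"
  proof -
    obtain j0 where "j0 \<in> J" using directed unfolding directed_set_def by blast
    then show ?thesis unfolding eventually_net_filter[OF directed] by blast
  qed
  from 1 2 3 4 show "\<forall>\<^sub>F j in net_filter J le. ereal (part_entropy \<kappa> \<alpha> - 2 * \<epsilon>) \<le>
      elog (Lp_norm p (\<P> j) (?c j)) / ereal (real (d j))"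
  proof eventually_elim
    fix j assume tr: "1 / 2 < measure (\<P> j) (?T j)" and mu: "AE \<sigma> in \<P> j. multiplicative H (d j) F0 \<delta>0 \<sigma>"
      and dj: "max d0 (nat \<lceil>ln 2 / \<epsilon>\<rceil>) \<le> d j" and j: "j \<in> J"
    interpret pj: prob_space "\<P> j" by (rule prob_space_\<P>[OF j])
    have sp: "space (\<P> j) = sofic_maps H (d j)"
      using sets_eq_imp_space_eq[OF sets_\<P>[OF j]] space_sofic_maps_borel by metis
    from mu obtain Nl where Nl: "{\<sigma> \<in> space (\<P> j). \<not> multiplicative H (d j) F0 \<delta>0 \<sigma>} \<subseteq> Nl"
      "emeasure (\<P> j) Nl = 0" "Nl \<in> sets (\<P> j)" by (rule AE_E)
    \<comment> \<open>The measure of a non-measurable set is 0 by convention, so the lower bound 1/2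
      already forces measurability.\<close>
    have Ts: "?T j \<in> sets (\<P> j)"
    proof (rule ccontr)
      assume "?T j \<notin> sets (\<P> j)"
      then have "measure (\<P> j) (?T j) = 0" by (rule measure_notin_sets)
      then show False using tr by simp
    qed
    let ?E = "?T j - Nl"
    have E: "?E \<in> sets (\<P> j)" using Ts Nl(3) by (rule sets.Diff)
    have "measure (\<P> j) (?T j) \<le> measure (\<P> j) (?E \<union> Nl)"
      by (rule pj.finite_measure_mono[OF _ sets.Un[OF E Nl(3)]]) blast
    also have "\<dots> \<le> measure (\<P> j) ?E + measure (\<P> j) Nl" using E Nl(3) by (rule measure_Un_le)
    also have "measure (\<P> j) Nl = 0" using Nl(2) by (simp add: measure_def)
    finally have mE: "1 / 2 \<le> measure (\<P> j) ?E" using tr by simp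
    have dpos: "d j \<ge> 1" by (rule d_pos[OF j])
    have cnt: "exp (real (d j) * (part_entropy \<kappa> \<alpha> - \<epsilon>)) \<le> ?c j \<sigma>" if \<sigma>: "\<sigma> \<in> ?E" for \<sigma>
    proof (rule low[of _ _ F0 \<delta>0])
      have "sofic_map_axioms H \<nu> (d j) \<sigma> F0 \<delta>0"
        by (rule sofic_map_axioms.intro) (use \<sigma> Nl(1) sp F0 dpos in auto)
      then show "sofic_map H \<nu> (d j) \<sigma> F0 \<delta>0" by (rule sofic_map.intro[OF pmp_discrete_groupoid_axioms])
    qed (use dj in auto)
    have "ereal (exp (real (d j) * (part_entropy \<kappa> \<alpha> - \<epsilon>)) / 2) \<le> Lp_norm p (\<P> j) (?c j)"
      by (rule pj.Lp_norm_ge[OF p E mE cnt]) simp_all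
    moreover have "exp (real (d j) * (part_entropy \<kappa> \<alpha> - 2 * \<epsilon>)) \<le> exp (real (d j) * (part_entropy \<kappa> \<alpha> - \<epsilon>)) / 2"
    proof -
      have "ln 2 / \<epsilon> \<le> real (d j)" using dj by linarith
      then have "ln 2 \<le> real (d j) * \<epsilon>" using \<epsilon> by (simp add: field_simps)
      moreover have "real (d j) * (part_entropy \<kappa> \<alpha> - 2 * \<epsilon>) = real (d j) * (part_entropy \<kappa> \<alpha> - \<epsilon>) - real (d j) * \<epsilon>"
        by (simp add: right_diff_distrib)
      ultimately have "real (d j) * (part_entropy \<kappa> \<alpha> - 2 * \<epsilon>) \<le> real (d j) * (part_entropy \<kappa> \<alpha> - \<epsilon>) - ln 2" by linarith
      then have "exp (real (d j) * (part_entropy \<kappa> \<alpha> - 2 * \<epsilon>)) \<le> exp (real (d j) * (part_entropy \<kappa> \<alpha> - \<epsilon>) - ln 2)"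
        by (simp only: exp_le_cancel_iff)
      then show ?thesis by (simp only: exp_diff exp_ln_iff) simp
    qed
    ultimately have "ereal (exp (real (d j) * (part_entropy \<kappa> \<alpha> - 2 * \<epsilon>))) \<le> Lp_norm p (\<P> j) (?c j)"
      by (meson ereal_less_eq(3) order_trans)
    then show "ereal (part_entropy \<kappa> \<alpha> - 2 * \<epsilon>) \<le> elog (Lp_norm p (\<P> j) (?c j)) / ereal (real (d j))"
      by (rule elog_div_ge[OF _ dpos])
  qed
qed

lemma measure_entropy_ge:
  "base_entropy \<kappa> \<le> measure_entropy H (bernoulli_gpd H \<kappa>) \<mu> bernoulli_proj J le d \<P> \<beta> p"
proof (rule dense_le)
  fix y assume "y < base_entropy \<kappa>"
  \<comment> \<open>The base entropy may be infinite, so it is approached from below by real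
    numbers.\<close>
  then obtain c where c: "y < ereal c" "ereal c < base_entropy \<kappa>" using ereal_dense2 by blast
  obtain \<alpha> where \<alpha>: "base_partition \<alpha>" "c \<le> part_entropy \<kappa> \<alpha>" by (rule base_entropy_approx[OF c(2)])
  let ?h = "INF P\<in>{P \<in> finite_borel_partitions (bernoulli_gpd H \<kappa>) \<mu>. refines (units (bernoulli_gpd H \<kappa>)) P (lift_part \<alpha>)}.
      partition_entropy H (bernoulli_gpd H \<kappa>) \<mu> bernoulli_proj J le d \<P> \<beta> p (lift_part \<alpha>) P"
  have "ereal c \<le> ?h"
  proof (rule ereal_le_epsilon2)
    fix e :: real assume e: "0 < e"
    have "ereal (part_entropy \<kappa> \<alpha> - 2 * (e / 2)) \<le> ?h"
      by (rule INF_greatest, rule partition_entropy_ge[OF \<alpha>(1)]) (use e in \<open>auto simp: units_bernoulli\<close>)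
    then have "ereal (part_entropy \<kappa> \<alpha> - 2 * (e / 2)) + ereal e \<le> ?h + ereal e" by (rule add_right_mono)
    moreover have "ereal c \<le> ereal (part_entropy \<kappa> \<alpha> - 2 * (e / 2)) + ereal e" using \<alpha>(2) by simp
    ultimately show "ereal c \<le> ?h + ereal e" by (rule order_trans[rotated])
  qed
  also have "?h \<le> measure_entropy H (bernoulli_gpd H \<kappa>) \<mu> bernoulli_proj J le d \<P> \<beta> p"
    unfolding measure_entropy_def by (rule SUP_upper) (rule lift_part_fbp[OF \<alpha>(1)])
  finally show "y \<le> measure_entropy H (bernoulli_gpd H \<kappa>) \<mu> bernoulli_proj J le d \<P> \<beta> p"
    using c(1) by (meson less_imp_le order_trans)
qed

end

theorem theorem12p1:
  fixes H :: "'h gpd" and \<nu> :: "'h measure"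
    and J :: "'j set" and le :: "'j \<Rightarrow> 'j \<Rightarrow> bool"
    and d :: "'j \<Rightarrow> nat" and \<P> :: "'j \<Rightarrow> ('h set \<Rightarrow> (nat \<times> nat) set) measure"
    and \<beta> :: "'j bias" and p :: ennreal
    and \<kappa> :: "'k measure"
  assumes "pmp_discrete_groupoid H \<nu>"
    and "sofic_approximation H \<nu> J le d \<P>"
    and "is_bias J le \<beta>"
    and "1 \<le> p"
    and "standard_borel \<kappa>" and "prob_space \<kappa>"
  shows "measure_entropy H (bernoulli_gpd H \<kappa>) (bernoulli_measure H \<nu> \<kappa>) bernoulli_proj
           J le d \<P> \<beta> p = base_entropy \<kappa>"
proof -
  interpret bernoulli_sofic H \<nu> \<kappa> J le d \<P> \<beta> p
    using assms by (intro bernoulli_sofic.intro bernoulli.intro bernoulli_axioms.intro bernoulli_sofic_axioms.intro)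
  show ?thesis by (rule antisym[OF measure_entropy_le measure_entropy_ge])
qed

end
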